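(* Let $X, Y$ be topological spaces, let $f : X \to Y$ be a weak homotopy equivalence, let $G$ be a coefficient system (bundle of abelian groups) on $Y$, and let $f^*G$ be the pull-back of $G$ via $f$. Then the induced homomorphisms on singular homology and cohomology with local coefficients $$f_* : H_*(X; f^*G) \to H_*(Y; G), \qquad f^* : H^*(Y; G) \to H^*(X; f^*G)$$ are isomorphisms (in every degree).
   Context: A weak homotopy equivalence is a continuous map inducing a bijection on path components and isomorphisms on all homotopy groups for all choices of basepoint. A bundle of abelian groups (local coefficient system, coefficient system) $G$ on a space $X$ assigns to each $x\in X$ an abelian group $G(x)$ and to each path $u$ from $x$ to $y$ in $X$ an isomorphism $G(u): G(y)\to G(x)$, depending only on the homotopy class of $u$ rel endpoints, with constant paths going to identities and $G(u\cdot v)=G(u)\circ G(v)$ for $u$ from $x$ to $y$ followed by $v$ from $y$ to $z$. For continuous $f:X\to Y$ and $G$ on $Y$, the pull-back is $(f^*G)(x)=G(f(x))$, $(f^*G)(u)=G(f\circ u)$. Singular (co)homology with coefficients in $G$: let $\Delta^k=\langle e_0,\dots,e_k\rangle$ be the standard simplex; for $\sigma:\Delta^k\to X$ let $\sigma_i$ be the restriction of $\sigma$ to the $i$-th face (opposite $e_i$), and let $\bar\sigma$ be $\sigma$ composed with the straight path from $e_1$ to $e_0$. Then $S_k(X;G)=\bigoplus_{\sigma:\Delta^k\to X}G(\sigma(e_0))$, with $g\sigma$ denoting the element equal to $g$ in the factor of $\sigma$ and $0$ elsewhere, and $$\partial(g\sigma)=G(\bar\sigma)(g)\,\sigma_0+\sum_{i=1}^k(-1)^i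 g\,\sigma_i.$$ Also $S^k(X;G)=\prod_{\sigma:\Delta^k\to X}G(\sigma(e_0))$ and, for $c\in S^k(X;G)$ and $\sigma:\Delta^{k+1}\to X$, $$(-1)^k(\delta c)(\sigma)=G(\bar\sigma)^{-1}c(\sigma_0)+\sum_{i=1}^{k+1}(-1)^i c(\sigma_i).$$ $H_*(X;G)$ and $H^*(X;G)$ are the homology groups of these complexes. A map $f:X\to Y$ induces $f_\#(g\sigma)=g\,(f\circ\sigma)$ from $S_*(X;f^*G)$ to $S_*(Y;G)$ and $(f^\#c)(\sigma)=c(f\circ\sigma)$ from $S^*(Y;G)$ to $S^*(X;f^*G)$; $f_*$ and $f^*$ are the induced maps. *)

theory Defs
  imports "HOL-Homology.Homology" "HOL-Algebra.Product_Groups"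
begin

section \<open>Weak homotopy equivalences\<close>

definition path_components_map ::
    "'b topology \<Rightarrow> ('a \<Rightarrow> 'b) \<Rightarrow> 'a set \<Rightarrow> 'b set" where
  "path_components_map Y f C = {y. \<exists>x\<in>C. path_component_of Y (f x) y}"

definition cube :: "nat \<Rightarrow> (nat \<Rightarrow> real) topology" where
  "cube n = product_topology (\<lambda>_. top_of_set {0..1}) {..<n}"

definition cube_boundary :: "nat \<Rightarrow> (nat \<Rightarrow> real) set" where
  "cube_boundary n = {x \<in> topspace (cube n). \<exists>i<n. x i = 0 \<or> x i = 1}"

definition spheroid :: "nat \<Rightarrow> 'a topology \<Rightarrow> 'a \<Rightarrow> ((nat \<Rightarrow> real) \<Rightarrow> 'a) \<Rightarrow> bool" where
  "spheroid n X x0 p \<longleftrightarrow>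
     continuous_map (cube n) X p \<and> (\<forall>s\<in>cube_boundary n. p s = x0)"

text \<open>Values outside the cube do not affect this relation, so a homotopy class contains
  every function that agrees on the cube with one of its members.\<close>

definition spheroid_homotopic ::
    "nat \<Rightarrow> 'a topology \<Rightarrow> 'a \<Rightarrow> ((nat \<Rightarrow> real) \<Rightarrow> 'a) \<Rightarrow> ((nat \<Rightarrow> real) \<Rightarrow> 'a) \<Rightarrow> bool" where
  "spheroid_homotopic n X x0 =
     homotopic_with (\<lambda>h. \<forall>s\<in>cube_boundary n. h s = x0) (cube n) X"

definition spheroid_concat ::
    "((nat \<Rightarrow> real) \<Rightarrow> 'a) \<Rightarrow> ((nat \<Rightarrow> real) \<Rightarrow> 'a) \<Rightarrow> (nat \<Rightarrow> real) \<Rightarrow> 'a" where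
  "spheroid_concat p q =
     (\<lambda>s. if s 0 \<le> 1/2 then p (s(0 := 2 * s 0)) else q (s(0 := 2 * s 0 - 1)))"

text \<open>Only used for \<open>n \<ge> 1\<close>. The product of two classes is the class of the
  concatenation of representatives, written without choosing representatives; likewise for
  the induced map below.\<close>

definition homotopy_group ::
    "nat \<Rightarrow> 'a topology \<Rightarrow> 'a \<Rightarrow> ((nat \<Rightarrow> real) \<Rightarrow> 'a) set monoid" where
  "homotopy_group n X x0 =
     \<lparr>carrier = (\<lambda>p. Collect (spheroid_homotopic n X x0 p)) ` Collect (spheroid n X x0),
      monoid.mult = (\<lambda>A B. {r. \<exists>p\<in>A. \<exists>q\<in>B. spheroid_homotopic n X x0 (spheroid_concat p q) r}),
      one = Collect (spheroid_homotopic n X x0 (\<lambda>_. x0))\<rparr>"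

definition homotopy_group_map ::
    "nat \<Rightarrow> 'b topology \<Rightarrow> 'b \<Rightarrow> ('a \<Rightarrow> 'b)
      \<Rightarrow> ((nat \<Rightarrow> real) \<Rightarrow> 'a) set \<Rightarrow> ((nat \<Rightarrow> real) \<Rightarrow> 'b) set" where
  "homotopy_group_map n Y y0 f A = {r. \<exists>p\<in>A. spheroid_homotopic n Y y0 (f \<circ> p) r}"

definition weak_homotopy_equivalence ::
    "'a topology \<Rightarrow> 'b topology \<Rightarrow> ('a \<Rightarrow> 'b) \<Rightarrow> bool" where
  "weak_homotopy_equivalence X Y f \<longleftrightarrow>
     continuous_map X Y f \<and>
     bij_betw (path_components_map Y f) (path_components_of X) (path_components_of Y) \<and>
     (\<forall>x0\<in>topspace X. \<forall>n\<ge>1.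
        homotopy_group_map n Y (f x0) f
          \<in> iso (homotopy_group n X x0) (homotopy_group n Y (f x0)))"


section \<open>Bundles of abelian groups\<close>

definition path_concat :: "(real \<Rightarrow> 'a) \<Rightarrow> (real \<Rightarrow> 'a) \<Rightarrow> real \<Rightarrow> 'a" where
  "path_concat u v = (\<lambda>t. if t \<le> 1/2 then u (2 * t) else v (2 * t - 1))"

definition path_homotopic :: "'a topology \<Rightarrow> (real \<Rightarrow> 'a) \<Rightarrow> (real \<Rightarrow> 'a) \<Rightarrow> bool" where
  "path_homotopic X u v \<longleftrightarrow>
     homotopic_with (\<lambda>h. h 0 = u 0 \<and> h 1 = u 1) (top_of_set {0..1}) X u v"

text \<open>All fibres have carriers in one type \<open>'g\<close>. This is no restriction, since any family of
  groups can be realised inside the disjoint union of its members.\<close>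

record ('a, 'g) coeff_system =
  fibre :: "'a \<Rightarrow> 'g monoid"
  transport :: "(real \<Rightarrow> 'a) \<Rightarrow> 'g \<Rightarrow> 'g"

text \<open>Transport is contravariant: a path from \<open>x\<close> to \<open>y\<close> gives a map from the fibre over
  \<open>y\<close> to the fibre over \<open>x\<close>.\<close>

definition coefficient_system :: "'a topology \<Rightarrow> ('a, 'g) coeff_system \<Rightarrow> bool" where
  "coefficient_system X G \<longleftrightarrow>
     (\<forall>x\<in>topspace X. comm_group (fibre G x)) \<and>
     (\<forall>u. pathin X u \<longrightarrow> transport G u \<in> iso (fibre G (u 1)) (fibre G (u 0))) \<and>
     (\<forall>u v. path_homotopic X u v \<longrightarrow>
        (\<forall>g\<in>carrier (fibre G (u 1)). transport G u g = transport G v g)) \<and>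
     (\<forall>x\<in>topspace X. \<forall>g\<in>carrier (fibre G x). transport G (\<lambda>_. x) g = g) \<and>
     (\<forall>u v. pathin X u \<and> pathin X v \<and> u 1 = v 0 \<longrightarrow>
        (\<forall>g\<in>carrier (fibre G (v 1)).
           transport G (path_concat u v) g = transport G u (transport G v g)))"

definition pullback :: "('a \<Rightarrow> 'b) \<Rightarrow> ('b, 'g) coeff_system \<Rightarrow> ('a, 'g) coeff_system" where
  "pullback f G = \<lparr>fibre = (\<lambda>x. fibre G (f x)), transport = (\<lambda>u. transport G (f \<circ> u))\<rparr>"

lemma coefficient_system_pullback:
  assumes G: "coefficient_system Y G" and f: "continuous_map X Y f"
  shows "coefficient_system X (pullback f G)"
proof -
  have path: "pathin Y (f \<circ> u)" if "pathin X u" for u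
    using pathin_compose that f by blast
  have htpy: "path_homotopic Y (f \<circ> u) (f \<circ> v)" if "path_homotopic X u v" for u v
    using that unfolding path_homotopic_def
    by (rule homotopic_with_compose_continuous_map_left [OF _ f]) auto
  have pt: "f x \<in> topspace Y" if "x \<in> topspace X" for x
    using f that by (auto simp: continuous_map_def)
  have cat: "f \<circ> path_concat u v = path_concat (f \<circ> u) (f \<circ> v)" for u v
    by (auto simp: path_concat_def)
  have const: "f \<circ> (\<lambda>_. x) = (\<lambda>_. f x)" for x by auto
  show ?thesis
    unfolding coefficient_system_def pullback_def coeff_system.simps cat const
    using G path htpy pt unfolding coefficient_system_def
    by (intro conjI ballI allI impI) (force simp: o_def)+
qed


section \<open>Singular homology with local coefficients\<close>

text \<open>Groups are written multiplicatively, as is customary for \<open>monoid\<close> records; in particular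
  \<open>(-1)\<^sup>i g\<close> becomes an integer power of \<open>g\<close>.\<close>

definition vertex :: "nat \<Rightarrow> nat \<Rightarrow> real" where
  "vertex i = (\<lambda>j. if j = i then 1 else 0)"

definition edge_path :: "((nat \<Rightarrow> real) \<Rightarrow> 'a) \<Rightarrow> real \<Rightarrow> 'a" where
  "edge_path \<sigma> = (\<lambda>t. \<sigma> (\<lambda>j. (1 - t) * vertex 1 j + t * vertex 0 j))"

definition simplex_fibre :: "('a, 'g) coeff_system \<Rightarrow> ((nat \<Rightarrow> real) \<Rightarrow> 'a) \<Rightarrow> 'g monoid" where
  "simplex_fibre G \<sigma> = fibre G (\<sigma> (vertex 0))"

definition local_chain_group ::
    "nat \<Rightarrow> 'a topology \<Rightarrow> ('a, 'g) coeff_system \<Rightarrow> (((nat \<Rightarrow> real) \<Rightarrow> 'a) \<Rightarrow> 'g) monoid" where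
  "local_chain_group k X G = sum_group (singular_simplex_set k X) (simplex_fibre G)"

definition chain_single ::
    "nat \<Rightarrow> 'a topology \<Rightarrow> ('a, 'g) coeff_system \<Rightarrow> 'g \<Rightarrow> ((nat \<Rightarrow> real) \<Rightarrow> 'a)
      \<Rightarrow> ((nat \<Rightarrow> real) \<Rightarrow> 'a) \<Rightarrow> 'g" where
  "chain_single k X G g \<sigma> =
     (\<lambda>\<tau>\<in>singular_simplex_set k X. if \<tau> = \<sigma> then g else \<one>\<^bsub>simplex_fibre G \<tau>\<^esub>)"

definition chain_support ::
    "nat \<Rightarrow> 'a topology \<Rightarrow> ('a, 'g) coeff_system \<Rightarrow> (((nat \<Rightarrow> real) \<Rightarrow> 'a) \<Rightarrow> 'g)
      \<Rightarrow> ((nat \<Rightarrow> real) \<Rightarrow> 'a) set" where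
  "chain_support k X G c = {\<sigma> \<in> singular_simplex_set k X. c \<sigma> \<noteq> \<one>\<^bsub>simplex_fibre G \<sigma>\<^esub>}"

definition boundary_single ::
    "nat \<Rightarrow> 'a topology \<Rightarrow> ('a, 'g) coeff_system \<Rightarrow> 'g \<Rightarrow> ((nat \<Rightarrow> real) \<Rightarrow> 'a)
      \<Rightarrow> ((nat \<Rightarrow> real) \<Rightarrow> 'a) \<Rightarrow> 'g" where
  "boundary_single k X G g \<sigma> =
     chain_single (k - 1) X G (transport G (edge_path \<sigma>) g) (singular_face k 0 \<sigma>)
       \<otimes>\<^bsub>local_chain_group (k - 1) X G\<^esub>
     (\<Otimes>\<^bsub>local_chain_group (k - 1) X G\<^esub> i\<in>{1..k}.
        chain_single (k - 1) X G g (singular_face k i \<sigma>)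
          [^]\<^bsub>local_chain_group (k - 1) X G\<^esub> ((- 1) ^ i :: int))"

text \<open>The additive extension of \<open>boundary_single\<close>, from degree \<open>k\<close> to degree \<open>k - 1\<close>. As for
  \<open>chain_boundary\<close>, it is trivial in degree \<open>0\<close>, so every \<open>0\<close>-chain is a cycle.\<close>

definition local_boundary ::
    "nat \<Rightarrow> 'a topology \<Rightarrow> ('a, 'g) coeff_system \<Rightarrow> (((nat \<Rightarrow> real) \<Rightarrow> 'a) \<Rightarrow> 'g)
      \<Rightarrow> ((nat \<Rightarrow> real) \<Rightarrow> 'a) \<Rightarrow> 'g" where
  "local_boundary k X G c =
     (if k = 0 then \<one>\<^bsub>local_chain_group (k - 1) X G\<^esub>
      else \<Otimes>\<^bsub>local_chain_group (k - 1) X G\<^esub> \<sigma>\<in>chain_support k X G c.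
             boundary_single k X G (c \<sigma>) \<sigma>)"

definition local_cycles ::
    "nat \<Rightarrow> 'a topology \<Rightarrow> ('a, 'g) coeff_system \<Rightarrow> (((nat \<Rightarrow> real) \<Rightarrow> 'a) \<Rightarrow> 'g) set" where
  "local_cycles k X G =
     kernel (local_chain_group k X G) (local_chain_group (k - 1) X G) (local_boundary k X G)"

definition local_boundaries ::
    "nat \<Rightarrow> 'a topology \<Rightarrow> ('a, 'g) coeff_system \<Rightarrow> (((nat \<Rightarrow> real) \<Rightarrow> 'a) \<Rightarrow> 'g) set" where
  "local_boundaries k X G =
     local_boundary (Suc k) X G ` carrier (local_chain_group (Suc k) X G)"

definition local_homology ::
    "nat \<Rightarrow> 'a topology \<Rightarrow> ('a, 'g) coeff_system \<Rightarrow> (((nat \<Rightarrow> real) \<Rightarrow> 'a) \<Rightarrow> 'g) set monoid" where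
  "local_homology k X G =
     subgroup_generated (local_chain_group k X G) (local_cycles k X G) Mod local_boundaries k X G"

definition local_chain_map ::
    "nat \<Rightarrow> 'a topology \<Rightarrow> 'b topology \<Rightarrow> ('b, 'g) coeff_system \<Rightarrow> ('a \<Rightarrow> 'b)
      \<Rightarrow> (((nat \<Rightarrow> real) \<Rightarrow> 'a) \<Rightarrow> 'g) \<Rightarrow> ((nat \<Rightarrow> real) \<Rightarrow> 'b) \<Rightarrow> 'g" where
  "local_chain_map k X Y G f c =
     (\<Otimes>\<^bsub>local_chain_group k Y G\<^esub> \<sigma>\<in>chain_support k X (pullback f G) c.
        chain_single k Y G (c \<sigma>) (simplex_map k f \<sigma>))"

text \<open>A coset of boundaries is sent to the coset of boundaries containing its image.\<close>

definition local_homology_map ::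
    "nat \<Rightarrow> 'a topology \<Rightarrow> 'b topology \<Rightarrow> ('b, 'g) coeff_system \<Rightarrow> ('a \<Rightarrow> 'b)
      \<Rightarrow> (((nat \<Rightarrow> real) \<Rightarrow> 'a) \<Rightarrow> 'g) set \<Rightarrow> (((nat \<Rightarrow> real) \<Rightarrow> 'b) \<Rightarrow> 'g) set" where
  "local_homology_map k X Y G f C =
     local_boundaries k Y G <#>\<^bsub>local_chain_group k Y G\<^esub> (local_chain_map k X Y G f ` C)"


section \<open>Singular cohomology with local coefficients\<close>

definition local_cochain_group ::
    "nat \<Rightarrow> 'a topology \<Rightarrow> ('a, 'g) coeff_system \<Rightarrow> (((nat \<Rightarrow> real) \<Rightarrow> 'a) \<Rightarrow> 'g) monoid" where
  "local_cochain_group k X G = product_group (singular_simplex_set k X) (simplex_fibre G)"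

definition local_coboundary ::
    "nat \<Rightarrow> 'a topology \<Rightarrow> ('a, 'g) coeff_system \<Rightarrow> (((nat \<Rightarrow> real) \<Rightarrow> 'a) \<Rightarrow> 'g)
      \<Rightarrow> ((nat \<Rightarrow> real) \<Rightarrow> 'a) \<Rightarrow> 'g" where
  "local_coboundary k X G c =
     (\<lambda>\<sigma>\<in>singular_simplex_set (Suc k) X.
        (inv_into (carrier (simplex_fibre G \<sigma>)) (transport G (edge_path \<sigma>))
            (c (singular_face (Suc k) 0 \<sigma>))
          \<otimes>\<^bsub>simplex_fibre G \<sigma>\<^esub>
         (\<Otimes>\<^bsub>simplex_fibre G \<sigma>\<^esub> i\<in>{1..Suc k}.
            c (singular_face (Suc k) i \<sigma>) [^]\<^bsub>simplex_fibre G \<sigma>\<^esub> ((- 1) ^ i :: int)))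
        [^]\<^bsub>simplex_fibre G \<sigma>\<^esub> ((- 1) ^ k :: int))"

definition local_cocycles ::
    "nat \<Rightarrow> 'a topology \<Rightarrow> ('a, 'g) coeff_system \<Rightarrow> (((nat \<Rightarrow> real) \<Rightarrow> 'a) \<Rightarrow> 'g) set" where
  "local_cocycles k X G =
     kernel (local_cochain_group k X G) (local_cochain_group (Suc k) X G) (local_coboundary k X G)"

definition local_coboundaries ::
    "nat \<Rightarrow> 'a topology \<Rightarrow> ('a, 'g) coeff_system \<Rightarrow> (((nat \<Rightarrow> real) \<Rightarrow> 'a) \<Rightarrow> 'g) set" where
  "local_coboundaries k X G =
     (if k = 0 then {\<one>\<^bsub>local_cochain_group k X G\<^esub>}
      else local_coboundary (k - 1) X G ` carrier (local_cochain_group (k - 1) X G))"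

definition local_cohomology ::
    "nat \<Rightarrow> 'a topology \<Rightarrow> ('a, 'g) coeff_system \<Rightarrow> (((nat \<Rightarrow> real) \<Rightarrow> 'a) \<Rightarrow> 'g) set monoid" where
  "local_cohomology k X G =
     subgroup_generated (local_cochain_group k X G) (local_cocycles k X G)
       Mod local_coboundaries k X G"

definition local_cochain_map ::
    "nat \<Rightarrow> 'a topology \<Rightarrow> ('a \<Rightarrow> 'b)
      \<Rightarrow> (((nat \<Rightarrow> real) \<Rightarrow> 'b) \<Rightarrow> 'g) \<Rightarrow> ((nat \<Rightarrow> real) \<Rightarrow> 'a) \<Rightarrow> 'g" where
  "local_cochain_map k X f c = (\<lambda>\<sigma>\<in>singular_simplex_set k X. c (simplex_map k f \<sigma>))"

definition local_cohomology_map ::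
    "nat \<Rightarrow> 'a topology \<Rightarrow> ('b, 'g) coeff_system \<Rightarrow> ('a \<Rightarrow> 'b)
      \<Rightarrow> (((nat \<Rightarrow> real) \<Rightarrow> 'b) \<Rightarrow> 'g) set \<Rightarrow> (((nat \<Rightarrow> real) \<Rightarrow> 'a) \<Rightarrow> 'g) set" where
  "local_cohomology_map k X G f C =
     local_coboundaries k X (pullback f G)
       <#>\<^bsub>local_cochain_group k X (pullback f G)\<^esub> (local_cochain_map k X f ` C)"

end

theory Submission
  imports Defs
begin

text \<open>Replace \<open>f\<close> by its path fibration. Let \<open>E\<close> consist of the pairs of a singular simplex
  \<open>\<tau>\<close> of \<open>X\<close> and a homotopy \<open>h\<close> from \<open>f \<circ> \<tau>\<close> to a singular simplex \<open>\<sigma>\<close> of \<open>Y\<close>. By the homotopy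
  extension property the projection to \<open>\<tau>\<close> is a trivial fibration: simplices of the base lift,
  with any prescribed lift of their boundary. Because \<open>f\<close> is a weak equivalence, so is the projection
  to \<open>\<sigma>\<close>: elements of the homotopy groups are lifted and compared on cubes, and the simplex is a
  quotient of the cube with collapsing confined to the boundary. A trivial fibration has a section
  compatible with faces, and a choice of prisms makes the section and the projection inverse chain
  homotopy equivalences, for all coefficients pulled back from the base. On \<open>E\<close> the two pulled back
  systems are isomorphic by transport along \<open>t \<mapsto> h (1 - t, e\<^sub>0)\<close>. Finally the map induced
  by \<open>f\<close> is the composite of the section of constant homotopies, this isomorphism and the projection
  to \<open>\<sigma>\<close>.\<close>

text \<open>Chains with local coefficients see a simplex only through its faces and through
  transport along one edge. So the path fibration is never topologised: only its singular simplices
  and their faces are kept, and degenerate simplices are taken in the base alone. Upstairs their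
  place is taken by the lifting property, applied over a degenerate simplex. The obstacle lies in
  the lifting for \<open>path_target\<close>. The hypothesis on \<open>f\<close> speaks of cubes
  whose whole boundary goes to one point, while a lifting problem has arbitrary boundary values.
  These are moved to a point by contracting the cube, so homotopies are needed that follow a
  prescribed track on the boundary, together with the fact that such a track determines the end up
  to homotopy relative to the boundary. Injectivity in dimension \<open>m\<close> (on path
  components if \<open>m = 0\<close>) then extends a map over the cube of dimension
  \<open>m + 1\<close>, and surjectivity in dimension \<open>m + 1\<close> corrects the extension.
  The two coefficient systems pulled back to the path simplices have different fibres, which is why
  operators carry an isomorphism of fibres along with each simplex.\<close>

section \<open>Evaluation of formal integer combinations in an abelian group\<close>

text \<open>The homomorphism from the free abelian group on \<open>'i\<close> to \<open>H\<close>
  that extends \<open>f\<close>, for a multiplicatively written target with a carrier.\<close>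

definition frag_eval :: "('g, 'm) monoid_scheme \<Rightarrow> ('i \<Rightarrow> 'g) \<Rightarrow> ('i \<Rightarrow>\<^sub>0 int) \<Rightarrow> 'g" where
  "frag_eval H f x = finprod H (\<lambda>a. f a [^]\<^bsub>H\<^esub> Poly_Mapping.lookup x a) (Poly_Mapping.keys x)"

context comm_group
begin

lemma frag_eval_superset:
  assumes "finite K" "Poly_Mapping.keys x \<subseteq> K" "f \<in> K \<rightarrow> carrier G"
  shows "frag_eval G f x = finprod G (\<lambda>a. f a [^] Poly_Mapping.lookup x a) K"
  unfolding frag_eval_def
  by (rule finprod_mono_neutral_cong_left) (use assms in \<open>auto simp: in_keys_iff Pi_iff\<close>)

lemma frag_eval_closed [simp, intro]:
  "f \<in> Poly_Mapping.keys x \<rightarrow> carrier G \<Longrightarrow> frag_eval G f x \<in> carrier G"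
  unfolding frag_eval_def by (auto intro!: finprod_closed)

lemma frag_eval_cong:
  assumes "\<And>a. a \<in> Poly_Mapping.keys x \<Longrightarrow> f a = g a" "g \<in> Poly_Mapping.keys x \<rightarrow> carrier G"
  shows "frag_eval G f x = frag_eval G g x"
  unfolding frag_eval_def using assms by (intro finprod_cong') auto

lemma frag_eval_0 [simp]: "frag_eval G f 0 = \<one>"
  by (simp add: frag_eval_def)

lemma frag_eval_of [simp]: "f a \<in> carrier G \<Longrightarrow> frag_eval G f (frag_of a) = f a"
  by (simp add: frag_eval_def)

lemma frag_eval_add:
  assumes "f \<in> Poly_Mapping.keys x \<rightarrow> carrier G" "f \<in> Poly_Mapping.keys y \<rightarrow> carrier G"
  shows "frag_eval G f (x + y) = frag_eval G f x \<otimes> frag_eval G f y"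
proof -
  let ?K = "Poly_Mapping.keys x \<union> Poly_Mapping.keys y"
  have f: "f \<in> ?K \<rightarrow> carrier G" using assms by blast
  have K: "Poly_Mapping.keys (x + y) \<subseteq> ?K" by (rule keys_add)
  have "frag_eval G f (x + y) = finprod G (\<lambda>a. f a [^] Poly_Mapping.lookup (x + y) a) ?K"
    by (rule frag_eval_superset) (use f K in auto)
  also have "\<dots> = finprod G (\<lambda>a. f a [^] Poly_Mapping.lookup x a \<otimes> f a [^] Poly_Mapping.lookup y a) ?K"
    using f Pi_mem [OF f] by (intro finprod_cong') (auto simp: Poly_Mapping.lookup_add int_pow_mult Pi_iff)
  also have "\<dots> = finprod G (\<lambda>a. f a [^] Poly_Mapping.lookup x a) ?K \<otimes> finprod G (\<lambda>a. f a [^] Poly_Mapping.lookup y a) ?K"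
    using f by (intro finprod_multf) auto
  also have "\<dots> = frag_eval G f x \<otimes> frag_eval G f y"
    using f by (simp add: frag_eval_superset [of ?K x f] frag_eval_superset [of ?K y f])
  finally show ?thesis .
qed

lemma frag_eval_cmul:
  assumes "f \<in> Poly_Mapping.keys x \<rightarrow> carrier G"
  shows "frag_eval G f (frag_cmul n x) = frag_eval G f x [^] n"
proof -
  have *: "finprod G (\<lambda>a. f a [^] (n * Poly_Mapping.lookup x a)) K
           = finprod G (\<lambda>a. f a [^] Poly_Mapping.lookup x a) K [^] n"
    if "finite K" "f \<in> K \<rightarrow> carrier G" for K
    using that
  proof (induction K rule: finite_induct)
    case (insert a K)
    then have fa: "f a \<in> carrier G" and fK: "f \<in> K \<rightarrow> carrier G" by auto
    then have "f a [^] (n * Poly_Mapping.lookup x a) = (f a [^] Poly_Mapping.lookup x a) [^] n"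
      by (simp add: int_pow_pow mult.commute)
    moreover have "(\<lambda>a. f a [^] (n * Poly_Mapping.lookup x a)) \<in> K \<rightarrow> carrier G"
      "(\<lambda>a. f a [^] Poly_Mapping.lookup x a) \<in> K \<rightarrow> carrier G"
      using fK by auto
    ultimately show ?case
      using insert fa fK by (simp add: int_pow_distrib finprod_closed)
  qed auto
  have "frag_eval G f (frag_cmul n x) = finprod G (\<lambda>a. f a [^] Poly_Mapping.lookup (frag_cmul n x) a) (Poly_Mapping.keys x)"
    by (rule frag_eval_superset) (use assms in \<open>auto simp: keys_cmul\<close>)
  then show ?thesis
    using * [of "Poly_Mapping.keys x"] assms by (simp add: frag_eval_def)
qed

lemma frag_eval_sum:
  assumes "finite I" "\<And>i. i \<in> I \<Longrightarrow> f \<in> Poly_Mapping.keys (x i) \<rightarrow> carrier G"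
  shows "frag_eval G f (\<Sum>i\<in>I. x i) = finprod G (\<lambda>i. frag_eval G f (x i)) I"
  using assms
proof (induction I rule: finite_induct)
  case (insert i I)
  have "f \<in> Poly_Mapping.keys (\<Sum>i\<in>I. x i) \<rightarrow> carrier G"
    using insert.prems keys_sum [of x I] by blast
  then show ?case
    using insert by (subst finprod_insert) (auto simp: frag_eval_add)
qed auto

lemma frag_eval_extend:
  assumes "\<And>a. a \<in> Poly_Mapping.keys x \<Longrightarrow> f \<in> Poly_Mapping.keys (u a) \<rightarrow> carrier G"
  shows "frag_eval G f (frag_extend u x) = frag_eval G (\<lambda>a. frag_eval G f (u a)) x"
proof -
  have "frag_eval G f (frag_extend u x)
     = finprod G (\<lambda>a. frag_eval G f (frag_cmul (Poly_Mapping.lookup x a) (u a))) (Poly_Mapping.keys x)"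
    unfolding frag_extend_def
    by (rule frag_eval_sum) (use assms keys_cmul in \<open>auto simp: Pi_iff\<close>)
  also have "\<dots> = frag_eval G (\<lambda>a. frag_eval G f (u a)) x"
    unfolding frag_eval_def [of G "\<lambda>a. frag_eval G f (u a)"]
    by (rule finprod_cong') (use assms in \<open>auto simp: frag_eval_cmul\<close>)
  finally show ?thesis .
qed

lemma finprod_hom:
  assumes "h \<in> hom G H" "comm_group H" "f \<in> I \<rightarrow> carrier G"
  shows "h (finprod G f I) = finprod H (h \<circ> f) I"
  using assms(3)
proof (induction I rule: infinite_finite_induct)
  interpret H: comm_group H by fact
  \<comment> \<open>A product over an infinite set is the unit by convention, on both sides.\<close>
  case (infinite A)
  then show ?case using assms by (simp add: hom_one)
next
  interpret H: comm_group H by fact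
  case empty
  then show ?case using assms by (simp add: hom_one)
next
  interpret H: comm_group H by fact
  case (insert x F)
  have "(\<lambda>a. h (f a)) \<in> F \<rightarrow> carrier H" "h (f x) \<in> carrier H"
    using insert.prems hom_in_carrier [OF assms(1)] by (auto simp: Pi_iff)
  then show ?case using insert hom_mult [OF assms(1)] by (simp add: finprod_closed)
qed

lemma frag_eval_hom:
  assumes "h \<in> hom G H" "comm_group H" "f \<in> Poly_Mapping.keys x \<rightarrow> carrier G"
  shows "h (frag_eval G f x) = frag_eval H (h \<circ> f) x"
proof -
  interpret H: comm_group H by fact
  have "h (frag_eval G f x) = finprod H (h \<circ> (\<lambda>a. f a [^] Poly_Mapping.lookup x a)) (Poly_Mapping.keys x)"
    unfolding frag_eval_def by (rule finprod_hom) (use assms in auto)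
  also have "\<dots> = frag_eval H (h \<circ> f) x"
    unfolding frag_eval_def
    using assms hom_in_carrier [OF assms(1)]
    by (intro H.finprod_cong') (auto simp: hom_int_pow [OF assms(1)] Pi_iff is_group)
  finally show ?thesis .
qed

lemma frag_eval_mult_fun:
  assumes "f \<in> Poly_Mapping.keys x \<rightarrow> carrier G" "g \<in> Poly_Mapping.keys x \<rightarrow> carrier G"
  shows "frag_eval G (\<lambda>a. f a \<otimes> g a) x = frag_eval G f x \<otimes> frag_eval G g x"
proof -
  have "frag_eval G (\<lambda>a. f a \<otimes> g a) x = finprod G (\<lambda>a. f a [^] Poly_Mapping.lookup x a \<otimes> g a [^] Poly_Mapping.lookup x a) (Poly_Mapping.keys x)"
    unfolding frag_eval_def
    by (rule finprod_cong') (use assms in \<open>auto simp: int_pow_distrib Pi_iff\<close>)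
  then show ?thesis
    unfolding frag_eval_def using assms by (subst finprod_multf [symmetric]) auto
qed

end

section \<open>Isomorphisms of quotients of abelian groups\<close>

text \<open>\<open>F\<close> induces an isomorphism from \<open>Z / B\<close> to \<open>Z' / B'\<close>, expressed without quotient groups.\<close>

definition quot_equiv ::
  "'a monoid \<Rightarrow> 'a set \<Rightarrow> 'a set \<Rightarrow> 'b monoid \<Rightarrow> 'b set \<Rightarrow> 'b set \<Rightarrow> ('a \<Rightarrow> 'b) \<Rightarrow> bool" where
  "quot_equiv C Z B C' Z' B' F \<longleftrightarrow>
     F \<in> hom C C' \<and> F ` Z \<subseteq> Z' \<and> F ` B \<subseteq> B' \<and>
     (\<forall>z'\<in>Z'. \<exists>z\<in>Z. \<exists>b\<in>B'. z' = b \<otimes>\<^bsub>C'\<^esub> F z) \<and> (\<forall>z\<in>Z. F z \<in> B' \<longrightarrow> z \<in> B)"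

lemma quot_equivD:
  assumes "quot_equiv C Z B C' Z' B' F"
  shows "F \<in> hom C C'" "z \<in> Z \<Longrightarrow> F z \<in> Z'" "z \<in> B \<Longrightarrow> F z \<in> B'"
    "z' \<in> Z' \<Longrightarrow> \<exists>z\<in>Z. \<exists>b\<in>B'. z' = b \<otimes>\<^bsub>C'\<^esub> F z"
    "\<lbrakk>z \<in> Z; F z \<in> B'\<rbrakk> \<Longrightarrow> z \<in> B"
  using assms by (simp_all add: quot_equiv_def image_subset_iff)

text \<open>Surjectivity modulo boundaries composes because the correction \<open>b\<close> made for
  \<open>F\<close> is carried by \<open>F'\<close> into \<open>B''\<close>, where it merges with the
  correction made for \<open>F'\<close>.\<close>

lemma quot_equiv_comp:
  assumes F: "quot_equiv C Z B C' Z' B' F" and F': "quot_equiv C' Z' B' C'' Z'' B'' F'"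
    and C'': "comm_group C''" "subgroup B'' C''" and Z: "Z \<subseteq> carrier C" and B': "B' \<subseteq> carrier C'"
  shows "quot_equiv C Z B C'' Z'' B'' (F' \<circ> F)"
proof -
  interpret C'': comm_group C'' by fact
  note FD = quot_equivD [OF F] and FD' = quot_equivD [OF F']
  have "\<exists>z\<in>Z. \<exists>b\<in>B''. z'' = b \<otimes>\<^bsub>C''\<^esub> (F' \<circ> F) z" if z'': "z'' \<in> Z''" for z''
  proof -
    obtain z' b' where z': "z' \<in> Z'" "b' \<in> B''" "z'' = b' \<otimes>\<^bsub>C''\<^esub> F' z'"
      using FD'(4) [OF z''] by auto
    obtain z b where z: "z \<in> Z" "b \<in> B'" "z' = b \<otimes>\<^bsub>C'\<^esub> F z"
      using FD(4) [OF z'(1)] by auto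
    have "F' b \<in> B''" using FD'(3) [OF z(2)] .
    have car: "b \<in> carrier C'" "F z \<in> carrier C'"
      using z(1,2) Z B' hom_in_carrier [OF FD(1)] by auto
    have "b' \<in> carrier C''" "F' b \<in> carrier C''"
      using subgroup.mem_carrier [OF C''(2)] z'(2) \<open>F' b \<in> B''\<close> by auto
    then have "z'' = (b' \<otimes>\<^bsub>C''\<^esub> F' b) \<otimes>\<^bsub>C''\<^esub> F' (F z)"
      using z'(3) z(3) hom_mult [OF FD'(1) car] hom_in_carrier [OF FD'(1)] car
      by (simp add: C''.m_assoc)
    moreover have "b' \<otimes>\<^bsub>C''\<^esub> F' b \<in> B''"
      using subgroup.m_closed [OF C''(2) z'(2) \<open>F' b \<in> B''\<close>] .
    ultimately show ?thesis
      using z(1) by auto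
  qed
  then have "\<forall>z''\<in>Z''. \<exists>z\<in>Z. \<exists>b\<in>B''. z'' = b \<otimes>\<^bsub>C''\<^esub> (F' \<circ> F) z" by simp
  moreover have "\<forall>z\<in>Z. (F' \<circ> F) z \<in> B'' \<longrightarrow> z \<in> B"
    using FD(2,5) FD'(5) by simp
  moreover have "\<forall>z\<in>Z. (F' \<circ> F) z \<in> Z''" "\<forall>z\<in>B. (F' \<circ> F) z \<in> B''"
    using FD(2,3) FD'(2,3) by simp_all
  ultimately show ?thesis
    unfolding quot_equiv_def image_subset_iff
    using hom_compose [OF FD(1) FD'(1)] by - (intro conjI; assumption)
qed

text \<open>The map on cosets has the shape of \<open>local_homology_map\<close> and
  \<open>local_cohomology_map\<close>. It sends the coset of \<open>z\<close> to that of
  \<open>F z\<close>: another representative \<open>b z\<close> gives \<open>F b\<close> times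
  \<open>F z\<close>, and \<open>F b\<close> is absorbed by the factor \<open>B'\<close>. The rest
  is arithmetic of cosets.\<close>

lemma quot_equiv_iso:
  assumes F: "quot_equiv C Z B C' Z' B' F"
    and C: "comm_group C" "subgroup Z C" "subgroup B C" "B \<subseteq> Z"
    and C': "comm_group C'" "subgroup Z' C'" "subgroup B' C'" "B' \<subseteq> Z'"
  shows "(\<lambda>D. B' <#>\<^bsub>C'\<^esub> (F ` D))
           \<in> iso (subgroup_generated C Z Mod B) (subgroup_generated C' Z' Mod B')"
proof -
  interpret C: comm_group C by fact
  interpret C': comm_group C' by fact
  interpret Z: subgroup Z C by fact
  interpret B: subgroup B C by fact
  interpret Z': subgroup Z' C' by fact
  interpret B': subgroup B' C' by fact
  let ?\<phi> = "\<lambda>D. B' <#>\<^bsub>C'\<^esub> (F ` D)"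
  have hom: "F \<in> hom C C'" and FZ: "\<And>z. z \<in> Z \<Longrightarrow> F z \<in> Z'" and FB: "\<And>z. z \<in> B \<Longrightarrow> F z \<in> B'"
    and surj: "\<And>z'. z' \<in> Z' \<Longrightarrow> \<exists>z\<in>Z. \<exists>b\<in>B'. z' = b \<otimes>\<^bsub>C'\<^esub> F z"
    and inj: "\<And>z. z \<in> Z \<Longrightarrow> F z \<in> B' \<Longrightarrow> z \<in> B"
    using quot_equivD [OF F] by simp_all
  have car: "carrier (subgroup_generated C Z Mod B) = (\<lambda>z. B #>\<^bsub>C\<^esub> z) ` Z"
    using C by (auto simp: FactGroup_def RCOSETS_def Z.carrier_subgroup_generated_subgroup r_coset_def)
  have car': "carrier (subgroup_generated C' Z' Mod B') = (\<lambda>z. B' #>\<^bsub>C'\<^esub> z) ` Z'"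
    using C' by (auto simp: FactGroup_def RCOSETS_def Z'.carrier_subgroup_generated_subgroup r_coset_def)
  have \<phi>: "?\<phi> (B #>\<^bsub>C\<^esub> z) = B' #>\<^bsub>C'\<^esub> F z" if "z \<in> Z" for z
  proof
    show "?\<phi> (B #>\<^bsub>C\<^esub> z) \<subseteq> B' #>\<^bsub>C'\<^esub> F z"
    proof (clarsimp simp: set_mult_def r_coset_def)
      fix b' b assume b: "b' \<in> B'" "b \<in> B"
      have "b' \<otimes>\<^bsub>C'\<^esub> F (b \<otimes>\<^bsub>C\<^esub> z) = (b' \<otimes>\<^bsub>C'\<^esub> F b) \<otimes>\<^bsub>C'\<^esub> F z"
        using b that FB FZ hom_mult [OF hom, of b z] by (simp add: C'.m_assoc)
      then show "\<exists>h\<in>B'. b' \<otimes>\<^bsub>C'\<^esub> F (b \<otimes>\<^bsub>C\<^esub> z) = h \<otimes>\<^bsub>C'\<^esub> F z"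
        using b FB by auto
    qed
    show "B' #>\<^bsub>C'\<^esub> F z \<subseteq> ?\<phi> (B #>\<^bsub>C\<^esub> z)"
    proof (clarsimp simp: set_mult_def r_coset_def)
      fix b' assume "b' \<in> B'"
      then show "\<exists>xa\<in>B'. \<exists>x\<in>B. b' \<otimes>\<^bsub>C'\<^esub> F z = xa \<otimes>\<^bsub>C'\<^esub> F (x \<otimes>\<^bsub>C\<^esub> z)"
        using that by (intro bexI [of _ b'] bexI [of _ "\<one>\<^bsub>C\<^esub>"]) auto
    qed
  qed
  have nB: "B \<lhd> C" and nB': "B' \<lhd> C'"
    using C.subgroup_imp_normal C'.subgroup_imp_normal C C' by auto
  \<comment> \<open>\<open>subgroup_generated\<close> keeps the multiplication of \<open>C\<close>,
    so cosets are still multiplied as sets in \<open>C\<close>.\<close>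
  have mult: "D1 \<otimes>\<^bsub>subgroup_generated C Z Mod B\<^esub> D2 = D1 <#>\<^bsub>C\<^esub> D2" for D1 D2
    by (simp add: FactGroup_def set_mult_def)
  have mult': "D1 \<otimes>\<^bsub>subgroup_generated C' Z' Mod B'\<^esub> D2 = D1 <#>\<^bsub>C'\<^esub> D2" for D1 D2
    by (simp add: FactGroup_def set_mult_def)
  show ?thesis
    unfolding iso_def
  proof (intro CollectI conjI homI)
    show "?\<phi> D \<in> carrier (subgroup_generated C' Z' Mod B')"
      if "D \<in> carrier (subgroup_generated C Z Mod B)" for D
      using that FZ unfolding car car' by (auto simp: \<phi>)
    show "?\<phi> (D1 \<otimes>\<^bsub>subgroup_generated C Z Mod B\<^esub> D2)
        = ?\<phi> D1 \<otimes>\<^bsub>subgroup_generated C' Z' Mod B'\<^esub> ?\<phi> D2"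
      if D: "D1 \<in> carrier (subgroup_generated C Z Mod B)" "D2 \<in> carrier (subgroup_generated C Z Mod B)" for D1 D2
    proof -
      obtain z1 where 1: "D1 = B #>\<^bsub>C\<^esub> z1" "z1 \<in> Z"
        using D(1) unfolding car by (rule imageE)
      obtain z2 where 2: "D2 = B #>\<^bsub>C\<^esub> z2" "z2 \<in> Z"
        using D(2) unfolding car by (rule imageE)
      note z = 1(2) 2(2) 1(1) 2(1)
      have "D1 <#>\<^bsub>C\<^esub> D2 = B #>\<^bsub>C\<^esub> (z1 \<otimes>\<^bsub>C\<^esub> z2)"
        unfolding z(3,4) by (rule normal.rcos_sum [OF nB]) (use z in auto)
      moreover have "(B' #>\<^bsub>C'\<^esub> F z1) <#>\<^bsub>C'\<^esub> (B' #>\<^bsub>C'\<^esub> F z2) = B' #>\<^bsub>C'\<^esub> (F z1 \<otimes>\<^bsub>C'\<^esub> F z2)"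
        by (rule normal.rcos_sum [OF nB']) (use z FZ in auto)
      ultimately show ?thesis
        unfolding mult mult' using z \<phi> hom_mult [OF hom, of z1 z2] by simp
    qed
    show "bij_betw ?\<phi> (carrier (subgroup_generated C Z Mod B)) (carrier (subgroup_generated C' Z' Mod B'))"
      unfolding bij_betw_def car car'
    proof
      show "inj_on ?\<phi> ((\<lambda>z. B #>\<^bsub>C\<^esub> z) ` Z)"
      proof (rule inj_onI, clarsimp simp: \<phi>)
        fix z w assume z: "z \<in> Z" "w \<in> Z" and eq: "B' #>\<^bsub>C'\<^esub> F z = B' #>\<^bsub>C'\<^esub> F w"
        have "F z \<in> B' #>\<^bsub>C'\<^esub> F w"
          using C'.rcos_self [OF _ C'(3), of "F z"] eq FZ [OF z(1)] by simp
        then have "F z \<otimes>\<^bsub>C'\<^esub> inv\<^bsub>C'\<^esub> F w \<in> B'"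
          using B'.rcos_module_imp [OF C'.is_group] FZ [OF z(2)] by simp
        moreover have "F (z \<otimes>\<^bsub>C\<^esub> inv\<^bsub>C\<^esub> w) = F z \<otimes>\<^bsub>C'\<^esub> inv\<^bsub>C'\<^esub> F w"
          using z hom_mult [OF hom, of z "inv\<^bsub>C\<^esub> w"] group_hom.hom_inv [of C C' F w] hom
          by (simp add: group_hom_def group_hom_axioms_def C.is_group C'.is_group)
        ultimately have "z \<otimes>\<^bsub>C\<^esub> inv\<^bsub>C\<^esub> w \<in> B"
          using inj z by simp
        then have "z \<in> B #>\<^bsub>C\<^esub> w"
          using B.rcos_module_rev [OF C.is_group, of w z] z by simp
        then show "B #>\<^bsub>C\<^esub> z = B #>\<^bsub>C\<^esub> w"
          using C.repr_independence [of z B w] z C(3) by simp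
      qed
      show "?\<phi> ` (\<lambda>z. B #>\<^bsub>C\<^esub> z) ` Z = (\<lambda>z. B' #>\<^bsub>C'\<^esub> z) ` Z'"
      proof
        show "?\<phi> ` (\<lambda>z. B #>\<^bsub>C\<^esub> z) ` Z \<subseteq> (\<lambda>z. B' #>\<^bsub>C'\<^esub> z) ` Z'"
          using FZ by (auto simp: \<phi>)
        show "(\<lambda>z. B' #>\<^bsub>C'\<^esub> z) ` Z' \<subseteq> ?\<phi> ` (\<lambda>z. B #>\<^bsub>C\<^esub> z) ` Z"
        proof clarify
          fix z' assume "z' \<in> Z'"
          then obtain z b where z: "z \<in> Z" "b \<in> B'" "z' = b \<otimes>\<^bsub>C'\<^esub> F z"
            using surj by blast
          then have "z' \<in> B' #>\<^bsub>C'\<^esub> F z" by (auto simp: r_coset_def)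
          then have "B' #>\<^bsub>C'\<^esub> z' = B' #>\<^bsub>C'\<^esub> F z"
            using C'.repr_independence [of z' B' "F z"] FZ [OF z(1)] C'(3) by simp
          then show "B' #>\<^bsub>C'\<^esub> z' \<in> ?\<phi> ` (\<lambda>z. B #>\<^bsub>C\<^esub> z) ` Z"
            using z(1) \<phi> [OF z(1)] by blast
        qed
      qed
    qed
  qed
qed

section \<open>Direct sums and products of abelian groups\<close>

definition sum_single :: "'s set \<Rightarrow> ('s \<Rightarrow> 'g monoid) \<Rightarrow> 's \<Rightarrow> 'g \<Rightarrow> 's \<Rightarrow> 'g" where
  "sum_single S A \<sigma> g = (\<lambda>\<tau>\<in>S. if \<tau> = \<sigma> then g else \<one>\<^bsub>A \<tau>\<^esub>)"

lemma comm_group_product_group: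
  assumes "\<forall>i\<in>I. comm_group (G i)"
  shows "comm_group (product_group I G)"
proof (rule group.group_comm_groupI)
  show "group (product_group I G)"
    using assms by (simp add: comm_group.axioms(2))
qed (use assms in \<open>auto simp: PiE_iff comm_group.axioms(1) intro!: restrict_ext comm_monoid.m_comm\<close>)

lemma comm_group_sum_group:
  assumes "\<forall>i\<in>I. comm_group (G i)"
  shows "comm_group (sum_group I G)"
proof (rule group.group_comm_groupI)
  show "group (sum_group I G)"
    using assms by (simp add: comm_group.axioms(2))
next
  fix x y assume "x \<in> carrier (sum_group I G)" "y \<in> carrier (sum_group I G)"
  then have "x \<in> (\<Pi>\<^sub>E i\<in>I. carrier (G i))" "y \<in> (\<Pi>\<^sub>E i\<in>I. carrier (G i))"
    using carrier_sum_group [of I G] assms by (simp_all add: comm_group.axioms(2))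
  then show "x \<otimes>\<^bsub>sum_group I G\<^esub> y = y \<otimes>\<^bsub>sum_group I G\<^esub> x"
    using assms by (auto simp: PiE_iff comm_group.axioms(1) intro!: restrict_ext comm_monoid.m_comm)
qed

text \<open>Maps defined in different ways usually agree on the carrier only, since the values
  outside it are arbitrary. Being a homomorphism does not see those values.\<close>

lemma hom_cong_carrier:
  assumes "f \<in> hom G H" "\<And>x. x \<in> carrier G \<Longrightarrow> g x = f x" "group G"
  shows "g \<in> hom G H"
  using assms by (auto simp: hom_def Pi_iff group.is_monoid monoid.m_closed)

lemma iso_restrict:
  assumes "f \<in> iso G H" "group G"
  shows "restrict f (carrier G) \<in> iso G H"
proof -
  have "bij_betw (restrict f (carrier G)) (carrier G) (carrier H)"
    by (subst bij_betw_cong [of _ _ f]) (use assms in \<open>simp_all add: iso_def\<close>)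
  then show ?thesis
    using assms hom_cong_carrier [of f G H "restrict f (carrier G)"] by (simp add: iso_def)
qed

lemma restrict_id_iso: "comm_group H \<Longrightarrow> (\<lambda>g\<in>carrier H. g) \<in> iso H H"
  using iso_restrict [OF iso_set_refl, of H] by (simp add: comm_group.axioms(2))

lemma iso_compose:
  assumes "f \<in> iso G H" "h \<in> iso H K" "group G"
  shows "compose (carrier G) h f \<in> iso G K"
  using iso_restrict [OF iso_set_trans [OF assms(1,2)] assms(3)]
  by (simp add: compose_def restrict_def comp_def)

context
  fixes S :: "'s set" and A :: "'s \<Rightarrow> 'g monoid"
  assumes A: "\<forall>\<sigma>\<in>S. comm_group (A \<sigma>)"
begin

lemma sum_group_carrier_iff:
  "c \<in> carrier (sum_group S A) \<longleftrightarrow> c \<in> (\<Pi>\<^sub>E i\<in>S. carrier (A i)) \<and> finite {i \<in> S. c i \<noteq> \<one>\<^bsub>A i\<^esub>}"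
  by (subst carrier_sum_group) (use A in \<open>auto simp: comm_group.axioms(2)\<close>)

lemma sum_single_closed:
  assumes "\<sigma> \<in> S" "g \<in> carrier (A \<sigma>)"
  shows "sum_single S A \<sigma> g \<in> carrier (sum_group S A)"
proof -
  have "{i \<in> S. sum_single S A \<sigma> g i \<noteq> \<one>\<^bsub>A i\<^esub>} \<subseteq> {\<sigma>}"
    by (auto simp: sum_single_def)
  then have "finite {i \<in> S. sum_single S A \<sigma> g i \<noteq> \<one>\<^bsub>A i\<^esub>}"
    using finite_subset by blast
  moreover have "\<one>\<^bsub>A i\<^esub> \<in> carrier (A i)" if "i \<in> S" for i
    using bspec [OF A that] by (simp add: comm_group.axioms(2) group.is_monoid)
  ultimately show ?thesis
    unfolding sum_group_carrier_iff using assms by (auto simp: sum_single_def)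
qed

lemma sum_single_hom:
  assumes "\<sigma> \<in> S"
  shows "sum_single S A \<sigma> \<in> hom (A \<sigma>) (sum_group S A)"
proof (rule homI)
  show "sum_single S A \<sigma> (x \<otimes>\<^bsub>A \<sigma>\<^esub> y) = sum_single S A \<sigma> x \<otimes>\<^bsub>sum_group S A\<^esub> sum_single S A \<sigma> y"
    if "x \<in> carrier (A \<sigma>)" "y \<in> carrier (A \<sigma>)" for x y
  proof (rule ext)
    fix \<tau>
    have "\<one>\<^bsub>A \<tau>\<^esub> \<otimes>\<^bsub>A \<tau>\<^esub> \<one>\<^bsub>A \<tau>\<^esub> = \<one>\<^bsub>A \<tau>\<^esub>" if "\<tau> \<in> S"
      using bspec [OF A that] by (simp add: comm_group.axioms(2) group.is_monoid)
    then show "sum_single S A \<sigma> (x \<otimes>\<^bsub>A \<sigma>\<^esub> y) \<tau> = (sum_single S A \<sigma> x \<otimes>\<^bsub>sum_group S A\<^esub> sum_single S A \<sigma> y) \<tau>"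
      by (auto simp: sum_single_def)
  qed
qed (simp add: sum_single_closed assms)

text \<open>Checked coordinate by coordinate: evaluation at \<open>\<tau>\<close> is a homomorphism,
  and it sends every factor except that of \<open>\<tau>\<close> to the unit.\<close>

lemma sum_single_expansion:
  assumes c: "c \<in> carrier (sum_group S A)"
  shows "c = finprod (sum_group S A) (\<lambda>\<sigma>. sum_single S A \<sigma> (c \<sigma>)) {\<sigma> \<in> S. c \<sigma> \<noteq> \<one>\<^bsub>A \<sigma>\<^esub>}"
    (is "c = ?r")
proof
  interpret C: comm_group "sum_group S A" by (rule comm_group_sum_group [OF A])
  let ?supp = "{\<sigma> \<in> S. c \<sigma> \<noteq> \<one>\<^bsub>A \<sigma>\<^esub>}"
  have cc: "c \<sigma> \<in> carrier (A \<sigma>)" if "\<sigma> \<in> S" for \<sigma>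
    using c that unfolding sum_group_carrier_iff by auto
  have single: "(\<lambda>\<sigma>. sum_single S A \<sigma> (c \<sigma>)) \<in> ?supp \<rightarrow> carrier (sum_group S A)"
    using cc sum_single_closed by auto
  have r: "?r \<in> carrier (sum_group S A)"
    using single by (rule C.finprod_closed)
  fix \<tau>
  show "c \<tau> = ?r \<tau>"
  proof (cases "\<tau> \<in> S")
    case True
    interpret At: comm_group "A \<tau>" by (rule bspec [OF A True])
    have "(\<lambda>c. c \<tau>) \<in> hom (sum_group S A) (A \<tau>)"
      using True by (auto intro!: homI simp: sum_group_carrier_iff)
    then have "?r \<tau> = finprod (A \<tau>) ((\<lambda>c. c \<tau>) \<circ> (\<lambda>\<sigma>. sum_single S A \<sigma> (c \<sigma>))) ?supp"
      by (rule C.finprod_hom [OF _ At.comm_group_axioms single])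
    also have "\<dots> = finprod (A \<tau>) (\<lambda>\<sigma>. if \<tau> = \<sigma> then c \<tau> else \<one>\<^bsub>A \<tau>\<^esub>) ?supp"
      using True cc by (intro At.finprod_cong') (auto simp: sum_single_def)
    also have "\<dots> = c \<tau>"
    proof (cases "\<tau> \<in> ?supp")
      case True
      then show ?thesis
        using At.finprod_singleton [of \<tau> ?supp "\<lambda>_. c \<tau>"] c cc
        unfolding sum_group_carrier_iff by auto
    next
      case False
      then have "finprod (A \<tau>) (\<lambda>\<sigma>. if \<tau> = \<sigma> then c \<tau> else \<one>\<^bsub>A \<tau>\<^esub>) ?supp = finprod (A \<tau>) (\<lambda>\<sigma>. \<one>\<^bsub>A \<tau>\<^esub>) ?supp"
        by (intro At.finprod_cong') auto
      with False True show ?thesis by simp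
    qed
    finally show ?thesis by simp
  next
    case False
    \<comment> \<open>Off the index set both sides are extensional functions, hence take the same
      default value.\<close>
    have *: "d \<tau> = undefined" if "d \<in> carrier (sum_group S A)" for d
      using that PiE_arb [OF _ False] unfolding sum_group_carrier_iff by blast
    show ?thesis
      by (rule trans [OF * [OF c] * [OF r, symmetric]])
  qed
qed

text \<open>The elements concentrated on one index generate the direct sum. Identities between
  operators on chains are all reduced to generators by this rule.\<close>

lemma sum_group_hom_eqI:
  assumes "h \<in> hom (sum_group S A) H" "h' \<in> hom (sum_group S A) H" "comm_group H"
    and eq: "\<And>\<sigma> g. \<sigma> \<in> S \<Longrightarrow> g \<in> carrier (A \<sigma>) \<Longrightarrow> h (sum_single S A \<sigma> g) = h' (sum_single S A \<sigma> g)"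
    and c: "c \<in> carrier (sum_group S A)"
  shows "h c = h' c"
proof -
  interpret C: comm_group "sum_group S A" by (rule comm_group_sum_group [OF A])
  interpret H: comm_group H by fact
  let ?supp = "{\<sigma> \<in> S. c \<sigma> \<noteq> \<one>\<^bsub>A \<sigma>\<^esub>}"
  have cc: "c \<sigma> \<in> carrier (A \<sigma>)" if "\<sigma> \<in> S" for \<sigma>
    using c that unfolding sum_group_carrier_iff by auto
  have single: "(\<lambda>\<sigma>. sum_single S A \<sigma> (c \<sigma>)) \<in> ?supp \<rightarrow> carrier (sum_group S A)"
    using cc sum_single_closed by auto
  have "h c = finprod H (h \<circ> (\<lambda>\<sigma>. sum_single S A \<sigma> (c \<sigma>))) ?supp"
    unfolding C.finprod_hom [OF assms(1,3) single, symmetric] sum_single_expansion [OF c, symmetric] ..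
  also have "\<dots> = finprod H (h' \<circ> (\<lambda>\<sigma>. sum_single S A \<sigma> (c \<sigma>))) ?supp"
    using single cc hom_in_carrier [OF assms(2)]
    by (intro H.finprod_cong') (auto simp: eq Pi_iff)
  also have "\<dots> = h' c"
    unfolding C.finprod_hom [OF assms(2,3) single, symmetric] sum_single_expansion [OF c, symmetric] ..
  finally show ?thesis .
qed

text \<open>The universal property of the direct sum, with the extension written as a product over
  the support, which is how \<open>local_boundary\<close> and \<open>local_chain_map\<close> are
  written.\<close>

lemma sum_group_extend:
  assumes H: "comm_group H" and F: "\<And>\<sigma>. \<sigma> \<in> S \<Longrightarrow> F \<sigma> \<in> hom (A \<sigma>) H"
  shows sum_group_extend_hom: "(\<lambda>c. finprod H (\<lambda>\<sigma>. F \<sigma> (c \<sigma>)) {\<sigma> \<in> S. c \<sigma> \<noteq> \<one>\<^bsub>A \<sigma>\<^esub>}) \<in> hom (sum_group S A) H"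
    and sum_group_extend_single:
      "\<sigma> \<in> S \<Longrightarrow> g \<in> carrier (A \<sigma>) \<Longrightarrow>
       finprod H (\<lambda>\<tau>. F \<tau> (sum_single S A \<sigma> g \<tau>)) {\<tau> \<in> S. sum_single S A \<sigma> g \<tau> \<noteq> \<one>\<^bsub>A \<tau>\<^esub>} = F \<sigma> g"
proof -
  interpret H: comm_group H by fact
  have one: "F \<sigma> \<one>\<^bsub>A \<sigma>\<^esub> = \<one>\<^bsub>H\<^esub>" if "\<sigma> \<in> S" for \<sigma>
    using F [OF that] bspec [OF A that] by (simp add: hom_one comm_group.axioms(2))
  have car: "F \<sigma> x \<in> carrier H" if "\<sigma> \<in> S" "x \<in> carrier (A \<sigma>)" for \<sigma> x
    using hom_in_carrier [OF F] that by blast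
  \<comment> \<open>\<open>gfinprod\<close> keeps the indices where the value
    \<open>F \<sigma> (c \<sigma>)\<close> is not the unit, the statement those where
    \<open>c \<sigma>\<close> is not. The extra factors are units.\<close>
  have eq: "gfinprod H (\<lambda>\<sigma>. F \<sigma> (c \<sigma>)) S = finprod H (\<lambda>\<sigma>. F \<sigma> (c \<sigma>)) {\<sigma> \<in> S. c \<sigma> \<noteq> \<one>\<^bsub>A \<sigma>\<^esub>}"
    if "c \<in> carrier (sum_group S A)" for c
  proof -
    have c: "\<And>\<sigma>. \<sigma> \<in> S \<Longrightarrow> c \<sigma> \<in> carrier (A \<sigma>)" and fin: "finite {\<sigma> \<in> S. c \<sigma> \<noteq> \<one>\<^bsub>A \<sigma>\<^esub>}"
      using that unfolding sum_group_carrier_iff by auto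
    have sub: "{\<sigma> \<in> S. F \<sigma> (c \<sigma>) \<noteq> \<one>\<^bsub>H\<^esub>} \<subseteq> {\<sigma> \<in> S. c \<sigma> \<noteq> \<one>\<^bsub>A \<sigma>\<^esub>}"
      using one by auto
    show ?thesis
      unfolding gfinprod_def using finite_subset [OF sub fin] sub c car fin
      by (auto intro!: H.finprod_mono_neutral_cong_left)
  qed
  have "(\<lambda>c. gfinprod H (\<lambda>\<sigma>. F \<sigma> (c \<sigma>)) S) \<in> hom (sum_group S A) H"
    by (rule H.hom_group_sum) (use F A comm_group.axioms(2) in blast)+
  then show "(\<lambda>c. finprod H (\<lambda>\<sigma>. F \<sigma> (c \<sigma>)) {\<sigma> \<in> S. c \<sigma> \<noteq> \<one>\<^bsub>A \<sigma>\<^esub>}) \<in> hom (sum_group S A) H"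
    by (rule hom_cong_carrier) (simp_all add: eq comm_group.axioms(2) [OF comm_group_sum_group [OF A]])
  assume \<sigma>: "\<sigma> \<in> S" and g: "g \<in> carrier (A \<sigma>)"
  have "finprod H (\<lambda>\<tau>. F \<tau> (sum_single S A \<sigma> g \<tau>)) {\<tau> \<in> S. sum_single S A \<sigma> g \<tau> \<noteq> \<one>\<^bsub>A \<tau>\<^esub>}
      = finprod H (\<lambda>\<tau>. F \<tau> (sum_single S A \<sigma> g \<tau>)) {\<sigma>}"
    by (rule H.finprod_mono_neutral_cong_left)
      (use \<sigma> g one car in \<open>auto simp: sum_single_def split: if_splits\<close>)
  also have "\<dots> = F \<sigma> g"
    using \<sigma> g car by (simp add: sum_single_def)
  finally show "finprod H (\<lambda>\<tau>. F \<tau> (sum_single S A \<sigma> g \<tau>)) {\<tau> \<in> S. sum_single S A \<sigma> g \<tau> \<noteq> \<one>\<^bsub>A \<tau>\<^esub>} = F \<sigma> g" .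
qed

end

section \<open>Local operators on chains and cochains\<close>

text \<open>An operator is given by a formal integer combination of pairs \<open>(\<tau>, \<phi>)\<close> for each \<open>\<sigma>\<close>; a pair
  sends the chain \<open>g \<sigma>\<close> to \<open>\<phi>(g) \<tau>\<close> and the cochain \<open>c\<close> to the value
  \<open>\<phi>\<^sup>-\<^sup>1 (c \<tau>)\<close> on \<open>\<sigma>\<close>. Identities between formal combinations then hold for
  homology and cohomology at once.\<close>

definition local_op ::
  "'s set \<Rightarrow> ('s \<Rightarrow> 'g monoid) \<Rightarrow> 't set \<Rightarrow> ('t \<Rightarrow> 'g monoid) \<Rightarrow> ('s \<Rightarrow> ('t \<times> ('g \<Rightarrow> 'g)) \<Rightarrow>\<^sub>0 int) \<Rightarrow> bool" where
  "local_op S A S' A' \<Phi> \<longleftrightarrow>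
     (\<forall>\<sigma>\<in>S. \<forall>x\<in>Poly_Mapping.keys (\<Phi> \<sigma>). fst x \<in> S' \<and> snd x \<in> iso (A \<sigma>) (A' (fst x)))"

text \<open>\<open>compose\<close> cuts the composite down to the carrier of the fibre. Two
  composites that agree on the fibre are then equal as functions, hence the same key of the formal
  combination, and can cancel.\<close>

definition op_comp ::
  "('s \<Rightarrow> 'g monoid) \<Rightarrow> ('t \<Rightarrow> ('u \<times> ('g \<Rightarrow> 'g)) \<Rightarrow>\<^sub>0 int) \<Rightarrow> ('s \<Rightarrow> ('t \<times> ('g \<Rightarrow> 'g)) \<Rightarrow>\<^sub>0 int)
    \<Rightarrow> 's \<Rightarrow> ('u \<times> ('g \<Rightarrow> 'g)) \<Rightarrow>\<^sub>0 int" where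
  "op_comp A \<Psi> \<Phi> \<sigma> =
     frag_extend (\<lambda>x. frag_extend (\<lambda>y. frag_of (fst y, compose (carrier (A \<sigma>)) (snd y) (snd x))) (\<Psi> (fst x))) (\<Phi> \<sigma>)"

definition op_id :: "('s \<Rightarrow> 'g monoid) \<Rightarrow> 's \<Rightarrow> ('s \<times> ('g \<Rightarrow> 'g)) \<Rightarrow>\<^sub>0 int" where
  "op_id A \<sigma> = frag_of (\<sigma>, \<lambda>g\<in>carrier (A \<sigma>). g)"

text \<open>Written as a product over the support so that the singular boundary and the map induced
  by \<open>f\<close> are instances of it.\<close>

definition op_chain ::
  "'s set \<Rightarrow> ('s \<Rightarrow> 'g monoid) \<Rightarrow> 't set \<Rightarrow> ('t \<Rightarrow> 'g monoid) \<Rightarrow> ('s \<Rightarrow> ('t \<times> ('g \<Rightarrow> 'g)) \<Rightarrow>\<^sub>0 int)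
    \<Rightarrow> ('s \<Rightarrow> 'g) \<Rightarrow> 't \<Rightarrow> 'g" where
  "op_chain S A S' A' \<Phi> c =
     finprod (sum_group S' A')
       (\<lambda>\<sigma>. frag_eval (sum_group S' A') (\<lambda>x. sum_single S' A' (fst x) (snd x (c \<sigma>))) (\<Phi> \<sigma>))
       {\<sigma> \<in> S. c \<sigma> \<noteq> \<one>\<^bsub>A \<sigma>\<^esub>}"

text \<open>A value of \<open>c\<close> lives in the fibre over \<open>fst x\<close> and has to
  return to the fibre over \<open>\<sigma>\<close>; this is why \<open>local_op\<close> asks for
  isomorphisms. For the boundary operator the inverse is the one in
  \<open>local_coboundary\<close>.\<close>

definition op_cochain ::
  "'s set \<Rightarrow> ('s \<Rightarrow> 'g monoid) \<Rightarrow> ('s \<Rightarrow> ('t \<times> ('g \<Rightarrow> 'g)) \<Rightarrow>\<^sub>0 int) \<Rightarrow> ('t \<Rightarrow> 'g) \<Rightarrow> 's \<Rightarrow> 'g" where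
  "op_cochain S A \<Phi> c =
     (\<lambda>\<sigma>\<in>S. frag_eval (A \<sigma>) (\<lambda>x. inv_into (carrier (A \<sigma>)) (snd x) (c (fst x))) (\<Phi> \<sigma>))"

lemma local_opD:
  assumes "local_op S A S' A' \<Phi>" "\<sigma> \<in> S" "x \<in> Poly_Mapping.keys (\<Phi> \<sigma>)"
  shows "fst x \<in> S'" "snd x \<in> iso (A \<sigma>) (A' (fst x))" "snd x \<in> hom (A \<sigma>) (A' (fst x))"
    "g \<in> carrier (A \<sigma>) \<Longrightarrow> snd x g \<in> carrier (A' (fst x))"
proof -
  have x: "fst x \<in> S' \<and> snd x \<in> iso (A \<sigma>) (A' (fst x))"
    using assms by (simp add: local_op_def)
  then show "fst x \<in> S'" "snd x \<in> iso (A \<sigma>) (A' (fst x))" by simp_all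
  show h: "snd x \<in> hom (A \<sigma>) (A' (fst x))" using x by (simp add: iso_def)
  show "snd x g \<in> carrier (A' (fst x))" if "g \<in> carrier (A \<sigma>)"
    using hom_in_carrier [OF h that] .
qed

lemma local_op_add:
  assumes "local_op S A S' A' \<Phi>" "local_op S A S' A' \<Psi>"
  shows "local_op S A S' A' (\<lambda>\<sigma>. \<Phi> \<sigma> + \<Psi> \<sigma>)"
  unfolding local_op_def
proof (intro ballI)
  fix \<sigma> x assume "\<sigma> \<in> S" "x \<in> Poly_Mapping.keys (\<Phi> \<sigma> + \<Psi> \<sigma>)"
  then show "fst x \<in> S' \<and> snd x \<in> iso (A \<sigma>) (A' (fst x))"
    using keys_add [of "\<Phi> \<sigma>" "\<Psi> \<sigma>"] local_opD(1,2) [OF assms(1)] local_opD(1,2) [OF assms(2)] by blast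
qed

lemma local_op_id:
  assumes "\<forall>\<sigma>\<in>S. group (A \<sigma>)"
  shows "local_op S A S A (op_id A)"
  using iso_restrict [OF iso_set_refl] assms
  by (auto simp: local_op_def op_id_def)

lemma local_op_comp:
  assumes \<Psi>: "local_op S' A' S'' A'' \<Psi>" and \<Phi>: "local_op S A S' A' \<Phi>"
    and A: "\<forall>\<sigma>\<in>S. group (A \<sigma>)"
  shows "local_op S A S'' A'' (op_comp A \<Psi> \<Phi>)"
  unfolding local_op_def
proof (intro ballI)
  fix \<sigma> z assume \<sigma>: "\<sigma> \<in> S" and "z \<in> Poly_Mapping.keys (op_comp A \<Psi> \<Phi> \<sigma>)"
  then obtain x where x: "x \<in> Poly_Mapping.keys (\<Phi> \<sigma>)"
    and "z \<in> Poly_Mapping.keys (frag_extend (\<lambda>y. frag_of (fst y, compose (carrier (A \<sigma>)) (snd y) (snd x))) (\<Psi> (fst x)))"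
    unfolding op_comp_def using keys_frag_extend by fastforce
  then obtain y where y: "y \<in> Poly_Mapping.keys (\<Psi> (fst x))"
    and "z \<in> Poly_Mapping.keys (frag_of (fst y, compose (carrier (A \<sigma>)) (snd y) (snd x)))"
    using keys_frag_extend by fastforce
  then have z: "z = (fst y, compose (carrier (A \<sigma>)) (snd y) (snd x))" by simp
  note xD = local_opD(1,2) [OF \<Phi> \<sigma> x]
  note yD = local_opD(1,2) [OF \<Psi> xD(1) y]
  show "fst z \<in> S'' \<and> snd z \<in> iso (A \<sigma>) (A'' (fst z))"
    using iso_compose [OF xD(2) yD(2) bspec [OF A \<sigma>]] yD(1) by (simp add: z)
qed

context
  fixes S :: "'s set" and A :: "'s \<Rightarrow> 'g monoid" and S' :: "'t set" and A' :: "'t \<Rightarrow> 'g monoid"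
  assumes A: "\<forall>\<sigma>\<in>S. comm_group (A \<sigma>)" and A': "\<forall>\<sigma>\<in>S'. comm_group (A' \<sigma>)"
begin

lemma single_image_closed:
  assumes "local_op S A S' A' \<Phi>" "\<sigma> \<in> S" "g \<in> carrier (A \<sigma>)"
  shows "(\<lambda>x. sum_single S' A' (fst x) (snd x g)) \<in> Poly_Mapping.keys (\<Phi> \<sigma>) \<rightarrow> carrier (sum_group S' A')"
  using local_opD [OF assms(1,2)] assms(3) sum_single_closed [OF A'] by (auto simp: Pi_iff)

text \<open>Both parts come from the universal property of the direct sum. On the summand of
  \<open>\<sigma>\<close> the operator is additive because each isomorphism of fibres and each
  inclusion of a summand is.\<close>

lemma
  assumes \<Phi>: "local_op S A S' A' \<Phi>"
  shows op_chain_hom: "op_chain S A S' A' \<Phi> \<in> hom (sum_group S A) (sum_group S' A')"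
    and op_chain_single: "\<sigma> \<in> S \<Longrightarrow> g \<in> carrier (A \<sigma>) \<Longrightarrow>
       op_chain S A S' A' \<Phi> (sum_single S A \<sigma> g)
       = frag_eval (sum_group S' A') (\<lambda>x. sum_single S' A' (fst x) (snd x g)) (\<Phi> \<sigma>)"
proof -
  interpret C': comm_group "sum_group S' A'" by (rule comm_group_sum_group [OF A'])
  define F where "F = (\<lambda>\<sigma> g. frag_eval (sum_group S' A') (\<lambda>x. sum_single S' A' (fst x) (snd x g)) (\<Phi> \<sigma>))"
  have F: "F \<sigma> \<in> hom (A \<sigma>) (sum_group S' A')" if \<sigma>: "\<sigma> \<in> S" for \<sigma>
  proof (rule homI)
    show "F \<sigma> x \<in> carrier (sum_group S' A')" if "x \<in> carrier (A \<sigma>)" for x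
      unfolding F_def using single_image_closed [OF \<Phi> \<sigma> that] by (rule C'.frag_eval_closed)
    fix g h assume g: "g \<in> carrier (A \<sigma>)" "h \<in> carrier (A \<sigma>)"
    have "F \<sigma> (g \<otimes>\<^bsub>A \<sigma>\<^esub> h) = frag_eval (sum_group S' A')
       (\<lambda>x. sum_single S' A' (fst x) (snd x g) \<otimes>\<^bsub>sum_group S' A'\<^esub> sum_single S' A' (fst x) (snd x h)) (\<Phi> \<sigma>)"
      unfolding F_def
    proof (rule C'.frag_eval_cong)
      fix a assume a: "a \<in> Poly_Mapping.keys (\<Phi> \<sigma>)"
      note aD = local_opD [OF \<Phi> \<sigma> a]
      show "sum_single S' A' (fst a) (snd a (g \<otimes>\<^bsub>A \<sigma>\<^esub> h))
         = sum_single S' A' (fst a) (snd a g) \<otimes>\<^bsub>sum_group S' A'\<^esub> sum_single S' A' (fst a) (snd a h)"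
        using hom_mult [OF aD(3) g] hom_mult [OF sum_single_hom [OF A' aD(1)] aD(4) [OF g(1)] aD(4) [OF g(2)]] by simp
    qed (use single_image_closed [OF \<Phi> \<sigma>] g in \<open>auto simp: Pi_iff simp del: mult_sum_group\<close>)
    also have "\<dots> = F \<sigma> g \<otimes>\<^bsub>sum_group S' A'\<^esub> F \<sigma> h"
      unfolding F_def by (rule C'.frag_eval_mult_fun) (use single_image_closed [OF \<Phi> \<sigma>] g in auto)
    finally show "F \<sigma> (g \<otimes>\<^bsub>A \<sigma>\<^esub> h) = F \<sigma> g \<otimes>\<^bsub>sum_group S' A'\<^esub> F \<sigma> h" .
  qed
  have eq: "op_chain S A S' A' \<Phi> = (\<lambda>c. finprod (sum_group S' A') (\<lambda>\<sigma>. F \<sigma> (c \<sigma>)) {\<sigma> \<in> S. c \<sigma> \<noteq> \<one>\<^bsub>A \<sigma>\<^esub>})"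
    by (simp add: op_chain_def F_def fun_eq_iff)
  show "op_chain S A S' A' \<Phi> \<in> hom (sum_group S A) (sum_group S' A')"
    unfolding eq by (rule sum_group_extend_hom [OF A C'.comm_group_axioms F])
  show "op_chain S A S' A' \<Phi> (sum_single S A \<sigma> g)
       = frag_eval (sum_group S' A') (\<lambda>x. sum_single S' A' (fst x) (snd x g)) (\<Phi> \<sigma>)"
    if "\<sigma> \<in> S" "g \<in> carrier (A \<sigma>)"
    unfolding eq using sum_group_extend_single [OF A C'.comm_group_axioms F that] by (simp add: F_def)
qed

lemma op_chain_cong:
  "(\<And>\<sigma>. \<sigma> \<in> S \<Longrightarrow> \<Phi> \<sigma> = \<Psi> \<sigma>) \<Longrightarrow> local_op S A S' A' \<Psi> \<Longrightarrow> c \<in> carrier (sum_group S A) \<Longrightarrow> op_chain S A S' A' \<Phi> c = op_chain S A S' A' \<Psi> c"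
proof -
  assume eq: "\<And>\<sigma>. \<sigma> \<in> S \<Longrightarrow> \<Phi> \<sigma> = \<Psi> \<sigma>" and \<Psi>: "local_op S A S' A' \<Psi>" and c: "c \<in> carrier (sum_group S A)"
  have \<Phi>: "local_op S A S' A' \<Phi>" using \<Psi> eq by (simp add: local_op_def)
  show ?thesis
    by (rule sum_group_hom_eqI [OF A op_chain_hom [OF \<Phi>] op_chain_hom [OF \<Psi>] comm_group_sum_group [OF A'] _ c])
      (simp_all add: op_chain_single \<Phi> \<Psi> eq)
qed

lemma op_chain_add:
  assumes \<Phi>: "local_op S A S' A' \<Phi>" and \<Psi>: "local_op S A S' A' \<Psi>" and c: "c \<in> carrier (sum_group S A)"
  shows "op_chain S A S' A' (\<lambda>\<sigma>. \<Phi> \<sigma> + \<Psi> \<sigma>) c = op_chain S A S' A' \<Phi> c \<otimes>\<^bsub>sum_group S' A'\<^esub> op_chain S A S' A' \<Psi> c"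
proof -
  interpret C: comm_group "sum_group S A" by (rule comm_group_sum_group [OF A])
  interpret C': comm_group "sum_group S' A'" by (rule comm_group_sum_group [OF A'])
  note car = hom_in_carrier [OF op_chain_hom [OF \<Phi>]] hom_in_carrier [OF op_chain_hom [OF \<Psi>]]
  have "(\<lambda>c. op_chain S A S' A' \<Phi> c \<otimes>\<^bsub>sum_group S' A'\<^esub> op_chain S A S' A' \<Psi> c) \<in> hom (sum_group S A) (sum_group S' A')"
    using car hom_mult [OF op_chain_hom [OF \<Phi>]] hom_mult [OF op_chain_hom [OF \<Psi>]]
    by (intro homI) (simp_all add: C'.m_ac del: mult_sum_group)
  then show ?thesis
    by (rule sum_group_hom_eqI [OF A op_chain_hom [OF local_op_add [OF \<Phi> \<Psi>]] _ C'.comm_group_axioms _ c])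
      (simp add: op_chain_single \<Phi> \<Psi> local_op_add C'.frag_eval_add single_image_closed del: mult_sum_group)
qed

lemma op_chain_zero: "op_chain S A S' A' (\<lambda>_. 0) c = \<one>\<^bsub>sum_group S' A'\<^esub>"
proof -
  interpret C': comm_group "sum_group S' A'" by (rule comm_group_sum_group [OF A'])
  show ?thesis unfolding op_chain_def by (simp add: C'.finprod_one del: one_sum_group)
qed

lemma op_cochain_closed:
  assumes \<Phi>: "local_op S A S' A' \<Phi>" and c: "c \<in> carrier (product_group S' A')" and \<sigma>: "\<sigma> \<in> S"
  shows "(\<lambda>x. inv_into (carrier (A \<sigma>)) (snd x) (c (fst x))) \<in> Poly_Mapping.keys (\<Phi> \<sigma>) \<rightarrow> carrier (A \<sigma>)"
proof
  fix x assume x: "x \<in> Poly_Mapping.keys (\<Phi> \<sigma>)"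
  have "snd x ` carrier (A \<sigma>) = carrier (A' (fst x))"
    using local_opD(2) [OF \<Phi> \<sigma> x] by (simp add: iso_def bij_betw_def)
  moreover have "c (fst x) \<in> carrier (A' (fst x))"
    using c local_opD(1) [OF \<Phi> \<sigma> x] by auto
  ultimately show "inv_into (carrier (A \<sigma>)) (snd x) (c (fst x)) \<in> carrier (A \<sigma>)"
    by (metis inv_into_into)
qed

lemma op_cochain_hom:
  assumes \<Phi>: "local_op S A S' A' \<Phi>"
  shows "op_cochain S A \<Phi> \<in> hom (product_group S' A') (product_group S A)"
proof (rule homI)
  show "op_cochain S A \<Phi> c \<in> carrier (product_group S A)" if "c \<in> carrier (product_group S' A')" for c
    using comm_group.frag_eval_closed [OF bspec [OF A] op_cochain_closed [OF \<Phi> that]]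
    by (auto simp: op_cochain_def)
  fix c d assume c: "c \<in> carrier (product_group S' A')" and d: "d \<in> carrier (product_group S' A')"
  show "op_cochain S A \<Phi> (c \<otimes>\<^bsub>product_group S' A'\<^esub> d)
     = op_cochain S A \<Phi> c \<otimes>\<^bsub>product_group S A\<^esub> op_cochain S A \<Phi> d"
  proof
    fix \<sigma>
    show "op_cochain S A \<Phi> (c \<otimes>\<^bsub>product_group S' A'\<^esub> d) \<sigma>
     = (op_cochain S A \<Phi> c \<otimes>\<^bsub>product_group S A\<^esub> op_cochain S A \<Phi> d) \<sigma>"
    proof (cases "\<sigma> \<in> S")
      case True
      interpret As: comm_group "A \<sigma>" by (rule bspec [OF A True])
      note cl = op_cochain_closed [OF \<Phi> c True] op_cochain_closed [OF \<Phi> d True]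
      have "frag_eval (A \<sigma>) (\<lambda>x. inv_into (carrier (A \<sigma>)) (snd x) ((c \<otimes>\<^bsub>product_group S' A'\<^esub> d) (fst x))) (\<Phi> \<sigma>)
        = frag_eval (A \<sigma>) (\<lambda>x. inv_into (carrier (A \<sigma>)) (snd x) (c (fst x)) \<otimes>\<^bsub>A \<sigma>\<^esub> inv_into (carrier (A \<sigma>)) (snd x) (d (fst x))) (\<Phi> \<sigma>)"
      proof (rule As.frag_eval_cong)
        fix x assume x: "x \<in> Poly_Mapping.keys (\<Phi> \<sigma>)"
        note xD = local_opD(1,2) [OF \<Phi> True x]
        have "inv_into (carrier (A \<sigma>)) (snd x) \<in> iso (A' (fst x)) (A \<sigma>)"
          by (rule As.iso_set_sym [OF xD(2)])
        then show "inv_into (carrier (A \<sigma>)) (snd x) ((c \<otimes>\<^bsub>product_group S' A'\<^esub> d) (fst x))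
          = inv_into (carrier (A \<sigma>)) (snd x) (c (fst x)) \<otimes>\<^bsub>A \<sigma>\<^esub> inv_into (carrier (A \<sigma>)) (snd x) (d (fst x))"
          using hom_mult [of "inv_into (carrier (A \<sigma>)) (snd x)" "A' (fst x)" "A \<sigma>" "c (fst x)" "d (fst x)"] c d xD(1)
          by (auto simp: iso_def)
      qed (use cl in auto)
      also have "\<dots> = op_cochain S A \<Phi> c \<sigma> \<otimes>\<^bsub>A \<sigma>\<^esub> op_cochain S A \<Phi> d \<sigma>"
        using As.frag_eval_mult_fun [OF cl] True by (simp add: op_cochain_def)
      finally show ?thesis
        using True by (simp add: op_cochain_def)
    qed (simp add: op_cochain_def)
  qed
qed

lemma op_cochain_add:
  assumes \<Phi>: "local_op S A S' A' \<Phi>" and \<Psi>: "local_op S A S' A' \<Psi>" and c: "c \<in> carrier (product_group S' A')"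
  shows "op_cochain S A (\<lambda>\<sigma>. \<Phi> \<sigma> + \<Psi> \<sigma>) c = op_cochain S A \<Phi> c \<otimes>\<^bsub>product_group S A\<^esub> op_cochain S A \<Psi> c"
proof
  fix \<sigma>
  show "op_cochain S A (\<lambda>\<sigma>. \<Phi> \<sigma> + \<Psi> \<sigma>) c \<sigma> = (op_cochain S A \<Phi> c \<otimes>\<^bsub>product_group S A\<^esub> op_cochain S A \<Psi> c) \<sigma>"
    using comm_group.frag_eval_add [OF bspec [OF A] op_cochain_closed [OF \<Phi> c] op_cochain_closed [OF \<Psi> c]]
    by (simp add: op_cochain_def)
qed

lemma op_cochain_zero: "op_cochain S A (\<lambda>_. 0) c = \<one>\<^bsub>product_group S A\<^esub>"
  using comm_group.frag_eval_0 [OF bspec [OF A]] by (auto simp: op_cochain_def fun_eq_iff)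

end

lemma op_cochain_cong:
  "(\<And>\<sigma>. \<sigma> \<in> S \<Longrightarrow> \<Phi> \<sigma> = \<Psi> \<sigma>) \<Longrightarrow> op_cochain S A \<Phi> = op_cochain S A \<Psi>"
  by (simp add: op_cochain_def fun_eq_iff)

lemma op_chain_id:
  assumes A: "\<forall>\<sigma>\<in>S. comm_group (A \<sigma>)" and c: "c \<in> carrier (sum_group S A)"
  shows "op_chain S A S A (op_id A) c = c"
proof -
  interpret C: comm_group "sum_group S A" by (rule comm_group_sum_group [OF A])
  have op: "local_op S A S A (op_id A)" by (rule local_op_id) (simp add: A comm_group.axioms(2))
  have "(\<lambda>c. c) \<in> hom (sum_group S A) (sum_group S A)"
    by (rule homI) auto
  then show ?thesis
    by (rule sum_group_hom_eqI [OF A op_chain_hom [OF A A op] _ C.comm_group_axioms _ c])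
      (simp_all add: op_chain_single [OF A A op] op_id_def C.frag_eval_of sum_single_closed A)
qed

lemma op_cochain_id:
  assumes A: "\<forall>\<sigma>\<in>S. comm_group (A \<sigma>)" and c: "c \<in> carrier (product_group S A)"
  shows "op_cochain S A (op_id A) c = c"
proof
  fix \<sigma>
  show "op_cochain S A (op_id A) c \<sigma> = c \<sigma>"
  proof (cases "\<sigma> \<in> S")
    case True
    then have c\<sigma>: "c \<sigma> \<in> carrier (A \<sigma>)" using c by auto
    interpret As: comm_group "A \<sigma>" using A True by blast
    let ?h = "\<lambda>x. inv_into (carrier (A \<sigma>)) (snd x) (c (fst x))"
    have inv: "?h (\<sigma>, \<lambda>g\<in>carrier (A \<sigma>). g) = c \<sigma>"
      unfolding fst_conv snd_conv by (rule inv_into_f_eq) (use c\<sigma> in \<open>auto simp: inj_on_def\<close>)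
    then have "frag_eval (A \<sigma>) ?h (frag_of (\<sigma>, \<lambda>g\<in>carrier (A \<sigma>). g)) = c \<sigma>"
      by (subst As.frag_eval_of) (simp_all only: c\<sigma>)
    then show ?thesis
      unfolding op_cochain_def op_id_def using True by simp
  next
    case False
    then show ?thesis
      unfolding op_cochain_def using c PiE_arb [of c S _ \<sigma>] by simp
  qed
qed

context
  fixes S :: "'s set" and A :: "'s \<Rightarrow> 'g monoid" and S' :: "'t set" and A' :: "'t \<Rightarrow> 'g monoid"
    and S'' :: "'u set" and A'' :: "'u \<Rightarrow> 'g monoid"
  assumes A: "\<forall>\<sigma>\<in>S. comm_group (A \<sigma>)" and A': "\<forall>\<sigma>\<in>S'. comm_group (A' \<sigma>)"
    and A'': "\<forall>\<sigma>\<in>S''. comm_group (A'' \<sigma>)"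
begin

text \<open>On a generator, \<open>frag_eval_extend\<close> unfolds the double formal combination,
  and the chain operator of \<open>\<Psi>\<close>, being a homomorphism, passes through the
  evaluation of \<open>\<Phi> \<sigma>\<close>.\<close>

lemma op_chain_comp:
  assumes \<Phi>: "local_op S A S' A' \<Phi>" and \<Psi>: "local_op S' A' S'' A'' \<Psi>" and c: "c \<in> carrier (sum_group S A)"
  shows "op_chain S A S'' A'' (op_comp A \<Psi> \<Phi>) c = op_chain S' A' S'' A'' \<Psi> (op_chain S A S' A' \<Phi> c)"
proof -
  interpret C': comm_group "sum_group S' A'" by (rule comm_group_sum_group [OF A'])
  interpret C'': comm_group "sum_group S'' A''" by (rule comm_group_sum_group [OF A''])
  have gA: "\<forall>\<sigma>\<in>S. group (A \<sigma>)" by (simp add: A comm_group.axioms(2))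
  note \<Psi>\<Phi> = local_op_comp [OF \<Psi> \<Phi> gA]
  have hom: "(\<lambda>c. op_chain S' A' S'' A'' \<Psi> (op_chain S A S' A' \<Phi> c)) \<in> hom (sum_group S A) (sum_group S'' A'')"
    using hom_compose [OF op_chain_hom [OF A A' \<Phi>] op_chain_hom [OF A' A'' \<Psi>]] by (simp add: comp_def)
  show ?thesis
  proof (rule sum_group_hom_eqI [OF A op_chain_hom [OF A A'' \<Psi>\<Phi>] hom C''.comm_group_axioms _ c])
    fix \<sigma> g assume \<sigma>: "\<sigma> \<in> S" and g: "g \<in> carrier (A \<sigma>)"
    let ?h = "\<lambda>x. sum_single S'' A'' (fst x) (snd x g)"
    let ?k = "\<lambda>x y. (fst y, compose (carrier (A \<sigma>)) (snd y) (snd x))"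
    have cl: "?h (?k x y) \<in> carrier (sum_group S'' A'')"
      if x: "x \<in> Poly_Mapping.keys (\<Phi> \<sigma>)" and y: "y \<in> Poly_Mapping.keys (\<Psi> (fst x))" for x y
      using local_opD [OF \<Phi> \<sigma> x] local_opD [OF \<Psi> _ y] g sum_single_closed [OF A'']
      by (simp add: compose_eq)
    have cl2: "?h \<in> Poly_Mapping.keys (frag_extend (\<lambda>y. frag_of (?k x y)) (\<Psi> (fst x))) \<rightarrow> carrier (sum_group S'' A'')"
      if x: "x \<in> Poly_Mapping.keys (\<Phi> \<sigma>)" for x
    proof
      fix z assume "z \<in> Poly_Mapping.keys (frag_extend (\<lambda>y. frag_of (?k x y)) (\<Psi> (fst x)))"
      then obtain y where "y \<in> Poly_Mapping.keys (\<Psi> (fst x))" "z \<in> Poly_Mapping.keys (frag_of (?k x y))"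
        using keys_frag_extend by fastforce
      then show "?h z \<in> carrier (sum_group S'' A'')" using cl [OF x] by (simp only: keys_frag_of singleton_iff)
    qed
    have "op_chain S A S'' A'' (op_comp A \<Psi> \<Phi>) (sum_single S A \<sigma> g)
       = frag_eval (sum_group S'' A'') ?h (op_comp A \<Psi> \<Phi> \<sigma>)"
      by (rule op_chain_single [OF A A'' \<Psi>\<Phi> \<sigma> g])
    also have "\<dots> = frag_eval (sum_group S'' A'') (\<lambda>x. frag_eval (sum_group S'' A'') ?h (frag_extend (\<lambda>y. frag_of (?k x y)) (\<Psi> (fst x)))) (\<Phi> \<sigma>)"
      unfolding op_comp_def by (rule C''.frag_eval_extend [OF cl2])
    also have "\<dots> = frag_eval (sum_group S'' A'') (op_chain S' A' S'' A'' \<Psi> \<circ> (\<lambda>x. sum_single S' A' (fst x) (snd x g))) (\<Phi> \<sigma>)"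
    proof (rule C''.frag_eval_cong)
      fix x assume x: "x \<in> Poly_Mapping.keys (\<Phi> \<sigma>)"
      note xD = local_opD [OF \<Phi> \<sigma> x]
      have "frag_eval (sum_group S'' A'') ?h (frag_extend (\<lambda>y. frag_of (?k x y)) (\<Psi> (fst x)))
        = frag_eval (sum_group S'' A'') (\<lambda>y. frag_eval (sum_group S'' A'') ?h (frag_of (?k x y))) (\<Psi> (fst x))"
        by (rule C''.frag_eval_extend) (use cl [OF x] in auto)
      also have "\<dots> = frag_eval (sum_group S'' A'') (\<lambda>y. sum_single S'' A'' (fst y) (snd y (snd x g))) (\<Psi> (fst x))"
      proof (rule C''.frag_eval_cong)
        fix y assume y: "y \<in> Poly_Mapping.keys (\<Psi> (fst x))"
        show "frag_eval (sum_group S'' A'') ?h (frag_of (?k x y)) = sum_single S'' A'' (fst y) (snd y (snd x g))"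
          using C''.frag_eval_of [of ?h "?k x y", OF cl [OF x y]] g by (simp add: compose_eq)
      qed (use single_image_closed [OF A' A'' \<Psi> xD(1) xD(4) [OF g]] in auto)
      also have "\<dots> = op_chain S' A' S'' A'' \<Psi> (sum_single S' A' (fst x) (snd x g))"
        by (rule op_chain_single [OF A' A'' \<Psi> xD(1) xD(4) [OF g], symmetric])
      finally show "frag_eval (sum_group S'' A'') ?h (frag_extend (\<lambda>y. frag_of (?k x y)) (\<Psi> (fst x)))
        = (op_chain S' A' S'' A'' \<Psi> \<circ> (\<lambda>x. sum_single S' A' (fst x) (snd x g))) x" by simp
    next
      show "(op_chain S' A' S'' A'' \<Psi> \<circ> (\<lambda>x. sum_single S' A' (fst x) (snd x g))) \<in> Poly_Mapping.keys (\<Phi> \<sigma>) \<rightarrow> carrier (sum_group S'' A'')"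
        using single_image_closed [OF A A' \<Phi> \<sigma> g] hom_in_carrier [OF op_chain_hom [OF A' A'' \<Psi>]] by (simp add: Pi_iff)
    qed
    also have "\<dots> = op_chain S' A' S'' A'' \<Psi> (frag_eval (sum_group S' A') (\<lambda>x. sum_single S' A' (fst x) (snd x g)) (\<Phi> \<sigma>))"
      by (rule C'.frag_eval_hom [OF op_chain_hom [OF A' A'' \<Psi>] C''.comm_group_axioms single_image_closed [OF A A' \<Phi> \<sigma> g], symmetric])
    also have "\<dots> = op_chain S' A' S'' A'' \<Psi> (op_chain S A S' A' \<Phi> (sum_single S A \<sigma> g))"
      by (simp add: op_chain_single [OF A A' \<Phi> \<sigma> g])
    finally show "op_chain S A S'' A'' (op_comp A \<Psi> \<Phi>) (sum_single S A \<sigma> g) = op_chain S' A' S'' A'' \<Psi> (op_chain S A S' A' \<Phi> (sum_single S A \<sigma> g))" .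
  qed
qed

text \<open>Here the order is reversed, as for transposed matrices. The homomorphism that passes
  through the evaluation is now the inverse of the fibre isomorphism of
  \<open>\<Phi>\<close>.\<close>

lemma op_cochain_comp:
  assumes \<Phi>: "local_op S A S' A' \<Phi>" and \<Psi>: "local_op S' A' S'' A'' \<Psi>" and c: "c \<in> carrier (product_group S'' A'')"
  shows "op_cochain S A (op_comp A \<Psi> \<Phi>) c = op_cochain S A \<Phi> (op_cochain S' A' \<Psi> c)"
proof
  fix \<sigma>
  show "op_cochain S A (op_comp A \<Psi> \<Phi>) c \<sigma> = op_cochain S A \<Phi> (op_cochain S' A' \<Psi> c) \<sigma>"
  proof (cases "\<sigma> \<in> S")
    case True
    interpret As: comm_group "A \<sigma>" by (rule bspec [OF A True])
    let ?h = "\<lambda>x. inv_into (carrier (A \<sigma>)) (snd x) (c (fst x))"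
    let ?k = "\<lambda>x y. (fst y, compose (carrier (A \<sigma>)) (snd y) (snd x))"
    \<comment> \<open>The inverse of a composite: first \<open>snd y\<close> is undone, then
      \<open>snd x\<close>.\<close>
    have h: "?h (?k x y) = inv_into (carrier (A \<sigma>)) (snd x) (inv_into (carrier (A' (fst x))) (snd y) (c (fst y)))"
      "?h (?k x y) \<in> carrier (A \<sigma>)"
      if x: "x \<in> Poly_Mapping.keys (\<Phi> \<sigma>)" and y: "y \<in> Poly_Mapping.keys (\<Psi> (fst x))" for x y
    proof -
      note xD = local_opD [OF \<Phi> True x]
      note yD = local_opD [OF \<Psi> xD(1) y]
      have bx: "bij_betw (snd x) (carrier (A \<sigma>)) (carrier (A' (fst x)))"
        and bi: "bij_betw (snd y) (carrier (A' (fst x))) (carrier (A'' (fst y)))"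
        using xD(2) yD(2) by (auto simp: iso_def)
      have cy: "c (fst y) \<in> carrier (A'' (fst y))" using c yD(1) by auto
      let ?v = "inv_into (carrier (A' (fst x))) (snd y) (c (fst y))"
      let ?w = "inv_into (carrier (A \<sigma>)) (snd x) ?v"
      have v: "?v \<in> carrier (A' (fst x))" "snd y ?v = c (fst y)"
        using bi cy by (auto simp: bij_betw_def inv_into_into f_inv_into_f)
      have w: "?w \<in> carrier (A \<sigma>)" "snd x ?w = ?v"
        using bx v by (auto simp: bij_betw_def inv_into_into f_inv_into_f)
      have "bij_betw (compose (carrier (A \<sigma>)) (snd y) (snd x)) (carrier (A \<sigma>)) (carrier (A'' (fst y)))"
        by (rule bij_betw_compose [OF bx bi])
      then show "?h (?k x y) = ?w"
        using w v by (simp add: bij_betw_def inv_into_f_eq compose_eq)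
      then show "?h (?k x y) \<in> carrier (A \<sigma>)" using w(1) by simp
    qed
    have cl2: "?h \<in> Poly_Mapping.keys (frag_extend (\<lambda>y. frag_of (?k x y)) (\<Psi> (fst x))) \<rightarrow> carrier (A \<sigma>)"
      if x: "x \<in> Poly_Mapping.keys (\<Phi> \<sigma>)" for x
    proof
      fix z assume "z \<in> Poly_Mapping.keys (frag_extend (\<lambda>y. frag_of (?k x y)) (\<Psi> (fst x)))"
      then obtain y where "y \<in> Poly_Mapping.keys (\<Psi> (fst x))" "z \<in> Poly_Mapping.keys (frag_of (?k x y))"
        using keys_frag_extend by fastforce
      then show "?h z \<in> carrier (A \<sigma>)" using h(2) [OF x] by (simp only: keys_frag_of singleton_iff)
    qed
    have "op_cochain S A (op_comp A \<Psi> \<Phi>) c \<sigma> = frag_eval (A \<sigma>) ?h (op_comp A \<Psi> \<Phi> \<sigma>)"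
      using True by (simp add: op_cochain_def)
    also have "\<dots> = frag_eval (A \<sigma>) (\<lambda>x. frag_eval (A \<sigma>) ?h (frag_extend (\<lambda>y. frag_of (?k x y)) (\<Psi> (fst x)))) (\<Phi> \<sigma>)"
      unfolding op_comp_def by (rule As.frag_eval_extend [OF cl2])
    also have "\<dots> = frag_eval (A \<sigma>) (\<lambda>x. inv_into (carrier (A \<sigma>)) (snd x) (op_cochain S' A' \<Psi> c (fst x))) (\<Phi> \<sigma>)"
    proof (rule As.frag_eval_cong)
      show "(\<lambda>x. inv_into (carrier (A \<sigma>)) (snd x) (op_cochain S' A' \<Psi> c (fst x))) \<in> Poly_Mapping.keys (\<Phi> \<sigma>) \<rightarrow> carrier (A \<sigma>)"
        by (rule op_cochain_closed [OF A A' \<Phi> hom_in_carrier [OF op_cochain_hom [OF A' A'' \<Psi>] c] True])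
      fix x assume x: "x \<in> Poly_Mapping.keys (\<Phi> \<sigma>)"
      note xD = local_opD [OF \<Phi> True x]
      interpret Ax: comm_group "A' (fst x)" by (rule bspec [OF A' xD(1)])
      let ?i = "inv_into (carrier (A \<sigma>)) (snd x)"
      let ?f = "\<lambda>y. inv_into (carrier (A' (fst x))) (snd y) (c (fst y))"
      note f = op_cochain_closed [OF A' A'' \<Psi> c xD(1)]
      have i: "?i \<in> hom (A' (fst x)) (A \<sigma>)"
        using As.iso_set_sym [OF xD(2)] by (simp add: iso_def)
      have "frag_eval (A \<sigma>) ?h (frag_extend (\<lambda>y. frag_of (?k x y)) (\<Psi> (fst x)))
        = frag_eval (A \<sigma>) (\<lambda>y. frag_eval (A \<sigma>) ?h (frag_of (?k x y))) (\<Psi> (fst x))"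
        by (rule As.frag_eval_extend) (use h(2) [OF x] in auto)
      also have "\<dots> = frag_eval (A \<sigma>) (?i \<circ> ?f) (\<Psi> (fst x))"
      proof (rule As.frag_eval_cong)
        fix y assume y: "y \<in> Poly_Mapping.keys (\<Psi> (fst x))"
        show "frag_eval (A \<sigma>) ?h (frag_of (?k x y)) = (?i \<circ> ?f) y"
          using As.frag_eval_of [of ?h "?k x y", OF h(2) [OF x y]] h(1) [OF x y] by simp
      qed (use f hom_in_carrier [OF i] in \<open>auto simp: Pi_iff\<close>)
      also have "\<dots> = ?i (frag_eval (A' (fst x)) ?f (\<Psi> (fst x)))"
        by (rule Ax.frag_eval_hom [OF i As.comm_group_axioms f, symmetric])
      finally show "frag_eval (A \<sigma>) ?h (frag_extend (\<lambda>y. frag_of (?k x y)) (\<Psi> (fst x)))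
        = ?i (op_cochain S' A' \<Psi> c (fst x))"
        using xD(1) by (simp add: op_cochain_def)
    qed
    also have "\<dots> = op_cochain S A \<Phi> (op_cochain S' A' \<Psi> c) \<sigma>"
      using True by (simp add: op_cochain_def)
    finally show ?thesis .
  qed (simp add: op_cochain_def)
qed

end

section \<open>Complexes of operators, chain maps and chain homotopies\<close>

text \<open>\<open>FG\<close> gives surjectivity, as \<open>z'\<close> is a boundary times
  \<open>F (G z')\<close>; \<open>GF\<close> gives injectivity, as \<open>z\<close> is a boundary
  times \<open>G (F z)\<close>, and \<open>G\<close> keeps boundaries.\<close>

lemma quot_equiv_homotopy:
  assumes C: "comm_group C" "subgroup B C" "Z \<subseteq> carrier C"
    and C': "comm_group C'" "subgroup B' C'" "Z' \<subseteq> carrier C'"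
    and F: "F \<in> hom C C'" "\<And>z. z \<in> Z \<Longrightarrow> F z \<in> Z'" "\<And>b. b \<in> B \<Longrightarrow> F b \<in> B'"
    and G: "\<And>z. z \<in> Z' \<Longrightarrow> G z \<in> Z" "\<And>b. b \<in> B' \<Longrightarrow> G b \<in> B"
    and GF: "\<And>z. z \<in> Z \<Longrightarrow> \<exists>b\<in>B. G (F z) = b \<otimes>\<^bsub>C\<^esub> z"
    and FG: "\<And>z. z \<in> Z' \<Longrightarrow> \<exists>b\<in>B'. F (G z) = b \<otimes>\<^bsub>C'\<^esub> z"
  shows "quot_equiv C Z B C' Z' B' F"
proof -
  interpret C: comm_group C by fact
  interpret C': comm_group C' by fact
  interpret B: subgroup B C by fact
  interpret B': subgroup B' C' by fact
  have surj: "\<exists>z\<in>Z. \<exists>b\<in>B'. z' = b \<otimes>\<^bsub>C'\<^esub> F z" if z': "z' \<in> Z'" for z'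
  proof -
    obtain b where b: "b \<in> B'" "F (G z') = b \<otimes>\<^bsub>C'\<^esub> z'"
      using FG [OF z'] by auto
    have "z' \<in> carrier C'" using z' C'(3) by auto
    then have "z' = inv\<^bsub>C'\<^esub> b \<otimes>\<^bsub>C'\<^esub> F (G z')"
      unfolding b(2) using B'.mem_carrier [OF b(1)] by (simp add: C'.m_assoc [symmetric])
    then show ?thesis
      using G(1) [OF z'] B'.m_inv_closed [OF b(1)] by blast
  qed
  have inj: "z \<in> B" if z: "z \<in> Z" "F z \<in> B'" for z
  proof -
    obtain b where b: "b \<in> B" "G (F z) = b \<otimes>\<^bsub>C\<^esub> z"
      using GF [OF z(1)] by auto
    have zc: "z \<in> carrier C" using z C(3) by auto
    have "inv\<^bsub>C\<^esub> b \<otimes>\<^bsub>C\<^esub> G (F z) \<in> B"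
      by (rule B.m_closed [OF B.m_inv_closed [OF b(1)] G(2) [OF z(2)]])
    moreover have "inv\<^bsub>C\<^esub> b \<otimes>\<^bsub>C\<^esub> G (F z) = z"
      unfolding b(2) using B.mem_carrier [OF b(1)] zc by (simp add: C.m_assoc [symmetric])
    ultimately show ?thesis by simp
  qed
  show ?thesis
    unfolding quot_equiv_def image_subset_iff
    by (intro conjI ballI impI) (simp_all add: F surj inj)
qed

text \<open>Natural subtraction makes degree 0 its own predecessor. With \<open>D 0\<close> zero,
  every chain of degree 0 is a cycle and the only coboundary of degree 0 is the unit, as in the
  definitions of local homology and cohomology.\<close>

definition op_complex ::
  "(nat \<Rightarrow> 's set) \<Rightarrow> ('s \<Rightarrow> 'g monoid) \<Rightarrow> (nat \<Rightarrow> 's \<Rightarrow> ('s \<times> ('g \<Rightarrow> 'g)) \<Rightarrow>\<^sub>0 int) \<Rightarrow> bool" where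
  "op_complex S A D \<longleftrightarrow>
     (\<forall>k. \<forall>\<sigma>\<in>S k. comm_group (A \<sigma>)) \<and> (\<forall>k. local_op (S k) A (S (k - 1)) A (D k)) \<and>
     D 0 = (\<lambda>_. 0) \<and> (\<forall>k. \<forall>\<sigma>\<in>S k. op_comp A (D (k - 1)) (D k) \<sigma> = 0)"

definition op_chain_map where
  "op_chain_map S A D S' A' D' \<Phi> \<longleftrightarrow>
     (\<forall>k::nat. local_op (S k) A (S' k) A' (\<Phi> k)) \<and>
     (\<forall>k. \<forall>\<sigma>\<in>S k. op_comp A (D' k) (\<Phi> k) \<sigma> = op_comp A (\<Phi> (k - 1)) (D k) \<sigma>)"

text \<open>The operator form of \<open>\<Phi> - id = D P + P D\<close>. In degree 0 the term
  \<open>P D\<close> vanishes because \<open>D 0\<close> does.\<close>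

definition op_homotopy where
  "op_homotopy S A D \<Phi> P \<longleftrightarrow>
     (\<forall>k::nat. local_op (S k) A (S (Suc k)) A (P k)) \<and>
     (\<forall>k. \<forall>\<sigma>\<in>S k. \<Phi> k \<sigma> = op_comp A (D (Suc k)) (P k) \<sigma> + op_comp A (P (k - 1)) (D k) \<sigma> + op_id A \<sigma>)"

definition op_cycles where
  "op_cycles S A D k = kernel (sum_group (S k) A) (sum_group (S (k - 1)) A) (op_chain (S k) A (S (k - 1)) A (D k))"

definition op_boundaries where
  "op_boundaries S A D k = op_chain (S (Suc k)) A (S k) A (D (Suc k)) ` carrier (sum_group (S (Suc k)) A)"

definition op_cocycles where
  "op_cocycles S A D k = kernel (product_group (S k) A) (product_group (S (Suc k)) A) (op_cochain (S (Suc k)) A (D (Suc k)))"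

definition op_coboundaries where
  "op_coboundaries S A D k = op_cochain (S k) A (D k) ` carrier (product_group (S (k - 1)) A)"

lemma op_comp_zero [simp]: "op_comp A \<Psi> (\<lambda>_. 0) \<sigma> = 0" "op_comp A (\<lambda>_. 0) \<Phi> \<sigma> = 0"
  by (simp_all add: op_comp_def frag_extend_eq_0)

context
  fixes S :: "nat \<Rightarrow> 's set" and A :: "'s \<Rightarrow> 'g monoid" and D
  assumes K: "op_complex S A D"
begin

lemma op_complexD:
  shows "\<forall>\<sigma>\<in>S k. comm_group (A \<sigma>)" "local_op (S k) A (S (k - 1)) A (D k)"
    "local_op (S (Suc k)) A (S k) A (D (Suc k))" "D 0 = (\<lambda>_. 0)"
    "\<sigma> \<in> S k \<Longrightarrow> op_comp A (D (k - 1)) (D k) \<sigma> = 0" "\<sigma> \<in> S (Suc k) \<Longrightarrow> op_comp A (D k) (D (Suc k)) \<sigma> = 0"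
    "\<forall>\<sigma>\<in>S k. group (A \<sigma>)"
proof -
  show D: "local_op (S k) A (S (k - 1)) A (D k)" and DD: "\<sigma> \<in> S k \<Longrightarrow> op_comp A (D (k - 1)) (D k) \<sigma> = 0"
    and A: "\<forall>\<sigma>\<in>S k. comm_group (A \<sigma>)" and "D 0 = (\<lambda>_. 0)" for \<sigma> k
    using K by (auto simp: op_complex_def)
  show "local_op (S (Suc k)) A (S k) A (D (Suc k))" "\<sigma> \<in> S (Suc k) \<Longrightarrow> op_comp A (D k) (D (Suc k)) \<sigma> = 0"
    using D [of "Suc k"] DD [of \<sigma> "Suc k"] by simp_all
  show "\<forall>\<sigma>\<in>S k. group (A \<sigma>)" using A by (simp add: comm_group.axioms(2))
qed

lemma subgroup_op_cycles: "subgroup (op_cycles S A D k) (sum_group (S k) A)"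
  unfolding op_cycles_def
  by (rule group_hom.subgroup_kernel)
    (simp_all add: group_hom_def group_hom_axioms_def op_chain_hom [OF op_complexD(1,1) op_complexD(2)]
      op_chain_hom [OF op_complexD(1,1) op_complexD(3)]
      comm_group.axioms(2) [OF comm_group_sum_group [OF op_complexD(1)]] del: One_nat_def)

lemma subgroup_op_boundaries: "subgroup (op_boundaries S A D k) (sum_group (S k) A)"
  unfolding op_boundaries_def
  by (rule group_hom.img_is_subgroup)
    (simp_all add: group_hom_def group_hom_axioms_def op_chain_hom [OF op_complexD(1,1) op_complexD(2)]
      op_chain_hom [OF op_complexD(1,1) op_complexD(3)]
      comm_group.axioms(2) [OF comm_group_sum_group [OF op_complexD(1)]] del: One_nat_def)

lemma subgroup_op_cocycles: "subgroup (op_cocycles S A D k) (product_group (S k) A)"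
  unfolding op_cocycles_def
  by (rule group_hom.subgroup_kernel)
    (simp add: group_hom_def group_hom_axioms_def op_cochain_hom [OF op_complexD(1,1,3)] op_complexD(7))

lemma subgroup_op_coboundaries: "subgroup (op_coboundaries S A D k) (product_group (S k) A)"
  unfolding op_coboundaries_def
  by (rule group_hom.img_is_subgroup)
    (simp add: group_hom_def group_hom_axioms_def op_cochain_hom [OF op_complexD(1,1,2)] op_complexD(7) del: One_nat_def)

lemma op_boundaries_subset: "op_boundaries S A D k \<subseteq> op_cycles S A D k"
proof
  fix b assume "b \<in> op_boundaries S A D k"
  then obtain c where c: "c \<in> carrier (sum_group (S (Suc k)) A)" and b: "b = op_chain (S (Suc k)) A (S k) A (D (Suc k)) c"
    unfolding op_boundaries_def by (rule imageE)
  have "op_chain (S k) A (S (k - 1)) A (D k) b = op_chain (S (Suc k)) A (S (k - 1)) A (op_comp A (D k) (D (Suc k))) c"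
    unfolding b by (rule op_chain_comp [OF op_complexD(1,1,1,3,2) c, symmetric])
  also have "\<dots> = op_chain (S (Suc k)) A (S (k - 1)) A (\<lambda>_. 0) c"
    by (rule op_chain_cong [OF op_complexD(1,1) _ _ c]) (simp_all add: op_complexD(6) local_op_def)
  also have "\<dots> = \<one>\<^bsub>sum_group (S (k - 1)) A\<^esub>"
    by (rule op_chain_zero [OF op_complexD(1,1)])
  finally show "b \<in> op_cycles S A D k"
    unfolding op_cycles_def kernel_def
    using hom_in_carrier [OF op_chain_hom [OF op_complexD(1,1,3)] c] b by simp
qed

lemma op_coboundaries_subset: "op_coboundaries S A D k \<subseteq> op_cocycles S A D k"
proof
  fix b assume "b \<in> op_coboundaries S A D k"
  then obtain c where c: "c \<in> carrier (product_group (S (k - 1)) A)" and b: "b = op_cochain (S k) A (D k) c"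
    unfolding op_coboundaries_def by (rule imageE)
  have "op_cochain (S (Suc k)) A (D (Suc k)) b = op_cochain (S (Suc k)) A (op_comp A (D k) (D (Suc k))) c"
    unfolding b by (rule op_cochain_comp [OF op_complexD(1,1,1,3,2) c, symmetric])
  also have "\<dots> = op_cochain (S (Suc k)) A (\<lambda>_. 0) c"
    by (rule fun_cong [OF op_cochain_cong]) (rule op_complexD(6))
  also have "\<dots> = \<one>\<^bsub>product_group (S (Suc k)) A\<^esub>"
    by (rule op_cochain_zero [OF op_complexD(1,1)])
  finally show "b \<in> op_cocycles S A D k"
    unfolding op_cocycles_def kernel_def
    using hom_in_carrier [OF op_cochain_hom [OF op_complexD(1,1,2)] c] b by simp
qed

text \<open>On a cycle the term \<open>P D\<close> gives the unit and \<open>D P\<close> gives a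
  boundary. On cochains the composition is reversed, so the two terms exchange their roles: on a
  cocycle \<open>D P\<close> gives the unit and \<open>P D\<close> a coboundary.\<close>

lemma op_homotopyD:
  assumes P: "op_homotopy S A D \<Phi> P"
  shows op_homotopy_cycle: "z \<in> op_cycles S A D k \<Longrightarrow>
      \<exists>b\<in>op_boundaries S A D k. op_chain (S k) A (S k) A (\<Phi> k) z = b \<otimes>\<^bsub>sum_group (S k) A\<^esub> z"
    and op_homotopy_cocycle: "c \<in> op_cocycles S A D k \<Longrightarrow>
      \<exists>b\<in>op_coboundaries S A D k. op_cochain (S k) A (\<Phi> k) c = b \<otimes>\<^bsub>product_group (S k) A\<^esub> c"
proof -
  note A = op_complexD(1)
  interpret C: comm_group "sum_group (S k) A" by (rule comm_group_sum_group [OF A])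
  interpret CC: comm_group "product_group (S k) A" by (rule comm_group_product_group [OF A])
  have Pop: "local_op (S k) A (S (Suc k)) A (P k)" for k
    using P by (simp add: op_homotopy_def)
  define R where "R = op_comp A (P (k - 1)) (D k)"
  define T where "T = op_comp A (D (Suc k)) (P k)"
  have T: "local_op (S k) A (S k) A T"
    unfolding T_def by (rule local_op_comp [OF op_complexD(3) Pop op_complexD(7)])
  have R: "local_op (S k) A (S k) A R"
  \<comment> \<open>In degree 0 the homotopy \<open>P (k - 1)\<close> is \<open>P 0\<close> and
    would end in degree 1. The composite is zero there, so it is an operator on degree 0 all the
    same.\<close>
  proof (cases k)
    case 0
    then show ?thesis by (simp add: R_def op_complexD(4) local_op_def)
  next
    case (Suc l)
    show ?thesis
      unfolding R_def Suc using local_op_comp [OF Pop op_complexD(3) op_complexD(7)] by simp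
  qed
  have I: "local_op (S k) A (S k) A (op_id A)" by (rule local_op_id [OF op_complexD(7)])
  have eq: "\<Phi> k \<sigma> = T \<sigma> + R \<sigma> + op_id A \<sigma>" if "\<sigma> \<in> S k" for \<sigma>
    using P that by (simp add: op_homotopy_def T_def R_def)
  note TR = local_op_add [OF T R]
  note TRI = local_op_add [OF TR I]
  show "\<exists>b\<in>op_boundaries S A D k. op_chain (S k) A (S k) A (\<Phi> k) z = b \<otimes>\<^bsub>sum_group (S k) A\<^esub> z"
    if z: "z \<in> op_cycles S A D k"
  proof -
    have zc: "z \<in> carrier (sum_group (S k) A)" and dz: "op_chain (S k) A (S (k - 1)) A (D k) z = \<one>\<^bsub>sum_group (S (k - 1)) A\<^esub>"
      using z by (simp_all add: op_cycles_def kernel_def)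
    have Rz: "op_chain (S k) A (S k) A R z = \<one>\<^bsub>sum_group (S k) A\<^esub>"
    proof (cases k)
      case 0
      then have "R = (\<lambda>_. 0)" by (simp add: R_def op_complexD(4) fun_eq_iff)
      then show ?thesis by (simp only: op_chain_zero [OF A A])
    next
      case (Suc l)
      have Pl: "local_op (S (k - 1)) A (S k) A (P (k - 1))" using Pop [of l] Suc by simp
      have "op_chain (S k) A (S k) A R z = op_chain (S (k - 1)) A (S k) A (P (k - 1)) (op_chain (S k) A (S (k - 1)) A (D k) z)"
        unfolding R_def by (rule op_chain_comp [OF A A A op_complexD(2) Pl zc])
      also have "\<dots> = \<one>\<^bsub>sum_group (S k) A\<^esub>"
        unfolding dz by (rule hom_one [OF op_chain_hom [OF A A Pl]])
          (simp_all only: comm_group.axioms(2) [OF comm_group_sum_group [OF A]])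
      finally show ?thesis .
    qed
    have Tz: "op_chain (S k) A (S k) A T z = op_chain (S (Suc k)) A (S k) A (D (Suc k)) (op_chain (S k) A (S (Suc k)) A (P k) z)"
      unfolding T_def by (rule op_chain_comp [OF A A A Pop op_complexD(3) zc])
    have b: "op_chain (S k) A (S k) A T z \<in> op_boundaries S A D k"
      unfolding Tz op_boundaries_def by (rule imageI, rule hom_in_carrier [OF op_chain_hom [OF A A Pop] zc])
    have "op_chain (S k) A (S k) A (\<Phi> k) z = op_chain (S k) A (S k) A (\<lambda>\<sigma>. T \<sigma> + R \<sigma> + op_id A \<sigma>) z"
      by (rule op_chain_cong [OF A A eq TRI zc])
    also have "\<dots> = op_chain (S k) A (S k) A T z \<otimes>\<^bsub>sum_group (S k) A\<^esub> \<one>\<^bsub>sum_group (S k) A\<^esub> \<otimes>\<^bsub>sum_group (S k) A\<^esub> z"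
      unfolding op_chain_add [OF A A TR I zc] op_chain_add [OF A A T R zc] Rz op_chain_id [OF A zc] ..
    also have "\<dots> = op_chain (S k) A (S k) A T z \<otimes>\<^bsub>sum_group (S k) A\<^esub> z"
      by (subst C.r_one) (rule hom_in_carrier [OF op_chain_hom [OF A A T] zc], rule refl)
    finally show ?thesis using b by (rule bexI)
  qed
  show "\<exists>b\<in>op_coboundaries S A D k. op_cochain (S k) A (\<Phi> k) c = b \<otimes>\<^bsub>product_group (S k) A\<^esub> c"
    if c: "c \<in> op_cocycles S A D k"
  proof -
    have cc: "c \<in> carrier (product_group (S k) A)" and dc: "op_cochain (S (Suc k)) A (D (Suc k)) c = \<one>\<^bsub>product_group (S (Suc k)) A\<^esub>"
      using c by (simp_all add: op_cocycles_def kernel_def)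
    have Rc: "op_cochain (S k) A R c \<in> op_coboundaries S A D k"
    proof (cases k)
      case 0
      then have "R = (\<lambda>_. 0)" by (simp add: R_def op_complexD(4) fun_eq_iff)
      then show ?thesis
        by (simp only: op_cochain_zero [OF A A] subgroup.one_closed [OF subgroup_op_coboundaries])
    next
      case (Suc l)
      have Pl: "local_op (S (k - 1)) A (S k) A (P (k - 1))" using Pop [of l] Suc by simp
      have "op_cochain (S k) A R c = op_cochain (S k) A (D k) (op_cochain (S (k - 1)) A (P (k - 1)) c)"
        unfolding R_def by (rule op_cochain_comp [OF A A A op_complexD(2) Pl cc])
      then show ?thesis
        unfolding op_coboundaries_def
        by (simp only:) (rule imageI, rule hom_in_carrier [OF op_cochain_hom [OF A A Pl] cc])
    qed
    have "op_cochain (S k) A T c = op_cochain (S k) A (P k) (op_cochain (S (Suc k)) A (D (Suc k)) c)"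
      unfolding T_def by (rule op_cochain_comp [OF A A A Pop op_complexD(3) cc])
    also have "\<dots> = \<one>\<^bsub>product_group (S k) A\<^esub>"
      unfolding dc by (rule hom_one [OF op_cochain_hom [OF A A Pop]])
        (simp_all only: comm_group.axioms(2) [OF comm_group_product_group [OF A]])
    finally have Tc: "op_cochain (S k) A T c = \<one>\<^bsub>product_group (S k) A\<^esub>" .
    have "op_cochain (S k) A (\<Phi> k) c = op_cochain (S k) A (\<lambda>\<sigma>. T \<sigma> + R \<sigma> + op_id A \<sigma>) c"
      by (rule fun_cong [OF op_cochain_cong]) (rule eq)
    also have "\<dots> = \<one>\<^bsub>product_group (S k) A\<^esub> \<otimes>\<^bsub>product_group (S k) A\<^esub> op_cochain (S k) A R c \<otimes>\<^bsub>product_group (S k) A\<^esub> c"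
      unfolding op_cochain_add [OF A A TR I cc] op_cochain_add [OF A A T R cc] Tc op_cochain_id [OF A cc] ..
    also have "\<dots> = op_cochain (S k) A R c \<otimes>\<^bsub>product_group (S k) A\<^esub> c"
      by (subst CC.l_one) (rule hom_in_carrier [OF op_cochain_hom [OF A A R] cc], rule refl)
    finally show ?thesis using Rc by (rule bexI)
  qed
qed

end

context
  fixes S :: "nat \<Rightarrow> 's set" and A :: "'s \<Rightarrow> 'g monoid" and D
    and S' :: "nat \<Rightarrow> 't set" and A' :: "'t \<Rightarrow> 'g monoid" and D' \<Phi>
  assumes K: "op_complex S A D" and K': "op_complex S' A' D'"
    and \<Phi>: "op_chain_map S A D S' A' D' \<Phi>"
begin

lemma op_chain_map_op: "local_op (S k) A (S' k) A' (\<Phi> k)"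
  using \<Phi> by (simp add: op_chain_map_def)

lemma op_chain_map_commute:
  assumes c: "c \<in> carrier (sum_group (S k) A)"
  shows "op_chain (S' k) A' (S' (k - 1)) A' (D' k) (op_chain (S k) A (S' k) A' (\<Phi> k) c)
       = op_chain (S (k - 1)) A (S' (k - 1)) A' (\<Phi> (k - 1)) (op_chain (S k) A (S (k - 1)) A (D k) c)"
proof -
  note A = op_complexD(1) [OF K] and A' = op_complexD(1) [OF K']
  have "op_chain (S' k) A' (S' (k - 1)) A' (D' k) (op_chain (S k) A (S' k) A' (\<Phi> k) c)
      = op_chain (S k) A (S' (k - 1)) A' (op_comp A (D' k) (\<Phi> k)) c"
    by (rule op_chain_comp [OF A A' A' op_chain_map_op op_complexD(2) [OF K'] c, symmetric])
  also have "\<dots> = op_chain (S k) A (S' (k - 1)) A' (op_comp A (\<Phi> (k - 1)) (D k)) c"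
    by (rule op_chain_cong [OF A A' _ local_op_comp [OF op_chain_map_op op_complexD(2,7) [OF K]] c])
      (use \<Phi> in \<open>simp add: op_chain_map_def\<close>)
  also have "\<dots> = op_chain (S (k - 1)) A (S' (k - 1)) A' (\<Phi> (k - 1)) (op_chain (S k) A (S (k - 1)) A (D k) c)"
    by (rule op_chain_comp [OF A A A' op_complexD(2) [OF K] op_chain_map_op c])
  finally show ?thesis .
qed

lemma op_cochain_map_commute:
  assumes c: "c \<in> carrier (product_group (S' (k - 1)) A')"
  shows "op_cochain (S k) A (D k) (op_cochain (S (k - 1)) A (\<Phi> (k - 1)) c)
       = op_cochain (S k) A (\<Phi> k) (op_cochain (S' k) A' (D' k) c)"
proof -
  note A = op_complexD(1) [OF K] and A' = op_complexD(1) [OF K']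
  have "op_cochain (S k) A (D k) (op_cochain (S (k - 1)) A (\<Phi> (k - 1)) c)
      = op_cochain (S k) A (op_comp A (\<Phi> (k - 1)) (D k)) c"
    by (rule op_cochain_comp [OF A A A' op_complexD(2) [OF K] op_chain_map_op c, symmetric])
  also have "\<dots> = op_cochain (S k) A (op_comp A (D' k) (\<Phi> k)) c"
    by (rule fun_cong [OF op_cochain_cong]) (use \<Phi> in \<open>simp add: op_chain_map_def\<close>)
  also have "\<dots> = op_cochain (S k) A (\<Phi> k) (op_cochain (S' k) A' (D' k) c)"
    by (rule op_cochain_comp [OF A A' A' op_chain_map_op op_complexD(2) [OF K'] c])
  finally show ?thesis .
qed

lemma op_chain_map_cycles:
  assumes z: "z \<in> op_cycles S A D k"
  shows "op_chain (S k) A (S' k) A' (\<Phi> k) z \<in> op_cycles S' A' D' k"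
proof -
  note A = op_complexD(1) [OF K] and A' = op_complexD(1) [OF K']
  have zc: "z \<in> carrier (sum_group (S k) A)" and dz: "op_chain (S k) A (S (k - 1)) A (D k) z = \<one>\<^bsub>sum_group (S (k - 1)) A\<^esub>"
    using z by (simp_all add: op_cycles_def kernel_def)
  have "op_chain (S' k) A' (S' (k - 1)) A' (D' k) (op_chain (S k) A (S' k) A' (\<Phi> k) z) = \<one>\<^bsub>sum_group (S' (k - 1)) A'\<^esub>"
    unfolding op_chain_map_commute [OF zc] dz
    by (rule hom_one [OF op_chain_hom [OF A A' op_chain_map_op]])
      (simp_all only: comm_group.axioms(2) [OF comm_group_sum_group [OF A]] comm_group.axioms(2) [OF comm_group_sum_group [OF A']])
  then show ?thesis
    unfolding op_cycles_def kernel_def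
    using hom_in_carrier [OF op_chain_hom [OF A A' op_chain_map_op] zc] by simp
qed

lemma op_chain_map_boundaries:
  assumes b: "b \<in> op_boundaries S A D k"
  shows "op_chain (S k) A (S' k) A' (\<Phi> k) b \<in> op_boundaries S' A' D' k"
proof -
  note A = op_complexD(1) [OF K] and A' = op_complexD(1) [OF K']
  obtain c where c: "c \<in> carrier (sum_group (S (Suc k)) A)" and b: "b = op_chain (S (Suc k)) A (S k) A (D (Suc k)) c"
    using b unfolding op_boundaries_def by (elim imageE)
  have "op_chain (S k) A (S' k) A' (\<Phi> k) b = op_chain (S' (Suc k)) A' (S' k) A' (D' (Suc k)) (op_chain (S (Suc k)) A (S' (Suc k)) A' (\<Phi> (Suc k)) c)"
    using op_chain_map_commute [OF c] b by simp
  then show ?thesis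
    unfolding op_boundaries_def
    by (simp only:) (rule imageI, rule hom_in_carrier [OF op_chain_hom [OF A A' op_chain_map_op] c])
qed

lemma op_cochain_map_cocycles:
  assumes z: "z \<in> op_cocycles S' A' D' k"
  shows "op_cochain (S k) A (\<Phi> k) z \<in> op_cocycles S A D k"
proof -
  note A = op_complexD(1) [OF K] and A' = op_complexD(1) [OF K']
  have zc: "z \<in> carrier (product_group (S' k) A')" and dz: "op_cochain (S' (Suc k)) A' (D' (Suc k)) z = \<one>\<^bsub>product_group (S' (Suc k)) A'\<^esub>"
    using z by (simp_all add: op_cocycles_def kernel_def)
  have "op_cochain (S (Suc k)) A (D (Suc k)) (op_cochain (S k) A (\<Phi> k) z) = op_cochain (S (Suc k)) A (\<Phi> (Suc k)) (op_cochain (S' (Suc k)) A' (D' (Suc k)) z)"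
    using op_cochain_map_commute [of z "Suc k"] zc by (simp del: carrier_product_group)
  also have "\<dots> = \<one>\<^bsub>product_group (S (Suc k)) A\<^esub>"
    unfolding dz by (rule hom_one [OF op_cochain_hom [OF A A' op_chain_map_op]])
      (simp_all only: comm_group.axioms(2) [OF comm_group_product_group [OF A]] comm_group.axioms(2) [OF comm_group_product_group [OF A']])
  finally show ?thesis
    unfolding op_cocycles_def kernel_def
    using hom_in_carrier [OF op_cochain_hom [OF A A' op_chain_map_op] zc] by simp
qed

lemma op_cochain_map_coboundaries:
  assumes b: "b \<in> op_coboundaries S' A' D' k"
  shows "op_cochain (S k) A (\<Phi> k) b \<in> op_coboundaries S A D k"
proof -
  note A = op_complexD(1) [OF K] and A' = op_complexD(1) [OF K']
  obtain c where c: "c \<in> carrier (product_group (S' (k - 1)) A')" and b: "b = op_cochain (S' k) A' (D' k) c"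
    using b unfolding op_coboundaries_def by (elim imageE)
  have "op_cochain (S k) A (\<Phi> k) b = op_cochain (S k) A (D k) (op_cochain (S (k - 1)) A (\<Phi> (k - 1)) c)"
    unfolding b by (rule op_cochain_map_commute [OF c, symmetric])
  then show ?thesis
    unfolding op_coboundaries_def
    by (simp only:) (rule imageI, rule hom_in_carrier [OF op_cochain_hom [OF A A' op_chain_map_op] c])
qed

end

text \<open>On chains \<open>P\<close> gives injectivity and \<open>Q\<close> surjectivity. On
  cochains \<open>\<Phi>\<close> induces a map from \<open>S'\<close> to \<open>S\<close>, so the
  two homotopies change places.\<close>

theorem op_homotopy_equivalence:
  assumes K: "op_complex S A D" and K': "op_complex S' A' D'"
    and \<Phi>: "op_chain_map S A D S' A' D' \<Phi>" and \<Psi>: "op_chain_map S' A' D' S A D \<Psi>"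
    and P: "op_homotopy S A D (\<lambda>k. op_comp A (\<Psi> k) (\<Phi> k)) P"
    and Q: "op_homotopy S' A' D' (\<lambda>k. op_comp A' (\<Phi> k) (\<Psi> k)) Q"
  shows "quot_equiv (sum_group (S k) A) (op_cycles S A D k) (op_boundaries S A D k)
           (sum_group (S' k) A') (op_cycles S' A' D' k) (op_boundaries S' A' D' k)
           (op_chain (S k) A (S' k) A' (\<Phi> k))" (is ?chain)
    and "quot_equiv (product_group (S' k) A') (op_cocycles S' A' D' k) (op_coboundaries S' A' D' k)
           (product_group (S k) A) (op_cocycles S A D k) (op_coboundaries S A D k)
           (op_cochain (S k) A (\<Phi> k))" (is ?cochain)
proof -
  note A = op_complexD(1) [OF K] and A' = op_complexD(1) [OF K']
  note \<Phi>op = op_chain_map_op [OF K K' \<Phi>] and \<Psi>op = op_chain_map_op [OF K' K \<Psi>]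
  have carr: "c \<in> carrier (sum_group (S k) A)" if "c \<in> op_cycles S A D k" for c
    using that by (simp add: op_cycles_def kernel_def)
  have carr': "c \<in> carrier (sum_group (S' k) A')" if "c \<in> op_cycles S' A' D' k" for c
    using that by (simp add: op_cycles_def kernel_def)
  show ?chain
  proof (rule quot_equiv_homotopy [where G = "op_chain (S' k) A' (S k) A (\<Psi> k)"])
    fix z assume z: "z \<in> op_cycles S A D k"
    show "\<exists>b\<in>op_boundaries S A D k. op_chain (S' k) A' (S k) A (\<Psi> k) (op_chain (S k) A (S' k) A' (\<Phi> k) z) = b \<otimes>\<^bsub>sum_group (S k) A\<^esub> z"
      using op_homotopy_cycle [OF K P z] unfolding op_chain_comp [OF A A' A \<Phi>op \<Psi>op carr [OF z]] .
  next
    fix z assume z: "z \<in> op_cycles S' A' D' k"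
    show "\<exists>b\<in>op_boundaries S' A' D' k. op_chain (S k) A (S' k) A' (\<Phi> k) (op_chain (S' k) A' (S k) A (\<Psi> k) z) = b \<otimes>\<^bsub>sum_group (S' k) A'\<^esub> z"
      using op_homotopy_cycle [OF K' Q z] unfolding op_chain_comp [OF A' A A' \<Psi>op \<Phi>op carr' [OF z]] .
  qed (simp_all only: comm_group_sum_group [OF A] comm_group_sum_group [OF A'] subgroup_op_boundaries K K' op_chain_hom [OF A A' \<Phi>op]
      op_chain_map_cycles [OF K K' \<Phi>] op_chain_map_boundaries [OF K K' \<Phi>]
      op_chain_map_cycles [OF K' K \<Psi>] op_chain_map_boundaries [OF K' K \<Psi>]
      subgroup.subset [OF subgroup_op_cycles])
  have carr: "c \<in> carrier (product_group (S k) A)" if "c \<in> op_cocycles S A D k" for c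
    using that by (simp add: op_cocycles_def kernel_def)
  have carr': "c \<in> carrier (product_group (S' k) A')" if "c \<in> op_cocycles S' A' D' k" for c
    using that by (simp add: op_cocycles_def kernel_def)
  show ?cochain
  proof (rule quot_equiv_homotopy [where G = "op_cochain (S' k) A' (\<Psi> k)"])
    fix z assume z: "z \<in> op_cocycles S A D k"
    show "\<exists>b\<in>op_coboundaries S A D k. op_cochain (S k) A (\<Phi> k) (op_cochain (S' k) A' (\<Psi> k) z) = b \<otimes>\<^bsub>product_group (S k) A\<^esub> z"
      using op_homotopy_cocycle [OF K P z] unfolding op_cochain_comp [OF A A' A \<Phi>op \<Psi>op carr [OF z]] .
  next
    fix z assume z: "z \<in> op_cocycles S' A' D' k"
    show "\<exists>b\<in>op_coboundaries S' A' D' k. op_cochain (S' k) A' (\<Psi> k) (op_cochain (S k) A (\<Phi> k) z) = b \<otimes>\<^bsub>product_group (S' k) A'\<^esub> z"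
      using op_homotopy_cocycle [OF K' Q z] unfolding op_cochain_comp [OF A' A A' \<Psi>op \<Phi>op carr' [OF z]] .
  qed (simp_all only: comm_group_product_group [OF A] comm_group_product_group [OF A'] subgroup_op_coboundaries K K' op_cochain_hom [OF A A' \<Phi>op]
      op_cochain_map_cocycles [OF K K' \<Phi>] op_cochain_map_coboundaries [OF K K' \<Phi>]
      op_cochain_map_cocycles [OF K' K \<Psi>] op_cochain_map_coboundaries [OF K' K \<Psi>]
      subgroup.subset [OF subgroup_op_cocycles])
qed

section \<open>Coefficients on simplices with face maps\<close>

text \<open>The cancellation behind the square of a boundary being zero: the term at
  \<open>(j, i)\<close> with \<open>i < j\<close> and the one at \<open>(i, j - 1)\<close> have
  equal values and opposite signs, and this pairing exhausts the index set.\<close>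

lemma alternating_double_sum_eq_0:
  fixes F :: "nat \<Rightarrow> nat \<Rightarrow> ('a \<Rightarrow>\<^sub>0 int)"
  assumes F: "\<And>i j. i < j \<Longrightarrow> j \<le> Suc k \<Longrightarrow> F i j = F (j - 1) i"
  shows "(\<Sum>j\<le>Suc k. \<Sum>i\<le>k. frag_cmul ((-1) ^ j * (-1) ^ i) (F i j)) = 0"
proof -
  let ?G = "\<lambda>(j, i). frag_cmul ((-1) ^ j * (-1) ^ i) (F i j)"
  define U where "U = {(j, i). j \<le> Suc k \<and> i \<le> k \<and> i < j}"
  define V where "V = {(j, i). j \<le> Suc k \<and> i \<le> k \<and> \<not> i < j}"
  have UV: "{..Suc k} \<times> {..k} = U \<union> V" "U \<inter> V = {}"
    by (auto simp: U_def V_def)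
  have fin: "finite (U \<union> V)"
    unfolding UV(1) [symmetric] by simp
  have "sum ?G U = sum (\<lambda>x. - ?G x) V"
  proof (rule sum.reindex_bij_witness [where j = "\<lambda>(j, i). (i, j - 1)" and i = "\<lambda>(j, i). (Suc i, j)"])
    fix x assume "x \<in> U"
    then obtain i j where x: "x = (j, i)" and ij: "i < j" "j \<le> Suc k" by (auto simp: U_def)
    then obtain l where l: "j = Suc l" by (cases j) auto
    show "- ?G (case x of (j, i) \<Rightarrow> (i, j - 1)) = ?G x"
      using F [OF ij] by (simp add: x l mult.commute)
  qed (auto simp: U_def V_def)
  then have "sum ?G (U \<union> V) = 0"
    using fin UV(2) by (simp add: sum.union_disjoint sum_negf)
  then show ?thesis
    unfolding UV(1) [symmetric] by (simp add: sum.cartesian_product)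
qed

text \<open>The cancellation in the prism formula, where \<open>F i j\<close> stands for face
  \<open>j\<close> of prism \<open>i\<close> and \<open>H i j\<close> for prism \<open>i\<close> of
  face \<open>j\<close>. The faces with \<open>j < i\<close> and with \<open>j > i + 1\<close>
  cancel against the terms \<open>H\<close>. The faces \<open>j = i\<close> and
  \<open>j = i + 1\<close> telescope, since neighbouring prisms share one of them, and leave the two
  ends.\<close>

lemma alternating_prism_sum:
  fixes F H :: "nat \<Rightarrow> nat \<Rightarrow> ('a \<Rightarrow>\<^sub>0 int)"
  assumes lt: "\<And>i j. j < i \<Longrightarrow> i \<le> k \<Longrightarrow> F i j = H (i - 1) j"
    and gt: "\<And>i j. Suc i < j \<Longrightarrow> j \<le> Suc k \<Longrightarrow> F i j = H i (j - 1)"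
    and eq: "\<And>i. i < k \<Longrightarrow> F i (Suc i) = F (Suc i) (Suc i)"
  shows "(\<Sum>i\<le>k. \<Sum>j\<le>Suc k. frag_cmul ((-1) ^ i * (-1) ^ j) (F i j))
           + (\<Sum>j\<le>k. \<Sum>i<k. frag_cmul ((-1) ^ j * (-1) ^ i) (H i j)) = F 0 0 - F k (Suc k)"
proof -
  let ?G = "\<lambda>(i, j). frag_cmul ((-1) ^ i * (-1) ^ j) (F i j)"
  let ?H = "\<lambda>(j, i). frag_cmul ((-1) ^ j * (-1) ^ i) (H i j)"
  define U where "U = {(i, j). i \<le> k \<and> j \<le> Suc k \<and> j < i}"
  define W where "W = {(i, j). i \<le> k \<and> j \<le> Suc k \<and> Suc i < j}"
  define D0 where "D0 = {(i, j). i \<le> k \<and> j = i}"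
  define D1 where "D1 = {(i, j). i \<le> k \<and> j = Suc i}"
  define U' where "U' = {(j, i). j \<le> k \<and> i < k \<and> j \<le> i}"
  define W' where "W' = {(j, i). j \<le> k \<and> i < k \<and> i < j}"
  have dec: "{..k} \<times> {..Suc k} = (U \<union> W) \<union> (D0 \<union> D1)"
    unfolding U_def W_def D0_def D1_def by auto
  have fin: "finite ((U \<union> W) \<union> (D0 \<union> D1))"
    unfolding dec [symmetric] by simp
  have fins: "finite U" "finite W" "finite D0" "finite D1"
    using fin by (meson finite_Un)+
  have disj: "U \<inter> W = {}" "D0 \<inter> D1 = {}" "(U \<union> W) \<inter> (D0 \<union> D1) = {}"
    unfolding U_def W_def D0_def D1_def by auto
  have dec': "{..k} \<times> {..<k} = U' \<union> W'"
    unfolding U'_def W'_def by auto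
  have fin': "finite (U' \<union> W')"
    unfolding dec' [symmetric] by simp
  have fins': "finite U'" "finite W'"
    using fin' by (meson finite_Un)+
  have disj': "U' \<inter> W' = {}"
    unfolding U'_def W'_def by auto
  have "sum ?G U = sum (\<lambda>x. - ?H x) U'"
  proof (rule sum.reindex_bij_witness [where j = "\<lambda>(i, j). (j, i - 1)" and i = "\<lambda>(j, i). (Suc i, j)"])
    fix x assume "x \<in> U"
    then obtain i j where x: "x = (i, j)" and ij: "j < i" "i \<le> k" by (auto simp: U_def)
    then obtain l where l: "i = Suc l" by (cases i) auto
    show "- ?H (case x of (i, j) \<Rightarrow> (j, i - 1)) = ?G x"
      using lt [OF ij] by (simp add: x l mult.commute)
  qed (auto simp: U_def U'_def)
  moreover have "sum ?G W = sum (\<lambda>x. - ?H x) W'"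
  proof (rule sum.reindex_bij_witness [where j = "\<lambda>(i, j). (j - 1, i)" and i = "\<lambda>(j, i). (i, Suc j)"])
    fix x assume "x \<in> W"
    then obtain i j where x: "x = (i, j)" and ij: "Suc i < j" "j \<le> Suc k" by (auto simp: W_def)
    then obtain l where l: "j = Suc l" by (cases j) auto
    show "- ?H (case x of (i, j) \<Rightarrow> (j - 1, i)) = ?G x"
      using gt [OF ij] by (simp add: x l mult.commute)
  qed (auto simp: W_def W'_def)
  moreover have "sum ?G (D0 \<union> D1) = F 0 0 - F k (Suc k)"
  proof -
    have d0: "sum ?G D0 = (\<Sum>i\<le>k. F i i)"
      by (rule sum.reindex_bij_witness [where j = fst and i = "\<lambda>i. (i, i)"])
        (auto simp: D0_def simp flip: power_add)
    have d1: "sum ?G D1 = (\<Sum>i\<le>k. - F i (Suc i))"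
      by (rule sum.reindex_bij_witness [where j = fst and i = "\<lambda>i. (i, Suc i)"])
        (auto simp: D1_def simp flip: power_add)
    have "sum ?G (D0 \<union> D1) = sum ?G D0 + sum ?G D1"
      by (rule sum.union_disjoint [OF fins(3,4) disj(2)])
    also have "\<dots> = (\<Sum>i\<le>k. F i i) - (\<Sum>i\<le>k. F i (Suc i))"
      by (simp add: d0 d1 sum_negf)
    also have "(\<Sum>i\<le>k. F i i) = F 0 0 + (\<Sum>i<k. F (Suc i) (Suc i))"
      by (rule sum.atMost_shift)
    also have "(\<Sum>i\<le>k. F i (Suc i)) = (\<Sum>i<k. F i (Suc i)) + F k (Suc k)"
      by (simp add: lessThan_Suc_atMost [symmetric])
    also have "(\<Sum>i<k. F i (Suc i)) = (\<Sum>i<k. F (Suc i) (Suc i))"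
      using eq by simp
    finally show ?thesis by simp
  qed
  moreover have "sum ?G ({..k} \<times> {..Suc k}) = (sum ?G U + sum ?G W) + sum ?G (D0 \<union> D1)"
  proof -
    have "sum ?G ((U \<union> W) \<union> (D0 \<union> D1)) = sum ?G (U \<union> W) + sum ?G (D0 \<union> D1)"
      by (rule sum.union_disjoint [OF _ _ disj(3)]) (simp_all add: fins)
    also have "sum ?G (U \<union> W) = sum ?G U + sum ?G W"
      by (rule sum.union_disjoint [OF fins(1,2) disj(1)])
    finally show ?thesis unfolding dec .
  qed
  moreover have "sum ?H ({..k} \<times> {..<k}) = sum ?H U' + sum ?H W'"
    unfolding dec'
    by (rule sum.union_disjoint [OF fins' disj'])
  ultimately have "sum ?G ({..k} \<times> {..Suc k}) + sum ?H ({..k} \<times> {..<k}) = F 0 0 - F k (Suc k)"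
    by (simp add: sum_negf)
  then show ?thesis
    by (simp only: sum.cartesian_product)
qed

lemma op_comp_sums:
  assumes "\<Phi> \<sigma> = (\<Sum>j\<in>J. frag_cmul (c j) (frag_of (\<tau> j, \<phi> j)))" "finite J"
    and "\<And>j. j \<in> J \<Longrightarrow> \<Psi> (\<tau> j) = (\<Sum>i\<in>I. frag_cmul (c' i) (frag_of (\<upsilon> i j, \<psi> i j)))" "finite I"
  shows "op_comp A \<Psi> \<Phi> \<sigma> = (\<Sum>j\<in>J. \<Sum>i\<in>I. frag_cmul (c j * c' i) (frag_of (\<upsilon> i j, compose (carrier (A \<sigma>)) (\<psi> i j) (\<phi> j))))"
  unfolding op_comp_def assms(1)
  using assms(2-4) by (simp add: frag_extend_sum frag_extend_cmul frag_cmul_sum cong: sum.cong)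

text \<open>A semisimplicial set. The dimension is an argument of the face maps because that of
  \<open>singular_face\<close> is, and a simplex of type \<open>'s\<close> does not carry its
  dimension.\<close>

locale face_system =
  fixes S :: "nat \<Rightarrow> 's set" and d :: "nat \<Rightarrow> nat \<Rightarrow> 's \<Rightarrow> 's"
  assumes face_in: "\<sigma> \<in> S (Suc k) \<Longrightarrow> i \<le> Suc k \<Longrightarrow> d (Suc k) i \<sigma> \<in> S k"
    and face_face: "\<sigma> \<in> S (Suc (Suc k)) \<Longrightarrow> i < j \<Longrightarrow> j \<le> Suc (Suc k) \<Longrightarrow>
      d (Suc k) i (d (Suc (Suc k)) j \<sigma>) = d (Suc k) (j - 1) (d (Suc (Suc k)) i \<sigma>)"

text \<open>Only face 0 loses vertex 0, over which the coefficient lies, so only this face needs a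
  transport. The restriction to the carrier makes the function a canonical key.\<close>

definition face_transport :: "('s \<Rightarrow> 'g monoid) \<Rightarrow> ('s \<Rightarrow> 'g \<Rightarrow> 'g) \<Rightarrow> nat \<Rightarrow> 's \<Rightarrow> 'g \<Rightarrow> 'g" where
  "face_transport A T j \<sigma> = (\<lambda>g\<in>carrier (A \<sigma>). if j = 0 then T \<sigma> g else g)"

definition face_op ::
  "(nat \<Rightarrow> nat \<Rightarrow> 's \<Rightarrow> 's) \<Rightarrow> ('s \<Rightarrow> 'g monoid) \<Rightarrow> ('s \<Rightarrow> 'g \<Rightarrow> 'g) \<Rightarrow> nat \<Rightarrow> 's \<Rightarrow> ('s \<times> ('g \<Rightarrow> 'g)) \<Rightarrow>\<^sub>0 int" where
  "face_op d A T k \<sigma> =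
     (if k = 0 then 0 else \<Sum>j\<le>k. frag_cmul ((-1) ^ j) (frag_of (d k j \<sigma>, face_transport A T j \<sigma>)))"

lemma face_op_0 [simp]: "face_op d A T 0 = (\<lambda>_. 0)"
  by (simp add: face_op_def fun_eq_iff)

lemma face_op_Suc:
  "face_op d A T (Suc k) \<sigma> = (\<Sum>j\<le>Suc k. frag_cmul ((-1) ^ j) (frag_of (d (Suc k) j \<sigma>, face_transport A T j \<sigma>)))"
  by (simp add: face_op_def)

text \<open>What the boundary sees of a bundle of groups: \<open>A \<sigma>\<close> is the fibre
  over vertex 0 and \<open>T \<sigma>\<close> the transport from it to the fibre over vertex 1.
  \<open>T_T\<close> is the cocycle condition on the triangle with vertices 0, 1, 2, because the
  first edge of face 0 is the edge 1-2 and that of face 1 is the edge 0-2. Faces of index at least 2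
  keep the edge 0-1, which is \<open>T_face\<close>.\<close>

locale local_system = face_system S d
  for S :: "nat \<Rightarrow> 's set" and d +
  fixes A :: "'s \<Rightarrow> 'g monoid" and T :: "'s \<Rightarrow> 'g \<Rightarrow> 'g"
  assumes grp: "\<sigma> \<in> S k \<Longrightarrow> comm_group (A \<sigma>)"
    and A_face: "\<sigma> \<in> S (Suc k) \<Longrightarrow> 1 \<le> i \<Longrightarrow> i \<le> Suc k \<Longrightarrow> A (d (Suc k) i \<sigma>) = A \<sigma>"
    and T_iso: "\<sigma> \<in> S (Suc k) \<Longrightarrow> T \<sigma> \<in> iso (A \<sigma>) (A (d (Suc k) 0 \<sigma>))"
    and T_T: "\<sigma> \<in> S (Suc (Suc k)) \<Longrightarrow> g \<in> carrier (A \<sigma>) \<Longrightarrow>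
      T (d (Suc (Suc k)) 0 \<sigma>) (T \<sigma> g) = T (d (Suc (Suc k)) 1 \<sigma>) g"
    and T_face: "\<sigma> \<in> S (Suc (Suc k)) \<Longrightarrow> g \<in> carrier (A \<sigma>) \<Longrightarrow> 2 \<le> i \<Longrightarrow> i \<le> Suc (Suc k) \<Longrightarrow>
      T (d (Suc (Suc k)) i \<sigma>) g = T \<sigma> g"
begin

lemma face_transport_iso:
  assumes "\<sigma> \<in> S (Suc k)" "j \<le> Suc k"
  shows "face_transport A T j \<sigma> \<in> iso (A \<sigma>) (A (d (Suc k) j \<sigma>))"
proof -
  have g: "group (A \<sigma>)" using grp [OF assms(1)] by (simp add: comm_group.axioms(2))
  show ?thesis
  proof (cases "j = 0")
    case True
    then show ?thesis
      using iso_restrict [OF T_iso [OF assms(1)] g] by (simp add: face_transport_def restrict_def)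
  next
    case False
    then show ?thesis
      using iso_restrict [OF iso_set_refl g] A_face [OF assms(1) _ assms(2)] by (simp add: face_transport_def)
  qed
qed

lemma T_closed: "\<sigma> \<in> S (Suc k) \<Longrightarrow> g \<in> carrier (A \<sigma>) \<Longrightarrow> T \<sigma> g \<in> carrier (A (d (Suc k) 0 \<sigma>))"
  using T_iso [of \<sigma> k] unfolding iso_def by (auto simp: hom_in_carrier)

lemma face_op_local: "local_op (S k) A (S (k - 1)) A (face_op d A T k)"
proof (cases k)
  case 0
  then show ?thesis by (simp add: local_op_def)
next
  case (Suc l)
  show ?thesis
    unfolding local_op_def
  proof (intro ballI)
    fix \<sigma> x assume \<sigma>: "\<sigma> \<in> S k" and x: "x \<in> Poly_Mapping.keys (face_op d A T k \<sigma>)"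
    have "x \<in> (\<Union>j\<in>{..Suc l}. Poly_Mapping.keys (frag_cmul ((-1) ^ j) (frag_of (d (Suc l) j \<sigma>, face_transport A T j \<sigma>))))"
      using x unfolding Suc face_op_Suc by (rule subsetD [OF keys_sum])
    then obtain j where j: "j \<le> Suc l" "x = (d (Suc l) j \<sigma>, face_transport A T j \<sigma>)"
      by auto
    then show "fst x \<in> S (k - 1) \<and> snd x \<in> iso (A \<sigma>) (A (fst x))"
      using face_in [OF _ j(1)] face_transport_iso [OF _ j(1)] \<sigma> Suc by simp
  qed
qed

text \<open>The two ways of passing to a face of a face transport coefficients alike. For
  \<open>i > 0\<close> nothing moves. For \<open>i = 0\<close> and \<open>j = 1\<close> this is the
  cocycle condition, and for \<open>i = 0\<close> and \<open>j \<ge> 2\<close> the edge 0-1 is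
  unaffected by removing vertex \<open>j\<close>.\<close>

lemma face_transport_compose:
  assumes \<sigma>: "\<sigma> \<in> S (Suc (Suc k))" and ij: "i < j" "j \<le> Suc (Suc k)"
  shows "compose (carrier (A \<sigma>)) (face_transport A T i (d (Suc (Suc k)) j \<sigma>)) (face_transport A T j \<sigma>)
       = compose (carrier (A \<sigma>)) (face_transport A T (j - 1) (d (Suc (Suc k)) i \<sigma>)) (face_transport A T i \<sigma>)"
    (is "compose _ ?f ?g = compose _ ?f' ?g'")
proof
  fix g
  show "compose (carrier (A \<sigma>)) ?f ?g g = compose (carrier (A \<sigma>)) ?f' ?g' g"
  proof (cases "g \<in> carrier (A \<sigma>)")
    case g: True
    have Aj: "A (d (Suc (Suc k)) j \<sigma>) = A \<sigma>"
      using A_face [OF \<sigma>] ij by simp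
    have Ai: "A (d (Suc (Suc k)) i \<sigma>) = A \<sigma>" if "i \<noteq> 0"
      using A_face [OF \<sigma>, of i] ij that by simp
    consider "i \<noteq> 0" | "i = 0" "j = 1" | "i = 0" "2 \<le> j"
      using ij by linarith
    then show ?thesis
    proof cases
      case 1
      then show ?thesis
        using g Aj Ai ij by (simp add: compose_eq face_transport_def)
    next
      case 2
      then show ?thesis
        using g Aj T_T [OF \<sigma> g] T_closed [OF \<sigma> g] by (simp add: compose_eq face_transport_def)
    next
      case 3
      then show ?thesis
        using g Aj T_face [OF \<sigma> g 3(2) ij(2)] T_closed [OF \<sigma> g] by (simp add: compose_eq face_transport_def)
    qed
  qed (simp add: compose_def)
qed

lemma op_complex_face_op: "op_complex S A (face_op d A T)"
proof -
  have "op_comp A (face_op d A T (k - 1)) (face_op d A T k) \<sigma> = 0" if \<sigma>: "\<sigma> \<in> S k" for k \<sigma>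
  proof -
    \<comment> \<open>In degree 1 the second operator is \<open>face_op\<close> in degree 0, which
      is zero; cancellation is needed from degree 2 on.\<close>
    consider "k = 0" | "k = 1" | l where "k = Suc (Suc l)"
      by (cases k) (auto, metis nat.exhaust)
    then show ?thesis
    proof cases
      case (3 l)
      let ?F = "\<lambda>i j. frag_of (d (Suc l) i (d (Suc (Suc l)) j \<sigma>),
         compose (carrier (A \<sigma>)) (face_transport A T i (d (Suc (Suc l)) j \<sigma>)) (face_transport A T j \<sigma>))"
      have "op_comp A (face_op d A T (Suc l)) (face_op d A T (Suc (Suc l))) \<sigma>
        = (\<Sum>j\<le>Suc (Suc l). \<Sum>i\<le>Suc l. frag_cmul ((-1) ^ j * (-1) ^ i) (?F i j))"
        by (rule op_comp_sums, rule face_op_Suc, simp, rule face_op_Suc, simp)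
      also have "\<dots> = 0"
        by (rule alternating_double_sum_eq_0)
          (use \<sigma> 3 in \<open>simp only: face_face face_transport_compose\<close>)
      finally show ?thesis by (simp add: 3)
    qed simp_all
  qed
  then show ?thesis
    unfolding op_complex_def using grp face_op_local by simp
qed

end

lemma op_comp_single:
  "op_comp A (\<lambda>\<tau>. frag_of (b \<tau>, \<psi> \<tau>)) (\<lambda>\<sigma>. frag_of (a \<sigma>, \<phi> \<sigma>)) \<sigma> = frag_of (b (a \<sigma>), compose (carrier (A \<sigma>)) (\<psi> (a \<sigma>)) (\<phi> \<sigma>))"
  by (simp add: op_comp_def)

text \<open>A map of semisimplicial sets with isomorphisms of fibres that respect the transports.
  With one term per simplex the two sides of the chain map identity agree face by face, without any
  cancellation.\<close>

lemma op_chain_map_single: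
  assumes L: "local_system S d A T" and L': "local_system S' d' A' T'"
    and a: "\<forall>k. \<forall>\<sigma>\<in>S k. a k \<sigma> \<in> S' k \<and> \<phi> k \<sigma> \<in> iso (A \<sigma>) (A' (a k \<sigma>))"
    and face: "\<forall>k. \<forall>\<sigma>\<in>S (Suc k). \<forall>i\<le>Suc k. d' (Suc k) i (a (Suc k) \<sigma>) = a k (d (Suc k) i \<sigma>)"
    and face_0: "\<forall>k. \<forall>\<sigma>\<in>S (Suc k). \<forall>g\<in>carrier (A \<sigma>). \<phi> k (d (Suc k) 0 \<sigma>) (T \<sigma> g) = T' (a (Suc k) \<sigma>) (\<phi> (Suc k) \<sigma> g)"
    and face_i: "\<forall>k. \<forall>\<sigma>\<in>S (Suc k). \<forall>g\<in>carrier (A \<sigma>). \<forall>i. 1 \<le> i \<and> i \<le> Suc k \<longrightarrow> \<phi> k (d (Suc k) i \<sigma>) g = \<phi> (Suc k) \<sigma> g"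
  shows "op_chain_map S A (face_op d A T) S' A' (face_op d' A' T') (\<lambda>k \<sigma>. frag_of (a k \<sigma>, restrict (\<phi> k \<sigma>) (carrier (A \<sigma>))))"
  unfolding op_chain_map_def
proof (intro conjI allI ballI)
  fix k
  let ?\<Phi> = "\<lambda>k \<sigma>. frag_of (a k \<sigma>, restrict (\<phi> k \<sigma>) (carrier (A \<sigma>)))"
  have "restrict (\<phi> k \<sigma>) (carrier (A \<sigma>)) \<in> iso (A \<sigma>) (A' (a k \<sigma>))" if "\<sigma> \<in> S k" for \<sigma>
    by (rule iso_restrict) (use a that local_system.grp [OF L that] in \<open>simp_all add: comm_group.axioms(2)\<close>)
  then show "local_op (S k) A (S' k) A' (?\<Phi> k)"
    using a by (simp add: local_op_def)
  fix \<sigma> assume \<sigma>: "\<sigma> \<in> S k"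
  show "op_comp A (face_op d' A' T' k) (?\<Phi> k) \<sigma> = op_comp A (?\<Phi> (k - 1)) (face_op d A T k) \<sigma>"
  proof (cases k)
    case (Suc l)
    then have \<sigma>': "\<sigma> \<in> S (Suc l)" using \<sigma> by simp
    have 1: "op_comp A (face_op d' A' T' (Suc l)) (?\<Phi> (Suc l)) \<sigma>
       = (\<Sum>j\<in>{()}. \<Sum>i\<le>Suc l. frag_cmul (1 * (-1) ^ i) (frag_of (d' (Suc l) i (a (Suc l) \<sigma>),
           compose (carrier (A \<sigma>)) (face_transport A' T' i (a (Suc l) \<sigma>)) (restrict (\<phi> (Suc l) \<sigma>) (carrier (A \<sigma>))))))"
      by (rule op_comp_sums [where \<tau> = "\<lambda>_. a (Suc l) \<sigma>"]) (simp_all add: face_op_Suc)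
    have 2: "op_comp A (?\<Phi> l) (face_op d A T (Suc l)) \<sigma>
       = (\<Sum>i\<le>Suc l. \<Sum>j\<in>{()}. frag_cmul ((-1) ^ i * 1) (frag_of (a l (d (Suc l) i \<sigma>),
           compose (carrier (A \<sigma>)) (restrict (\<phi> l (d (Suc l) i \<sigma>)) (carrier (A (d (Suc l) i \<sigma>)))) (face_transport A T i \<sigma>))))"
      by (rule op_comp_sums, rule face_op_Suc, simp, simp, simp)
    have "compose (carrier (A \<sigma>)) (face_transport A' T' i (a (Suc l) \<sigma>)) (restrict (\<phi> (Suc l) \<sigma>) (carrier (A \<sigma>)))
       = compose (carrier (A \<sigma>)) (restrict (\<phi> l (d (Suc l) i \<sigma>)) (carrier (A (d (Suc l) i \<sigma>)))) (face_transport A T i \<sigma>)"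
      if i: "i \<le> Suc l" for i
    proof (rule extensionalityI [of _ "carrier (A \<sigma>)"])
      fix g assume g: "g \<in> carrier (A \<sigma>)"
      have "\<phi> (Suc l) \<sigma> \<in> iso (A \<sigma>) (A' (a (Suc l) \<sigma>))" using a \<sigma>' by blast
      then have c: "\<phi> (Suc l) \<sigma> g \<in> carrier (A' (a (Suc l) \<sigma>))" using g by (auto simp: iso_def hom_in_carrier)
      have t: "face_transport A T i \<sigma> g \<in> carrier (A (d (Suc l) i \<sigma>))"
        using local_system.face_transport_iso [OF L \<sigma>' i] g by (auto simp: iso_def hom_in_carrier)
      have e: "\<phi> l (d (Suc l) i \<sigma>) (face_transport A T i \<sigma> g) = face_transport A' T' i (a (Suc l) \<sigma>) (\<phi> (Suc l) \<sigma> g)"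
      proof (cases "i = 0")
        case True
        then show ?thesis using face_0 [rule_format, OF \<sigma>' g] g c by (simp add: face_transport_def)
      next
        case False
        then show ?thesis using face_i [rule_format, OF \<sigma>' g, of i] g c i by (simp add: face_transport_def)
      qed
      show "compose (carrier (A \<sigma>)) (face_transport A' T' i (a (Suc l) \<sigma>)) (restrict (\<phi> (Suc l) \<sigma>) (carrier (A \<sigma>))) g
       = compose (carrier (A \<sigma>)) (restrict (\<phi> l (d (Suc l) i \<sigma>)) (carrier (A (d (Suc l) i \<sigma>)))) (face_transport A T i \<sigma>) g"
        using e g t by (simp add: compose_eq)
    qed simp_all
    then show ?thesis
      unfolding Suc diff_Suc_1 1 2 using face \<sigma>' by (simp add: Suc_le_eq)
  qed simp
qed

section \<open>Trivial fibrations\<close>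

text \<open>\<open>lift\<close> is the lifting property against the inclusion of the boundary of a
  simplex: a family \<open>x\<close> of faces that agrees on common faces is filled over any given
  simplex of the base. For \<open>k = 0\<close> the prescribed faces are two vertices with nothing
  to agree on, hence the premise \<open>k = Suc l\<close>. \<open>degen k i\<close> is the
  degeneracy repeating vertex \<open>i\<close>. For \<open>i = 0\<close> it makes the edge 0-1
  degenerate, so \<open>T_degen_0\<close> asks for the identity; for other \<open>i\<close> it keeps
  that edge.\<close>

locale trivial_fibration = B: local_system SB dB AB TB + E: face_system SE dE
  for SB :: "nat \<Rightarrow> 'b set" and dB and AB :: "'b \<Rightarrow> 'g monoid" and TB
    and SE :: "nat \<Rightarrow> 'e set" and dE +
  fixes p :: "'e \<Rightarrow> 'b" and degen :: "nat \<Rightarrow> nat \<Rightarrow> 'b \<Rightarrow> 'b"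
  assumes p_in: "e \<in> SE k \<Longrightarrow> p e \<in> SB k"
    and p_face: "e \<in> SE (Suc k) \<Longrightarrow> i \<le> Suc k \<Longrightarrow> p (dE (Suc k) i e) = dB (Suc k) i (p e)"
    and degen_in: "\<sigma> \<in> SB k \<Longrightarrow> i \<le> k \<Longrightarrow> degen k i \<sigma> \<in> SB (Suc k)"
    and degen_lt: "\<sigma> \<in> SB (Suc k) \<Longrightarrow> i \<le> Suc k \<Longrightarrow> j < i \<Longrightarrow>
      dB (Suc (Suc k)) j (degen (Suc k) i \<sigma>) = degen k (i - 1) (dB (Suc k) j \<sigma>)"
    and degen_eq: "\<sigma> \<in> SB k \<Longrightarrow> i \<le> k \<Longrightarrow> j = i \<or> j = Suc i \<Longrightarrow> dB (Suc k) j (degen k i \<sigma>) = \<sigma>"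
    and degen_gt: "\<sigma> \<in> SB (Suc k) \<Longrightarrow> Suc i < j \<Longrightarrow> j \<le> Suc (Suc k) \<Longrightarrow>
      dB (Suc (Suc k)) j (degen (Suc k) i \<sigma>) = degen k i (dB (Suc k) (j - 1) \<sigma>)"
    and A_degen: "\<sigma> \<in> SB k \<Longrightarrow> i \<le> k \<Longrightarrow> AB (degen k i \<sigma>) = AB \<sigma>"
    and T_degen_0: "\<sigma> \<in> SB k \<Longrightarrow> g \<in> carrier (AB \<sigma>) \<Longrightarrow> TB (degen k 0 \<sigma>) g = g"
    and T_degen: "\<sigma> \<in> SB k \<Longrightarrow> 1 \<le> i \<Longrightarrow> i \<le> k \<Longrightarrow> g \<in> carrier (AB \<sigma>) \<Longrightarrow> TB (degen k i \<sigma>) g = TB \<sigma> g"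
    and lift_0: "\<sigma> \<in> SB 0 \<Longrightarrow> \<exists>e\<in>SE 0. p e = \<sigma>"
    and lift: "\<lbrakk>\<sigma> \<in> SB (Suc k); \<And>j. j \<le> Suc k \<Longrightarrow> x j \<in> SE k \<and> p (x j) = dB (Suc k) j \<sigma>;
        \<And>l i j. \<lbrakk>k = Suc l; i < j; j \<le> Suc k\<rbrakk> \<Longrightarrow> dE k i (x j) = dE k (j - 1) (x i)\<rbrakk>
      \<Longrightarrow> \<exists>e\<in>SE (Suc k). p e = \<sigma> \<and> (\<forall>j\<le>Suc k. dE (Suc k) j e = x j)"
begin

text \<open>The coefficients upstairs are those pulled back along \<open>p\<close>. The axioms are
  inherited because \<open>p\<close> commutes with faces.\<close>

sublocale E: local_system SE dE "\<lambda>e. AB (p e)" "\<lambda>e. TB (p e)"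
proof (rule local_system.intro [OF E.face_system_axioms], rule local_system_axioms.intro)
  fix e k assume e: "e \<in> SE (Suc k)"
  show "AB (p (dE (Suc k) i e)) = AB (p e)" if "1 \<le> i" "i \<le> Suc k" for i
    using p_face [OF e that(2)] B.A_face [OF p_in [OF e] that] by simp
  show "TB (p e) \<in> iso (AB (p e)) (AB (p (dE (Suc k) 0 e)))"
    using p_face [OF e, of 0] B.T_iso [OF p_in [OF e]] by simp
next
  fix e k g assume e: "e \<in> SE (Suc (Suc k))" and g: "g \<in> carrier (AB (p e))"
  show "TB (p (dE (Suc (Suc k)) 0 e)) (TB (p e) g) = TB (p (dE (Suc (Suc k)) 1 e)) g"
    using p_face [OF e, of 0] p_face [OF e, of 1] B.T_T [OF p_in [OF e] g] by simp
  show "TB (p (dE (Suc (Suc k)) i e)) g = TB (p e) g" if "2 \<le> i" "i \<le> Suc (Suc k)" for i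
    using p_face [OF e that(2)] B.T_face [OF p_in [OF e] g that] by simp
qed (rule B.grp [OF p_in])

text \<open>A choice of lift, so that sections and prisms become functions defined by recursion on
  the dimension. In degree 0 no faces are prescribed.\<close>

definition fill :: "nat \<Rightarrow> 'b \<Rightarrow> (nat \<Rightarrow> 'e) \<Rightarrow> 'e" where
  "fill k \<sigma> x = (SOME e. e \<in> SE k \<and> p e = \<sigma> \<and> (k \<noteq> 0 \<longrightarrow> (\<forall>j\<le>k. dE k j e = x j)))"

lemma fill_0: "\<sigma> \<in> SB 0 \<Longrightarrow> fill 0 \<sigma> x \<in> SE 0 \<and> p (fill 0 \<sigma> x) = \<sigma>"
  unfolding fill_def using lift_0 [of \<sigma>] by (intro someI2_ex [where Q = "\<lambda>e. e \<in> SE 0 \<and> p e = \<sigma>"]) auto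

lemma fill_Suc:
  assumes "\<sigma> \<in> SB (Suc k)" "\<And>j. j \<le> Suc k \<Longrightarrow> x j \<in> SE k \<and> p (x j) = dB (Suc k) j \<sigma>"
    "\<And>l i j. k = Suc l \<Longrightarrow> i < j \<Longrightarrow> j \<le> Suc k \<Longrightarrow> dE k i (x j) = dE k (j - 1) (x i)"
  shows "fill (Suc k) \<sigma> x \<in> SE (Suc k) \<and> p (fill (Suc k) \<sigma> x) = \<sigma> \<and>
    (\<forall>j\<le>Suc k. dE (Suc k) j (fill (Suc k) \<sigma> x) = x j)"
proof -
  have "\<exists>e. e \<in> SE (Suc k) \<and> p e = \<sigma> \<and> (Suc k \<noteq> 0 \<longrightarrow> (\<forall>j\<le>Suc k. dE (Suc k) j e = x j))"
  proof -
    have "\<exists>e\<in>SE (Suc k). p e = \<sigma> \<and> (\<forall>j\<le>Suc k. dE (Suc k) j e = x j)"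
      by (rule lift) (fact assms)+
    then show ?thesis by blast
  qed
  from someI_ex [OF this] show ?thesis unfolding fill_def by blast
qed

definition is_section :: "(nat \<Rightarrow> 'b \<Rightarrow> 'e) \<Rightarrow> bool" where
  "is_section s \<longleftrightarrow> (\<forall>k. \<forall>\<sigma>\<in>SB k. s k \<sigma> \<in> SE k \<and> p (s k \<sigma>) = \<sigma>) \<and>
     (\<forall>k. \<forall>\<sigma>\<in>SB (Suc k). \<forall>j\<le>Suc k. dE (Suc k) j (s (Suc k) \<sigma>) = s k (dB (Suc k) j \<sigma>))"

primrec sect :: "nat \<Rightarrow> 'b \<Rightarrow> 'e" where
  "sect 0 \<sigma> = fill 0 \<sigma> (\<lambda>_. undefined)"
| "sect (Suc k) \<sigma> = fill (Suc k) \<sigma> (\<lambda>j. sect k (dB (Suc k) j \<sigma>))"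

text \<open>The chosen lifts of the faces of \<open>\<sigma>\<close> agree on common faces, because
  they already commute with faces and the face identity holds in the base. They therefore bound a
  simplex that can be filled over \<open>\<sigma>\<close>. Commuting with faces is part of the
  induction for this reason.\<close>

lemma is_section_sect: "is_section sect"
proof -
  have main: "\<forall>\<sigma>\<in>SB k. sect k \<sigma> \<in> SE k \<and> p (sect k \<sigma>) = \<sigma> \<and>
      (\<forall>l. k = Suc l \<longrightarrow> (\<forall>j\<le>k. dE k j (sect k \<sigma>) = sect l (dB k j \<sigma>)))" for k
  proof (induction k)
    case 0
    then show ?case using fill_0 by simp
  next
    case (Suc k)
    show ?case
    proof
      fix \<sigma> assume \<sigma>: "\<sigma> \<in> SB (Suc k)"
      have "fill (Suc k) \<sigma> (\<lambda>j. sect k (dB (Suc k) j \<sigma>)) \<in> SE (Suc k) \<and>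
          p (fill (Suc k) \<sigma> (\<lambda>j. sect k (dB (Suc k) j \<sigma>))) = \<sigma> \<and>
        (\<forall>j\<le>Suc k. dE (Suc k) j (fill (Suc k) \<sigma> (\<lambda>j. sect k (dB (Suc k) j \<sigma>))) = sect k (dB (Suc k) j \<sigma>))"
      proof (rule fill_Suc [OF \<sigma>])
        show "sect k (dB (Suc k) j \<sigma>) \<in> SE k \<and> p (sect k (dB (Suc k) j \<sigma>)) = dB (Suc k) j \<sigma>" if "j \<le> Suc k" for j
          using Suc B.face_in [OF \<sigma> that] by blast
        show "dE k i (sect k (dB (Suc k) j \<sigma>)) = dE k (j - 1) (sect k (dB (Suc k) i \<sigma>))"
          if k: "k = Suc l" and ij: "i < j" "j \<le> Suc k" for l i j
        proof -
          have "dE k i (sect k (dB (Suc k) j \<sigma>)) = sect l (dB k i (dB (Suc k) j \<sigma>))"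
            using Suc B.face_in [OF \<sigma> ij(2)] k ij by simp
          also have "\<dots> = sect l (dB k (j - 1) (dB (Suc k) i \<sigma>))"
            using B.face_face [of \<sigma> l i j] \<sigma> ij k by simp
          also have "\<dots> = dE k (j - 1) (sect k (dB (Suc k) i \<sigma>))"
            using Suc B.face_in [OF \<sigma>, of i] k ij by simp
          finally show ?thesis .
        qed
      qed
      then show "sect (Suc k) \<sigma> \<in> SE (Suc k) \<and> p (sect (Suc k) \<sigma>) = \<sigma> \<and>
        (\<forall>l. Suc k = Suc l \<longrightarrow> (\<forall>j\<le>Suc k. dE (Suc k) j (sect (Suc k) \<sigma>) = sect l (dB (Suc k) j \<sigma>)))"
        by simp
    qed
  qed
  show ?thesis
    unfolding is_section_def
  proof (intro conjI allI ballI impI)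
    fix k \<sigma> assume "\<sigma> \<in> SB k"
    then show "sect k \<sigma> \<in> SE k" "p (sect k \<sigma>) = \<sigma>" using main [of k] by blast+
  next
    fix k \<sigma> j assume "\<sigma> \<in> SB (Suc k)" "j \<le> Suc k"
    then show "dE (Suc k) j (sect (Suc k) \<sigma>) = sect k (dB (Suc k) j \<sigma>)" using main [of "Suc k"] by blast
  qed
qed

end

text \<open>The section is a parameter because two kinds are used: the chosen one,
  \<open>sect\<close>, for \<open>path_target\<close>, and the constant homotopies for the
  projection to simplices of \<open>X\<close>.\<close>

locale trivial_fibration_section = trivial_fibration SB dB AB TB SE dE p degen
  for SB :: "nat \<Rightarrow> 'b set" and dB and AB :: "'b \<Rightarrow> 'g monoid" and TB
    and SE :: "nat \<Rightarrow> 'e set" and dE and p degen +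
  fixes s :: "nat \<Rightarrow> 'b \<Rightarrow> 'e"
  assumes sec: "is_section s"
begin

lemma s_in: "\<sigma> \<in> SB k \<Longrightarrow> s k \<sigma> \<in> SE k" and p_s: "\<sigma> \<in> SB k \<Longrightarrow> p (s k \<sigma>) = \<sigma>"
  and face_s: "\<sigma> \<in> SB (Suc k) \<Longrightarrow> j \<le> Suc k \<Longrightarrow> dE (Suc k) j (s (Suc k) \<sigma>) = s k (dB (Suc k) j \<sigma>)"
  using sec by (simp_all add: is_section_def)

text \<open>\<open>interp k i e\<close> agrees with \<open>e\<close> on the first \<open>i\<close> vertices and with \<open>s (p e)\<close> on the
  others; \<open>prism k i e\<close>, lying over a degenerate simplex, joins \<open>interp k i e\<close> to
  \<open>interp k (i + 1) e\<close>.\<close>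

primrec interp :: "nat \<Rightarrow> nat \<Rightarrow> 'e \<Rightarrow> 'e" where
  "interp 0 i e = (if i = 0 then s 0 (p e) else e)"
| "interp (Suc k) i e =
     (if i = 0 then s (Suc k) (p e) else if i = Suc (Suc k) then e
      else fill (Suc k) (p e) (\<lambda>j. interp k (if j < i then i - 1 else i) (dE (Suc k) j e)))"

lemma interp_0: "interp k 0 e = s k (p e)"
  by (cases k) auto

lemma interp_last: "interp k (Suc k) e = e"
  by (cases k) auto

text \<open>Deleting vertex \<open>j\<close> with \<open>j < i\<close> leaves \<open>i - 1\<close>
  of the first \<open>i\<close> vertices, otherwise all of them remain; this is the index of the
  face. With this rule the faces prescribed in \<open>interp\<close> agree where they meet, and can
  be filled.\<close>

lemma interp_main:
  "\<forall>e\<in>SE k. \<forall>i\<le>Suc k. interp k i e \<in> SE k \<and> p (interp k i e) = p e \<and>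
     (\<forall>l. k = Suc l \<longrightarrow> (\<forall>j\<le>k. dE k j (interp k i e) = interp l (if j < i then i - 1 else i) (dE k j e)))"
proof (induction k)
  case 0
  then show ?case using s_in p_s p_in by auto
next
  case (Suc k)
  show ?case
  proof (intro ballI allI impI)
    fix e i assume e: "e \<in> SE (Suc k)" and i: "i \<le> Suc (Suc k)"
    let ?P = "interp (Suc k) i e \<in> SE (Suc k) \<and> p (interp (Suc k) i e) = p e \<and>
      (\<forall>j\<le>Suc k. dE (Suc k) j (interp (Suc k) i e) = interp k (if j < i then i - 1 else i) (dE (Suc k) j e))"
    consider "i = 0" | "i = Suc (Suc k)" | "1 \<le> i" "i \<le> Suc k" using i by linarith
    then have ?P
    proof cases
      case 1
      then show ?thesis
        using s_in [OF p_in [OF e]] p_s [OF p_in [OF e]] face_s [OF p_in [OF e]] p_face [OF e]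
        by (simp add: interp_0 del: interp.simps)
    next
      case 2
      then show ?thesis using e by (simp add: interp_last)
    next
      case 3
      let ?c = "\<lambda>i j. if j < i then i - 1 else i"
      let ?x = "\<lambda>j. interp k (?c i j) (dE (Suc k) j e)"
      have "fill (Suc k) (p e) ?x \<in> SE (Suc k) \<and> p (fill (Suc k) (p e) ?x) = p e \<and>
        (\<forall>j\<le>Suc k. dE (Suc k) j (fill (Suc k) (p e) ?x) = ?x j)"
      proof (rule fill_Suc [OF p_in [OF e]])
        show "?x j \<in> SE k \<and> p (?x j) = dB (Suc k) j (p e)" if j: "j \<le> Suc k" for j
          using Suc E.face_in [OF e j] 3 p_face [OF e j] by simp
        show "dE k a (?x b) = dE k (b - 1) (?x a)"
          if k: "k = Suc l" and ab: "a < b" "b \<le> Suc k" for l a b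
        proof -
          have b: "dE (Suc k) b e \<in> SE k" and a: "dE (Suc k) a e \<in> SE k"
            using E.face_in [OF e] ab by simp_all
          have IH: "dE k j (interp k m e') = interp l (?c m j) (dE k j e')"
            if "e' \<in> SE k" "m \<le> Suc k" "j \<le> k" for e' m j
            using Suc k that by blast
          have "dE k a (?x b) = interp l (?c (?c i b) a) (dE k a (dE (Suc k) b e))"
            by (rule IH [OF b]) (use 3 ab in auto)
          also have "dE k a (dE (Suc k) b e) = dE k (b - 1) (dE (Suc k) a e)"
            using E.face_face [of e l a b] e ab k by simp
          \<comment> \<open>Both sides count how many of the first \<open>i\<close> vertices are
            left once \<open>a\<close> and \<open>b\<close> are deleted. As \<open>a < b\<close>,
            deleting \<open>a\<close> first shifts \<open>b\<close> to \<open>b - 1\<close>.\<close>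
          also have "?c (?c i b) a = ?c (?c i a) (b - 1)"
            using ab by auto
          also have "interp l (?c (?c i a) (b - 1)) (dE k (b - 1) (dE (Suc k) a e)) = dE k (b - 1) (?x a)"
            by (rule IH [OF a, symmetric]) (use 3 ab in auto)
          finally show ?thesis .
        qed
      qed
      then show ?thesis using 3 by simp
    qed
    then show "interp (Suc k) i e \<in> SE (Suc k) \<and> p (interp (Suc k) i e) = p e \<and>
     (\<forall>l. Suc k = Suc l \<longrightarrow> (\<forall>j\<le>Suc k. dE (Suc k) j (interp (Suc k) i e) = interp l (if j < i then i - 1 else i) (dE (Suc k) j e)))"
      by (simp del: interp.simps)
  qed
qed

lemma interp_in: "e \<in> SE k \<Longrightarrow> i \<le> Suc k \<Longrightarrow> interp k i e \<in> SE k"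
  and p_interp: "e \<in> SE k \<Longrightarrow> i \<le> Suc k \<Longrightarrow> p (interp k i e) = p e"
  using interp_main [of k] by blast+

lemma face_interp:
  assumes "e \<in> SE (Suc k)" "i \<le> Suc (Suc k)" "j \<le> Suc k"
  shows "dE (Suc k) j (interp (Suc k) i e) = interp k (if j < i then i - 1 else i) (dE (Suc k) j e)"
  using interp_main [of "Suc k"] assms by blast

declare interp.simps [simp del]

primrec prism :: "nat \<Rightarrow> nat \<Rightarrow> 'e \<Rightarrow> 'e" where
  "prism 0 i e = fill (Suc 0) (degen 0 i (p e)) (\<lambda>j. interp 0 j e)"
| "prism (Suc k) i e = fill (Suc (Suc k)) (degen (Suc k) i (p e))
     (\<lambda>j. if j < i then prism k (i - 1) (dE (Suc k) j e)
          else if j \<le> Suc i then interp (Suc k) j e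
          else prism k i (dE (Suc k) (j - 1) e))"

text \<open>The vertices of \<open>prism k i e\<close> may be pictured as vertices \<open>0\<close>
  to \<open>i\<close> of \<open>e\<close> followed by vertices \<open>i\<close> to \<open>k\<close>
  of the section over \<open>p e\<close>. Deleting position \<open>i\<close> gives
  \<open>interp k i e\<close>, deleting position \<open>i + 1\<close> gives
  \<open>interp k (Suc i) e\<close>, and any other deletion gives a prism of a face of
  \<open>e\<close>. The proof checks that these prescribed faces lie over the faces of the
  degenerate simplex and agree with one another.\<close>

lemma prism_main:
  "\<forall>e\<in>SE k. \<forall>i\<le>k. prism k i e \<in> SE (Suc k) \<and> p (prism k i e) = degen k i (p e) \<and>
     dE (Suc k) i (prism k i e) = interp k i e \<and> dE (Suc k) (Suc i) (prism k i e) = interp k (Suc i) e \<and>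
     (\<forall>l. k = Suc l \<longrightarrow> (\<forall>j<i. dE (Suc k) j (prism k i e) = prism l (i - 1) (dE k j e)) \<and>
        (\<forall>j\<le>Suc k. Suc i < j \<longrightarrow> dE (Suc k) j (prism k i e) = prism l i (dE k (j - 1) e)))"
proof (induction k)
  case 0
  show ?case
  proof (intro ballI allI impI)
    fix e and i :: nat assume e: "e \<in> SE 0" and "i \<le> 0"
    then have i: "i = 0" by simp
    have "fill (Suc 0) (degen 0 0 (p e)) (\<lambda>j. interp 0 j e) \<in> SE (Suc 0) \<and>
        p (fill (Suc 0) (degen 0 0 (p e)) (\<lambda>j. interp 0 j e)) = degen 0 0 (p e) \<and>
        (\<forall>j\<le>Suc 0. dE (Suc 0) j (fill (Suc 0) (degen 0 0 (p e)) (\<lambda>j. interp 0 j e)) = interp 0 j e)"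
    proof (rule fill_Suc)
      fix j :: nat assume j: "j \<le> Suc 0"
      then have "j = 0 \<or> j = Suc 0" by linarith
      then show "interp 0 j e \<in> SE 0 \<and> p (interp 0 j e) = dB (Suc 0) j (degen 0 0 (p e))"
        using interp_in [OF e j] p_interp [OF e j] degen_eq [OF p_in [OF e], of 0 j] by auto
    qed (use degen_in [OF p_in [OF e]] in auto)
    then show "prism 0 i e \<in> SE (Suc 0) \<and> p (prism 0 i e) = degen 0 i (p e) \<and>
     dE (Suc 0) i (prism 0 i e) = interp 0 i e \<and> dE (Suc 0) (Suc i) (prism 0 i e) = interp 0 (Suc i) e \<and>
     (\<forall>l. 0 = Suc l \<longrightarrow> (\<forall>j<i. dE (Suc 0) j (prism 0 i e) = prism l (i - 1) (dE 0 j e)) \<and>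
        (\<forall>j\<le>Suc 0. Suc i < j \<longrightarrow> dE (Suc 0) j (prism 0 i e) = prism l i (dE 0 (j - 1) e)))"
      by (simp add: i)
  qed
next
  case (Suc k)
  note IH = Suc [rule_format]
  show ?case
  proof (intro ballI allI impI)
    fix e i assume e: "e \<in> SE (Suc k)" and i: "i \<le> Suc k"
    let ?x = "\<lambda>j. if j < i then prism k (i - 1) (dE (Suc k) j e)
          else if j \<le> Suc i then interp (Suc k) j e
          else prism k i (dE (Suc k) (j - 1) e)"
    note pe = p_in [OF e]
    have "fill (Suc (Suc k)) (degen (Suc k) i (p e)) ?x \<in> SE (Suc (Suc k)) \<and>
        p (fill (Suc (Suc k)) (degen (Suc k) i (p e)) ?x) = degen (Suc k) i (p e) \<and>
        (\<forall>j\<le>Suc (Suc k). dE (Suc (Suc k)) j (fill (Suc (Suc k)) (degen (Suc k) i (p e)) ?x) = ?x j)"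
    proof (rule fill_Suc [OF degen_in [OF pe i]])
      fix j assume j: "j \<le> Suc (Suc k)"
      consider "j < i" | "j = i \<or> j = Suc i" | "Suc i < j" by linarith
      then show "?x j \<in> SE (Suc k) \<and> p (?x j) = dB (Suc (Suc k)) j (degen (Suc k) i (p e))"
      proof cases
        case 1
        then have "dE (Suc k) j e \<in> SE k" "i - 1 \<le> k" "p (dE (Suc k) j e) = dB (Suc k) j (p e)"
          using E.face_in [OF e] p_face [OF e] i by simp_all
        then show ?thesis
          using IH 1 degen_lt [OF pe i 1] by simp
      next
        case 2
        then have "?x j = interp (Suc k) j e" by auto
        then show ?thesis
          using interp_in [OF e j] p_interp [OF e j] degen_eq [OF pe i 2] by simp
      next
        case 3
        then have "dE (Suc k) (j - 1) e \<in> SE k" "i \<le> k" "p (dE (Suc k) (j - 1) e) = dB (Suc k) (j - 1) (p e)"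
          using E.face_in [OF e] p_face [OF e] j by simp_all
        then show ?thesis
          using IH 3 degen_gt [OF pe 3 j] by simp
      qed
    next
      fix l' a b assume ab: "a < b" "b \<le> Suc (Suc k)"
      have fb: "dE (Suc k) b e \<in> SE k" if "b < i" using that E.face_in [OF e] i by simp
      have fb1: "dE (Suc k) (b - 1) e \<in> SE k" using E.face_in [OF e] ab by simp
      have fa: "dE (Suc k) a e \<in> SE k" using E.face_in [OF e] ab by simp
      have fa1: "dE (Suc k) (a - 1) e \<in> SE k" using E.face_in [OF e] ab by simp
      \<comment> \<open>Each of \<open>a\<close> and \<open>b\<close> lies before \<open>i\<close>,
        at \<open>i\<close> or \<open>i + 1\<close>, or beyond. In the third case the two
        interpolations meet: removing vertex \<open>i\<close>, the only one on which they differ,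
        leaves the same simplex.\<close>
      consider (1) "b < i" | (2) "b = i \<or> b = Suc i" "a < i" | (3) "b = Suc i" "a = i"
        | (4) "Suc i < b" "a < i" | (5) "Suc i < b" "a = i \<or> a = Suc i" | (6) "Suc i < b" "Suc i < a"
        using ab by linarith
      then show "dE (Suc k) a (?x b) = dE (Suc k) (b - 1) (?x a)"
      proof cases
        case 1
        then obtain l where k: "k = Suc l" using i ab by (cases k) auto
        have "dE (Suc k) a (prism k (i - 1) (dE (Suc k) b e)) = prism l (i - 1 - 1) (dE k a (dE (Suc k) b e))"
          using IH [OF fb [OF 1], of "i - 1"] 1 ab i k by auto
        moreover have "dE (Suc k) (b - 1) (prism k (i - 1) (dE (Suc k) a e)) = prism l (i - 1 - 1) (dE k (b - 1) (dE (Suc k) a e))"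
          using IH [OF fa, of "i - 1"] 1 ab i k by auto
        moreover have "dE k a (dE (Suc k) b e) = dE k (b - 1) (dE (Suc k) a e)"
          using E.face_face [of e l a b] e ab k 1 i by simp
        ultimately show ?thesis using 1 ab by simp
      next
        case 2
        have "?x b = interp (Suc k) b e" using 2 by auto
        moreover have "dE (Suc k) a (interp (Suc k) b e) = interp k (b - 1) (dE (Suc k) a e)"
          using face_interp [OF e, of b a] ab 2 i by simp
        moreover have "dE (Suc k) (b - 1) (prism k (i - 1) (dE (Suc k) a e)) = interp k (b - 1) (dE (Suc k) a e)"
          using IH [OF fa, of "i - 1"] 2 i by auto
        ultimately show ?thesis using 2 by simp
      next
        case 3
        then show ?thesis
          using face_interp [OF e, of b a] face_interp [OF e, of a a] i by simp
      next
        case 4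
        then obtain l where k: "k = Suc l" using i ab by (cases k) auto
        have ik: "i \<le> k" using 4 ab by simp
        have "dE (Suc k) a (prism k i (dE (Suc k) (b - 1) e)) = prism l (i - 1) (dE k a (dE (Suc k) (b - 1) e))"
          using IH [OF fb1 ik] 4 k by auto
        moreover have "dE (Suc k) (b - 1) (prism k (i - 1) (dE (Suc k) a e)) = prism l (i - 1) (dE k (b - 1 - 1) (dE (Suc k) a e))"
          using IH [OF fa, of "i - 1"] 4 ab i k by auto
        moreover have "dE k a (dE (Suc k) (b - 1) e) = dE k (b - 1 - 1) (dE (Suc k) a e)"
          using E.face_face [of e l a "b - 1"] e ab k 4 by simp
        ultimately show ?thesis using 4 by simp
      next
        case 5
        have ik: "i \<le> k" using 5 ab by simp
        have "?x a = interp (Suc k) a e" using 5 by auto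
        moreover have "dE (Suc k) (b - 1) (interp (Suc k) a e) = interp k a (dE (Suc k) (b - 1) e)"
        proof -
          have "\<not> b - 1 < a" "b - 1 \<le> Suc k" "a \<le> Suc (Suc k)" using 5 ab by auto
          then show ?thesis using face_interp [OF e, of a "b - 1"] by (simp del: One_nat_def)
        qed
        moreover have "dE (Suc k) a (prism k i (dE (Suc k) (b - 1) e)) = interp k a (dE (Suc k) (b - 1) e)"
          using IH [OF fb1 ik] 5 by auto
        ultimately show ?thesis using 5 by simp
      next
        case 6
        then obtain l where k: "k = Suc l" using ab by (cases k) auto
        have ik: "i \<le> k" using 6 ab by simp
        have "dE (Suc k) a (prism k i (dE (Suc k) (b - 1) e)) = prism l i (dE k (a - 1) (dE (Suc k) (b - 1) e))"
          using IH [OF fb1 ik] 6 k ab by auto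
        moreover have "dE (Suc k) (b - 1) (prism k i (dE (Suc k) (a - 1) e)) = prism l i (dE k (b - 1 - 1) (dE (Suc k) (a - 1) e))"
          using IH [OF fa1 ik] 6 ab k by auto
        moreover have "dE k (a - 1) (dE (Suc k) (b - 1) e) = dE k (b - 1 - 1) (dE (Suc k) (a - 1) e)"
          using E.face_face [of e l "a - 1" "b - 1"] e ab k 6 by simp
        ultimately show ?thesis using 6 by simp
      qed
    qed
    then show "prism (Suc k) i e \<in> SE (Suc (Suc k)) \<and> p (prism (Suc k) i e) = degen (Suc k) i (p e) \<and>
     dE (Suc (Suc k)) i (prism (Suc k) i e) = interp (Suc k) i e \<and>
     dE (Suc (Suc k)) (Suc i) (prism (Suc k) i e) = interp (Suc k) (Suc i) e \<and>
     (\<forall>l. Suc k = Suc l \<longrightarrow> (\<forall>j<i. dE (Suc (Suc k)) j (prism (Suc k) i e) = prism l (i - 1) (dE (Suc k) j e)) \<and>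
        (\<forall>j\<le>Suc (Suc k). Suc i < j \<longrightarrow> dE (Suc (Suc k)) j (prism (Suc k) i e) = prism l i (dE (Suc k) (j - 1) e)))"
      using i by simp
  qed
qed

declare prism.simps [simp del]

lemma prism_in: "e \<in> SE k \<Longrightarrow> i \<le> k \<Longrightarrow> prism k i e \<in> SE (Suc k)"
  and p_prism: "e \<in> SE k \<Longrightarrow> i \<le> k \<Longrightarrow> p (prism k i e) = degen k i (p e)"
  and face_prism_eq: "e \<in> SE k \<Longrightarrow> i \<le> k \<Longrightarrow> dE (Suc k) i (prism k i e) = interp k i e"
    "e \<in> SE k \<Longrightarrow> i \<le> k \<Longrightarrow> dE (Suc k) (Suc i) (prism k i e) = interp k (Suc i) e"
  using prism_main [of k] by blast+

lemma face_prism: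
  assumes "e \<in> SE (Suc k)" "i \<le> Suc k"
  shows "j < i \<Longrightarrow> dE (Suc (Suc k)) j (prism (Suc k) i e) = prism k (i - 1) (dE (Suc k) j e)"
    and "j \<le> Suc (Suc k) \<Longrightarrow> Suc i < j \<Longrightarrow> dE (Suc (Suc k)) j (prism (Suc k) i e) = prism k i (dE (Suc k) (j - 1) e)"
  using prism_main [of "Suc k"] assms by blast+

abbreviation "AE \<equiv> \<lambda>e. AB (p e)"
abbreviation "TE \<equiv> \<lambda>e. TB (p e)"

definition proj_op where "proj_op k e = frag_of (p e, \<lambda>g\<in>carrier (AE e). g)" for k :: nat
definition sect_op where "sect_op k \<sigma> = frag_of (s k \<sigma>, \<lambda>g\<in>carrier (AB \<sigma>). g)"
text \<open>A prism lies over a degeneracy of \<open>p e\<close>, which has the same fibre by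
  \<open>A_degen\<close>; so the coefficient is passed on unchanged.\<close>

definition prism_op where
  "prism_op k e = (\<Sum>i\<le>k. frag_cmul ((-1) ^ i) (frag_of (prism k i e, \<lambda>g\<in>carrier (AE e). g)))"

lemma proj_op_chain_map: "op_chain_map SE AE (face_op dE AE TE) SB AB (face_op dB AB TB) proj_op"
  unfolding proj_op_def [abs_def]
  by (rule op_chain_map_single [OF E.local_system_axioms B.local_system_axioms])
    (simp_all add: p_in p_face iso_set_refl)

lemma sect_op_chain_map: "op_chain_map SB AB (face_op dB AB TB) SE AE (face_op dE AE TE) sect_op"
  unfolding sect_op_def [abs_def]
  by (rule op_chain_map_single [OF B.local_system_axioms E.local_system_axioms])
    (simp_all add: s_in p_s face_s iso_set_refl)

lemma proj_sect_homotopy: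
  "op_homotopy SB AB (face_op dB AB TB) (\<lambda>k. op_comp AB (proj_op k) (sect_op k)) (\<lambda>_ _. 0)"
proof -
  have "op_comp AB (proj_op k) (sect_op k) \<sigma> = op_id AB \<sigma>" if "\<sigma> \<in> SB k" for k \<sigma>
    unfolding proj_op_def [abs_def] sect_op_def [abs_def] op_comp_single
    using p_s [OF that] by (simp add: op_id_def compose_def cong: restrict_cong)
  then show ?thesis
    by (simp add: op_homotopy_def local_op_def)
qed

text \<open>In the prism formula the two surviving faces are \<open>interp k 0 e\<close>, the
  section over \<open>p e\<close>, and \<open>interp k (Suc k) e\<close>, which is \<open>e\<close>.
  The transports have to match as well before terms may cancel.\<close>

lemma sect_proj_homotopy:
  "op_homotopy SE AE (face_op dE AE TE) (\<lambda>k. op_comp AE (sect_op k) (proj_op k)) prism_op"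
  unfolding op_homotopy_def
proof (intro conjI allI ballI)
  fix k
  show "local_op (SE k) AE (SE (Suc k)) AE (prism_op k)"
    unfolding local_op_def
  proof (intro ballI)
    fix e x assume e: "e \<in> SE k" and x: "x \<in> Poly_Mapping.keys (prism_op k e)"
    have "x \<in> (\<Union>i\<in>{..k}. Poly_Mapping.keys (frag_cmul ((-1) ^ i) (frag_of (prism k i e, \<lambda>g\<in>carrier (AE e). g))))"
      using x unfolding prism_op_def by (rule subsetD [OF keys_sum])
    then obtain i where i: "i \<le> k" "x = (prism k i e, \<lambda>g\<in>carrier (AE e). g)" by auto
    then show "fst x \<in> SE (Suc k) \<and> snd x \<in> iso (AE e) (AE (fst x))"
      using prism_in [OF e i(1)] p_prism [OF e i(1)] A_degen [OF p_in [OF e] i(1)] restrict_id_iso [OF E.grp [OF e]] by simp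
  qed
  fix e assume e: "e \<in> SE k"
  note pe = p_in [OF e]
  have Ap: "AE (prism k i e) = AE e" if "i \<le> k" for i
    using p_prism [OF e that] A_degen [OF pe that] by simp
  let ?F = "\<lambda>i j. frag_of (dE (Suc k) j (prism k i e),
     compose (carrier (AE e)) (face_transport AE TE j (prism k i e)) (\<lambda>g\<in>carrier (AE e). g))"
  let ?H = "\<lambda>i j. frag_of (prism (k - 1) i (dE k j e),
     compose (carrier (AE e)) (\<lambda>g\<in>carrier (AE (dE k j e)). g) (face_transport AE TE j e))"
  have 1: "op_comp AE (face_op dE AE TE (Suc k)) (prism_op k) e
     = (\<Sum>i\<le>k. \<Sum>j\<le>Suc k. frag_cmul ((-1) ^ i * (-1) ^ j) (?F i j))"
    by (rule op_comp_sums, rule prism_op_def, simp, rule face_op_Suc, simp)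
  have 2: "op_comp AE (prism_op (k - 1)) (face_op dE AE TE k) e
     = (\<Sum>j\<le>k. \<Sum>i<k. frag_cmul ((-1) ^ j * (-1) ^ i) (?H i j))"
  proof (cases k)
    case 0
    then show ?thesis by simp
  next
    case (Suc l)
    have "op_comp AE (prism_op l) (face_op dE AE TE (Suc l)) e
     = (\<Sum>j\<le>Suc l. \<Sum>i\<le>l. frag_cmul ((-1) ^ j * (-1) ^ i) (frag_of (prism l i (dE (Suc l) j e),
         compose (carrier (AE e)) (\<lambda>g\<in>carrier (AE (dE (Suc l) j e)). g) (face_transport AE TE j e))))"
      by (rule op_comp_sums, rule face_op_Suc, simp, rule prism_op_def, simp)
    then show ?thesis by (simp add: Suc lessThan_Suc_atMost)
  qed
  \<comment> \<open>Transport ends in the fibre of the face, so restricting the identity to that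
    fibre changes nothing.\<close>
  have tr: "compose (carrier (AE e)) (\<lambda>g\<in>carrier (AE (dE k j e)). g) (face_transport AE TE j e) = face_transport AE TE j e"
    if "k = Suc l" "j \<le> k" for j l
  proof -
    have "face_transport AE TE j e g \<in> carrier (AE (dE k j e))" if "g \<in> carrier (AE e)" for g
      using E.face_transport_iso [of e l j] e \<open>k = Suc l\<close> \<open>j \<le> k\<close> that by (auto simp: iso_def hom_in_carrier)
    then show ?thesis by (auto simp: compose_def face_transport_def fun_eq_iff)
  qed
  \<comment> \<open>Prism 0 lies over a simplex with degenerate edge 0-1, so passing to its face 0
    moves no coefficient. For \<open>i > 0\<close> that edge is the edge of
    \<open>p e\<close>.\<close>
  have trp: "compose (carrier (AE e)) (face_transport AE TE j (prism k i e)) (\<lambda>g\<in>carrier (AE e). g)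
      = (\<lambda>g\<in>carrier (AE e). if j = 0 \<and> i \<noteq> 0 then TE e g else g)" if i: "i \<le> k" for i j
  proof -
    have "TB (p (prism k i e)) g = (if i = 0 then g else TE e g)" if "g \<in> carrier (AE e)" for g
      using T_degen_0 [OF pe that] T_degen [OF pe _ i that] p_prism [OF e i] by auto
    then show ?thesis
      using Ap [OF i] by (auto simp: compose_def face_transport_def fun_eq_iff)
  qed
  have sum: "op_comp AE (face_op dE AE TE (Suc k)) (prism_op k) e + op_comp AE (prism_op (k - 1)) (face_op dE AE TE k) e
     = ?F 0 0 - ?F k (Suc k)"
    unfolding 1 2
  proof (rule alternating_prism_sum)
    fix i j assume ij: "j < i" "i \<le> k"
    then obtain l where l: "k = Suc l" by (cases k) auto
    have "dE (Suc k) j (prism k i e) = prism (k - 1) (i - 1) (dE k j e)"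
      using face_prism(1) [of e l i j] e ij l by simp
    moreover have "(\<lambda>g\<in>carrier (AE e). if j = 0 \<and> i \<noteq> 0 then TE e g else g) = face_transport AE TE j e"
      using ij by (auto simp: face_transport_def)
    ultimately show "?F i j = ?H (i - 1) j"
      using trp [OF ij(2)] tr [OF l, of j] ij by simp
  next
    fix i j assume ij: "Suc i < j" "j \<le> Suc k"
    then obtain l where l: "k = Suc l" by (cases k) auto
    have "dE (Suc k) j (prism k i e) = prism (k - 1) i (dE k (j - 1) e)"
      using face_prism(2) [of e l i j] e ij l by simp
    moreover have "(\<lambda>g\<in>carrier (AE e). if j = 0 \<and> i \<noteq> 0 then TE e g else g) = face_transport AE TE (j - 1) e"
      using ij by (auto simp: face_transport_def)
    ultimately show "?F i j = ?H i (j - 1)"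
      using trp [of i j] tr [OF l, of "j - 1"] ij by simp
  next
    fix i assume i: "i < k"
    then show "?F i (Suc i) = ?F (Suc i) (Suc i)"
      using face_prism_eq [OF e] trp by simp
  qed
  have F0: "?F 0 0 = op_comp AE (sect_op k) (proj_op k) e"
    unfolding proj_op_def [abs_def] sect_op_def [abs_def] op_comp_single
    using face_prism_eq(1) [OF e, of 0] trp [of 0 0] by (simp add: interp_0 compose_def cong: restrict_cong)
  have Fk: "?F k (Suc k) = op_id AE e"
    using face_prism_eq(2) [OF e, of k] trp [of k "Suc k"] by (simp add: interp_last op_id_def)
  show "op_comp AE (sect_op k) (proj_op k) e = op_comp AE (face_op dE AE TE (Suc k)) (prism_op k) e
     + op_comp AE (prism_op (k - 1)) (face_op dE AE TE k) e + op_id AE e"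
    unfolding sum F0 [symmetric] Fk [symmetric] by simp
qed

lemmas proj_op_equiv =
  op_homotopy_equivalence [OF E.op_complex_face_op B.op_complex_face_op proj_op_chain_map sect_op_chain_map
    sect_proj_homotopy proj_sect_homotopy]

lemmas sect_op_equiv =
  op_homotopy_equivalence [OF B.op_complex_face_op E.op_complex_face_op sect_op_chain_map proj_op_chain_map
    proj_sect_homotopy sect_proj_homotopy]

end

section \<open>Homotopies of maps on cubes with prescribed boundary values\<close>

abbreviation "unit_interval \<equiv> top_of_set {0..1::real}"

abbreviation cube_cyl :: "nat \<Rightarrow> (real \<times> (nat \<Rightarrow> real)) topology" where
  "cube_cyl n \<equiv> prod_topology unit_interval (cube n)"

lemma topspace_cube: "x \<in> topspace (cube n) \<longleftrightarrow> x \<in> extensional {..<n} \<and> (\<forall>i<n. 0 \<le> x i \<and> x i \<le> 1)"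
  by (auto simp: cube_def PiE_iff)

lemma cube_boundary_subset: "x \<in> cube_boundary n \<Longrightarrow> x \<in> topspace (cube n)"
  by (simp add: cube_boundary_def)

lemma continuous_map_cubeI:
  assumes "\<And>z. z \<in> topspace Z \<Longrightarrow> g z \<in> topspace (cube n)"
    and "\<And>i. i < n \<Longrightarrow> continuous_map Z euclideanreal (\<lambda>z. g z i)"
  shows "continuous_map Z (cube n) g"
  unfolding cube_def continuous_map_componentwise
proof (intro conjI ballI)
  show "g ` topspace Z \<subseteq> extensional {..<n}"
    using assms(1) by (auto simp: topspace_cube)
  fix k assume k: "k \<in> {..<n}"
  show "continuous_map Z unit_interval (\<lambda>z. g z k)"
    by (rule continuous_map_into_subtopology) (use assms k in \<open>auto simp: topspace_cube\<close>)
qed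

lemma continuous_map_cube_coord: "i < n \<Longrightarrow> continuous_map (cube n) euclideanreal (\<lambda>x. x i)"
  using continuous_map_product_projection [of i "{..<n}" "\<lambda>_. unit_interval"]
  by (auto simp: cube_def intro: continuous_map_into_fulltopology)

lemma continuous_map_coord: "i < n \<Longrightarrow> continuous_map (subtopology (prod_topology T (cube n)) S) euclideanreal (\<lambda>z. snd z i)"
  using continuous_map_compose [OF continuous_map_snd [of T "cube n"] continuous_map_cube_coord]
  by (auto simp: o_def intro: continuous_map_from_subtopology)

lemma continuous_map_time: "continuous_map (subtopology (prod_topology unit_interval T) S) euclideanreal fst"
  using continuous_map_into_fulltopology [OF continuous_map_fst [of unit_interval T]]
  by (auto intro: continuous_map_from_subtopology)

lemma continuous_map_pairD:
  "continuous_map Z X f \<Longrightarrow> continuous_map Z Y g \<Longrightarrow> continuous_map (prod_topology X Y) W h \<Longrightarrow>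
    continuous_map Z W (\<lambda>z. h (f z, g z))"
  using continuous_map_compose [of Z "prod_topology X Y" "\<lambda>z. (f z, g z)" W h] by (simp add: continuous_map_paired o_def)

lemma closedin_cube_boundary: "closedin (cube n) (cube_boundary n)"
proof -
  have "closedin (cube n) {x \<in> topspace (cube n). x i \<in> {0, 1}}" if "i < n" for i
    by (rule closedin_continuous_map_preimage [OF continuous_map_cube_coord [OF that]]) simp
  then have "closedin (cube n) (\<Union>i\<in>{..<n}. {x \<in> topspace (cube n). x i \<in> {0, 1}})"
    by (intro closedin_Union) auto
  moreover have "(\<Union>i\<in>{..<n}. {x \<in> topspace (cube n). x i \<in> {0, 1}}) = cube_boundary n"
    by (auto simp: cube_boundary_def)
  ultimately show ?thesis by simp
qed

text \<open>Twice the distance from the centre of the cube in the maximum norm: at most 1 on the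
  cube and equal to 1 on its boundary.\<close>

primrec gauge :: "nat \<Rightarrow> (nat \<Rightarrow> real) \<Rightarrow> real" where
  "gauge 0 x = 0"
| "gauge (Suc n) x = max (gauge n x) \<bar>2 * x n - 1\<bar>"

lemma gauge_ge: "i < n \<Longrightarrow> \<bar>2 * x i - 1\<bar> \<le> gauge n x"
  by (induction n) (auto simp: less_Suc_eq)

lemma gauge_le: "(\<And>i. i < n \<Longrightarrow> \<bar>2 * x i - 1\<bar> \<le> c) \<Longrightarrow> 0 \<le> c \<Longrightarrow> gauge n x \<le> c"
  by (induction n) auto

lemma gauge_attained: "0 < gauge n x \<Longrightarrow> \<exists>i<n. \<bar>2 * x i - 1\<bar> = gauge n x"
proof (induction n)
  case (Suc n)
  show ?case
  proof (cases "gauge n x \<le> \<bar>2 * x n - 1\<bar>")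
    case True
    then show ?thesis by (intro exI [of _ n]) auto
  next
    case False
    then have "0 < gauge n x" by linarith
    then obtain i where "i < n" "\<bar>2 * x i - 1\<bar> = gauge n x" using Suc.IH by blast
    then show ?thesis using False by (intro exI [of _ i]) auto
  qed
qed simp

lemma gauge_cube: "x \<in> topspace (cube n) \<Longrightarrow> gauge n x \<le> 1"
  by (rule gauge_le) (auto simp: topspace_cube abs_le_iff)

lemma gauge_boundary: "x \<in> cube_boundary n \<Longrightarrow> gauge n x = 1"
  using gauge_cube [of x n] gauge_ge [of _ n x] unfolding cube_boundary_def by fastforce

lemma continuous_map_gauge: "continuous_map (subtopology (prod_topology T (cube n)) S) euclideanreal (\<lambda>z. gauge n (snd z))"
proof -
  have "continuous_map (subtopology (prod_topology T (cube n)) S) euclideanreal (\<lambda>z. gauge k (snd z))" if "k \<le> n" for k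
    using that
  proof (induction k)
    case (Suc k)
    then show ?case
      using continuous_map_coord [of k n T S] by (auto intro!: continuous_intros)
  qed simp
  then show ?thesis by simp
qed

text \<open>Dilation about the centre by the factor \<open>c\<close>. It stays in the cube while
  \<open>gauge n x * c \<le> 1\<close>, and \<open>c = 1 / gauge n x\<close> is the radial
  projection to the boundary.\<close>

definition cube_scale :: "nat \<Rightarrow> real \<Rightarrow> (nat \<Rightarrow> real) \<Rightarrow> nat \<Rightarrow> real" where
  "cube_scale n c x = (\<lambda>i\<in>{..<n}. 1/2 + (x i - 1/2) * c)"

lemma cube_scale_in:
  assumes "0 \<le> c" "gauge n x * c \<le> 1"
  shows "cube_scale n c x \<in> topspace (cube n)"
proof -
  have "\<bar>(x i - 1/2) * c\<bar> \<le> 1/2" if "i < n" for i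
  proof -
    have "\<bar>2 * x i - 1\<bar> * c \<le> gauge n x * c"
      using gauge_ge [OF that] assms(1) by (rule mult_right_mono)
    then have "\<bar>(2 * x i - 1) * c\<bar> \<le> 1"
      using assms by (simp add: abs_mult)
    moreover have "(2 * x i - 1) * c = 2 * ((x i - 1/2) * c)" by (simp add: algebra_simps)
    ultimately show ?thesis by simp
  qed
  then show ?thesis
    by (force simp: topspace_cube cube_scale_def abs_le_iff)
qed

lemma cube_scale_boundary:
  assumes "0 < gauge n x"
  shows "cube_scale n (1 / gauge n x) x \<in> cube_boundary n"
proof -
  obtain i where i: "i < n" "\<bar>2 * x i - 1\<bar> = gauge n x"
    using gauge_attained [OF assms] by blast
  have "1/2 + (x i - 1/2) * (1 / gauge n x) = 0 \<or> 1/2 + (x i - 1/2) * (1 / gauge n x) = 1"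
    using i(2) assms by (auto simp: abs_if field_simps split: if_splits)
  then show ?thesis
    unfolding cube_boundary_def using cube_scale_in [of "1 / gauge n x" n x] i(1) assms
    by (auto simp: cube_scale_def)
qed

lemma cube_scale_1: "x \<in> topspace (cube n) \<Longrightarrow> cube_scale n 1 x = x"
  by (auto simp: cube_scale_def topspace_cube fun_eq_iff extensional_def)

text \<open>The cylinder over the cube is projected from the point at height 2 above the centre
  onto the union of its bottom and its sides.\<close>

lemma cube_HEP:
  assumes v: "continuous_map (cube n) Y v"
    and w: "continuous_map (subtopology (cube_cyl n) {z. snd z \<in> cube_boundary n}) Y w"
    and vw: "\<And>x. x \<in> cube_boundary n \<Longrightarrow> w (0, x) = v x"
  shows "\<exists>H. continuous_map (cube_cyl n) Y H \<and> (\<forall>x\<in>topspace (cube n). H (0, x) = v x) \<and>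
    (\<forall>t\<in>{0..1}. \<forall>x\<in>cube_boundary n. H (t, x) = w (t, x))"
proof -
  let ?g = "\<lambda>z::real \<times> (nat \<Rightarrow> real). gauge n (snd z)"
  \<comment> \<open>On the line from height 2 above the centre through \<open>z\<close>, the point
    at height \<open>s\<close> is dilated by \<open>(2 - s) / (2 - fst z)\<close>. The bottom is
    \<open>s = 0\<close>, which gives \<open>?A\<close>. The sides are met where the factor is
    \<open>1 / ?g z\<close>, that is at height \<open>2 - (2 - fst z) / ?g z\<close>, which gives
    \<open>?B\<close>.\<close>
  let ?A = "\<lambda>z. v (cube_scale n (2 / (2 - fst z)) (snd z))"
  let ?B = "\<lambda>z. w (2 - (2 - fst z) / ?g z, cube_scale n (1 / ?g z) (snd z))"
  let ?H = "\<lambda>z. if 2 * ?g z \<le> 2 - fst z then ?A z else ?B z"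
  let ?SA = "{z \<in> topspace (cube_cyl n). 2 * ?g z \<le> 2 - fst z}"
  let ?SB = "{z \<in> topspace (cube_cyl n). 2 - fst z \<le> 2 * ?g z}"
  have time: "0 \<le> fst z \<and> fst z \<le> 1" if "z \<in> topspace (cube_cyl n)" for z
    using that by auto
  have "continuous_map (cube_cyl n) Y ?H"
  proof (rule continuous_map_cases_le)
    show "continuous_map (cube_cyl n) euclideanreal (\<lambda>z. 2 * ?g z)" "continuous_map (cube_cyl n) euclideanreal (\<lambda>z. 2 - fst z)"
      using continuous_map_gauge [of unit_interval n UNIV] continuous_map_time [of "cube n" UNIV]
      by (auto intro!: continuous_intros)
    have "continuous_map (subtopology (cube_cyl n) ?SA) (cube n) (\<lambda>z. cube_scale n (2 / (2 - fst z)) (snd z))"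
    proof (rule continuous_map_cubeI)
      fix z assume "z \<in> topspace (subtopology (cube_cyl n) ?SA)"
      then have z: "z \<in> topspace (cube_cyl n)" "2 * ?g z \<le> 2 - fst z" by auto
      then show "cube_scale n (2 / (2 - fst z)) (snd z) \<in> topspace (cube n)"
        using time [OF z(1)] by (intro cube_scale_in) (auto simp: field_simps)
    next
      fix i assume i: "i < n"
      have "continuous_map (subtopology (cube_cyl n) ?SA) euclideanreal (\<lambda>z. 1/2 + (snd z i - 1/2) * (2 / (2 - fst z)))"
        by (intro continuous_intros continuous_map_coord [OF i] continuous_map_time) (auto dest: time)
      then show "continuous_map (subtopology (cube_cyl n) ?SA) euclideanreal (\<lambda>z. cube_scale n (2 / (2 - fst z)) (snd z) i)"
        using i by (simp add: cube_scale_def)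
    qed
    from continuous_map_compose [OF this v]
    show "continuous_map (subtopology (cube_cyl n) ?SA) Y ?A" by (simp add: o_def)
    \<comment> \<open>On this part \<open>?g z\<close> is at least 1/2, since the time is at most 1;
      so dividing by it is harmless.\<close>
    have pos: "0 < ?g z" if "z \<in> ?SB" for z
      using that by auto
    have cB1: "continuous_map (subtopology (cube_cyl n) ?SB) (cube n) (\<lambda>z. cube_scale n (1 / ?g z) (snd z))"
    proof (rule continuous_map_cubeI)
      fix z assume "z \<in> topspace (subtopology (cube_cyl n) ?SB)"
      then have "z \<in> ?SB" by auto
      then show "cube_scale n (1 / ?g z) (snd z) \<in> topspace (cube n)"
        using cube_boundary_subset [OF cube_scale_boundary [OF pos]] by blast
    next
      fix i assume i: "i < n"
      have "continuous_map (subtopology (cube_cyl n) ?SB) euclideanreal (\<lambda>z. 1/2 + (snd z i - 1/2) * (1 / ?g z))"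
        using pos by (intro continuous_intros continuous_map_coord [OF i] continuous_map_gauge) force
      then show "continuous_map (subtopology (cube_cyl n) ?SB) euclideanreal (\<lambda>z. cube_scale n (1 / ?g z) (snd z) i)"
        using i by (simp add: cube_scale_def)
    qed
    have cB2: "continuous_map (subtopology (cube_cyl n) ?SB) unit_interval (\<lambda>z. 2 - (2 - fst z) / ?g z)"
    proof (rule continuous_map_into_subtopology)
      show "continuous_map (subtopology (cube_cyl n) ?SB) euclideanreal (\<lambda>z. 2 - (2 - fst z) / ?g z)"
        using pos by (intro continuous_intros continuous_map_time continuous_map_gauge) force
      show "(\<lambda>z. 2 - (2 - fst z) / ?g z) \<in> topspace (subtopology (cube_cyl n) ?SB) \<rightarrow> {0..1}"
      proof
        fix z assume "z \<in> topspace (subtopology (cube_cyl n) ?SB)"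
        then have z: "z \<in> ?SB" by auto
        then have "?g z \<le> 1" using gauge_cube [of "snd z" n] by auto
        then show "2 - (2 - fst z) / ?g z \<in> {0..1}"
          using pos [OF z] z time [of z] by (auto simp: field_simps)
      qed
    qed
    have "continuous_map (subtopology (cube_cyl n) ?SB) (subtopology (cube_cyl n) {z. snd z \<in> cube_boundary n})
       (\<lambda>z. (2 - (2 - fst z) / ?g z, cube_scale n (1 / ?g z) (snd z)))"
    proof (rule continuous_map_into_subtopology [OF continuous_map_pairedI [OF cB2 cB1]])
      show "(\<lambda>z. (2 - (2 - fst z) / ?g z, cube_scale n (1 / ?g z) (snd z)))
        \<in> topspace (subtopology (cube_cyl n) ?SB) \<rightarrow> {z. snd z \<in> cube_boundary n}"
      proof
        fix z assume "z \<in> topspace (subtopology (cube_cyl n) ?SB)"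
        then have "z \<in> ?SB" by auto
        from cube_scale_boundary [OF pos [OF this]]
        show "(2 - (2 - fst z) / ?g z, cube_scale n (1 / ?g z) (snd z)) \<in> {z. snd z \<in> cube_boundary n}" by simp
      qed
    qed
    from continuous_map_compose [OF this w]
    show "continuous_map (subtopology (cube_cyl n) ?SB) Y ?B" by (simp add: o_def)
    fix z assume z: "z \<in> topspace (cube_cyl n)" and eq: "2 * ?g z = 2 - fst z"
    then have p: "0 < ?g z" using time [OF z] by auto
    have e: "2 - (2 - fst z) / ?g z = 0" "2 / (2 - fst z) = 1 / ?g z"
      using eq [symmetric] p by auto
    show "?A z = ?B z"
      unfolding e using vw [OF cube_scale_boundary [OF p]] by simp
  qed
  moreover have "?H (0, x) = v x" if "x \<in> topspace (cube n)" for x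
    using gauge_cube [OF that] cube_scale_1 [OF that] by simp
  moreover have "?H (t, x) = w (t, x)" if "t \<in> {0..1}" "x \<in> cube_boundary n" for t x
    using gauge_boundary [OF that(2)] cube_scale_1 [OF cube_boundary_subset [OF that(2)]] that(1) vw [OF that(2)]
    by (cases "t = 0") auto
  ultimately show ?thesis by (intro exI [of _ ?H] conjI ballI)
qed

text \<open>Together with \<open>cube_split\<close> the homeomorphism of the cylinder over the cube
  with the next cube; time becomes the last coordinate.\<close>

definition cube_join :: "nat \<Rightarrow> real \<times> (nat \<Rightarrow> real) \<Rightarrow> nat \<Rightarrow> real" where
  "cube_join n z = (\<lambda>i\<in>{..<Suc n}. if i = n then fst z else snd z i)"

definition cube_split :: "nat \<Rightarrow> (nat \<Rightarrow> real) \<Rightarrow> real \<times> (nat \<Rightarrow> real)" where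
  "cube_split n x = (x n, restrict x {..<n})"

lemma cube_join_in: "z \<in> topspace (cube_cyl n) \<Longrightarrow> cube_join n z \<in> topspace (cube (Suc n))"
  by (auto simp: topspace_cube cube_join_def less_Suc_eq)

lemma cube_split_in: "x \<in> topspace (cube (Suc n)) \<Longrightarrow> cube_split n x \<in> topspace (cube_cyl n)"
  by (auto simp: topspace_cube cube_split_def)

lemma cube_split_join: "z \<in> topspace (cube_cyl n) \<Longrightarrow> cube_split n (cube_join n z) = z"
  by (cases z) (auto simp: topspace_cube cube_split_def cube_join_def fun_eq_iff extensional_def)

lemma cube_join_split: "x \<in> topspace (cube (Suc n)) \<Longrightarrow> cube_join n (cube_split n x) = x"
  by (auto simp: topspace_cube cube_split_def cube_join_def fun_eq_iff extensional_def less_Suc_eq)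

lemma continuous_map_cube_join: "continuous_map (cube_cyl n) (cube (Suc n)) (cube_join n)"
proof (rule continuous_map_cubeI [OF cube_join_in])
  fix i assume "i < Suc n"
  then consider "i = n" | "i < n" by linarith
  then show "continuous_map (cube_cyl n) euclideanreal (\<lambda>z. cube_join n z i)"
  proof cases
    case 1
    then show ?thesis using continuous_map_time [of "cube n" UNIV] by (simp add: cube_join_def)
  next
    case 2
    then show ?thesis using continuous_map_coord [of i n unit_interval UNIV] by (simp add: cube_join_def)
  qed
qed

lemma continuous_map_cube_split: "continuous_map (cube (Suc n)) (cube_cyl n) (cube_split n)"
  unfolding cube_split_def [abs_def]
proof (rule continuous_map_pairedI)
  show "continuous_map (cube (Suc n)) unit_interval (\<lambda>x. x n)"
    by (rule continuous_map_into_subtopology [OF continuous_map_cube_coord]) (auto simp: topspace_cube)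
  show "continuous_map (cube (Suc n)) (cube n) (\<lambda>x. restrict x {..<n})"
    by (rule continuous_map_cubeI) (auto simp: topspace_cube continuous_map_cube_coord)
qed

lemma cube_boundary_Suc:
  "x \<in> cube_boundary (Suc n) \<longleftrightarrow>
     x \<in> topspace (cube (Suc n)) \<and> (x n = 0 \<or> x n = 1 \<or> snd (cube_split n x) \<in> cube_boundary n)"
  by (auto simp: cube_boundary_def cube_split_def topspace_cube less_Suc_eq)

lemma cube_join_boundary:
  assumes "z \<in> topspace (cube_cyl n)"
  shows "cube_join n z \<in> cube_boundary (Suc n) \<longleftrightarrow> fst z = 0 \<or> fst z = 1 \<or> snd z \<in> cube_boundary n"
  using cube_split_join [OF assms] cube_join_in [OF assms]
  by (simp add: cube_boundary_Suc) (simp add: cube_join_def)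

text \<open>This is \<open>cube_HEP\<close> one dimension up, with a second time \<open>u\<close>.
  The map \<open>V\<close> is given at \<open>u = 0\<close>, its two ends move along
  \<open>E0\<close> and \<open>E1\<close>, its sides along \<open>W\<close>, and the result is read
  off at \<open>u = 1\<close>.\<close>

lemma cube_HEP2:
  assumes V: "continuous_map (cube_cyl n) Y V"
    and W: "continuous_map (prod_topology unit_interval (subtopology (cube_cyl n) {z. snd z \<in> cube_boundary n})) Y W"
    and E: "continuous_map (cube_cyl n) Y E0" "continuous_map (cube_cyl n) Y E1"
    and VW: "\<And>r x. r \<in> {0..1} \<Longrightarrow> x \<in> cube_boundary n \<Longrightarrow> W (0, r, x) = V (r, x)"
    and VE: "\<And>x. x \<in> topspace (cube n) \<Longrightarrow> E0 (0, x) = V (0, x) \<and> E1 (0, x) = V (1, x)"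
    and WE: "\<And>u x. u \<in> {0..1} \<Longrightarrow> x \<in> cube_boundary n \<Longrightarrow> W (u, 0, x) = E0 (u, x) \<and> W (u, 1, x) = E1 (u, x)"
  shows "\<exists>H. continuous_map (cube_cyl n) Y H \<and>
     (\<forall>x\<in>topspace (cube n). H (0, x) = E0 (1, x) \<and> H (1, x) = E1 (1, x)) \<and>
     (\<forall>r\<in>{0..1}. \<forall>x\<in>cube_boundary n. H (r, x) = W (1, r, x))"
proof -
  let ?X = "subtopology (cube_cyl (Suc n)) {z. snd z \<in> cube_boundary (Suc n)}"
  let ?rest = "\<lambda>z. snd (cube_split n (snd z))"
  \<comment> \<open>The boundary of the next cube consists of three closed pieces: the two ends of
    the coordinate \<open>n\<close>, where \<open>E0\<close> and \<open>E1\<close> act, and the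
    sides, where \<open>W\<close> does. They are pasted together after checking the
    overlaps.\<close>
  define T where "T = (\<lambda>k::nat. if k = 0 then {z \<in> topspace ?X. snd z n \<in> {0}}
     else if k = 1 then {z \<in> topspace ?X. snd z n \<in> {1}} else {z \<in> topspace ?X. ?rest z \<in> cube_boundary n})"
  define F where "F = (\<lambda>(k::nat) z. if k = 0 then E0 (fst z, ?rest z)
     else if k = 1 then E1 (fst z, ?rest z) else W (fst z, cube_split n (snd z)))"
  define w where "w = (\<lambda>z. if snd z n = 0 then F 0 z else if snd z n = 1 then F 1 z else F 2 z)"
  have split: "continuous_map (subtopology ?X S) (cube_cyl n) (\<lambda>z. cube_split n (snd z))" for S
    using continuous_map_compose [OF continuous_map_snd continuous_map_cube_split, of unit_interval n]
    by (auto simp: o_def intro: continuous_map_from_subtopology)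
  then have rest: "continuous_map (subtopology ?X S) (cube n) ?rest" for S
    using continuous_map_compose [OF split continuous_map_snd] by (simp add: o_def)
  have time: "continuous_map (subtopology ?X S) unit_interval fst" for S
    by (intro continuous_map_from_subtopology continuous_map_fst)
  have time': "fst z \<in> {0..1}" "snd z \<in> cube_boundary (Suc n)" if "z \<in> topspace ?X" for z
    using that by auto
  have rest_in: "?rest z \<in> topspace (cube n)" if "z \<in> topspace ?X" for z
    using cube_split_in [OF cube_boundary_subset [OF time'(2) [OF that]]] by auto
  have F2: "F 2 z = W (fst z, snd z n, ?rest z)" for z
    unfolding F_def by (simp add: cube_split_def)
  have cont: "continuous_map ?X Y w"
  proof (rule pasting_lemma_closed)
    show "finite {..2::nat}" by simp
    show "closedin ?X (T k)" if "k \<in> {..2}" for k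
    proof -
      have "continuous_map ?X euclideanreal (\<lambda>z. snd z n)"
        by (rule continuous_map_coord [of n "Suc n"]) simp
      then have "closedin ?X {z \<in> topspace ?X. snd z n \<in> {0}}" "closedin ?X {z \<in> topspace ?X. snd z n \<in> {1}}"
        by (rule closedin_continuous_map_preimage, simp)+
      moreover have "closedin ?X {z \<in> topspace ?X. ?rest z \<in> cube_boundary n}"
        using rest [of UNIV] by (intro closedin_continuous_map_preimage [OF _ closedin_cube_boundary]) simp
      ultimately show ?thesis by (simp add: T_def)
    qed
    show "continuous_map (subtopology ?X (T k)) Y (F k)" if "k \<in> {..2}" for k
    proof -
      have "continuous_map (subtopology ?X (T 2)) (subtopology (cube_cyl n) {z. snd z \<in> cube_boundary n}) (\<lambda>z. cube_split n (snd z))"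
        by (rule continuous_map_into_subtopology [OF split]) (auto simp: T_def)
      then show ?thesis
        using continuous_map_pairD [OF time rest E(1)] continuous_map_pairD [OF time rest E(2)]
          continuous_map_pairD [OF time _ W, of "T 2"] that
        by (auto simp: F_def T_def)
    qed
    show "F i z = F j z" if "i \<in> {..2}" "j \<in> {..2}" and z: "z \<in> topspace ?X \<inter> T i \<inter> T j" for i j z
    proof -
      have main: "F i z = F j z" if "i < j" "j \<le> 2" "z \<in> topspace ?X \<inter> T i \<inter> T j" for i j
      proof -
        have z: "z \<in> topspace ?X" "z \<in> T i" "z \<in> T j" using that by auto
        consider "i = 0" "j = 1" | "i = 0" "j = 2" | "i = 1" "j = 2"
          using \<open>i < j\<close> \<open>j \<le> 2\<close> by linarith
        then show ?thesis
        proof cases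
          case 1
          then show ?thesis using z(2,3) by (simp add: T_def)
        next
          case 2
          then show ?thesis
            using WE [OF time'(1) [OF z(1)], of "?rest z"] z(2,3) F2 [of z] by (simp add: T_def F_def)
        next
          case 3
          then show ?thesis
            using WE [OF time'(1) [OF z(1)], of "?rest z"] z(2,3) F2 [of z] by (simp add: T_def F_def)
        qed
      qed
      show ?thesis
      proof (cases i j rule: linorder_cases)
        case less
        show ?thesis by (rule main [OF less _ z]) (use that(2) in simp)
      next
        case greater
        show ?thesis by (rule main [OF greater, symmetric]) (use that(1) z in auto)
      qed simp
    qed
    show "\<exists>j. j \<in> {..2} \<and> z \<in> T j \<and> w z = F j z" if z: "z \<in> topspace ?X" for z
    proof -
      consider "snd z n = 0" | "snd z n = 1" "snd z n \<noteq> 0" | "snd z n \<noteq> 0" "snd z n \<noteq> 1" "?rest z \<in> cube_boundary n"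
        using time'(2) [OF z] cube_boundary_Suc [of "snd z" n] by auto
      then show ?thesis
      proof cases
        case 1
        then show ?thesis using z by (intro exI [of _ 0]) (auto simp: T_def w_def)
      next
        case 2
        then show ?thesis using z by (intro exI [of _ 1]) (auto simp: T_def w_def)
      next
        case 3
        then show ?thesis using z by (intro exI [of _ 2]) (auto simp: T_def w_def)
      qed
    qed
  qed
  have Vs: "continuous_map (cube (Suc n)) Y (\<lambda>x. V (cube_split n x))"
    using continuous_map_compose [OF continuous_map_cube_split V] by (simp add: o_def)
  have w0: "w (0, x) = V (cube_split n x)" if x: "x \<in> cube_boundary (Suc n)" for x
  proof -
    have "(0, x) \<in> topspace ?X" using x cube_boundary_subset [OF x] by simp
    from rest_in [OF this] have r: "snd (cube_split n x) \<in> topspace (cube n)" by simp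
    have b: "x n = 0 \<or> x n = 1 \<or> snd (cube_split n x) \<in> cube_boundary n" "x n \<in> {0..1}"
      using x by (auto simp: cube_boundary_Suc topspace_cube)
    have "V (cube_split n x) = V (x n, snd (cube_split n x))"
      by (simp add: cube_split_def)
    moreover have "F 2 (0, x) = W (0, x n, snd (cube_split n x))"
      using F2 [of "(0, x)"] by simp
    ultimately show ?thesis
      using VE [OF r] VW [of "x n" "snd (cube_split n x)"] b by (auto simp: w_def F_def)
  qed
  obtain H where H: "continuous_map (cube_cyl (Suc n)) Y H"
    "\<forall>t\<in>{0..1}. \<forall>x\<in>cube_boundary (Suc n). H (t, x) = w (t, x)"
    using cube_HEP [OF Vs cont w0] by blast
  have Hw: "H (1, cube_join n z) = w (1, cube_join n z)"
    if "z \<in> topspace (cube_cyl n)" "fst z = 0 \<or> fst z = 1 \<or> snd z \<in> cube_boundary n" for z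
    using H(2) cube_join_boundary [OF that(1)] that(2) by simp
  have jn: "cube_join n z n = fst z" for z by (simp add: cube_join_def)
  have "continuous_map (cube_cyl n) Y (\<lambda>z. H (1, cube_join n z))"
    by (rule continuous_map_pairD [OF _ continuous_map_cube_join H(1)]) simp
  moreover have "H (1, cube_join n (0, x)) = E0 (1, x) \<and> H (1, cube_join n (1, x)) = E1 (1, x)"
    if "x \<in> topspace (cube n)" for x
    using Hw [of "(0, x)"] Hw [of "(1, x)"] cube_split_join [of "(0, x)" n] cube_split_join [of "(1, x)" n] that jn
    by (simp add: w_def F_def)
  moreover have "H (1, cube_join n (r, x)) = W (1, r, x)" if r: "r \<in> {0..1}" and x: "x \<in> cube_boundary n" for r x
  proof -
    have z: "(r, x) \<in> topspace (cube_cyl n)" using r cube_boundary_subset [OF x] by simp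
    have "w (1, cube_join n (r, x)) = (if r = 0 then E0 (1, x) else if r = 1 then E1 (1, x) else W (1, r, x))"
      unfolding w_def F_def fst_conv snd_conv jn cube_split_join [OF z] by simp
    then show ?thesis
      using Hw [OF z] WE [OF _ x, of 1] x by auto
  qed
  ultimately show ?thesis by (intro exI [of _ "\<lambda>z. H (1, cube_join n z)"] conjI ballI) auto
qed

section \<open>Homotopies with a prescribed track on the boundary\<close>

text \<open>Unlike a relative homotopy, this one moves the boundary, along \<open>h\<close>. Values
  of \<open>h\<close> off the boundary of the cube do not matter. A relative homotopy is the case of
  a track that stands still.\<close>

definition cube_htpy ::
  "nat \<Rightarrow> 'a topology \<Rightarrow> (real \<times> (nat \<Rightarrow> real) \<Rightarrow> 'a) \<Rightarrow> ((nat \<Rightarrow> real) \<Rightarrow> 'a) \<Rightarrow> ((nat \<Rightarrow> real) \<Rightarrow> 'a) \<Rightarrow> bool" where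
  "cube_htpy n Y h \<alpha> \<beta> \<longleftrightarrow>
     (\<exists>H. continuous_map (cube_cyl n) Y H \<and> (\<forall>x\<in>topspace (cube n). H (0, x) = \<alpha> x \<and> H (1, x) = \<beta> x) \<and>
        (\<forall>t\<in>{0..1}. \<forall>x\<in>cube_boundary n. H (t, x) = h (t, x)))"

abbreviation cube_bdry_cyl :: "nat \<Rightarrow> (real \<times> (nat \<Rightarrow> real)) topology" where
  "cube_bdry_cyl n \<equiv> subtopology (cube_cyl n) {z. snd z \<in> cube_boundary n}"

abbreviation cube_rel_htpy where
  "cube_rel_htpy n Y \<alpha> \<beta> \<equiv> cube_htpy n Y (\<lambda>z. \<alpha> (snd z)) \<alpha> \<beta>"

lemma cube_htpy_cong:
  assumes "cube_htpy n Y h \<alpha> \<beta>"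
    and "\<And>t x. t \<in> {0..1} \<Longrightarrow> x \<in> cube_boundary n \<Longrightarrow> h' (t, x) = h (t, x)"
    and "\<And>x. x \<in> topspace (cube n) \<Longrightarrow> \<alpha>' x = \<alpha> x" "\<And>x. x \<in> topspace (cube n) \<Longrightarrow> \<beta>' x = \<beta> x"
  shows "cube_htpy n Y h' \<alpha>' \<beta>'"
  using assms unfolding cube_htpy_def by simp

lemma continuous_map_slice:
  "continuous_map (cube_cyl n) Y H \<Longrightarrow> t \<in> {0..1} \<Longrightarrow> continuous_map (cube n) Y (\<lambda>x. H (t, x))"
  by (rule continuous_map_pairD [where X = unit_interval and Y = "cube n"]) auto

lemma cube_htpyD:
  assumes "cube_htpy n Y h \<alpha> \<beta>"
  shows cube_htpy_continuous: "continuous_map (cube n) Y \<alpha>" "continuous_map (cube n) Y \<beta>"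
      "continuous_map (cube_bdry_cyl n) Y h"
    and cube_htpy_ends: "x \<in> cube_boundary n \<Longrightarrow> h (0, x) = \<alpha> x" "x \<in> cube_boundary n \<Longrightarrow> h (1, x) = \<beta> x"
proof -
  obtain H where H: "continuous_map (cube_cyl n) Y H" "\<forall>x\<in>topspace (cube n). H (0, x) = \<alpha> x \<and> H (1, x) = \<beta> x"
    "\<forall>t\<in>{0..1}. \<forall>x\<in>cube_boundary n. H (t, x) = h (t, x)"
    using assms unfolding cube_htpy_def by blast
  show "continuous_map (cube n) Y \<alpha>"
    using continuous_map_slice [OF H(1), of 0] by (rule continuous_map_eq) (use H(2) in auto)
  show "continuous_map (cube n) Y \<beta>"
    using continuous_map_slice [OF H(1), of 1] by (rule continuous_map_eq) (use H(2) in auto)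
  show "continuous_map (cube_bdry_cyl n) Y h"
    using continuous_map_from_subtopology [OF H(1)]
    by (rule continuous_map_eq) (use H(3) in auto)
  show "h (0, x) = \<alpha> x" "h (1, x) = \<beta> x" if "x \<in> cube_boundary n"
    using H(2,3) that cube_boundary_subset [OF that] by force+
qed

lemma continuous_map_flip: "continuous_map (cube_cyl n) (cube_cyl n) (\<lambda>z. (1 - fst z, snd z))"
proof (rule continuous_map_pairedI [OF _ continuous_map_snd])
  show "continuous_map (cube_cyl n) unit_interval (\<lambda>z. 1 - fst z)"
    by (rule continuous_map_into_subtopology)
      (use continuous_map_time [of "cube n" UNIV] in \<open>auto intro!: continuous_intros\<close>)
qed

lemma continuous_map_flip_bdry:
  assumes "continuous_map (cube_bdry_cyl n) Y h"
  shows "continuous_map (cube_bdry_cyl n) Y (\<lambda>z. h (1 - fst z, snd z))"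
proof -
  have "continuous_map (cube_bdry_cyl n) (cube_bdry_cyl n) (\<lambda>z. (1 - fst z, snd z))"
    by (rule continuous_map_into_subtopology [OF continuous_map_from_subtopology [OF continuous_map_flip]]) auto
  from continuous_map_compose [OF this assms] show ?thesis by (simp add: o_def)
qed

text \<open>A map can be carried along any motion of its boundary values; this is the homotopy
  extension property in the present notation.\<close>

lemma cube_htpy_extend:
  assumes "continuous_map (cube n) Y \<alpha>" "continuous_map (cube_bdry_cyl n) Y h"
    and "\<And>x. x \<in> cube_boundary n \<Longrightarrow> h (0, x) = \<alpha> x"
  shows "\<exists>\<beta>. cube_htpy n Y h \<alpha> \<beta>"
proof -
  obtain H where "continuous_map (cube_cyl n) Y H" "\<forall>x\<in>topspace (cube n). H (0, x) = \<alpha> x"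
     "\<forall>t\<in>{0..1}. \<forall>x\<in>cube_boundary n. H (t, x) = h (t, x)"
    using cube_HEP [OF assms] by blast
  then have "cube_htpy n Y h \<alpha> (\<lambda>x. H (1, x))"
    unfolding cube_htpy_def by (intro exI [of _ H]) simp
  then show ?thesis by blast
qed

lemma cube_htpy_reverse:
  assumes "cube_htpy n Y h \<alpha> \<beta>"
  shows "cube_htpy n Y (\<lambda>z. h (1 - fst z, snd z)) \<beta> \<alpha>"
proof -
  obtain H where H: "continuous_map (cube_cyl n) Y H" "\<forall>x\<in>topspace (cube n). H (0, x) = \<alpha> x \<and> H (1, x) = \<beta> x"
    "\<forall>t\<in>{0..1}. \<forall>x\<in>cube_boundary n. H (t, x) = h (t, x)"
    using assms unfolding cube_htpy_def by blast
  have "continuous_map (cube_cyl n) Y (\<lambda>z. H (1 - fst z, snd z))"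
    using continuous_map_compose [OF continuous_map_flip H(1)] by (simp add: o_def)
  then show ?thesis
    unfolding cube_htpy_def using H(2,3) by (intro exI [of _ "\<lambda>z. H (1 - fst z, snd z)"]) auto
qed

lemma cube_htpy_extend_back:
  assumes "continuous_map (cube n) Y \<beta>" "continuous_map (cube_bdry_cyl n) Y h"
    and "\<And>x. x \<in> cube_boundary n \<Longrightarrow> h (1, x) = \<beta> x"
  shows "\<exists>\<alpha>. cube_htpy n Y h \<alpha> \<beta>"
proof -
  obtain \<alpha> where "cube_htpy n Y (\<lambda>z. h (1 - fst z, snd z)) \<beta> \<alpha>"
    using cube_htpy_extend [OF assms(1) continuous_map_flip_bdry [OF assms(2)]] assms(3) by auto
  from cube_htpy_reverse [OF this] show ?thesis by (auto intro: cube_htpy_cong)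
qed

lemma cube_htpy_compose:
  assumes "continuous_map X Y f" "cube_htpy n X h \<alpha> \<beta>"
  shows "cube_htpy n Y (f \<circ> h) (f \<circ> \<alpha>) (f \<circ> \<beta>)"
proof -
  obtain H where H: "continuous_map (cube_cyl n) X H" "\<forall>x\<in>topspace (cube n). H (0, x) = \<alpha> x \<and> H (1, x) = \<beta> x"
    "\<forall>t\<in>{0..1}. \<forall>x\<in>cube_boundary n. H (t, x) = h (t, x)"
    using assms unfolding cube_htpy_def by blast
  then show ?thesis
    unfolding cube_htpy_def using continuous_map_compose [OF H(1) assms(1)]
    by (intro exI [of _ "f \<circ> H"]) auto
qed

lemma cube_rel_htpy_sym:
  assumes "cube_rel_htpy n Y \<alpha> \<beta>"
  shows "cube_rel_htpy n Y \<beta> \<alpha>"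
  using cube_htpy_reverse [OF assms] cube_htpy_ends(2) [OF assms]
  by (auto intro: cube_htpy_cong)

lemma continuous_map_bdry_square:
  "continuous_map (prod_topology unit_interval (cube_bdry_cyl n)) (cube_bdry_cyl n) (\<lambda>z. (fst z, snd (snd z)))"
proof (rule continuous_map_into_subtopology [OF continuous_map_pairedI [OF continuous_map_fst]])
  have "continuous_map (cube_bdry_cyl n) (cube n) snd"
    by (rule continuous_map_from_subtopology [OF continuous_map_snd])
  from continuous_map_compose [OF continuous_map_snd this]
  show "continuous_map (prod_topology unit_interval (cube_bdry_cyl n)) (cube n) (\<lambda>z. snd (snd z))"
    by (simp add: o_def)
qed auto

text \<open>Apply \<open>cube_HEP2\<close> to the constant homotopy of \<open>\<alpha>\<close>: its
  two ends are moved by the two given homotopies and its sides by \<open>h\<close>, so at the final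
  time it joins \<open>\<beta>\<close> to \<open>\<beta>'\<close> without moving the
  boundary.\<close>

lemma cube_htpy_unique:
  assumes 1: "cube_htpy n Y h \<alpha> \<beta>" and 2: "cube_htpy n Y h \<alpha> \<beta>'"
  shows "cube_rel_htpy n Y \<beta> \<beta>'"
proof -
  obtain H where H: "continuous_map (cube_cyl n) Y H" "\<forall>x\<in>topspace (cube n). H (0, x) = \<alpha> x \<and> H (1, x) = \<beta> x"
    "\<forall>t\<in>{0..1}. \<forall>x\<in>cube_boundary n. H (t, x) = h (t, x)"
    using 1 unfolding cube_htpy_def by blast
  obtain H' where H': "continuous_map (cube_cyl n) Y H'" "\<forall>x\<in>topspace (cube n). H' (0, x) = \<alpha> x \<and> H' (1, x) = \<beta>' x"
    "\<forall>t\<in>{0..1}. \<forall>x\<in>cube_boundary n. H' (t, x) = h (t, x)"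
    using 2 unfolding cube_htpy_def by blast
  have V: "continuous_map (cube_cyl n) Y (\<lambda>z. \<alpha> (snd z))"
    using continuous_map_compose [OF continuous_map_snd cube_htpy_continuous(1) [OF 1]] by (simp add: o_def)
  have W: "continuous_map (prod_topology unit_interval (cube_bdry_cyl n)) Y (\<lambda>z. h (fst z, snd (snd z)))"
    using continuous_map_compose [OF continuous_map_bdry_square cube_htpy_continuous(3) [OF 1]] by (simp add: o_def)
  obtain K where "continuous_map (cube_cyl n) Y K"
     "\<forall>x\<in>topspace (cube n). K (0, x) = H (1, x) \<and> K (1, x) = H' (1, x)"
     "\<forall>r\<in>{0..1}. \<forall>x\<in>cube_boundary n. K (r, x) = h (1, x)"
    using cube_HEP2 [OF V W H(1) H'(1)] H(2,3) H'(2,3) cube_htpy_ends(1) [OF 1] by auto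
  then show ?thesis
    unfolding cube_htpy_def using H(2) H'(2) cube_htpy_ends(2) [OF 1] by (intro exI [of _ K]) auto
qed

text \<open>Again \<open>cube_HEP2\<close>, now applied to the given homotopy: its start is moved by
  the relative homotopy, while its end and its sides stay where they are.\<close>

lemma cube_htpy_rel_left:
  assumes 1: "cube_htpy n Y h \<alpha> \<beta>" and 2: "cube_rel_htpy n Y \<alpha> \<alpha>'"
  shows "cube_htpy n Y h \<alpha>' \<beta>"
proof -
  obtain H where H: "continuous_map (cube_cyl n) Y H" "\<forall>x\<in>topspace (cube n). H (0, x) = \<alpha> x \<and> H (1, x) = \<beta> x"
    "\<forall>t\<in>{0..1}. \<forall>x\<in>cube_boundary n. H (t, x) = h (t, x)"
    using 1 unfolding cube_htpy_def by blast
  obtain H' where H': "continuous_map (cube_cyl n) Y H'" "\<forall>x\<in>topspace (cube n). H' (0, x) = \<alpha> x \<and> H' (1, x) = \<alpha>' x"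
    "\<forall>t\<in>{0..1}. \<forall>x\<in>cube_boundary n. H' (t, x) = \<alpha> x"
    using 2 unfolding cube_htpy_def by auto
  have E1: "continuous_map (cube_cyl n) Y (\<lambda>z. \<beta> (snd z))"
    using continuous_map_compose [OF continuous_map_snd cube_htpy_continuous(2) [OF 1]] by (simp add: o_def)
  have W: "continuous_map (prod_topology unit_interval (cube_bdry_cyl n)) Y (\<lambda>z. h (snd z))"
    using continuous_map_compose [OF continuous_map_snd cube_htpy_continuous(3) [OF 1]] by (simp add: o_def)
  obtain K where "continuous_map (cube_cyl n) Y K"
     "\<forall>x\<in>topspace (cube n). K (0, x) = H' (1, x) \<and> K (1, x) = \<beta> x"
     "\<forall>r\<in>{0..1}. \<forall>x\<in>cube_boundary n. K (r, x) = h (r, x)"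
    using cube_HEP2 [OF H(1) W H'(1) E1] H(2,3) H'(2,3) cube_htpy_ends [OF 1] by auto
  then show ?thesis
    unfolding cube_htpy_def using H'(2) by (intro exI [of _ K]) auto
qed

lemma cube_htpy_rel_right:
  assumes 1: "cube_htpy n Y h \<alpha> \<beta>" and 2: "cube_rel_htpy n Y \<beta> \<beta>'"
  shows "cube_htpy n Y h \<alpha> \<beta>'"
  using cube_htpy_reverse [OF cube_htpy_rel_left [OF cube_htpy_reverse [OF 1] 2]]
  by (auto intro: cube_htpy_cong)

lemma cube_htpy_unique_back:
  assumes 1: "cube_htpy n Y h \<alpha> \<beta>" and 2: "cube_htpy n Y h \<alpha>' \<beta>"
  shows "cube_rel_htpy n Y \<alpha> \<alpha>'"
  by (rule cube_htpy_unique [OF cube_htpy_reverse [OF 1] cube_htpy_reverse [OF 2]])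

section \<open>Spheroids and weak homotopy equivalences\<close>

text \<open>The bridge from homotopy groups to relative homotopies of cubes: a boundary sent to one
  point is a boundary held fixed.\<close>

lemma spheroid_homotopic_iff:
  assumes "\<And>x. x \<in> cube_boundary n \<Longrightarrow> p x = x0"
  shows "spheroid_homotopic n X x0 p q \<longleftrightarrow> cube_rel_htpy n X p q"
proof -
  have "spheroid_homotopic n X x0 p q \<longleftrightarrow>
     (\<exists>h. continuous_map (cube_cyl n) X h \<and> (\<forall>x\<in>topspace (cube n). h (0, x) = p x) \<and>
       (\<forall>x\<in>topspace (cube n). h (1, x) = q x) \<and> (\<forall>t\<in>{0..1}. \<forall>s\<in>cube_boundary n. h (t, s) = x0))"
    unfolding spheroid_homotopic_def by (rule homotopic_with) (metis cube_boundary_subset)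
  then show ?thesis
    unfolding cube_htpy_def using assms by auto
qed

context
  fixes X :: "'a topology" and Y :: "'b topology" and f
  assumes weq: "weak_homotopy_equivalence X Y f"
begin

lemma weq_continuous: "continuous_map X Y f"
  using weq by (simp add: weak_homotopy_equivalence_def)

lemma homotopy_group_map_class:
  assumes "spheroid n X x0 p"
  shows "homotopy_group_map n Y (f x0) f (Collect (spheroid_homotopic n X x0 p))
       = Collect (spheroid_homotopic n Y (f x0) (f \<circ> p))"
proof -
  have "spheroid_homotopic n X x0 p p"
    using assms by (simp add: spheroid_homotopic_def spheroid_def)
  moreover have "spheroid_homotopic n Y (f x0) (f \<circ> p) (f \<circ> q)" if "spheroid_homotopic n X x0 p q" for q
    using that unfolding spheroid_homotopic_def
    by (rule homotopic_with_compose_continuous_map_left [OF _ weq_continuous]) auto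
  moreover have "spheroid_homotopic n Y (f x0) p' r" if "spheroid_homotopic n Y (f x0) p' q" "spheroid_homotopic n Y (f x0) q r" for p' q r
    using that unfolding spheroid_homotopic_def by (rule homotopic_with_trans)
  ultimately show ?thesis
    unfolding homotopy_group_map_def by blast
qed

lemma weq_iso:
  "x0 \<in> topspace X \<Longrightarrow> n \<ge> 1 \<Longrightarrow>
    homotopy_group_map n Y (f x0) f \<in> iso (homotopy_group n X x0) (homotopy_group n Y (f x0))"
  using weq by (simp add: weak_homotopy_equivalence_def)

lemma weq_spheroid_inject:
  assumes x0: "x0 \<in> topspace X" and n: "n \<ge> 1" and p: "spheroid n X x0 p" and q: "spheroid n X x0 q"
    and fpq: "spheroid_homotopic n Y (f x0) (f \<circ> p) (f \<circ> q)"
  shows "spheroid_homotopic n X x0 p q"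
proof -
  have inj: "inj_on (homotopy_group_map n Y (f x0) f) (carrier (homotopy_group n X x0))"
    using weq_iso [OF x0 n] by (simp add: iso_def bij_betw_def)
  have "Collect (spheroid_homotopic n Y (f x0) (f \<circ> p)) = Collect (spheroid_homotopic n Y (f x0) (f \<circ> q))"
  proof (rule Collect_cong)
    note h = fpq [unfolded spheroid_homotopic_def]
    show "spheroid_homotopic n Y (f x0) (f \<circ> p) r \<longleftrightarrow> spheroid_homotopic n Y (f x0) (f \<circ> q) r" for r
      unfolding spheroid_homotopic_def
      using homotopic_with_trans [OF h, of r] homotopic_with_trans [OF homotopic_with_symD [OF h], of r] by blast
  qed
  then have eq: "homotopy_group_map n Y (f x0) f (Collect (spheroid_homotopic n X x0 p))
      = homotopy_group_map n Y (f x0) f (Collect (spheroid_homotopic n X x0 q))"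
    by (simp only: homotopy_group_map_class p q)
  have "Collect (spheroid_homotopic n X x0 p) = Collect (spheroid_homotopic n X x0 q)"
    by (rule inj_onD [OF inj eq]) (use p q in \<open>simp_all add: homotopy_group_def\<close>)
  moreover have "spheroid_homotopic n X x0 q q"
    using q by (simp add: spheroid_homotopic_def spheroid_def)
  ultimately show ?thesis by blast
qed

lemma weq_spheroid_surject:
  assumes x0: "x0 \<in> topspace X" and n: "n \<ge> 1" and r: "spheroid n Y (f x0) r"
  shows "\<exists>p. spheroid n X x0 p \<and> spheroid_homotopic n Y (f x0) (f \<circ> p) r"
proof -
  have "homotopy_group_map n Y (f x0) f ` carrier (homotopy_group n X x0) = carrier (homotopy_group n Y (f x0))"
    using weq_iso [OF x0 n] by (simp add: iso_def bij_betw_def)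
  moreover have "Collect (spheroid_homotopic n Y (f x0) r) \<in> carrier (homotopy_group n Y (f x0))"
    using r by (simp add: homotopy_group_def)
  ultimately have "Collect (spheroid_homotopic n Y (f x0) r) \<in> homotopy_group_map n Y (f x0) f ` carrier (homotopy_group n X x0)"
    by simp
  then obtain p where p: "spheroid n X x0 p"
    and eq: "Collect (spheroid_homotopic n Y (f x0) r) = Collect (spheroid_homotopic n Y (f x0) (f \<circ> p))"
    by (auto simp: homotopy_group_def homotopy_group_map_class)
  have "spheroid_homotopic n Y (f x0) r r"
    using r by (simp add: spheroid_homotopic_def spheroid_def)
  then show ?thesis using p eq by blast
qed

lemma path_components_map_class:
  assumes "x \<in> topspace X"
  shows "path_components_map Y f (Collect (path_component_of X x)) = Collect (path_component_of Y (f x))"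
proof -
  have "path_component_of X x x" using assms by (simp add: path_component_of_refl)
  moreover have "path_component_of Y (f x) (f x')" if "path_component_of X x x'" for x'
    using that pathin_compose [OF _ weq_continuous] unfolding path_component_of_def by fastforce
  ultimately show ?thesis
    unfolding path_components_map_def by (auto intro: path_component_of_trans)
qed

lemma weq_bij: "bij_betw (path_components_map Y f) (path_components_of X) (path_components_of Y)"
  using weq by (simp add: weak_homotopy_equivalence_def)

lemma weq_component_inject:
  assumes "x \<in> topspace X" "x' \<in> topspace X" "path_component_of Y (f x) (f x')"
  shows "path_component_of X x x'"
proof -
  have "Collect (path_component_of Y (f x)) = Collect (path_component_of Y (f x'))"
  proof (rule Collect_cong)
    show "path_component_of Y (f x) y \<longleftrightarrow> path_component_of Y (f x') y" for y
      using path_component_of_trans [OF assms(3), of y] path_component_of_trans [OF path_component_of_sym [OF assms(3)], of y]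
      by blast
  qed
  then have eq: "path_components_map Y f (Collect (path_component_of X x)) = path_components_map Y f (Collect (path_component_of X x'))"
    by (simp only: path_components_map_class assms(1,2))
  have inj: "inj_on (path_components_map Y f) (path_components_of X)"
    using weq_bij by (simp add: bij_betw_def)
  have "Collect (path_component_of X x) = Collect (path_component_of X x')"
    by (rule inj_onD [OF inj eq]) (use assms(1,2) in \<open>simp_all add: path_components_of_def\<close>)
  moreover have "path_component_of X x' x'" using assms by (simp add: path_component_of_refl)
  ultimately show ?thesis by blast
qed

lemma weq_component_surject:
  assumes "y \<in> topspace Y"
  shows "\<exists>x\<in>topspace X. path_component_of Y (f x) y"
proof -
  have "Collect (path_component_of Y y) \<in> path_components_of Y"
    using assms by (simp add: path_components_of_def)
  then have "Collect (path_component_of Y y) \<in> path_components_map Y f ` path_components_of X"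
    using weq_bij by (simp add: bij_betw_def)
  then obtain x where x: "x \<in> topspace X" "Collect (path_component_of Y y) = Collect (path_component_of Y (f x))"
    by (auto simp: path_components_of_def path_components_map_class)
  moreover have "path_component_of Y y y" using assms by (simp add: path_component_of_refl)
  ultimately show ?thesis by blast
qed

lemma cube_boundary_0: "cube_boundary 0 = {}"
  by (simp add: cube_boundary_def)

text \<open>The only point of the cube of dimension 0 is \<open>\<lambda>_. undefined\<close>, and
  its boundary is empty. So homotopies there are paths, and path components take the place of
  homotopy groups.\<close>

lemma cube_htpy_0_iff:
  assumes "continuous_map (cube 0) Z \<alpha>" "continuous_map (cube 0) Z \<beta>"
  shows "cube_htpy 0 Z h \<alpha> \<beta> \<longleftrightarrow> path_component_of Z (\<alpha> (\<lambda>_. undefined)) (\<beta> (\<lambda>_. undefined))"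
proof
  have top: "topspace (cube 0) = {\<lambda>_. undefined}"
    by (auto simp: topspace_cube)
  show "path_component_of Z (\<alpha> (\<lambda>_. undefined)) (\<beta> (\<lambda>_. undefined))" if ht: "cube_htpy 0 Z h \<alpha> \<beta>"
  proof -
    obtain H where H: "continuous_map (cube_cyl 0) Z H" "\<forall>x\<in>topspace (cube 0). H (0, x) = \<alpha> x \<and> H (1, x) = \<beta> x"
      using ht unfolding cube_htpy_def by blast
    have "pathin Z (\<lambda>t. H (t, \<lambda>_. undefined))"
      unfolding pathin_def
      by (rule continuous_map_pairD [OF _ _ H(1)]) (auto simp: top)
    then show ?thesis
      unfolding path_component_of_def using H(2) top by (intro exI [of _ "\<lambda>t. H (t, \<lambda>_. undefined)"]) auto
  qed
  show "cube_htpy 0 Z h \<alpha> \<beta>" if pc: "path_component_of Z (\<alpha> (\<lambda>_. undefined)) (\<beta> (\<lambda>_. undefined))"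
  proof -
    obtain g where g: "pathin Z g" "g 0 = \<alpha> (\<lambda>_. undefined)" "g 1 = \<beta> (\<lambda>_. undefined)"
      using pc unfolding path_component_of_def by blast
    have "continuous_map (cube_cyl 0) Z (\<lambda>z. g (fst z))"
      using continuous_map_compose [OF continuous_map_fst, of unit_interval Z g "cube 0"] g(1) by (simp add: pathin_def o_def)
    then show ?thesis
      unfolding cube_htpy_def using g top cube_boundary_0 by (intro exI [of _ "\<lambda>z. g (fst z)"]) auto
  qed
qed

section \<open>Extending and lifting maps of cubes along a weak equivalence\<close>

definition cube_contract :: "nat \<Rightarrow> real \<times> (nat \<Rightarrow> real) \<Rightarrow> nat \<Rightarrow> real" where
  "cube_contract n z = (\<lambda>i\<in>{..<n}. (1 - fst z) * snd z i)"

lemma continuous_map_cube_contract: "continuous_map (cube_cyl n) (cube n) (cube_contract n)"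
proof (rule continuous_map_cubeI)
  show "cube_contract n z \<in> topspace (cube n)" if "z \<in> topspace (cube_cyl n)" for z
    using that by (auto simp: topspace_cube cube_contract_def mult_le_one)
  show "continuous_map (cube_cyl n) euclideanreal (\<lambda>z. cube_contract n z i)" if "i < n" for i
    using that continuous_map_coord [OF that, of unit_interval UNIV] continuous_map_time [of "cube n" UNIV]
    by (simp add: cube_contract_def) (intro continuous_intros; simp)
qed

lemma cube_contract_0: "x \<in> topspace (cube n) \<Longrightarrow> cube_contract n (0, x) = x"
  by (auto simp: topspace_cube cube_contract_def fun_eq_iff extensional_def)

lemma cube_contract_1: "cube_contract n (1, x) = (\<lambda>i\<in>{..<n}. 0)"
  by (simp add: cube_contract_def cong: restrict_cong)

text \<open>The restriction of this homotopy to the boundary is a track that moves the boundary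
  values of \<open>\<alpha>\<close> to a single point. Any other map with the same boundary values
  can be carried along it and becomes a spheroid.\<close>

lemma cube_htpy_contract:
  assumes "continuous_map (cube n) Z \<alpha>"
  shows "cube_htpy n Z (\<lambda>z. \<alpha> (cube_contract n z)) \<alpha> (\<lambda>_. \<alpha> (\<lambda>i\<in>{..<n}. 0))"
  unfolding cube_htpy_def
  using continuous_map_compose [OF continuous_map_cube_contract assms]
  by (intro exI [of _ "\<lambda>z. \<alpha> (cube_contract n z)"]) (simp add: o_def cube_contract_0 cube_contract_1)

lemma cube_origin: "(\<lambda>i\<in>{..<n}. 0) \<in> topspace (cube n)"
  by (auto simp: topspace_cube)

text \<open>Carry both maps along the track \<open>h\<close> contracting \<open>\<alpha>\<close>:
  then \<open>\<alpha>\<close> becomes constant and \<open>\<beta>\<close> a spheroid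
  \<open>\<beta>1\<close>. As \<open>f \<circ> \<alpha>\<close> and \<open>f \<circ> \<beta>\<close>
  are homotopic, uniqueness of the end makes \<open>f \<circ> \<beta>1\<close> null-homotopic, and
  injectivity on the homotopy group makes \<open>\<beta>1\<close> so. Hence both maps reach the same
  end along \<open>h\<close>, and going back they are homotopic.\<close>

lemma weq_rel_inject:
  assumes \<alpha>: "continuous_map (cube n) X \<alpha>" and \<beta>: "continuous_map (cube n) X \<beta>"
    and bd: "\<And>x. x \<in> cube_boundary n \<Longrightarrow> \<alpha> x = \<beta> x"
    and f: "cube_rel_htpy n Y (f \<circ> \<alpha>) (f \<circ> \<beta>)"
  shows "cube_rel_htpy n X \<alpha> \<beta>"
proof (cases n)
  case 0
  have fc: "continuous_map (cube 0) Y (f \<circ> \<alpha>)" "continuous_map (cube 0) Y (f \<circ> \<beta>)"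
    using cube_htpy_continuous(1,2) [OF f] 0 by simp_all
  have "(\<lambda>_. undefined) \<in> topspace (cube 0)" by (auto simp: topspace_cube)
  then have "\<alpha> (\<lambda>_. undefined) \<in> topspace X" "\<beta> (\<lambda>_. undefined) \<in> topspace X"
    using \<alpha> \<beta> 0 by (auto simp: continuous_map_def)
  moreover have "path_component_of Y (f (\<alpha> (\<lambda>_. undefined))) (f (\<beta> (\<lambda>_. undefined)))"
    using f cube_htpy_0_iff [OF fc] 0 by simp
  ultimately have "path_component_of X (\<alpha> (\<lambda>_. undefined)) (\<beta> (\<lambda>_. undefined))"
    by (rule weq_component_inject)
  then show ?thesis
    using cube_htpy_0_iff \<alpha> \<beta> 0 by blast
next
  case (Suc m)
  define h where "h = (\<lambda>z. \<alpha> (cube_contract n z))"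
  define x0 where "x0 = \<alpha> (\<lambda>i\<in>{..<n}. 0)"
  have x0: "x0 \<in> topspace X"
    using \<alpha> cube_origin [of n] by (auto simp: x0_def continuous_map_def)
  have H\<alpha>: "cube_htpy n X h \<alpha> (\<lambda>_. x0)"
    unfolding h_def x0_def by (rule cube_htpy_contract [OF \<alpha>])
  obtain \<beta>1 where H\<beta>: "cube_htpy n X h \<beta> \<beta>1"
    using cube_htpy_extend [OF \<beta> cube_htpy_continuous(3) [OF H\<alpha>]] cube_htpy_ends(1) [OF H\<alpha>] bd by auto
  have \<beta>1: "\<beta>1 x = x0" if "x \<in> cube_boundary n" for x
    using cube_htpy_ends(2) [OF H\<alpha> that] cube_htpy_ends(2) [OF H\<beta> that] by simp
  have sph: "spheroid n X x0 (\<lambda>_. x0)" "spheroid n X x0 \<beta>1"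
    using x0 \<beta>1 cube_htpy_continuous(2) [OF H\<beta>] by (simp_all add: spheroid_def)
  note fH\<alpha> = cube_htpy_compose [OF weq_continuous H\<alpha>] and fH\<beta> = cube_htpy_compose [OF weq_continuous H\<beta>]
  have "cube_rel_htpy n Y (f \<circ> (\<lambda>_. x0)) (f \<circ> \<beta>1)"
    by (rule cube_htpy_unique [OF cube_htpy_rel_left [OF fH\<alpha> f] fH\<beta>])
  then have "spheroid_homotopic n Y (f x0) (f \<circ> (\<lambda>_. x0)) (f \<circ> \<beta>1)"
    by (subst spheroid_homotopic_iff) simp_all
  then have "spheroid_homotopic n X x0 (\<lambda>_. x0) \<beta>1"
    using weq_spheroid_inject [OF x0 _ sph] Suc by simp
  then have "cube_rel_htpy n X (\<lambda>_. x0) \<beta>1"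
    by (subst (asm) spheroid_homotopic_iff) simp_all
  from cube_htpy_rel_right [OF H\<alpha> this] show ?thesis
    using H\<beta> by (rule cube_htpy_unique_back)
qed

text \<open>Contracting \<open>A\<close> carries \<open>b\<close>, along the image of the same
  track, to a spheroid \<open>w\<close> of \<open>Y\<close>. Surjectivity on the homotopy group
  gives a spheroid of \<open>X\<close> over it up to homotopy, and carrying this back along the
  track restores the boundary values of \<open>A\<close>.\<close>

lemma weq_rel_surject:
  assumes n: "n \<ge> 1" and A: "continuous_map (cube n) X A" and b: "continuous_map (cube n) Y b"
    and bd: "\<And>x. x \<in> cube_boundary n \<Longrightarrow> b x = f (A x)"
  shows "\<exists>A'. continuous_map (cube n) X A' \<and> (\<forall>x\<in>cube_boundary n. A' x = A x) \<and> cube_rel_htpy n Y (f \<circ> A') b"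
proof -
  define h where "h = (\<lambda>z. A (cube_contract n z))"
  define x0 where "x0 = A (\<lambda>i\<in>{..<n}. 0)"
  have x0: "x0 \<in> topspace X"
    using A cube_origin [of n] by (auto simp: x0_def continuous_map_def)
  have HA: "cube_htpy n X h A (\<lambda>_. x0)"
    unfolding h_def x0_def by (rule cube_htpy_contract [OF A])
  note fHA = cube_htpy_compose [OF weq_continuous HA]
  obtain w where w: "cube_htpy n Y (f \<circ> h) b w"
    using cube_htpy_extend [OF b cube_htpy_continuous(3) [OF fHA]] cube_htpy_ends(1) [OF HA] bd by auto
  have "w x = f x0" if "x \<in> cube_boundary n" for x
    using cube_htpy_ends(2) [OF w that] cube_htpy_ends(2) [OF HA that] by simp
  then have "spheroid n Y (f x0) w"
    using cube_htpy_continuous(2) [OF w] by (simp add: spheroid_def)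
  then obtain \<omega> where \<omega>: "spheroid n X x0 \<omega>" "spheroid_homotopic n Y (f x0) (f \<circ> \<omega>) w"
    using weq_spheroid_surject [OF x0 n] by blast
  have f\<omega>: "cube_rel_htpy n Y (f \<circ> \<omega>) w"
    using \<omega> by (subst (asm) spheroid_homotopic_iff) (simp_all add: spheroid_def)
  have "\<And>x. x \<in> cube_boundary n \<Longrightarrow> h (1, x) = \<omega> x"
    using \<omega>(1) cube_htpy_ends(2) [OF HA] by (simp add: spheroid_def)
  then obtain A' where A': "cube_htpy n X h A' \<omega>"
    using cube_htpy_extend_back [OF _ cube_htpy_continuous(3) [OF HA]] \<omega>(1) unfolding spheroid_def by blast
  have "cube_rel_htpy n Y (f \<circ> A') b"
    by (rule cube_htpy_unique_back [OF cube_htpy_rel_right [OF cube_htpy_compose [OF weq_continuous A'] f\<omega>] w])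
  moreover have "\<forall>x\<in>cube_boundary n. A' x = A x"
    using cube_htpy_ends(1) [OF A'] cube_htpy_ends(1) [OF HA] by simp
  ultimately show ?thesis
    using cube_htpy_continuous(1) [OF A'] by blast
qed

text \<open>Read the boundary of the next cube as a bottom \<open>\<alpha>0\<close>, a top
  \<open>\<alpha>1\<close> and sides \<open>h\<close>. Carry \<open>\<alpha>0\<close> along
  \<open>h\<close> to some \<open>\<alpha>'\<close>. After applying \<open>f\<close>, both
  \<open>\<alpha>'\<close> and \<open>\<alpha>1\<close> are ends of homotopies with the same start
  and track, the second being given by \<open>b\<close>; so they are homotopic, and by injectivity
  already in \<open>X\<close>. This closes the cylinder to a map on the whole cube.\<close>

lemma weq_extend:
  assumes a: "continuous_map (subtopology (cube (Suc m)) (cube_boundary (Suc m))) X a"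
    and b: "continuous_map (cube (Suc m)) Y b" and ab: "\<And>x. x \<in> cube_boundary (Suc m) \<Longrightarrow> b x = f (a x)"
  shows "\<exists>A. continuous_map (cube (Suc m)) X A \<and> (\<forall>x\<in>cube_boundary (Suc m). A x = a x)"
proof -
  let ?j = "cube_join m"
  have jb: "?j (t, x) \<in> cube_boundary (Suc m)" if "t \<in> {0..1}" "x \<in> topspace (cube m)" "t = 0 \<or> t = 1 \<or> x \<in> cube_boundary m" for t x
    using cube_join_boundary [of "(t, x)" m] that by auto
  have slice: "continuous_map (cube m) X (\<lambda>x. a (?j (t, x)))" if t: "t = 0 \<or> t = 1" for t
  proof -
    have "continuous_map (cube m) (cube (Suc m)) (\<lambda>x. ?j (t, x))"
      by (rule continuous_map_slice [OF continuous_map_cube_join]) (use t in auto)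
    then have "continuous_map (cube m) (subtopology (cube (Suc m)) (cube_boundary (Suc m))) (\<lambda>x. ?j (t, x))"
      by (rule continuous_map_into_subtopology) (use jb t in auto)
    from continuous_map_compose [OF this a] show ?thesis by (simp add: o_def)
  qed
  define h where "h = (\<lambda>z. a (?j z))"
  have h: "continuous_map (cube_bdry_cyl m) X h"
  proof -
    have "continuous_map (cube_bdry_cyl m) (subtopology (cube (Suc m)) (cube_boundary (Suc m))) ?j"
      by (rule continuous_map_into_subtopology [OF continuous_map_from_subtopology [OF continuous_map_cube_join]])
        (use jb in auto)
    from continuous_map_compose [OF this a] show ?thesis by (simp add: h_def o_def)
  qed
  define \<alpha>0 where "\<alpha>0 = (\<lambda>x. a (?j (0, x)))"
  define \<alpha>1 where "\<alpha>1 = (\<lambda>x. a (?j (1, x)))"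
  have \<alpha>: "continuous_map (cube m) X \<alpha>0" "continuous_map (cube m) X \<alpha>1"
    unfolding \<alpha>0_def \<alpha>1_def using slice by auto
  have h01: "h (0, x) = \<alpha>0 x" "h (1, x) = \<alpha>1 x" for x
    by (simp_all add: h_def \<alpha>0_def \<alpha>1_def)
  obtain \<alpha>' where \<alpha>': "cube_htpy m X h \<alpha>0 \<alpha>'"
    using cube_htpy_extend [OF \<alpha>(1) h] h01 by blast
  have bY: "cube_htpy m Y (f \<circ> h) (f \<circ> \<alpha>0) (f \<circ> \<alpha>1)"
    unfolding cube_htpy_def
  proof (intro exI conjI ballI)
    show "continuous_map (cube_cyl m) Y (\<lambda>z. b (?j z))"
      using continuous_map_compose [OF continuous_map_cube_join b] by (simp add: o_def)
  qed (use ab jb in \<open>auto simp: h_def \<alpha>0_def \<alpha>1_def dest: cube_boundary_subset\<close>)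
  have "cube_rel_htpy m Y (f \<circ> \<alpha>') (f \<circ> \<alpha>1)"
    by (rule cube_htpy_unique [OF cube_htpy_compose [OF weq_continuous \<alpha>'] bY])
  moreover have "\<And>x. x \<in> cube_boundary m \<Longrightarrow> \<alpha>' x = \<alpha>1 x"
    using cube_htpy_ends(2) [OF \<alpha>'] h01 by simp
  ultimately have "cube_rel_htpy m X \<alpha>' \<alpha>1"
    using weq_rel_inject [OF cube_htpy_continuous(2) [OF \<alpha>'] \<alpha>(2)] by blast
  from cube_htpy_rel_right [OF \<alpha>' this]
  obtain H where H: "continuous_map (cube_cyl m) X H" "\<forall>x\<in>topspace (cube m). H (0, x) = \<alpha>0 x \<and> H (1, x) = \<alpha>1 x"
    "\<forall>t\<in>{0..1}. \<forall>x\<in>cube_boundary m. H (t, x) = h (t, x)"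
    unfolding cube_htpy_def by blast
  have "continuous_map (cube (Suc m)) X (\<lambda>x. H (cube_split m x))"
    using continuous_map_compose [OF continuous_map_cube_split H(1)] by (simp add: o_def)
  moreover have "H (cube_split m x) = a x" if x: "x \<in> cube_boundary (Suc m)" for x
  proof -
    obtain t y where ty: "cube_split m x = (t, y)" by (cases "cube_split m x")
    have xj: "?j (t, y) = x"
      using cube_join_split [OF cube_boundary_subset [OF x]] ty by simp
    have y: "t \<in> {0..1}" "y \<in> topspace (cube m)"
      using cube_split_in [OF cube_boundary_subset [OF x]] ty by auto
    have "t = 0 \<or> t = 1 \<or> y \<in> cube_boundary m"
      using x ty by (auto simp: cube_boundary_Suc cube_split_def)
    then show ?thesis
      using H(2,3) y xj unfolding ty by (auto simp: h_def \<alpha>0_def \<alpha>1_def)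
  qed
  ultimately show ?thesis by blast
qed

text \<open>Carry \<open>b\<close> back along \<open>h\<close> to a map \<open>b'\<close> with
  boundary values \<open>f \<circ> a\<close>. Then \<open>weq_extend\<close> extends
  \<open>a\<close> over the cube, \<open>weq_rel_surject\<close> changes the extension inside so
  that its image becomes homotopic to \<open>b'\<close> relative to the boundary, and this homotopy
  is absorbed into the one from \<open>b'\<close> to \<open>b\<close>.\<close>

theorem weq_cube_lift:
  assumes a: "continuous_map (subtopology (cube n) (cube_boundary n)) X a"
    and b: "continuous_map (cube n) Y b" and h: "continuous_map (cube_bdry_cyl n) Y h"
    and h0: "\<And>x. x \<in> cube_boundary n \<Longrightarrow> h (0, x) = f (a x)"
    and h1: "\<And>x. x \<in> cube_boundary n \<Longrightarrow> h (1, x) = b x"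
  shows "\<exists>A. continuous_map (cube n) X A \<and> (\<forall>x\<in>cube_boundary n. A x = a x) \<and> cube_htpy n Y h (f \<circ> A) b"
\<comment> \<open>In dimension 0 there is no boundary, and lifting a point up to a path is
  surjectivity on path components.\<close>
proof (cases n)
  case 0
  have u: "(\<lambda>_. undefined) \<in> topspace (cube 0)" by (auto simp: topspace_cube)
  then have "b (\<lambda>_. undefined) \<in> topspace Y"
    using b 0 by (auto simp: continuous_map_def)
  then obtain x where x: "x \<in> topspace X" "path_component_of Y (f x) (b (\<lambda>_. undefined))"
    using weq_component_surject by blast
  have c: "continuous_map (cube 0) X (\<lambda>_. x)" using x by simp
  have "cube_htpy 0 Y h (f \<circ> (\<lambda>_. x)) b"
    using cube_htpy_0_iff [OF continuous_map_compose [OF c weq_continuous], of b] b 0 x(2) by simp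
  then show ?thesis using c 0 cube_boundary_0 by blast
next
  case (Suc m)
  obtain b' where b': "cube_htpy n Y h b' b"
    using cube_htpy_extend_back [OF b h h1] by blast
  have bd: "b' x = f (a x)" if "x \<in> cube_boundary n" for x
    using cube_htpy_ends(1) [OF b' that] h0 [OF that] by simp
  obtain A where A: "continuous_map (cube n) X A" "\<forall>x\<in>cube_boundary n. A x = a x"
    using weq_extend [of m a b'] a cube_htpy_continuous(1) [OF b'] bd Suc by blast
  have "n \<ge> 1" using Suc by simp
  then obtain A' where A': "continuous_map (cube n) X A'" "\<forall>x\<in>cube_boundary n. A' x = A x" "cube_rel_htpy n Y (f \<circ> A') b'"
    using weq_rel_surject [OF _ A(1) cube_htpy_continuous(1) [OF b']] bd A(2) by auto
  have "\<forall>x\<in>cube_boundary n. A' x = a x" using A'(2) A(2) by simp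
  then show ?thesis
    using cube_htpy_rel_left [OF b' cube_rel_htpy_sym [OF A'(3)]] A'(1) by blast
qed

end

section \<open>The simplex as a quotient of the cube\<close>

abbreviation simplex_top :: "nat \<Rightarrow> (nat \<Rightarrow> real) topology" where
  "simplex_top n \<equiv> subtopology (powertop_real UNIV) (standard_simplex n)"

abbreviation simplex_cyl :: "nat \<Rightarrow> (real \<times> (nat \<Rightarrow> real)) topology" where
  "simplex_cyl n \<equiv> prod_topology unit_interval (simplex_top n)"

definition simplex_boundary :: "nat \<Rightarrow> (nat \<Rightarrow> real) set" where
  "simplex_boundary n = {x \<in> standard_simplex n. \<exists>j\<le>n. x j = 0}"

abbreviation simplex_bdry_cyl :: "nat \<Rightarrow> (real \<times> (nat \<Rightarrow> real)) topology" where
  "simplex_bdry_cyl n \<equiv> subtopology (simplex_cyl n) {z. snd z \<in> simplex_boundary n}"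

lemma continuous_map_simplexI:
  assumes "\<And>z. z \<in> topspace Z \<Longrightarrow> g z \<in> standard_simplex n"
    and "\<And>i. continuous_map Z euclideanreal (\<lambda>z. g z i)"
  shows "continuous_map Z (simplex_top n) g"
proof (rule continuous_map_into_subtopology)
  show "continuous_map Z (powertop_real UNIV) g"
    unfolding continuous_map_componentwise_UNIV using assms(2) by blast
qed (use assms(1) in auto)

lemma continuous_map_simplex_coord: "continuous_map (subtopology (simplex_top n) S) euclideanreal (\<lambda>x. x i)"
  by (intro continuous_map_from_subtopology) (auto intro: continuous_map_product_projection)

lemma continuous_map_simplex_proj: "continuous_map (simplex_top n) euclideanreal (\<lambda>x. x i)"
  using continuous_map_simplex_coord [of n UNIV i] by simp

text \<open>Barycentric coordinates by breaking a stick: \<open>x i\<close> is the fraction of the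
  remaining length that is left after coordinate \<open>i\<close> has been cut off. Once some
  \<open>x i\<close> is 0 the later values of \<open>x\<close> have no effect, and this is the only
  collapsing.\<close>

definition cube_to_simplex :: "nat \<Rightarrow> (nat \<Rightarrow> real) \<Rightarrow> nat \<Rightarrow> real" where
  "cube_to_simplex n x = (\<lambda>j. if j < n then (\<Prod>i<j. x i) * (1 - x j) else if j = n then \<Prod>i<n. x i else 0)"

lemma cube_to_simplex_in:
  assumes x: "x \<in> topspace (cube n)"
  shows "cube_to_simplex n x \<in> standard_simplex n"
proof -
  have x01: "0 \<le> x i \<and> x i \<le> 1" if "i < n" for i
    using x that by (simp add: topspace_cube)
  have pr: "0 \<le> (\<Prod>i<j. x i) \<and> (\<Prod>i<j. x i) \<le> 1" if "j \<le> n" for j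
    using x01 that by (auto intro!: prod_nonneg prod_le_1)
  \<comment> \<open>A telescoping sum: each summand is the difference of two successive
    products.\<close>
  have sum: "(\<Sum>j<m. (\<Prod>i<j. x i) * (1 - x j)) = 1 - (\<Prod>i<m. x i)" for m
    by (induction m) (auto simp: algebra_simps)
  have "(\<Sum>j\<le>n. cube_to_simplex n x j) = (\<Sum>j<n. cube_to_simplex n x j) + cube_to_simplex n x n"
    by (simp add: lessThan_Suc_atMost [symmetric])
  also have "\<dots> = 1"
    using sum [of n] by (simp add: cube_to_simplex_def)
  finally show ?thesis
    unfolding standard_simplex_def
    using pr x01 by (auto simp: cube_to_simplex_def intro!: mult_le_one mult_nonneg_nonneg)
qed

lemma continuous_map_cube_to_simplex: "continuous_map (cube n) (simplex_top n) (cube_to_simplex n)"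
proof (rule continuous_map_simplexI [OF cube_to_simplex_in])
  fix j
  have pr: "continuous_map (cube n) euclideanreal (\<lambda>x. \<Prod>i<m. x i)" if "m \<le> n" for m
    using that by (intro continuous_map_prod continuous_map_cube_coord) auto
  consider "j < n" | "j = n" | "n < j" by linarith
  then show "continuous_map (cube n) euclideanreal (\<lambda>x. cube_to_simplex n x j)"
  proof cases
    case 1
    then show ?thesis
      using pr [of j] continuous_map_cube_coord [OF 1] by (simp add: cube_to_simplex_def continuous_intros)
  next
    case 2
    then show ?thesis using pr [of n] by (simp add: cube_to_simplex_def)
  next
    case 3
    then show ?thesis by (simp add: cube_to_simplex_def)
  qed
qed

lemma cube_to_simplex_boundary:
  assumes x: "x \<in> topspace (cube n)"
  shows "cube_to_simplex n x \<in> simplex_boundary n \<longleftrightarrow> x \<in> cube_boundary n"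
proof
  assume "cube_to_simplex n x \<in> simplex_boundary n"
  then obtain j where j: "j \<le> n" "cube_to_simplex n x j = 0" by (auto simp: simplex_boundary_def)
  then have "(\<exists>i<n. x i = 0) \<or> (\<exists>i<n. x i = 1)"
  proof (cases "j = n")
    case True
    then show ?thesis using j by (auto simp: cube_to_simplex_def)
  next
    case False
    then have "j < n" using j by simp
    then have "(\<Prod>i<j. x i) = 0 \<or> x j = 1" using j by (simp add: cube_to_simplex_def)
    then show ?thesis
    proof
      assume "(\<Prod>i<j. x i) = 0"
      then obtain i where "i < j" "x i = 0" by auto
      then show ?thesis using \<open>j < n\<close> by (intro disjI1 exI [of _ i]) simp
    qed (use \<open>j < n\<close> in blast)
  qed
  then show "x \<in> cube_boundary n" using x unfolding cube_boundary_def by blast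
next
  assume "x \<in> cube_boundary n"
  then obtain i where i: "i < n" "x i = 0 \<or> x i = 1" by (auto simp: cube_boundary_def)
  then have "cube_to_simplex n x n = 0 \<or> cube_to_simplex n x i = 0"
    by (auto simp: cube_to_simplex_def)
  then show "cube_to_simplex n x \<in> simplex_boundary n"
    unfolding simplex_boundary_def using cube_to_simplex_in [OF x] i by (auto intro: less_imp_le)
qed

text \<open>Off the boundary no partial product vanishes, so \<open>x j\<close> can be recovered
  from coordinate \<open>j\<close> by division, one index after another.\<close>

lemma cube_to_simplex_inject:
  assumes x: "x \<in> topspace (cube n)" and y: "y \<in> topspace (cube n)"
    and eq: "cube_to_simplex n x = cube_to_simplex n y" and nb: "x \<notin> cube_boundary n"
  shows "x = y"
proof -
  have main: "(\<Prod>i<j. x i) = (\<Prod>i<j. y i) \<and> (\<forall>i<j. x i = y i)" if "j \<le> n" for j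
    using that
  proof (induction j)
    case (Suc j)
    then have j: "j < n" and IH: "(\<Prod>i<j. x i) = (\<Prod>i<j. y i)" "\<forall>i<j. x i = y i" by auto
    have "(\<Prod>i<j. x i) * (1 - x j) = (\<Prod>i<j. y i) * (1 - y j)"
      using fun_cong [OF eq, of j] j by (simp add: cube_to_simplex_def)
    moreover have "(\<Prod>i<j. x i) \<noteq> 0"
      using nb x j by (auto simp: cube_boundary_def)
    ultimately have "x j = y j" using IH(1) by simp
    then show ?case using IH by (simp add: less_Suc_eq)
  qed simp
  show ?thesis
  proof
    fix i
    show "x i = y i"
      using main [of n] x y by (cases "i < n") (auto simp: topspace_cube extensional_def)
  qed
qed

lemma cube_to_simplex_surj:
  assumes y: "y \<in> standard_simplex n"
  shows "\<exists>x\<in>topspace (cube n). cube_to_simplex n x = y"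
proof -
  \<comment> \<open>\<open>u j\<close> is the length left before coordinate \<open>j\<close> is cut
    off, and \<open>x\<close> solves the defining equations of \<open>cube_to_simplex\<close>. If
    nothing is left then \<open>y j\<close> is 0 as well, and any value of \<open>x j\<close> in the
    interval would do.\<close>
  define u where "u j = 1 - (\<Sum>i<j. y i)" for j
  define x where "x = (\<lambda>j\<in>{..<n}. if u j = 0 then 0 else 1 - y j / u j)"
  have y0: "0 \<le> y i" and yn: "n < i \<Longrightarrow> y i = 0" and ys: "(\<Sum>i\<le>n. y i) = 1" for i
    using y by (auto simp: standard_simplex_def)
  have u0: "u 0 = 1" and us: "u (Suc j) = u j - y j" for j by (simp_all add: u_def)
  have un: "u n = y n"
    using ys by (simp add: u_def lessThan_Suc_atMost [symmetric])
  have upos: "0 \<le> u j" if "j \<le> Suc n" for j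
  proof -
    have "(\<Sum>i<j. y i) \<le> (\<Sum>i\<le>n. y i)"
      by (rule sum_mono2) (use y0 that in auto)
    then show ?thesis using ys by (simp add: u_def)
  qed
  have yu: "y j \<le> u j" if "j \<le> n" for j
    using upos [of "Suc j"] us [of j] that by simp
  have pr: "(\<Prod>i<j. x i) = u j" if "j \<le> n" for j
    using that
  proof (induction j)
    case (Suc j)
    then have j: "j < n" and IH: "(\<Prod>i<j. x i) = u j" by auto
    show ?case
    proof (cases "u j = 0")
      case True
      then have "u (Suc j) = 0"
        using us [of j] y0 [of j] upos [of "Suc j"] j by simp
      then show ?thesis using IH True by simp
    next
      case False
      have "(\<Prod>i<Suc j. x i) = u j * x j" using IH by simp
      also have "\<dots> = u j * (1 - y j / u j)" using j False by (simp add: x_def)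
      also have "\<dots> = u j - y j" using False by (simp add: right_diff_distrib)
      finally show ?thesis by (simp add: us)
    qed
  qed (simp add: u0)
  have "x \<in> topspace (cube n)"
    unfolding topspace_cube
  proof (intro conjI allI impI)
    fix i assume i: "i < n"
    have "0 \<le> u i" "y i \<le> u i" "0 \<le> y i" using upos [of i] yu [of i] y0 [of i] i by auto
    then show "0 \<le> x i" "x i \<le> 1"
      using i by (auto simp: x_def divide_le_eq_1)
  qed (simp add: x_def)
  moreover have "cube_to_simplex n x j = y j" for j
  proof -
    consider "j < n" | "j = n" | "n < j" by linarith
    then show ?thesis
    proof cases
      case 1
      then show ?thesis
        using pr [of j] yu [of j] y0 [of j] by (auto simp: cube_to_simplex_def x_def)
    next
      case 2
      then show ?thesis using pr [of n] un by (simp add: cube_to_simplex_def)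
    next
      case 3
      then show ?thesis using yn by (simp add: cube_to_simplex_def)
    qed
  qed
  ultimately show ?thesis by blast
qed

lemma compact_space_cube: "compact_space (cube n)"
proof -
  have "compact_space unit_interval" by (simp add: compact_space_subtopology)
  then show ?thesis
    unfolding cube_def by (simp add: compact_space_product_topology)
qed

lemma Hausdorff_space_simplex: "Hausdorff_space (simplex_top n)"
  by (intro Hausdorff_space_subtopology) (simp add: Hausdorff_space_product_topology)

lemma continuous_map_cyl_to_simplex: "continuous_map (cube_cyl n) (simplex_cyl n) (\<lambda>z. (fst z, cube_to_simplex n (snd z)))"
  using continuous_map_compose [OF continuous_map_snd continuous_map_cube_to_simplex]
  by (intro continuous_map_pairedI continuous_map_fst) (simp add: o_def)

text \<open>A continuous surjection from a compact space onto a Hausdorff space is a quotient map.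
  The cylinder is treated directly, so that homotopies descend and not only maps.\<close>

lemma quotient_map_cyl_to_simplex: "quotient_map (cube_cyl n) (simplex_cyl n) (\<lambda>z. (fst z, cube_to_simplex n (snd z)))"
proof (rule continuous_imp_quotient_map [OF continuous_map_cyl_to_simplex])
  show "compact_space (cube_cyl n)"
    by (simp add: compact_space_prod_topology compact_space_cube compact_space_subtopology)
  show "Hausdorff_space (simplex_cyl n)"
    by (simp add: Hausdorff_space_prod_topology Hausdorff_space_simplex Hausdorff_space_subtopology)
  show "(\<lambda>z. (fst z, cube_to_simplex n (snd z))) ` topspace (cube_cyl n) = topspace (simplex_cyl n)"
  proof
    show "(\<lambda>z. (fst z, cube_to_simplex n (snd z))) ` topspace (cube_cyl n) \<subseteq> topspace (simplex_cyl n)"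
      using cube_to_simplex_in by auto
    show "topspace (simplex_cyl n) \<subseteq> (\<lambda>z. (fst z, cube_to_simplex n (snd z))) ` topspace (cube_cyl n)"
    proof
      fix z assume "z \<in> topspace (simplex_cyl n)"
      then have z: "fst z \<in> {0..1}" "snd z \<in> standard_simplex n" by auto
      obtain x where x: "x \<in> topspace (cube n)" "cube_to_simplex n x = snd z"
        using cube_to_simplex_surj [OF z(2)] by blast
      show "z \<in> (\<lambda>z. (fst z, cube_to_simplex n (snd z))) ` topspace (cube_cyl n)"
        by (rule image_eqI [of _ _ "(fst z, x)"]) (use x z in auto)
    qed
  qed
qed

lemma simplex_boundary_subset: "x \<in> simplex_boundary n \<Longrightarrow> x \<in> standard_simplex n"
  by (simp add: simplex_boundary_def)

lemma continuous_map_bdry_cyl_to_simplex: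
  assumes "continuous_map (simplex_bdry_cyl n) Y h"
  shows "continuous_map (cube_bdry_cyl n) Y (\<lambda>z. h (fst z, cube_to_simplex n (snd z)))"
proof -
  have "continuous_map (cube_bdry_cyl n) (simplex_bdry_cyl n) (\<lambda>z. (fst z, cube_to_simplex n (snd z)))"
    by (rule continuous_map_into_subtopology [OF continuous_map_from_subtopology [OF continuous_map_cyl_to_simplex]])
      (auto simp: cube_to_simplex_boundary)
  from continuous_map_compose [OF this assms] show ?thesis by (simp add: o_def)
qed

text \<open>Points are identified only within the boundary of the cube. If the values there come
  from the simplex, the map is constant on the fibres of the quotient map.\<close>

lemma descend_cyl:
  assumes H: "continuous_map (cube_cyl n) Y H"
    and bd: "\<And>t x. t \<in> {0..1} \<Longrightarrow> x \<in> cube_boundary n \<Longrightarrow> H (t, x) = h (t, cube_to_simplex n x)"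
  obtains K where "continuous_map (simplex_cyl n) Y K"
    "\<And>t x. t \<in> {0..1} \<Longrightarrow> x \<in> topspace (cube n) \<Longrightarrow> K (t, cube_to_simplex n x) = H (t, x)"
    "\<And>t y. t \<in> {0..1} \<Longrightarrow> y \<in> simplex_boundary n \<Longrightarrow> K (t, y) = h (t, y)"
proof -
  have const: "H z = H z'" if z: "z \<in> topspace (cube_cyl n)" "z' \<in> topspace (cube_cyl n)"
     and eq: "(fst z, cube_to_simplex n (snd z)) = (fst z', cube_to_simplex n (snd z'))" for z z'
  proof -
    obtain t x where 1: "z = (t, x)" by (cases z)
    obtain t' x' where 2: "z' = (t', x')" by (cases z')
    have t: "t' = t" "t \<in> {0..1}" and x: "x \<in> topspace (cube n)" "x' \<in> topspace (cube n)"
      and e: "cube_to_simplex n x = cube_to_simplex n x'"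
      using z eq by (auto simp: 1 2)
    show ?thesis
    proof (cases "x \<in> cube_boundary n")
      case True
      then have "x' \<in> cube_boundary n"
        using cube_to_simplex_boundary [OF x(1)] cube_to_simplex_boundary [OF x(2)] e by simp
      then show ?thesis
        using bd [OF t(2) True] bd [OF t(2), of x'] e t(1) by (simp add: 1 2)
    next
      case False
      then show ?thesis
        using cube_to_simplex_inject [OF x e] t(1) by (simp add: 1 2)
    qed
  qed
  have "\<exists>K. continuous_map (simplex_cyl n) Y K \<and> (\<forall>z\<in>topspace (cube_cyl n). K (fst z, cube_to_simplex n (snd z)) = H z)"
  proof (rule quotient_map_lift_exists [OF quotient_map_cyl_to_simplex H])
    show "H z = H z'" if "z \<in> topspace (cube_cyl n)" "z' \<in> topspace (cube_cyl n)"
      "(fst z, cube_to_simplex n (snd z)) = (fst z', cube_to_simplex n (snd z'))" for z z'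
      by (rule const [OF that])
  qed blast
  then obtain K where K: "continuous_map (simplex_cyl n) Y K"
    "\<And>z. z \<in> topspace (cube_cyl n) \<Longrightarrow> K (fst z, cube_to_simplex n (snd z)) = H z"
    by blast
  have K2: "K (t, cube_to_simplex n x) = H (t, x)" if "t \<in> {0..1}" "x \<in> topspace (cube n)" for t x
    using K(2) [of "(t, x)"] that by simp
  show thesis
  proof
    show "continuous_map (simplex_cyl n) Y K" by (rule K(1))
    show "K (t, cube_to_simplex n x) = H (t, x)" if "t \<in> {0..1}" "x \<in> topspace (cube n)" for t x
      by (rule K2 [OF that])
    fix t y assume t: "t \<in> {0..1::real}" and y: "y \<in> simplex_boundary n"
    obtain x where x: "x \<in> topspace (cube n)" "cube_to_simplex n x = y"
      using cube_to_simplex_surj [OF simplex_boundary_subset [OF y]] by blast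
    have xb: "x \<in> cube_boundary n"
      using cube_to_simplex_boundary [OF x(1)] x(2) y by simp
    show "K (t, y) = h (t, y)"
      using K2 [OF t x(1)] bd [OF t xb] x(2) by simp
  qed
qed

lemma simplex_HEP:
  assumes v: "continuous_map (simplex_top n) Y v" and w: "continuous_map (simplex_bdry_cyl n) Y w"
    and vw: "\<And>x. x \<in> simplex_boundary n \<Longrightarrow> w (0, x) = v x"
  shows "\<exists>H. continuous_map (simplex_cyl n) Y H \<and> (\<forall>x\<in>standard_simplex n. H (0, x) = v x) \<and>
    (\<forall>t\<in>{0..1}. \<forall>x\<in>simplex_boundary n. H (t, x) = w (t, x))"
proof -
  have "continuous_map (cube n) Y (\<lambda>x. v (cube_to_simplex n x))"
    using continuous_map_compose [OF continuous_map_cube_to_simplex v] by (simp add: o_def)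
  from cube_HEP [OF this continuous_map_bdry_cyl_to_simplex [OF w]]
  obtain H where H: "continuous_map (cube_cyl n) Y H"
    "\<forall>x\<in>topspace (cube n). H (0, x) = v (cube_to_simplex n x)"
    "\<forall>t\<in>{0..1}. \<forall>x\<in>cube_boundary n. H (t, x) = w (t, cube_to_simplex n x)"
    using vw cube_to_simplex_boundary cube_boundary_subset by fastforce
  obtain K where K: "continuous_map (simplex_cyl n) Y K"
    "\<And>t x. t \<in> {0..1} \<Longrightarrow> x \<in> topspace (cube n) \<Longrightarrow> K (t, cube_to_simplex n x) = H (t, x)"
    "\<And>t y. t \<in> {0..1} \<Longrightarrow> y \<in> simplex_boundary n \<Longrightarrow> K (t, y) = w (t, y)"
    by (rule descend_cyl [OF H(1), of w]) (use H(3) in auto)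
  have "K (0, y) = v y" if y: "y \<in> standard_simplex n" for y
  proof -
    obtain x where x: "x \<in> topspace (cube n)" "cube_to_simplex n x = y"
      using cube_to_simplex_surj [OF y] by blast
    show ?thesis using K(2) [of 0 x] H(2) x by simp
  qed
  then show ?thesis using K(1,3) by blast
qed

lemma weq_simplex_lift:
  assumes weq: "weak_homotopy_equivalence X Y f"
    and a: "continuous_map (subtopology (simplex_top n) (simplex_boundary n)) X a"
    and b: "continuous_map (simplex_top n) Y b" and h: "continuous_map (simplex_bdry_cyl n) Y h"
    and h0: "\<And>x. x \<in> simplex_boundary n \<Longrightarrow> h (0, x) = f (a x)"
    and h1: "\<And>x. x \<in> simplex_boundary n \<Longrightarrow> h (1, x) = b x"
  shows "\<exists>A H. continuous_map (simplex_top n) X A \<and> (\<forall>x\<in>simplex_boundary n. A x = a x) \<and>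
     continuous_map (simplex_cyl n) Y H \<and> (\<forall>x\<in>standard_simplex n. H (0, x) = f (A x) \<and> H (1, x) = b x) \<and>
     (\<forall>t\<in>{0..1}. \<forall>x\<in>simplex_boundary n. H (t, x) = h (t, x))"
proof -
  let ?r = "cube_to_simplex n"
  have rb: "?r x \<in> simplex_boundary n" if "x \<in> cube_boundary n" for x
    using that cube_to_simplex_boundary cube_boundary_subset by blast
  have "continuous_map (subtopology (cube n) (cube_boundary n)) (subtopology (simplex_top n) (simplex_boundary n)) ?r"
    by (rule continuous_map_into_subtopology [OF continuous_map_from_subtopology [OF continuous_map_cube_to_simplex]])
      (use rb in auto)
  from continuous_map_compose [OF this a]
  have ar: "continuous_map (subtopology (cube n) (cube_boundary n)) X (\<lambda>x. a (?r x))" by (simp add: o_def)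
  have br: "continuous_map (cube n) Y (\<lambda>x. b (?r x))"
    using continuous_map_compose [OF continuous_map_cube_to_simplex b] by (simp add: o_def)
  have "\<exists>A. continuous_map (cube n) X A \<and> (\<forall>x\<in>cube_boundary n. A x = a (?r x)) \<and>
      cube_htpy n Y (\<lambda>z. h (fst z, ?r (snd z))) (f \<circ> A) (\<lambda>x. b (?r x))"
    by (rule weq_cube_lift [OF weq ar br continuous_map_bdry_cyl_to_simplex [OF h]]) (simp_all add: h0 h1 rb)
  then obtain A H where A: "continuous_map (cube n) X A" "\<forall>x\<in>cube_boundary n. A x = a (?r x)"
    and H: "continuous_map (cube_cyl n) Y H" "\<forall>x\<in>topspace (cube n). H (0, x) = f (A x) \<and> H (1, x) = b (?r x)"
      "\<forall>t\<in>{0..1}. \<forall>x\<in>cube_boundary n. H (t, x) = h (t, ?r x)"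
    unfolding cube_htpy_def by auto
  \<comment> \<open>The lift \<open>A\<close> is made a homotopy independent of time, so that
    \<open>descend_cyl\<close> applies to it too; time 0 is taken afterwards.\<close>
  have "continuous_map (cube_cyl n) X (\<lambda>z. A (snd z))"
    using continuous_map_compose [OF continuous_map_snd A(1)] by (simp add: o_def)
  then obtain A' where A': "continuous_map (simplex_cyl n) X A'"
    "\<And>t x. t \<in> {0..1} \<Longrightarrow> x \<in> topspace (cube n) \<Longrightarrow> A' (t, ?r x) = A x"
    "\<And>t y. t \<in> {0..1} \<Longrightarrow> y \<in> simplex_boundary n \<Longrightarrow> A' (t, y) = a y"
    by (rule descend_cyl [where h = "\<lambda>z. a (snd z)"]) (use A(2) in auto)
  obtain K where K: "continuous_map (simplex_cyl n) Y K"
    "\<And>t x. t \<in> {0..1} \<Longrightarrow> x \<in> topspace (cube n) \<Longrightarrow> K (t, ?r x) = H (t, x)"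
    "\<And>t y. t \<in> {0..1} \<Longrightarrow> y \<in> simplex_boundary n \<Longrightarrow> K (t, y) = h (t, y)"
    by (rule descend_cyl [OF H(1), of h]) (use H(3) in auto)
  have "K (0, y) = f (A' (0, y)) \<and> K (1, y) = b y" if y: "y \<in> standard_simplex n" for y
  proof -
    obtain x where x: "x \<in> topspace (cube n)" "?r x = y"
      using cube_to_simplex_surj [OF y] by blast
    show ?thesis using K(2) [of 0 x] K(2) [of 1 x] A'(2) [of 0 x] H(2) x by simp
  qed
  moreover have "continuous_map (simplex_top n) X (\<lambda>x. A' (0, x))"
    by (rule continuous_map_pairD [OF _ _ A'(1)]) auto
  ultimately show ?thesis
    using A'(3) [of 0] K(1,3) by (intro exI [of _ "\<lambda>x. A' (0, x)"] exI [of _ K]) simp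
qed

section \<open>Faces and degeneracies of the simplex\<close>

lemma sum_simplical_face: "j \<le> n \<Longrightarrow> (\<Sum>i\<le>n. simplical_face j x i) = (\<Sum>i<n. x i)" for x :: "nat \<Rightarrow> real"
proof (induction n rule: dec_induct)
  case base
  have "(\<Sum>i<j. simplical_face j x i) = (\<Sum>i<j. x i)"
    by (rule sum.cong) (auto simp: simplical_face_def)
  then show ?case
    by (simp add: lessThan_Suc_atMost [symmetric]) (simp add: simplical_face_def)
next
  case (step n)
  then show ?case by (simp add: simplical_face_def)
qed

lemma simplical_face_in: "j \<le> Suc n \<Longrightarrow> x \<in> standard_simplex n \<Longrightarrow> simplical_face j x \<in> standard_simplex (Suc n)"
  using simplical_face_in_standard_simplex [of "Suc n" j x] by simp

lemma simplical_face_face: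
  assumes ij: "i < j"
  shows "simplical_face j (simplical_face i x) = simplical_face i (simplical_face (j - 1) x)"
proof
  fix p
  obtain j' where j: "j = Suc j'" "i \<le> j'" using ij by (cases j) auto
  show "simplical_face j (simplical_face i x) p = simplical_face i (simplical_face (j - 1) x) p"
    using j(2) by (cases p) (auto simp: simplical_face_def j(1))
qed

text \<open>The inverse of the face map \<open>simplical_face j\<close> on the points whose
  coordinate \<open>j\<close> is 0.\<close>

definition simplex_drop :: "nat \<Rightarrow> (nat \<Rightarrow> real) \<Rightarrow> nat \<Rightarrow> real" where
  "simplex_drop j x = (\<lambda>i. if i < j then x i else x (Suc i))"

lemma drop_face [simp]: "simplex_drop j (simplical_face j x) = x"
  by (auto simp: simplex_drop_def simplical_face_def fun_eq_iff)

lemma face_drop: "x j = 0 \<Longrightarrow> simplical_face j (simplex_drop j x) = x"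
  by (auto simp: simplex_drop_def simplical_face_def fun_eq_iff)

lemma simplex_drop_in:
  assumes x: "x \<in> standard_simplex (Suc n)" and j: "j \<le> Suc n" "x j = 0"
  shows "simplex_drop j x \<in> standard_simplex n"
proof -
  have "(\<Sum>i\<le>Suc n. x i) = (\<Sum>i<Suc n. simplex_drop j x i)"
    using sum_simplical_face [OF j(1), of "simplex_drop j x"] face_drop [of x j, OF j(2)] by simp
  then show ?thesis
    using x j by (auto simp: standard_simplex_def simplex_drop_def lessThan_Suc_atMost [symmetric])
qed

lemma face_boundary: "j \<le> Suc n \<Longrightarrow> x \<in> standard_simplex n \<Longrightarrow> simplical_face j x \<in> simplex_boundary (Suc n)"
  using simplical_face_in by (auto simp: simplex_boundary_def simplical_face_def)

lemma boundary_face: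
  assumes "x \<in> simplex_boundary (Suc n)"
  obtains j y where "j \<le> Suc n" "y \<in> standard_simplex n" "x = simplical_face j y"
proof -
  obtain j where j: "j \<le> Suc n" "x j = 0" using assms by (auto simp: simplex_boundary_def)
  then show thesis
    using that [OF j(1) simplex_drop_in [OF simplex_boundary_subset [OF assms] j]] face_drop [of x j, OF j(2)] by simp
qed

lemma simplex_boundary_0: "simplex_boundary 0 = {}"
  by (auto simp: simplex_boundary_def standard_simplex_0)

text \<open>The boundary is a finite union of closed faces, and on face \<open>j\<close> the glued
  map is \<open>g j\<close> after \<open>simplex_drop j\<close>. A point on two faces is a face of a
  face, where \<open>compat\<close> gives the agreement.\<close>

lemma glue_faces:
  assumes g: "\<And>j. j \<le> Suc m \<Longrightarrow> continuous_map (simplex_cyl m) W (g j)"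
    and compat: "\<And>l i j t x. \<lbrakk>m = Suc l; i < j; j \<le> Suc m; t \<in> {0..1}; x \<in> standard_simplex l\<rbrakk>
      \<Longrightarrow> g j (t, simplical_face i x) = g i (t, simplical_face (j - 1) x)"
  obtains G where "continuous_map (simplex_bdry_cyl (Suc m)) W G"
    "\<And>j t x. j \<le> Suc m \<Longrightarrow> t \<in> {0..1} \<Longrightarrow> x \<in> standard_simplex m \<Longrightarrow> G (t, simplical_face j x) = g j (t, x)"
proof -
  let ?X = "simplex_bdry_cyl (Suc m)"
  let ?f = "\<lambda>j z. g j (fst z, simplex_drop j (snd z))"
  define T where "T j = {z \<in> topspace ?X. snd z j \<in> {0}}" for j
  have coord: "continuous_map ?X euclideanreal (\<lambda>z. snd z i)" for i
    using continuous_map_compose [OF continuous_map_from_subtopology [OF continuous_map_snd] continuous_map_simplex_coord [of "Suc m" UNIV i]]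
    by (simp add: o_def)
  have key: "g j (t, simplex_drop j x) = g i (t, simplex_drop i x)"
    if ij: "i < j" "j \<le> Suc m" and t: "t \<in> {0..1}" and x: "x \<in> standard_simplex (Suc m)" "x i = 0" "x j = 0" for i j t x
  \<comment> \<open>For \<open>m = 0\<close> the faces are the two ends of an interval and do not
    meet: both coordinates would be 0, while their sum is 1.\<close>
  proof (cases m)
    case 0
    then have "i = 0" "j = 1" using ij by auto
    then show ?thesis using x 0 by (simp add: standard_simplex_def)
  next
    case (Suc l)
    define w where "w = simplex_drop i (simplex_drop j x)"
    have dj: "simplex_drop j x \<in> standard_simplex m" "simplex_drop j x i = 0"
      using simplex_drop_in [OF x(1) ij(2) x(3)] ij x(2) by (auto simp: simplex_drop_def)
    have w: "w \<in> standard_simplex l"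
      unfolding w_def using simplex_drop_in [of "simplex_drop j x" l i] dj ij Suc by simp
    have e1: "simplex_drop j x = simplical_face i w"
      unfolding w_def using face_drop [of "simplex_drop j x" i] dj(2) by simp
    have "x = simplical_face j (simplical_face i w)"
      using face_drop [of x j] x(3) e1 by simp
    then have "x = simplical_face i (simplical_face (j - 1) w)"
      using simplical_face_face [OF ij(1)] by simp
    then have e2: "simplex_drop i x = simplical_face (j - 1) w"
      by simp
    show ?thesis
      unfolding e1 e2 by (rule compat [OF Suc ij t w])
  qed
  obtain G where G: "continuous_map ?X W G" "\<And>z j. j \<in> {..Suc m} \<Longrightarrow> z \<in> topspace ?X \<inter> T j \<Longrightarrow> G z = ?f j z"
  proof (rule pasting_lemma_exists_closed [of "{..Suc m}" ?X T W ?f])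
    show "topspace ?X \<subseteq> \<Union> (T ` {..Suc m})"
      by (auto simp: T_def simplex_boundary_def)
    show "closedin ?X (T i)" for i
      unfolding T_def by (rule closedin_continuous_map_preimage [OF coord]) simp
    show "continuous_map (subtopology ?X (T j)) W (?f j)" if "j \<in> {..Suc m}" for j
    proof -
      have "continuous_map (subtopology ?X (T j)) (simplex_top m) (\<lambda>z. simplex_drop j (snd z))"
      proof (rule continuous_map_simplexI)
        show "simplex_drop j (snd z) \<in> standard_simplex m" if "z \<in> topspace (subtopology ?X (T j))" for z
          using that \<open>j \<in> {..Suc m}\<close> by (intro simplex_drop_in) (auto simp: T_def)
        show "continuous_map (subtopology ?X (T j)) euclideanreal (\<lambda>z. simplex_drop j (snd z) i)" for i
          using continuous_map_from_subtopology [OF coord] by (simp add: simplex_drop_def)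
      qed
      moreover have "continuous_map (subtopology ?X (T j)) unit_interval fst"
        by (intro continuous_map_from_subtopology continuous_map_fst)
      ultimately show ?thesis
        using continuous_map_pairD [OF _ _ g [of j], of "subtopology ?X (T j)" fst "\<lambda>z. simplex_drop j (snd z)"] that by simp
    qed
    show "?f i z = ?f j z" if "i \<in> {..Suc m}" "j \<in> {..Suc m}" "z \<in> topspace ?X \<inter> T i \<inter> T j" for i j z
    proof -
      have z: "fst z \<in> {0..1}" "snd z \<in> standard_simplex (Suc m)" "snd z i = 0" "snd z j = 0"
        using that(3) by (auto simp: T_def)
      show ?thesis
      proof (cases i j rule: linorder_cases)
        case less
        show ?thesis by (rule key [symmetric, OF less _ z(1,2,3,4)]) (use that in simp)
      next
        case greater
        show ?thesis by (rule key [OF greater _ z(1,2,4,3)]) (use that in simp)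
      qed simp
    qed
  qed auto
  show thesis
  proof (rule that [OF G(1)])
    fix j t x assume jx: "j \<le> Suc m" "t \<in> {0..1::real}" "x \<in> standard_simplex m"
    have "(t, simplical_face j x) \<in> topspace ?X \<inter> T j"
      using face_boundary [OF jx(1,3)] simplical_face_in [OF jx(1,3)] jx(2) by (simp add: T_def) (simp add: simplical_face_def)
    then show "G (t, simplical_face j x) = g j (t, x)"
      using G(2) [of j "(t, simplical_face j x)"] jx(1) by simp
  qed
qed

text \<open>The affine map that sends vertices \<open>i\<close> and \<open>i + 1\<close> both to
  vertex \<open>i\<close>; composing with it is the degeneracy of index \<open>i\<close>.\<close>

definition simplex_merge :: "nat \<Rightarrow> (nat \<Rightarrow> real) \<Rightarrow> nat \<Rightarrow> real" where
  "simplex_merge i x = (\<lambda>j. if j < i then x j else if j = i then x i + x (Suc i) else x (Suc j))"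

lemma simplex_merge_in:
  assumes x: "x \<in> standard_simplex (Suc k)" and i: "i \<le> k"
  shows "simplex_merge i x \<in> standard_simplex k"
proof -
  have x0: "0 \<le> x j" and xk: "Suc k < j \<Longrightarrow> x j = 0" and xs: "(\<Sum>j\<le>Suc k. x j) = 1" for j
    using x by (auto simp: standard_simplex_def)
  have sum: "(\<Sum>j\<le>k. simplex_merge i x j) = (\<Sum>j\<le>Suc k. x j)"
    using i
  proof (induction k rule: dec_induct)
    case base
    have "(\<Sum>j<i. simplex_merge i x j) = (\<Sum>j<i. x j)"
      by (rule sum.cong) (auto simp: simplex_merge_def)
    then show ?case
      by (simp add: lessThan_Suc_atMost [symmetric]) (simp add: simplex_merge_def)
  next
    case (step n)
    then show ?case by (simp add: simplex_merge_def)
  qed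
  have m0: "0 \<le> simplex_merge i x j" for j
    using x0 by (simp add: simplex_merge_def)
  have mk: "simplex_merge i x j = 0" if "k < j" for j
    using xk that i by (simp add: simplex_merge_def)
  have "simplex_merge i x j \<le> 1" for j
  proof (cases "j \<le> k")
    case True
    then have "simplex_merge i x j \<le> (\<Sum>j\<le>k. simplex_merge i x j)"
      using m0 by (intro member_le_sum) auto
    then show ?thesis using sum xs by simp
  qed (simp add: mk)
  then show ?thesis
    unfolding standard_simplex_def using m0 mk sum xs by simp
qed

lemma merge_face_less:
  assumes "j < i"
  shows "simplex_merge i (simplical_face j x) = simplical_face j (simplex_merge (i - 1) x)"
proof
  fix p
  obtain i' where i: "i = Suc i'" "j \<le> i'" using assms by (cases i) auto
  show "simplex_merge i (simplical_face j x) p = simplical_face j (simplex_merge (i - 1) x) p"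
    using i(2) by (cases p) (auto simp: simplical_face_def simplex_merge_def i(1))
qed

lemma merge_face_eq:
  assumes "j = i \<or> j = Suc i"
  shows "simplex_merge i (simplical_face j x) = x"
proof
  fix p
  consider "p < i" | "p = i" | "i < p" by linarith
  then show "simplex_merge i (simplical_face j x) p = x p"
    using assms by cases (auto simp: simplical_face_def simplex_merge_def)
qed

lemma merge_face_greater:
  assumes "Suc i < j"
  shows "simplex_merge i (simplical_face j x) = simplical_face (j - 1) (simplex_merge i x)"
proof
  fix p
  obtain j' where j: "j = Suc j'" "i < j'" using assms by (cases j) auto
  show "simplex_merge i (simplical_face j x) p = simplical_face (j - 1) (simplex_merge i x) p"
    using j(2) by (cases p) (auto simp: simplical_face_def simplex_merge_def j(1))
qed

lemma continuous_map_simplical_face: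
  assumes "j \<le> Suc n"
  shows "continuous_map (simplex_top n) (simplex_top (Suc n)) (simplical_face j)"
proof (rule continuous_map_simplexI)
  show "continuous_map (simplex_top n) euclideanreal (\<lambda>x. simplical_face j x i)" for i
    using continuous_map_simplex_coord [of n UNIV] by (simp add: simplical_face_def)
qed (use simplical_face_in [OF assms] in auto)

lemma continuous_map_simplex_merge:
  assumes "i \<le> k"
  shows "continuous_map (simplex_top (Suc k)) (simplex_top k) (simplex_merge i)"
proof (rule continuous_map_simplexI)
  show "continuous_map (simplex_top (Suc k)) euclideanreal (\<lambda>x. simplex_merge i x j)" for j
    using continuous_map_simplex_coord [of "Suc k" UNIV] by (simp add: simplex_merge_def continuous_intros)
qed (use simplex_merge_in [OF _ assms] in auto)

section \<open>Transport along paths in simplices\<close>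

text \<open>The cylinder over a simplex is convex, so the straight-line homotopy stays inside and
  fixes common ends.\<close>

lemma path_homotopic_simplex_cyl:
  assumes c: "pathin (simplex_cyl n) c" and c': "pathin (simplex_cyl n) c'"
    and ends: "c 0 = c' 0" "c 1 = c' 1"
  shows "path_homotopic (simplex_cyl n) c c'"
proof -
  let ?h = "\<lambda>z. ((1 - fst z) * fst (c (snd z)) + fst z * fst (c' (snd z)),
      \<lambda>i. (1 - fst z) * snd (c (snd z)) i + fst z * snd (c' (snd z)) i)"
  let ?Q = "prod_topology unit_interval unit_interval"
  have in_cyl: "fst (c t) \<in> {0..1} \<and> snd (c t) \<in> standard_simplex n \<and> fst (c' t) \<in> {0..1} \<and> snd (c' t) \<in> standard_simplex n"
    if "t \<in> {0..1}" for t
  proof -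
    have "c t \<in> topspace (simplex_cyl n)" "c' t \<in> topspace (simplex_cyl n)"
      using continuous_map_image_subset_topspace [OF c [unfolded pathin_def]]
        continuous_map_image_subset_topspace [OF c' [unfolded pathin_def]] that by (simp_all add: image_subset_iff del: topspace_prod_topology)
    then show ?thesis by auto
  qed
  have time: "continuous_map ?Q euclideanreal fst"
    using continuous_map_time [of unit_interval UNIV] by simp
  have fst_c: "continuous_map ?Q euclideanreal (\<lambda>z. fst (d (snd z)))" and snd_c: "continuous_map ?Q euclideanreal (\<lambda>z. snd (d (snd z)) i)"
    if "pathin (simplex_cyl n) d" for d i
  proof -
    have d: "continuous_map ?Q (simplex_cyl n) (\<lambda>z. d (snd z))"
      using continuous_map_compose [OF continuous_map_snd [of unit_interval unit_interval] that [unfolded pathin_def]]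
      by (simp only: o_def)
    show "continuous_map ?Q euclideanreal (\<lambda>z. fst (d (snd z)))"
      using continuous_map_into_fulltopology [OF continuous_map_compose [OF d continuous_map_fst]] by (simp add: o_def)
    show "continuous_map ?Q euclideanreal (\<lambda>z. snd (d (snd z)) i)"
      using continuous_map_compose [OF continuous_map_compose [OF d continuous_map_snd] continuous_map_simplex_proj [of n i]]
      by (simp add: o_def)
  qed
  have "continuous_map ?Q (simplex_cyl n) ?h"
  proof (intro continuous_map_pairedI)
    show "continuous_map ?Q unit_interval (\<lambda>z. (1 - fst z) * fst (c (snd z)) + fst z * fst (c' (snd z)))"
    proof (rule continuous_map_into_subtopology)
      show "continuous_map ?Q euclideanreal (\<lambda>z. (1 - fst z) * fst (c (snd z)) + fst z * fst (c' (snd z)))"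
        by (intro continuous_intros time fst_c c c') simp
      show "(\<lambda>z. (1 - fst z) * fst (c (snd z)) + fst z * fst (c' (snd z))) \<in> topspace ?Q \<rightarrow> {0..1}"
      proof
        fix z assume "z \<in> topspace ?Q"
        then have z: "fst z \<in> {0..1}" "snd z \<in> {0..1}" by auto
        have b: "0 \<le> fst (c (snd z))" "fst (c (snd z)) \<le> 1" "0 \<le> fst (c' (snd z))" "fst (c' (snd z)) \<le> 1"
          using in_cyl [OF z(2)] by simp_all
        have "(1 - fst z) * fst (c (snd z)) + fst z * fst (c' (snd z)) \<le> 1"
          by (rule convex_bound_le) (use z(1) b in auto)
        moreover have "0 \<le> (1 - fst z) * fst (c (snd z)) + fst z * fst (c' (snd z))"
          using z(1) b by simp
        ultimately show "(1 - fst z) * fst (c (snd z)) + fst z * fst (c' (snd z)) \<in> {0..1}" by simp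
      qed
    qed
    show "continuous_map ?Q (simplex_top n) (\<lambda>z i. (1 - fst z) * snd (c (snd z)) i + fst z * snd (c' (snd z)) i)"
    proof (rule continuous_map_simplexI)
      show "continuous_map ?Q euclideanreal (\<lambda>z. (1 - fst z) * snd (c (snd z)) i + fst z * snd (c' (snd z)) i)" for i
        by (intro continuous_intros time snd_c c c') simp
      fix z assume "z \<in> topspace ?Q"
      then have z: "0 \<le> fst z" "fst z \<le> 1" "snd z \<in> {0..1}" by auto
      then show "(\<lambda>i. (1 - fst z) * snd (c (snd z)) i + fst z * snd (c' (snd z)) i) \<in> standard_simplex n"
        using convex_standard_simplex [of "snd (c (snd z))" n "snd (c' (snd z))" "fst z"] in_cyl [OF z(3)] by blast
    qed
  qed
  moreover have "?h (t, 0) = c 0 \<and> ?h (t, 1) = c 1" if "t \<in> {0..1}" for t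
    using ends by (simp add: algebra_simps prod_eq_iff)
  ultimately show ?thesis
    unfolding path_homotopic_def homotopic_with_def
    by (intro exI [of _ ?h]) (simp add: algebra_simps prod_eq_iff)
qed

lemma pathin_concat:
  assumes u: "pathin X u" and v: "pathin X v" and uv: "u 1 = v 0"
  shows "pathin X (path_concat u v)"
  unfolding pathin_def path_concat_def
proof (rule continuous_map_cases_le)
  have id: "continuous_map unit_interval euclideanreal (\<lambda>t. t)"
    by (simp add: continuous_map_from_subtopology)
  then show "continuous_map unit_interval euclideanreal (\<lambda>t. t)" "continuous_map unit_interval euclideanreal (\<lambda>t. 1/2)" by auto
  have "continuous_map (subtopology unit_interval {t \<in> topspace unit_interval. t \<le> 1/2}) unit_interval (\<lambda>t. 2 * t)"
    by (rule continuous_map_into_subtopology [OF continuous_map_from_subtopology]) (use id in \<open>auto intro!: continuous_intros\<close>)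
  from continuous_map_compose [OF this u [unfolded pathin_def]]
  show "continuous_map (subtopology unit_interval {t \<in> topspace unit_interval. t \<le> 1/2}) X (\<lambda>t. u (2 * t))"
    by (simp add: o_def)
  have "continuous_map (subtopology unit_interval {t \<in> topspace unit_interval. 1/2 \<le> t}) unit_interval (\<lambda>t. 2 * t - 1)"
    by (rule continuous_map_into_subtopology [OF continuous_map_from_subtopology]) (use id in \<open>auto intro!: continuous_intros\<close>)
  from continuous_map_compose [OF this v [unfolded pathin_def]]
  show "continuous_map (subtopology unit_interval {t \<in> topspace unit_interval. 1/2 \<le> t}) X (\<lambda>t. v (2 * t - 1))"
    by (simp add: o_def)
  show "u (2 * t) = v (2 * t - 1)" if "t = 1/2" for t
    unfolding that using uv by simp
qed

lemma path_concat_ends: "path_concat u v 0 = u 0" "path_concat u v 1 = v 1"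
  by (simp_all add: path_concat_def)

lemma
  assumes "coefficient_system X G"
  shows coefficient_grp: "x \<in> topspace X \<Longrightarrow> comm_group (fibre G x)"
    and transport_iso: "pathin X u \<Longrightarrow> transport G u \<in> iso (fibre G (u 1)) (fibre G (u 0))"
    and transport_homotopic: "path_homotopic X u v \<Longrightarrow> g \<in> carrier (fibre G (u 1)) \<Longrightarrow> transport G u g = transport G v g"
    and transport_const: "x \<in> topspace X \<Longrightarrow> g \<in> carrier (fibre G x) \<Longrightarrow> transport G (\<lambda>_. x) g = g"
    and transport_concat: "pathin X u \<Longrightarrow> pathin X v \<Longrightarrow> u 1 = v 0 \<Longrightarrow> g \<in> carrier (fibre G (v 1)) \<Longrightarrow>
      transport G (path_concat u v) g = transport G u (transport G v g)"
  using assms unfolding coefficient_system_def by blast+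

text \<open>Paths are functions on all reals. Two of them that agree on the unit interval are
  homotopic relative to the ends, by a constant homotopy, hence have the same transport.\<close>

lemma transport_cong:
  assumes G: "coefficient_system X G" and u: "pathin X u" and uv: "\<And>t. t \<in> {0..1} \<Longrightarrow> u t = v t"
    and g: "g \<in> carrier (fibre G (u 1))"
  shows "transport G u g = transport G v g"
proof (rule transport_homotopic [where u = u, OF G _ g])
  show "path_homotopic X u v"
    unfolding path_homotopic_def
    by (rule homotopic_with_equal) (use u uv [of 0] uv [of 1] uv in \<open>auto simp: pathin_def\<close>)
qed

text \<open>The source of the identities between transports along different routes: both paths
  factor through one map on a convex cylinder, where their lifts have common ends.\<close>

lemma transport_simplex_cyl:
  assumes G: "coefficient_system Y G" and F: "continuous_map (simplex_cyl n) Y F"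
    and c: "pathin (simplex_cyl n) c" and c': "pathin (simplex_cyl n) c'"
    and ends: "c 0 = c' 0" "c 1 = c' 1"
    and u: "\<And>t. t \<in> {0..1} \<Longrightarrow> F (c t) = u t" and v: "\<And>t. t \<in> {0..1} \<Longrightarrow> F (c' t) = v t"
    and g: "g \<in> carrier (fibre G (u 1))"
  shows "transport G u g = transport G v g"
proof -
  have p: "pathin Y (F \<circ> c)" "pathin Y (F \<circ> c')"
    using pathin_compose [OF c F] pathin_compose [OF c' F] .
  have "u 1 = (F \<circ> c) 1" "u 1 = (F \<circ> c') 1"
    using u [of 1] ends(2) by simp_all
  then have g1: "g \<in> carrier (fibre G ((F \<circ> c) 1))" and g2: "g \<in> carrier (fibre G ((F \<circ> c') 1))"
    using g by simp_all
  have "path_homotopic Y (F \<circ> c) (F \<circ> c')"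
    using path_homotopic_simplex_cyl [OF c c' ends] unfolding path_homotopic_def
    by (rule homotopic_with_compose_continuous_map_left [OF _ F]) auto
  then have "transport G (F \<circ> c) g = transport G (F \<circ> c') g"
    by (rule transport_homotopic [where u = "F \<circ> c", OF G _ g1])
  moreover have "transport G (F \<circ> c) g = transport G u g"
    by (rule transport_cong [OF G p(1) _ g1]) (simp add: u)
  moreover have "transport G (F \<circ> c') g = transport G v g"
    by (rule transport_cong [OF G p(2) _ g2]) (simp add: v)
  ultimately show ?thesis by simp
qed

text \<open>It runs from vertex 1 to vertex 0. As transport is contravariant, this gives a map from
  the fibre over vertex 0 to the fibre over vertex 1, as face 0 requires.\<close>

definition simplex_edge :: "real \<Rightarrow> nat \<Rightarrow> real" where
  "simplex_edge t = (\<lambda>j. (1 - t) * vertex 1 j + t * vertex 0 j)"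

lemma edge_path_eq: "edge_path \<sigma> t = \<sigma> (simplex_edge t)"
  by (simp add: edge_path_def simplex_edge_def)

lemma simplex_edge_ends [simp]: "simplex_edge 0 = vertex 1" "simplex_edge 1 = vertex 0"
  by (auto simp: simplex_edge_def)

lemma vertex_in: "i \<le> n \<Longrightarrow> vertex i \<in> standard_simplex n"
  by (simp add: vertex_def)

lemma simplex_edge_in: "t \<in> {0..1} \<Longrightarrow> simplex_edge t \<in> standard_simplex (Suc n)"
  unfolding simplex_edge_def by (rule convex_standard_simplex) (auto intro: vertex_in)

lemma pathin_simplex_edge: "pathin (simplex_top (Suc n)) simplex_edge"
  unfolding pathin_def
proof (rule continuous_map_simplexI)
  show "continuous_map unit_interval euclideanreal (\<lambda>z. simplex_edge z i)" for i
    unfolding simplex_edge_def by (intro continuous_intros) (auto simp: continuous_map_from_subtopology)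
qed (use simplex_edge_in in auto)

lemma face_vertex:
  "simplical_face 0 (vertex i) = vertex (Suc i)"
  "1 \<le> i \<Longrightarrow> simplical_face i (vertex 0) = vertex 0"
  "simplical_face (Suc 0) (vertex (Suc 0)) = vertex 2"
  by (auto simp: simplical_face_def vertex_def fun_eq_iff)

lemma face_edge: "2 \<le> i \<Longrightarrow> simplical_face i (simplex_edge t) = simplex_edge t"
  by (auto simp: simplical_face_def simplex_edge_def vertex_def fun_eq_iff)

lemma merge_edge: "simplex_merge 0 (simplex_edge t) = vertex 0" "1 \<le> i \<Longrightarrow> simplex_merge i (simplex_edge t) = simplex_edge t"
  by (auto simp: simplex_merge_def simplex_edge_def vertex_def fun_eq_iff)

lemma merge_vertex: "simplex_merge i (vertex 0) = vertex 0"
  by (auto simp: simplex_merge_def vertex_def fun_eq_iff)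

lemma singular_face_apply: "x \<in> standard_simplex k \<Longrightarrow> singular_face (Suc k) i \<sigma> x = \<sigma> (simplical_face i x)"
  by (simp add: singular_face_def)

lemma singular_simplexD:
  "singular_simplex k X \<sigma> \<Longrightarrow> continuous_map (simplex_top k) X \<sigma>"
  "singular_simplex k X \<sigma> \<Longrightarrow> \<sigma> \<in> extensional (standard_simplex k)"
  by (simp_all add: singular_simplex_def)

lemma singular_simplex_pathin: "singular_simplex k X \<sigma> \<Longrightarrow> pathin (simplex_top k) c \<Longrightarrow> pathin X (\<lambda>t. \<sigma> (c t))"
  using pathin_compose [of "simplex_top k" c X \<sigma>] singular_simplexD(1) [of k X \<sigma>] by (simp add: o_def)

lemma face_system_singular: "face_system (\<lambda>k. singular_simplex_set k X) singular_face"
proof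
  show "singular_face (Suc k) i \<sigma> \<in> singular_simplex_set k X" if "\<sigma> \<in> singular_simplex_set (Suc k) X" "i \<le> Suc k" for \<sigma> k i
    using singular_simplex_singular_face [of "Suc k" X \<sigma> i] that by simp
  show "singular_face (Suc k) i (singular_face (Suc (Suc k)) j \<sigma>) = singular_face (Suc k) (j - 1) (singular_face (Suc (Suc k)) i \<sigma>)"
    if "i < j" "j \<le> Suc (Suc k)" for \<sigma> :: "(nat \<Rightarrow> real) \<Rightarrow> 'a" and k i j
    unfolding singular_face_def using that
    by (intro restrict_ext) (simp add: simplical_face_in simplical_face_face)
qed

lemma simplex_vertex_in: "singular_simplex k X \<sigma> \<Longrightarrow> i \<le> k \<Longrightarrow> \<sigma> (vertex i) \<in> topspace X"
  using singular_simplexD(1) [of k X \<sigma>] vertex_in [of i k] by (auto simp: continuous_map_def)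

text \<open>For the cocycle condition, the edges from vertex 2 to 1 and from 1 to 0, run through in
  this order, are homotopic inside the simplex to the edge from 2 to 0, which is the first edge of
  face 1.\<close>

lemma local_system_singular:
  assumes G: "coefficient_system X G"
  shows "local_system (\<lambda>k. singular_simplex_set k X) singular_face (simplex_fibre G) (\<lambda>\<sigma>. transport G (edge_path \<sigma>))"
proof (rule local_system.intro [OF face_system_singular], rule local_system_axioms.intro)
  show "comm_group (simplex_fibre G \<sigma>)" if "\<sigma> \<in> singular_simplex_set k X" for \<sigma> k
    unfolding simplex_fibre_def using coefficient_grp [OF G simplex_vertex_in] that by blast
next
  fix \<sigma> k assume "\<sigma> \<in> singular_simplex_set (Suc k) X"
  then have \<sigma>: "singular_simplex (Suc k) X \<sigma>" by simp
  show "simplex_fibre G (singular_face (Suc k) i \<sigma>) = simplex_fibre G \<sigma>" if "1 \<le> i" "i \<le> Suc k" for i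
    using that by (simp add: simplex_fibre_def singular_face_apply vertex_in face_vertex)
  have "pathin X (edge_path \<sigma>)"
    using singular_simplex_pathin [OF \<sigma> pathin_simplex_edge] by (simp add: edge_path_eq [abs_def])
  from transport_iso [OF G this]
  show "transport G (edge_path \<sigma>) \<in> iso (simplex_fibre G \<sigma>) (simplex_fibre G (singular_face (Suc k) 0 \<sigma>))"
    by (simp add: edge_path_eq simplex_fibre_def singular_face_apply vertex_in face_vertex)
next
  fix \<sigma> k g assume "\<sigma> \<in> singular_simplex_set (Suc (Suc k)) X" and g: "g \<in> carrier (simplex_fibre G \<sigma>)"
  then have \<sigma>: "singular_simplex (Suc (Suc k)) X \<sigma>" by simp
  have face_path: "pathin (simplex_top (Suc (Suc k))) (\<lambda>t. simplical_face i (simplex_edge t))" if "i \<le> Suc (Suc k)" for i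
    using pathin_compose [OF pathin_simplex_edge continuous_map_simplical_face [OF that]] by (simp add: o_def)
  have edge_face: "edge_path (singular_face (Suc (Suc k)) i \<sigma>) t = \<sigma> (simplical_face i (simplex_edge t))"
    if "t \<in> {0..1}" for t i
    using that by (simp add: edge_path_eq singular_face_apply simplex_edge_in)
  have sfp: "pathin X (edge_path (singular_face (Suc (Suc k)) i \<sigma>))" if "i \<le> Suc (Suc k)" for i
    using singular_simplex_pathin [OF singular_simplex_singular_face [OF \<sigma> _ that, simplified] pathin_simplex_edge]
    by (simp add: edge_path_eq [abs_def])
  have sp: "pathin X (edge_path \<sigma>)"
    using singular_simplex_pathin [OF \<sigma> pathin_simplex_edge] by (simp add: edge_path_eq [abs_def])
  have g1: "g \<in> carrier (fibre G (edge_path \<sigma> 1))"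
    using g by (simp add: edge_path_eq simplex_fibre_def)
  let ?u = "edge_path (singular_face (Suc (Suc k)) 0 \<sigma>)" and ?v = "edge_path \<sigma>"
  let ?c = "path_concat (\<lambda>t. simplical_face 0 (simplex_edge t)) simplex_edge"
  have uv: "?u 1 = ?v 0"
    using edge_face [of 1 0] by (simp add: edge_path_eq face_vertex)
  have "transport G ?u (transport G ?v g) = transport G (path_concat ?u ?v) g"
    by (rule transport_concat [OF G sfp sp uv g1, symmetric]) simp
  \<comment> \<open>Both paths are placed at height 0 of the cylinder over the simplex, with a map
    that ignores the height.\<close>
  also have "\<dots> = transport G (edge_path (singular_face (Suc (Suc k)) 1 \<sigma>)) g"
  proof (rule transport_simplex_cyl [OF G, where F = "\<lambda>z. \<sigma> (snd z)" and c = "\<lambda>t. (0, ?c t)"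
        and c' = "\<lambda>t. (0, simplical_face 1 (simplex_edge t))"])
    show "continuous_map (simplex_cyl (Suc (Suc k))) X (\<lambda>z. \<sigma> (snd z))"
      using continuous_map_compose [OF continuous_map_snd singular_simplexD(1) [OF \<sigma>]] by (simp add: o_def)
    have "pathin (simplex_top (Suc (Suc k))) ?c"
      by (rule pathin_concat [OF face_path pathin_simplex_edge]) (simp_all add: face_vertex)
    then show "pathin (simplex_cyl (Suc (Suc k))) (\<lambda>t. (0, ?c t))"
      unfolding pathin_def by (intro continuous_map_pairedI) auto
    show "pathin (simplex_cyl (Suc (Suc k))) (\<lambda>t. (0, simplical_face 1 (simplex_edge t)))"
      using face_path [of 1] unfolding pathin_def by (intro continuous_map_pairedI) auto
    show "\<sigma> (snd (0::real, ?c t)) = path_concat ?u ?v t" if "t \<in> {0..1}" for t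
      using edge_face [of "2 * t" 0] that by (auto simp: path_concat_def edge_path_eq)
    show "\<sigma> (snd (0::real, simplical_face 1 (simplex_edge t))) = edge_path (singular_face (Suc (Suc k)) 1 \<sigma>) t" if "t \<in> {0..1}" for t
      using edge_face [OF that] by simp
    show "g \<in> carrier (fibre G (path_concat ?u ?v 1))"
      using g1 by (simp add: path_concat_ends)
  qed (simp_all add: path_concat_ends face_vertex numeral_2_eq_2)
  finally show "transport G ?u (transport G ?v g) = transport G (edge_path (singular_face (Suc (Suc k)) 1 \<sigma>)) g" .
  show "transport G (edge_path (singular_face (Suc (Suc k)) i \<sigma>)) g = transport G (edge_path \<sigma>) g"
    if i: "2 \<le> i" "i \<le> Suc (Suc k)" for i
  proof (rule transport_cong [OF G sp _ g1, symmetric])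
    show "edge_path \<sigma> t = edge_path (singular_face (Suc (Suc k)) i \<sigma>) t" if "t \<in> {0..1}" for t
      using edge_face [OF that, of i] face_edge [OF i(1)] by (simp add: edge_path_eq)
  qed
qed

section \<open>Trivial fibrations over singular simplices\<close>

definition simplex_degen :: "nat \<Rightarrow> nat \<Rightarrow> ((nat \<Rightarrow> real) \<Rightarrow> 'a) \<Rightarrow> (nat \<Rightarrow> real) \<Rightarrow> 'a" where
  "simplex_degen k i \<sigma> = restrict (\<sigma> \<circ> simplex_merge i) (standard_simplex (Suc k))"

lemma simplex_degen_apply: "x \<in> standard_simplex (Suc k) \<Longrightarrow> simplex_degen k i \<sigma> x = \<sigma> (simplex_merge i x)"
  by (simp add: simplex_degen_def)

text \<open>The conditions on degeneracies hold for the singular simplices of any space, so only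
  those on the total complex and its lifting property remain.\<close>

lemma trivial_fibration_singularI:
  assumes G: "coefficient_system X G" and E: "face_system SE dE"
    and "\<And>e k. e \<in> SE k \<Longrightarrow> p e \<in> singular_simplex_set k X"
    and "\<And>e k i. e \<in> SE (Suc k) \<Longrightarrow> i \<le> Suc k \<Longrightarrow> p (dE (Suc k) i e) = singular_face (Suc k) i (p e)"
    and "\<And>\<sigma>. \<sigma> \<in> singular_simplex_set 0 X \<Longrightarrow> \<exists>e\<in>SE 0. p e = \<sigma>"
    and "\<And>\<sigma> k x. \<lbrakk>\<sigma> \<in> singular_simplex_set (Suc k) X;
        \<And>j. j \<le> Suc k \<Longrightarrow> x j \<in> SE k \<and> p (x j) = singular_face (Suc k) j \<sigma>;
        \<And>l i j. \<lbrakk>k = Suc l; i < j; j \<le> Suc k\<rbrakk> \<Longrightarrow> dE k i (x j) = dE k (j - 1) (x i)\<rbrakk>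
      \<Longrightarrow> \<exists>e\<in>SE (Suc k). p e = \<sigma> \<and> (\<forall>j\<le>Suc k. dE (Suc k) j e = x j)"
  shows "trivial_fibration (\<lambda>k. singular_simplex_set k X) singular_face (simplex_fibre G)
     (\<lambda>\<sigma>. transport G (edge_path \<sigma>)) SE dE p simplex_degen"
proof (rule trivial_fibration.intro [OF local_system_singular [OF G] E], rule trivial_fibration_axioms.intro)
  show "simplex_degen k i \<sigma> \<in> singular_simplex_set (Suc k) X" if "\<sigma> \<in> singular_simplex_set k X" "i \<le> k" for \<sigma> k i
    using continuous_map_compose [OF continuous_map_simplex_merge [OF that(2)] singular_simplexD(1)] that(1)
    by (simp add: singular_simplex_def simplex_degen_def)
  show "singular_face (Suc (Suc k)) j (simplex_degen (Suc k) i \<sigma>) = simplex_degen k (i - 1) (singular_face (Suc k) j \<sigma>)"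
    if "i \<le> Suc k" "j < i" for \<sigma> :: "(nat \<Rightarrow> real) \<Rightarrow> 'a" and k i j
    unfolding singular_face_def simplex_degen_def using that
    by (simp, intro restrict_ext) (simp add: simplical_face_in simplex_merge_in merge_face_less)
  show "singular_face (Suc k) j (simplex_degen k i \<sigma>) = \<sigma>"
    if \<sigma>: "\<sigma> \<in> singular_simplex_set k X" and "i \<le> k" "j = i \<or> j = Suc i" for \<sigma> k i j
  proof -
    have "singular_face (Suc k) j (simplex_degen k i \<sigma>) = restrict \<sigma> (standard_simplex k)"
      unfolding singular_face_def simplex_degen_def using that(2,3)
      by (simp, intro restrict_ext) (auto simp: simplical_face_in merge_face_eq)
    then show ?thesis
      using singular_simplexD(2) [of k X \<sigma>] \<sigma> by (simp add: extensional_restrict)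
  qed
  show "singular_face (Suc (Suc k)) j (simplex_degen (Suc k) i \<sigma>) = simplex_degen k i (singular_face (Suc k) (j - 1) \<sigma>)"
    if "Suc i < j" "j \<le> Suc (Suc k)" for \<sigma> :: "(nat \<Rightarrow> real) \<Rightarrow> 'a" and k i j
    unfolding singular_face_def simplex_degen_def using that
    by (simp, intro restrict_ext) (simp add: simplical_face_in simplex_merge_in merge_face_greater)
  show "simplex_fibre G (simplex_degen k i \<sigma>) = simplex_fibre G \<sigma>" for k i \<sigma>
    by (simp add: simplex_fibre_def simplex_degen_apply vertex_in merge_vertex)
  have edge_degen: "edge_path (simplex_degen k i \<sigma>) t = \<sigma> (simplex_merge i (simplex_edge t))"
    if "t \<in> {0..1}" for k i t and \<sigma> :: "(nat \<Rightarrow> real) \<Rightarrow> 'a"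
    using that by (simp add: edge_path_eq simplex_degen_apply simplex_edge_in)
  show "transport G (edge_path (simplex_degen k 0 \<sigma>)) g = g"
    if \<sigma>: "\<sigma> \<in> singular_simplex_set k X" and g: "g \<in> carrier (simplex_fibre G \<sigma>)" for \<sigma> k g
  proof -
    have x: "\<sigma> (vertex 0) \<in> topspace X" using simplex_vertex_in [of k X \<sigma> 0] \<sigma> by simp
    have "transport G (\<lambda>_. \<sigma> (vertex 0)) g = transport G (edge_path (simplex_degen k 0 \<sigma>)) g"
      by (rule transport_cong [OF G])
        (use x g edge_degen merge_edge(1) in \<open>simp_all add: simplex_fibre_def pathin_const\<close>)
    then show ?thesis
      using transport_const [OF G x] g by (simp add: simplex_fibre_def)
  qed
  show "transport G (edge_path (simplex_degen k i \<sigma>)) g = transport G (edge_path \<sigma>) g"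
    if \<sigma>: "\<sigma> \<in> singular_simplex_set k X" and i: "1 \<le> i" "i \<le> k" and g: "g \<in> carrier (simplex_fibre G \<sigma>)" for \<sigma> k i g
  proof -
    obtain l where k: "k = Suc l" using i by (cases k) auto
    have "pathin X (edge_path \<sigma>)"
      using singular_simplex_pathin [of k X \<sigma>, OF _ pathin_simplex_edge [of l, folded k]] \<sigma> by (simp add: edge_path_eq [abs_def])
    then have "transport G (edge_path \<sigma>) g = transport G (edge_path (simplex_degen k i \<sigma>)) g"
      by (rule transport_cong [OF G]) (use g edge_degen merge_edge(2) [OF i(1)] in \<open>simp_all add: edge_path_eq simplex_fibre_def\<close>)
    then show ?thesis by simp
  qed
qed (fact assms)+

section \<open>Simplices with a path to a simplex of the target\<close>

text \<open>The singular simplices of the path fibration of \<open>f\<close>: a simplex \<open>\<tau>\<close> of \<open>X\<close> with a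
  homotopy from \<open>f \<circ> \<tau>\<close>, whose final value is a simplex of \<open>Y\<close>.\<close>

definition path_simplices ::
  "'a topology \<Rightarrow> 'b topology \<Rightarrow> ('a \<Rightarrow> 'b) \<Rightarrow> nat \<Rightarrow> (((nat \<Rightarrow> real) \<Rightarrow> 'a) \<times> (real \<times> (nat \<Rightarrow> real) \<Rightarrow> 'b)) set" where
  "path_simplices X Y f k = {e. singular_simplex k X (fst e) \<and> snd e \<in> extensional ({0..1} \<times> standard_simplex k) \<and>
     continuous_map (simplex_cyl k) Y (snd e) \<and> (\<forall>x\<in>standard_simplex k. snd e (0, x) = f (fst e x))}"

text \<open>The restriction keeps homotopies extensional, so that the agreement of two faces is an
  equality of functions.\<close>

definition path_face ::
  "nat \<Rightarrow> nat \<Rightarrow> ((nat \<Rightarrow> real) \<Rightarrow> 'a) \<times> (real \<times> (nat \<Rightarrow> real) \<Rightarrow> 'b) \<Rightarrow> ((nat \<Rightarrow> real) \<Rightarrow> 'a) \<times> (real \<times> (nat \<Rightarrow> real) \<Rightarrow> 'b)" where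
  "path_face k i e = (singular_face k i (fst e),
     restrict (\<lambda>z. snd e (fst z, simplical_face i (snd z))) ({0..1} \<times> standard_simplex (k - 1)))"

definition path_target :: "((nat \<Rightarrow> real) \<Rightarrow> 'a) \<times> (real \<times> (nat \<Rightarrow> real) \<Rightarrow> 'b) \<Rightarrow> (nat \<Rightarrow> real) \<Rightarrow> 'b" where
  "path_target e = (\<lambda>x. snd e (1, x))"

lemma path_simplicesD:
  assumes "e \<in> path_simplices X Y f k"
  shows "singular_simplex k X (fst e)" "snd e \<in> extensional ({0..1} \<times> standard_simplex k)"
    "continuous_map (simplex_cyl k) Y (snd e)" "x \<in> standard_simplex k \<Longrightarrow> snd e (0, x) = f (fst e x)"
  using assms by (auto simp: path_simplices_def)

lemma path_face_apply:
  "t \<in> {0..1} \<Longrightarrow> x \<in> standard_simplex k \<Longrightarrow> snd (path_face (Suc k) i e) (t, x) = snd e (t, simplical_face i x)"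
  by (simp add: path_face_def)

lemma fst_path_face: "fst (path_face k i e) = singular_face k i (fst e)"
  by (simp add: path_face_def)

lemma face_system_path: "face_system (path_simplices X Y f) path_face"
proof
  fix e :: "((nat \<Rightarrow> real) \<Rightarrow> 'a) \<times> (real \<times> (nat \<Rightarrow> real) \<Rightarrow> 'b)" and k i
  assume e: "e \<in> path_simplices X Y f (Suc k)" and i: "i \<le> Suc k"
  have "continuous_map (simplex_cyl k) (simplex_top (Suc k)) (\<lambda>z. simplical_face i (snd z))"
    using continuous_map_compose [OF continuous_map_snd continuous_map_simplical_face [OF i]] by (simp add: o_def)
  from continuous_map_pairD [OF continuous_map_fst this path_simplicesD(3) [OF e]]
  have "continuous_map (simplex_cyl k) Y (\<lambda>z. snd e (fst z, simplical_face i (snd z)))" .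
  then have "continuous_map (simplex_cyl k) Y (snd (path_face (Suc k) i e))"
    by (rule continuous_map_eq) (auto simp: path_face_def)
  moreover have "singular_simplex k X (singular_face (Suc k) i (fst e))"
    using singular_simplex_singular_face [OF path_simplicesD(1) [OF e] _ i] by simp
  ultimately show "path_face (Suc k) i e \<in> path_simplices X Y f k"
    unfolding path_simplices_def using i path_simplicesD(4) [OF e]
    by (auto simp: path_face_def singular_face_apply simplical_face_in)
next
  fix e :: "((nat \<Rightarrow> real) \<Rightarrow> 'a) \<times> (real \<times> (nat \<Rightarrow> real) \<Rightarrow> 'b)" and k i j
  assume e: "e \<in> path_simplices X Y f (Suc (Suc k))" and ij: "i < j" "j \<le> Suc (Suc k)"
  have "singular_face (Suc k) i (singular_face (Suc (Suc k)) j (fst e)) = singular_face (Suc k) (j - 1) (singular_face (Suc (Suc k)) i (fst e))"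
    by (rule face_system.face_face [OF face_system_singular [of X] _ ij]) (use path_simplicesD(1) [OF e] in simp)
  then show "path_face (Suc k) i (path_face (Suc (Suc k)) j e) = path_face (Suc k) (j - 1) (path_face (Suc (Suc k)) i e)"
    unfolding path_face_def using ij
    by (auto simp: fun_eq_iff restrict_def simplical_face_in simplical_face_face)
qed

lemma path_target_in:
  assumes e: "e \<in> path_simplices X Y f k"
  shows "path_target e \<in> singular_simplex_set k Y"
proof -
  have "continuous_map (simplex_top k) Y (\<lambda>x. snd e (1, x))"
    by (rule continuous_map_pairD [OF _ _ path_simplicesD(3) [OF e]]) auto
  moreover have "(\<lambda>x. snd e (1, x)) \<in> extensional (standard_simplex k)"
    using path_simplicesD(2) [OF e] by (auto simp: extensional_def)
  ultimately show ?thesis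
    by (simp add: singular_simplex_def path_target_def)
qed

lemma path_target_face: "i \<le> Suc k \<Longrightarrow> path_target (path_face (Suc k) i e) = singular_face (Suc k) i (path_target e)"
  by (auto simp: path_target_def path_face_def singular_face_def fun_eq_iff restrict_def)

lemma path_simplexI:
  assumes "continuous_map (simplex_top k) X A" "continuous_map (simplex_cyl k) Y H" "\<And>x. x \<in> standard_simplex k \<Longrightarrow> H (0, x) = f (A x)"
  shows "(restrict A (standard_simplex k), restrict H ({0..1} \<times> standard_simplex k)) \<in> path_simplices X Y f k"
proof -
  have "continuous_map (simplex_cyl k) Y (restrict H ({0..1} \<times> standard_simplex k))"
    using assms(2) by (rule continuous_map_eq) auto
  moreover have "continuous_map (simplex_top k) X (restrict A (standard_simplex k))"
    using assms(1) by (rule continuous_map_eq) auto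
  ultimately show ?thesis
    using assms(3) by (auto simp: path_simplices_def singular_simplex_def)
qed

lemma path_face_eqI:
  assumes e: "e \<in> path_simplices X Y f k"
    and A: "\<And>x. x \<in> standard_simplex k \<Longrightarrow> A (simplical_face j x) = fst e x"
    and H: "\<And>t x. t \<in> {0..1} \<Longrightarrow> x \<in> standard_simplex k \<Longrightarrow> H (t, simplical_face j x) = snd e (t, x)"
    and j: "j \<le> Suc k"
  shows "path_face (Suc k) j (restrict A (standard_simplex (Suc k)), restrict H ({0..1} \<times> standard_simplex (Suc k))) = e"
proof -
  have "fst e x = singular_face (Suc k) j (restrict A (standard_simplex (Suc k))) x" for x
    using A [of x] simplical_face_in [OF j, of x] singular_simplexD(2) [OF path_simplicesD(1) [OF e]]
    by (auto simp: singular_face_def extensional_def)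
  moreover have "snd e z = restrict (\<lambda>z. restrict H ({0..1} \<times> standard_simplex (Suc k)) (fst z, simplical_face j (snd z))) ({0..1} \<times> standard_simplex k) z" for z
    using H [of "fst z" "snd z"] simplical_face_in [OF j, of "snd z"] path_simplicesD(2) [OF e]
    by (cases z) (auto simp: extensional_def)
  ultimately show ?thesis
    by (cases e) (auto simp: path_face_def fun_eq_iff)
qed

text \<open>A compatible family of path simplices on the faces gives boundary data on both levels: a
  map to \<open>X\<close> on the boundary and a homotopy in \<open>Y\<close> on its
  cylinder.\<close>

lemma glue_path_simplices:
  assumes x: "\<forall>j\<le>Suc k. x j \<in> path_simplices X Y f k"
    and compat: "\<forall>l i j. k = Suc l \<longrightarrow> i < j \<longrightarrow> j \<le> Suc k \<longrightarrow> path_face k i (x j) = path_face k (j - 1) (x i)"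
  shows "\<exists>a h. continuous_map (subtopology (simplex_top (Suc k)) (simplex_boundary (Suc k))) X a \<and>
    (\<forall>j\<le>Suc k. \<forall>y\<in>standard_simplex k. a (simplical_face j y) = fst (x j) y) \<and>
    continuous_map (simplex_bdry_cyl (Suc k)) Y h \<and>
    (\<forall>j\<le>Suc k. \<forall>t\<in>{0..1}. \<forall>y\<in>standard_simplex k. h (t, simplical_face j y) = snd (x j) (t, y))"
proof -
  have c: "snd (x j) (t, simplical_face i w) = snd (x i) (t, simplical_face (j - 1) w)"
      "fst (x j) (simplical_face i w) = fst (x i) (simplical_face (j - 1) w)"
    if "k = Suc l" "i < j" "j \<le> Suc k" "t \<in> {0..1}" "w \<in> standard_simplex l" for l i j t w
  proof -
    have e: "path_face k i (x j) = path_face k (j - 1) (x i)" using compat that by blast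
    show "snd (x j) (t, simplical_face i w) = snd (x i) (t, simplical_face (j - 1) w)"
      using arg_cong [OF e, of "\<lambda>e. snd e (t, w)"] that(1,4,5) by (simp add: path_face_apply)
    show "fst (x j) (simplical_face i w) = fst (x i) (simplical_face (j - 1) w)"
      using arg_cong [OF e, of "\<lambda>e. fst e w"] that(1,4,5) by (simp add: fst_path_face singular_face_apply)
  qed
  have cX: "continuous_map (simplex_cyl k) X (\<lambda>z. fst (x j) (snd z))" if "j \<le> Suc k" for j
  proof -
    have "continuous_map (simplex_top k) X (fst (x j))"
      using x that by (blast intro: singular_simplexD(1) path_simplicesD(1))
    from continuous_map_compose [OF continuous_map_snd this] show ?thesis by (simp add: o_def)
  qed
  have cY: "continuous_map (simplex_cyl k) Y (snd (x j))" if "j \<le> Suc k" for j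
    using x that by (blast intro: path_simplicesD(3))
  obtain h where h: "continuous_map (simplex_bdry_cyl (Suc k)) Y h"
    "\<And>j t y. j \<le> Suc k \<Longrightarrow> t \<in> {0..1} \<Longrightarrow> y \<in> standard_simplex k \<Longrightarrow> h (t, simplical_face j y) = snd (x j) (t, y)"
  proof (rule glue_faces [of k Y "\<lambda>j. snd (x j)"])
    show "snd (x j) (t, simplical_face i w) = snd (x i) (t, simplical_face (j - 1) w)"
      if "k = Suc l" "i < j" "j \<le> Suc k" "t \<in> {0..1}" "w \<in> standard_simplex l" for l i j t w
      using c(1) [OF that] .
  qed (use cY in auto)
  \<comment> \<open>The simplices of \<open>X\<close> are glued as homotopies independent of time,
    by the same lemma; the map is then read at time 0.\<close>
  obtain a where a: "continuous_map (simplex_bdry_cyl (Suc k)) X a"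
    "\<And>j t y. j \<le> Suc k \<Longrightarrow> t \<in> {0..1} \<Longrightarrow> y \<in> standard_simplex k \<Longrightarrow> a (t, simplical_face j y) = fst (x j) y"
  proof (rule glue_faces [of k X "\<lambda>j z. fst (x j) (snd z)"])
    show "fst (x j) (snd (t, simplical_face i w)) = fst (x i) (snd (t, simplical_face (j - 1) w))"
      if "k = Suc l" "i < j" "j \<le> Suc k" "t \<in> {0..1}" "w \<in> standard_simplex l" for l i j and t :: real and w
      using c(2) [OF that] by simp
  qed (use cX in auto)
  have "continuous_map (subtopology (simplex_top (Suc k)) (simplex_boundary (Suc k))) (simplex_bdry_cyl (Suc k)) (\<lambda>x. (0, x))"
    by (intro continuous_map_into_subtopology continuous_map_pairedI continuous_map_from_subtopology) auto
  from continuous_map_compose [OF this a(1)]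
  have "continuous_map (subtopology (simplex_top (Suc k)) (simplex_boundary (Suc k))) X (\<lambda>x. a (0, x))" by (simp add: o_def)
  then show ?thesis
    using a(2) [of _ 0] h by (intro exI [of _ "\<lambda>x. a (0, x)"] exI [of _ h] conjI allI ballI impI) auto
qed

text \<open>A lifting problem consists of a simplex \<open>\<sigma>\<close> of \<open>Y\<close>, a
  map \<open>a\<close> on the boundary to \<open>X\<close>, and a homotopy there from
  \<open>f \<circ> a\<close> to \<open>\<sigma>\<close>. These are the data of
  \<open>weq_simplex_lift\<close>, and here the full strength of a weak equivalence enters.\<close>

lemma trivial_fibration_path_target:
  assumes weq: "weak_homotopy_equivalence X Y f" and G: "coefficient_system Y G"
  shows "trivial_fibration (\<lambda>k. singular_simplex_set k Y) singular_face (simplex_fibre G)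
     (\<lambda>\<sigma>. transport G (edge_path \<sigma>)) (path_simplices X Y f) path_face path_target simplex_degen"
proof (rule trivial_fibration_singularI [OF G face_system_path path_target_in path_target_face])
  have b: "b \<in> extensional (standard_simplex k)" if "b \<in> singular_simplex_set k Y" for b k
    using singular_simplexD(2) [of k Y b] that by simp
  have target: "path_target (restrict A (standard_simplex k), restrict H ({0..1} \<times> standard_simplex k)) = b"
    if "\<And>x. x \<in> standard_simplex k \<Longrightarrow> H (1, x) = b x" "b \<in> singular_simplex_set k Y" for k H b and A :: "(nat \<Rightarrow> real) \<Rightarrow> 'a"
    using that(1) b [OF that(2)] by (auto simp: path_target_def fun_eq_iff extensional_def)
  show "\<exists>e\<in>path_simplices X Y f 0. path_target e = \<sigma>" if \<sigma>: "\<sigma> \<in> singular_simplex_set 0 Y" for \<sigma>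
  proof -
    \<comment> \<open>In dimension 0 the boundary is empty, and \<open>undefined\<close> stands for
      the data on it.\<close>
    have "\<exists>A H. continuous_map (simplex_top 0) X A \<and> (\<forall>x\<in>simplex_boundary 0. A x = undefined x) \<and>
       continuous_map (simplex_cyl 0) Y H \<and> (\<forall>x\<in>standard_simplex 0. H (0, x) = f (A x) \<and> H (1, x) = \<sigma> x) \<and>
       (\<forall>t\<in>{0..1}. \<forall>x\<in>simplex_boundary 0. H (t, x) = undefined (t, x))"
      by (rule weq_simplex_lift [OF weq]) (use \<sigma> singular_simplexD(1) [of 0 Y \<sigma>] in \<open>simp_all add: simplex_boundary_0 continuous_map_on_empty\<close>)
    then obtain A H where "continuous_map (simplex_top 0) X A" "continuous_map (simplex_cyl 0) Y H"
      "\<forall>x\<in>standard_simplex 0. H (0, x) = f (A x) \<and> H (1, x) = \<sigma> x" by blast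
    then show ?thesis
      using path_simplexI [of 0 X A Y H f] target [of 0 H \<sigma> A] \<sigma> by blast
  qed
  fix \<sigma> k x
  assume \<sigma>: "\<sigma> \<in> singular_simplex_set (Suc k) Y"
    and x: "\<And>j. j \<le> Suc k \<Longrightarrow> x j \<in> path_simplices X Y f k \<and> path_target (x j) = singular_face (Suc k) j \<sigma>"
    and compat: "\<And>l i j. \<lbrakk>k = Suc l; i < j; j \<le> Suc k\<rbrakk> \<Longrightarrow> path_face k i (x j) = path_face k (j - 1) (x i)"
  have xE: "x j \<in> path_simplices X Y f k" if "j \<le> Suc k" for j using x [OF that] by simp
  then have xE': "\<forall>j\<le>Suc k. x j \<in> path_simplices X Y f k" by blast
  have compat': "\<forall>l i j. k = Suc l \<longrightarrow> i < j \<longrightarrow> j \<le> Suc k \<longrightarrow> path_face k i (x j) = path_face k (j - 1) (x i)"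
    using compat by blast
  obtain a h where a: "continuous_map (subtopology (simplex_top (Suc k)) (simplex_boundary (Suc k))) X a"
    "\<And>j y. j \<le> Suc k \<Longrightarrow> y \<in> standard_simplex k \<Longrightarrow> a (simplical_face j y) = fst (x j) y"
    and h: "continuous_map (simplex_bdry_cyl (Suc k)) Y h"
    "\<And>j t y. j \<le> Suc k \<Longrightarrow> t \<in> {0..1} \<Longrightarrow> y \<in> standard_simplex k \<Longrightarrow> h (t, simplical_face j y) = snd (x j) (t, y)"
    using glue_path_simplices [OF xE' compat'] by blast
  have "\<exists>A H. continuous_map (simplex_top (Suc k)) X A \<and> (\<forall>x\<in>simplex_boundary (Suc k). A x = a x) \<and>
       continuous_map (simplex_cyl (Suc k)) Y H \<and> (\<forall>x\<in>standard_simplex (Suc k). H (0, x) = f (A x) \<and> H (1, x) = \<sigma> x) \<and>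
       (\<forall>t\<in>{0..1}. \<forall>x\<in>simplex_boundary (Suc k). H (t, x) = h (t, x))"
  proof (rule weq_simplex_lift [OF weq a(1) _ h(1)])
    show "continuous_map (simplex_top (Suc k)) Y \<sigma>" using singular_simplexD(1) [of "Suc k" Y \<sigma>] \<sigma> by simp
    fix w assume "w \<in> simplex_boundary (Suc k)"
    then obtain j y where jy: "j \<le> Suc k" "y \<in> standard_simplex k" "w = simplical_face j y" by (rule boundary_face)
    show "h (0, w) = f (a w)"
      using h(2) [OF jy(1) _ jy(2), of 0] a(2) [OF jy(1,2)] path_simplicesD(4) [OF xE [OF jy(1)] jy(2)] jy(3) by simp
    have "path_target (x j) y = singular_face (Suc k) j \<sigma> y" using x [OF jy(1)] by simp
    then show "h (1, w) = \<sigma> w"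
      using h(2) [OF jy(1) _ jy(2), of 1] jy by (simp add: path_target_def singular_face_apply)
  qed
  then obtain A H where AH: "continuous_map (simplex_top (Suc k)) X A" "\<forall>x\<in>simplex_boundary (Suc k). A x = a x"
     "continuous_map (simplex_cyl (Suc k)) Y H" "\<forall>x\<in>standard_simplex (Suc k). H (0, x) = f (A x) \<and> H (1, x) = \<sigma> x"
     "\<forall>t\<in>{0..1}. \<forall>x\<in>simplex_boundary (Suc k). H (t, x) = h (t, x)" by blast
  let ?e = "(restrict A (standard_simplex (Suc k)), restrict H ({0..1} \<times> standard_simplex (Suc k)))"
  have "?e \<in> path_simplices X Y f (Suc k)"
    by (rule path_simplexI [OF AH(1,3)]) (use AH(4) in blast)
  moreover have "path_target ?e = \<sigma>"
    by (rule target [OF _ \<sigma>]) (use AH(4) in blast)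
  moreover have "path_face (Suc k) j ?e = x j" if j: "j \<le> Suc k" for j
    by (rule path_face_eqI [OF xE [OF j] _ _ j]) (use AH(2,5) a(2) [OF j] h(2) [OF j] face_boundary [OF j] in auto)
  ultimately show "\<exists>e\<in>path_simplices X Y f (Suc k). path_target e = \<sigma> \<and> (\<forall>j\<le>Suc k. path_face (Suc k) j e = x j)"
    by blast
qed assumption

text \<open>Here the simplex of \<open>X\<close> is given, so \<open>f \<circ> \<sigma>\<close> is
  the start of the homotopy and only the homotopy has to be extended from the boundary.\<close>

lemma trivial_fibration_path_source:
  assumes f: "continuous_map X Y f" and G: "coefficient_system X G"
  shows "trivial_fibration (\<lambda>k. singular_simplex_set k X) singular_face (simplex_fibre G)
     (\<lambda>\<sigma>. transport G (edge_path \<sigma>)) (path_simplices X Y f) path_face fst simplex_degen"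
proof (rule trivial_fibration_singularI [OF G face_system_path _ fst_path_face])
  show "fst e \<in> singular_simplex_set k X" if "e \<in> path_simplices X Y f k" for e k
    using path_simplicesD(1) [OF that] by simp
  have ext: "restrict \<sigma> (standard_simplex k) = \<sigma>" and cont: "continuous_map (simplex_top k) X \<sigma>"
    and fcont: "continuous_map (simplex_top k) Y (\<lambda>x. f (\<sigma> x))"
    if "\<sigma> \<in> singular_simplex_set k X" for \<sigma> k
    using singular_simplexD [of k X \<sigma>] continuous_map_compose [OF _ f, of "simplex_top k" \<sigma>] that
    by (simp_all add: extensional_restrict o_def)
  show "\<exists>e\<in>path_simplices X Y f 0. fst e = \<sigma>" if \<sigma>: "\<sigma> \<in> singular_simplex_set 0 X" for \<sigma>
  proof -
    have "continuous_map (simplex_cyl 0) Y (\<lambda>z. f (\<sigma> (snd z)))"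
      using continuous_map_compose [OF continuous_map_snd fcont [OF \<sigma>]] by (simp add: o_def)
    then have "(restrict \<sigma> (standard_simplex 0), restrict (\<lambda>z. f (\<sigma> (snd z))) ({0..1} \<times> standard_simplex 0)) \<in> path_simplices X Y f 0"
      by (rule path_simplexI [OF cont [OF \<sigma>]]) simp
    then show ?thesis using ext [OF \<sigma>] by (metis fst_conv)
  qed
  fix \<sigma> k x
  assume \<sigma>: "\<sigma> \<in> singular_simplex_set (Suc k) X"
    and x: "\<And>j. j \<le> Suc k \<Longrightarrow> x j \<in> path_simplices X Y f k \<and> fst (x j) = singular_face (Suc k) j \<sigma>"
    and compat: "\<And>l i j. \<lbrakk>k = Suc l; i < j; j \<le> Suc k\<rbrakk> \<Longrightarrow> path_face k i (x j) = path_face k (j - 1) (x i)"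
  have xE: "x j \<in> path_simplices X Y f k" if "j \<le> Suc k" for j using x [OF that] by simp
  then have xE': "\<forall>j\<le>Suc k. x j \<in> path_simplices X Y f k" by blast
  have compat': "\<forall>l i j. k = Suc l \<longrightarrow> i < j \<longrightarrow> j \<le> Suc k \<longrightarrow> path_face k i (x j) = path_face k (j - 1) (x i)"
    using compat by blast
  have xs: "fst (x j) y = \<sigma> (simplical_face j y)" if "j \<le> Suc k" "y \<in> standard_simplex k" for j y
    using x [OF that(1)] that(2) by (simp add: singular_face_apply)
  obtain a h where a: "continuous_map (subtopology (simplex_top (Suc k)) (simplex_boundary (Suc k))) X a"
    "\<And>j y. j \<le> Suc k \<Longrightarrow> y \<in> standard_simplex k \<Longrightarrow> a (simplical_face j y) = fst (x j) y"
    and h: "continuous_map (simplex_bdry_cyl (Suc k)) Y h"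
    "\<And>j t y. j \<le> Suc k \<Longrightarrow> t \<in> {0..1} \<Longrightarrow> y \<in> standard_simplex k \<Longrightarrow> h (t, simplical_face j y) = snd (x j) (t, y)"
    using glue_path_simplices [OF xE' compat'] by blast
  have "\<exists>H. continuous_map (simplex_cyl (Suc k)) Y H \<and> (\<forall>x\<in>standard_simplex (Suc k). H (0, x) = f (\<sigma> x)) \<and>
    (\<forall>t\<in>{0..1}. \<forall>x\<in>simplex_boundary (Suc k). H (t, x) = h (t, x))"
  proof (rule simplex_HEP [OF fcont [OF \<sigma>] h(1)])
    fix w assume "w \<in> simplex_boundary (Suc k)"
    then obtain j y where jy: "j \<le> Suc k" "y \<in> standard_simplex k" "w = simplical_face j y" by (rule boundary_face)
    show "h (0, w) = f (\<sigma> w)"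
      using h(2) [OF jy(1) _ jy(2), of 0] path_simplicesD(4) [OF xE [OF jy(1)] jy(2)] jy(3) xs [OF jy(1,2)] by simp
  qed
  then obtain H where H: "continuous_map (simplex_cyl (Suc k)) Y H" "\<forall>x\<in>standard_simplex (Suc k). H (0, x) = f (\<sigma> x)"
    "\<forall>t\<in>{0..1}. \<forall>x\<in>simplex_boundary (Suc k). H (t, x) = h (t, x)" by blast
  let ?e = "(restrict \<sigma> (standard_simplex (Suc k)), restrict H ({0..1} \<times> standard_simplex (Suc k)))"
  have "?e \<in> path_simplices X Y f (Suc k)"
    by (rule path_simplexI [OF cont [OF \<sigma>] H(1)]) (use H(2) in blast)
  moreover have "fst ?e = \<sigma>"
    using ext [OF \<sigma>] by simp
  moreover have "path_face (Suc k) j ?e = x j" if j: "j \<le> Suc k" for j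
    by (rule path_face_eqI [OF xE [OF j] _ _ j]) (use xs [OF j] H(3) h(2) [OF j] face_boundary [OF j] in auto)
  ultimately show "\<exists>e\<in>path_simplices X Y f (Suc k). fst e = \<sigma> \<and> (\<forall>j\<le>Suc k. path_face (Suc k) j e = x j)"
    by blast
qed

section \<open>Comparison of the coefficient systems on path simplices\<close>

lemma inv_into_iso_eq:
  "f \<in> iso G H \<Longrightarrow> x \<in> carrier G \<Longrightarrow> f x = y \<Longrightarrow> inv_into (carrier G) f y = x"
  by (auto simp: iso_def bij_betw_def)

text \<open>Isomorphic systems on the same simplices: the inverses of \<open>\<theta>\<close>
  commute with the transports because \<open>\<theta>\<close> does and is injective on each fibre.
  The two chain maps are mutually inverse, so the homotopies are zero.\<close>

lemma local_system_iso_equiv: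
  assumes L: "local_system S d A T" and L': "local_system S d A' T'"
    and \<theta>: "\<forall>k. \<forall>\<sigma>\<in>S k. \<theta> \<sigma> \<in> iso (A \<sigma>) (A' \<sigma>)"
    and face_0: "\<forall>k. \<forall>\<sigma>\<in>S (Suc k). \<forall>g\<in>carrier (A \<sigma>). \<theta> (d (Suc k) 0 \<sigma>) (T \<sigma> g) = T' \<sigma> (\<theta> \<sigma> g)"
    and face_i: "\<forall>k. \<forall>\<sigma>\<in>S (Suc k). \<forall>g\<in>carrier (A \<sigma>). \<forall>i. 1 \<le> i \<and> i \<le> Suc k \<longrightarrow> \<theta> (d (Suc k) i \<sigma>) g = \<theta> \<sigma> g"
  defines "\<Phi> \<equiv> \<lambda>k \<sigma>. frag_of (\<sigma>, restrict (\<theta> \<sigma>) (carrier (A \<sigma>)))"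
    and "D \<equiv> face_op d A T" and "D' \<equiv> face_op d A' T'"
  shows "op_chain_map S A D S A' D' \<Phi>"
    and "quot_equiv (sum_group (S k) A) (op_cycles S A D k) (op_boundaries S A D k)
           (sum_group (S k) A') (op_cycles S A' D' k) (op_boundaries S A' D' k) (op_chain (S k) A (S k) A' (\<Phi> k))"
    and "quot_equiv (product_group (S k) A') (op_cocycles S A' D' k) (op_coboundaries S A' D' k)
           (product_group (S k) A) (op_cocycles S A D k) (op_coboundaries S A D k) (op_cochain (S k) A (\<Phi> k))"
proof -
  let ?\<theta>' = "\<lambda>\<sigma>. inv_into (carrier (A \<sigma>)) (\<theta> \<sigma>)"
  let ?\<Psi> = "\<lambda>k::nat. \<lambda>\<sigma>. frag_of (\<sigma>, restrict (?\<theta>' \<sigma>) (carrier (A' \<sigma>)))"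
  have grp: "comm_group (A \<sigma>)" "comm_group (A' \<sigma>)" if "\<sigma> \<in> S k" for k \<sigma>
    using local_system.grp [OF L that] local_system.grp [OF L' that] .
  have iso: "\<theta> \<sigma> \<in> iso (A \<sigma>) (A' \<sigma>)" if "\<sigma> \<in> S k" for k \<sigma> using \<theta> that by blast
  have iso': "?\<theta>' \<sigma> \<in> iso (A' \<sigma>) (A \<sigma>)" if "\<sigma> \<in> S k" for k \<sigma>
    using group.iso_set_sym [OF comm_group.axioms(2) iso [OF that]] grp(1) [OF that] by blast
  have inv: "\<theta> \<sigma> g \<in> carrier (A' \<sigma>)" "?\<theta>' \<sigma> (\<theta> \<sigma> g) = g" if "\<sigma> \<in> S k" "g \<in> carrier (A \<sigma>)" for k \<sigma> g
    using iso [OF that(1)] inv_into_iso_eq [OF iso [OF that(1)] that(2) refl] that(2) by (auto simp: iso_def hom_in_carrier)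
  have inv': "?\<theta>' \<sigma> g \<in> carrier (A \<sigma>)" "\<theta> \<sigma> (?\<theta>' \<sigma> g) = g" if "\<sigma> \<in> S k" "g \<in> carrier (A' \<sigma>)" for k \<sigma> g
    using iso [OF that(1)] iso' [OF that(1)] that(2) by (auto simp: iso_def hom_in_carrier bij_betw_inv_into_right)
  show \<Phi>: "op_chain_map S A D S A' D' \<Phi>"
    unfolding \<Phi>_def D_def D'_def
    by (rule op_chain_map_single [OF L L', where a = "\<lambda>_ \<sigma>. \<sigma>" and \<phi> = "\<lambda>_. \<theta>"]) (use \<theta> face_0 face_i in blast)+
  have \<Psi>: "op_chain_map S A' D' S A D ?\<Psi>"
    unfolding D_def D'_def
  proof (rule op_chain_map_single [OF L' L, where a = "\<lambda>_ \<sigma>. \<sigma>" and \<phi> = "\<lambda>_. ?\<theta>'"])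
    show "\<forall>k. \<forall>\<sigma>\<in>S k. \<sigma> \<in> S k \<and> ?\<theta>' \<sigma> \<in> iso (A' \<sigma>) (A \<sigma>)" using iso' by blast
    show "\<forall>k. \<forall>\<sigma>\<in>S (Suc k). \<forall>i\<le>Suc k. d (Suc k) i \<sigma> = d (Suc k) i \<sigma>" by simp
    show "\<forall>k. \<forall>\<sigma>\<in>S (Suc k). \<forall>g\<in>carrier (A' \<sigma>). ?\<theta>' (d (Suc k) 0 \<sigma>) (T' \<sigma> g) = T \<sigma> (?\<theta>' \<sigma> g)"
    proof (intro allI ballI)
      fix k \<sigma> g assume \<sigma>: "\<sigma> \<in> S (Suc k)" and g: "g \<in> carrier (A' \<sigma>)"
      let ?h = "?\<theta>' \<sigma> g"
      note h = inv' [OF \<sigma> g]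
      have "\<theta> (d (Suc k) 0 \<sigma>) (T \<sigma> ?h) = T' \<sigma> g" using face_0 \<sigma> h by simp
      moreover have "T \<sigma> ?h \<in> carrier (A (d (Suc k) 0 \<sigma>))" by (rule local_system.T_closed [OF L \<sigma> h(1)])
      moreover have "d (Suc k) 0 \<sigma> \<in> S k" using face_system.face_in [OF local_system.axioms(1) [OF L] \<sigma>, of 0] by simp
      ultimately show "?\<theta>' (d (Suc k) 0 \<sigma>) (T' \<sigma> g) = T \<sigma> ?h"
        using inv_into_iso_eq [OF iso] by blast
    qed
    show "\<forall>k. \<forall>\<sigma>\<in>S (Suc k). \<forall>g\<in>carrier (A' \<sigma>). \<forall>i. 1 \<le> i \<and> i \<le> Suc k \<longrightarrow> ?\<theta>' (d (Suc k) i \<sigma>) g = ?\<theta>' \<sigma> g"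
    proof (intro allI ballI impI)
      fix k \<sigma> g i assume \<sigma>: "\<sigma> \<in> S (Suc k)" and g: "g \<in> carrier (A' \<sigma>)" and i: "1 \<le> i \<and> i \<le> Suc k"
      let ?h = "?\<theta>' \<sigma> g"
      note h = inv' [OF \<sigma> g]
      have "\<theta> (d (Suc k) i \<sigma>) ?h = g" using face_i \<sigma> h i by simp
      moreover have "?h \<in> carrier (A (d (Suc k) i \<sigma>))" using h(1) local_system.A_face [OF L \<sigma>] i by simp
      moreover have "d (Suc k) i \<sigma> \<in> S k" using face_system.face_in [OF local_system.axioms(1) [OF L] \<sigma>, of i] i by simp
      ultimately show "?\<theta>' (d (Suc k) i \<sigma>) g = ?h"
        using inv_into_iso_eq [OF iso] by blast
    qed
  qed
  have "op_comp A (?\<Psi> k) (\<Phi> k) \<sigma> = op_id A \<sigma>" if "\<sigma> \<in> S k" for k \<sigma>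
  proof -
    have "compose (carrier (A \<sigma>)) (restrict (?\<theta>' \<sigma>) (carrier (A' \<sigma>))) (restrict (\<theta> \<sigma>) (carrier (A \<sigma>))) = (\<lambda>g\<in>carrier (A \<sigma>). g)"
      using inv [OF that] by (auto simp: compose_def fun_eq_iff)
    then show ?thesis unfolding \<Phi>_def op_comp_single op_id_def by simp
  qed
  then have P: "op_homotopy S A D (\<lambda>k. op_comp A (?\<Psi> k) (\<Phi> k)) (\<lambda>_ _. 0)"
    by (simp add: op_homotopy_def local_op_def)
  have "op_comp A' (\<Phi> k) (?\<Psi> k) \<sigma> = op_id A' \<sigma>" if "\<sigma> \<in> S k" for k \<sigma>
  proof -
    have "compose (carrier (A' \<sigma>)) (restrict (\<theta> \<sigma>) (carrier (A \<sigma>))) (restrict (?\<theta>' \<sigma>) (carrier (A' \<sigma>))) = (\<lambda>g\<in>carrier (A' \<sigma>). g)"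
      using inv' [OF that] by (auto simp: compose_def fun_eq_iff)
    then show ?thesis unfolding \<Phi>_def op_comp_single op_id_def by simp
  qed
  then have Q: "op_homotopy S A' D' (\<lambda>k. op_comp A' (\<Phi> k) (?\<Psi> k)) (\<lambda>_ _. 0)"
    by (simp add: op_homotopy_def local_op_def)
  have K: "op_complex S A D" "op_complex S A' D'"
    unfolding D_def D'_def by (rule local_system.op_complex_face_op [OF L], rule local_system.op_complex_face_op [OF L'])
  show "quot_equiv (sum_group (S k) A) (op_cycles S A D k) (op_boundaries S A D k)
           (sum_group (S k) A') (op_cycles S A' D' k) (op_boundaries S A' D' k) (op_chain (S k) A (S k) A' (\<Phi> k))"
    by (rule op_homotopy_equivalence(1) [OF K \<Phi> \<Psi> P Q])
  show "quot_equiv (product_group (S k) A') (op_cocycles S A' D' k) (op_coboundaries S A' D' k)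
           (product_group (S k) A) (op_cocycles S A D k) (op_coboundaries S A D k) (op_cochain (S k) A (\<Phi> k))"
    by (rule op_homotopy_equivalence(2) [OF K \<Phi> \<Psi> P Q])
qed

text \<open>Time is reversed because transport is contravariant: the path runs from the target
  vertex back to \<open>f\<close> of the source vertex, so the map goes from the fibre pulled back
  along \<open>f\<close> to the fibre over the target.\<close>

definition path_transport ::
  "('b, 'g) coeff_system \<Rightarrow> ((nat \<Rightarrow> real) \<Rightarrow> 'a) \<times> (real \<times> (nat \<Rightarrow> real) \<Rightarrow> 'b) \<Rightarrow> 'g \<Rightarrow> 'g" where
  "path_transport G e = transport G (\<lambda>t. snd e (1 - t, vertex 0))"

lemma pathin_reverse_time: "v \<in> standard_simplex k \<Longrightarrow> pathin (simplex_cyl k) (\<lambda>t. (1 - t, v))"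
  unfolding pathin_def
proof (intro continuous_map_pairedI)
  show "continuous_map unit_interval unit_interval (\<lambda>t. 1 - t)"
    by (rule continuous_map_into_subtopology) (auto intro!: continuous_intros)
qed auto

lemma pathin_simplex_cyl_edge: "t0 \<in> {0..1} \<Longrightarrow> pathin (simplex_cyl (Suc k)) (\<lambda>t. (t0, simplex_edge t))"
  using pathin_simplex_edge [of k] unfolding pathin_def by (intro continuous_map_pairedI) auto

lemma path_simplices_pathin:
  "e \<in> path_simplices X Y f k \<Longrightarrow> pathin (simplex_cyl k) c \<Longrightarrow> pathin Y (\<lambda>t. snd e (c t))"
  using pathin_compose [of "simplex_cyl k" c Y "snd e"] path_simplicesD(3) [of e X Y f k] by (simp add: o_def)

lemma simplex_fibre_pullback: "simplex_fibre (pullback f G) \<tau> = fibre G (f (\<tau> (vertex 0)))"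
  and transport_pullback: "transport (pullback f G) u = transport G (f \<circ> u)"
  by (simp_all add: simplex_fibre_def pullback_def)

context
  fixes X :: "'a topology" and Y :: "'b topology" and f :: "'a \<Rightarrow> 'b" and G :: "('b, 'g) coeff_system"
  assumes G: "coefficient_system Y G"
begin

lemma path_transport_iso:
  assumes e: "e \<in> path_simplices X Y f k"
  shows "path_transport G e \<in> iso (simplex_fibre (pullback f G) (fst e)) (simplex_fibre G (path_target e))"
  using transport_iso [OF G path_simplices_pathin [OF e pathin_reverse_time [OF vertex_in [of 0 k]]]]
    path_simplicesD(4) [OF e vertex_in [of 0 k]]
  unfolding simplex_fibre_pullback by (simp add: path_transport_def simplex_fibre_def path_target_def)

lemma path_transport_face:
  assumes e: "e \<in> path_simplices X Y f (Suc k)" and g: "g \<in> carrier (simplex_fibre (pullback f G) (fst e))"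
    and i: "1 \<le> i"
  shows "path_transport G (path_face (Suc k) i e) g = path_transport G e g"
  unfolding path_transport_def
proof (rule transport_cong [OF G path_simplices_pathin [OF e pathin_reverse_time], symmetric])
  show "snd e (1 - t, vertex 0) = snd (path_face (Suc k) i e) (1 - t, vertex 0)" if "t \<in> {0..1}" for t
    using that i by (simp add: path_face_apply vertex_in face_vertex)
  show "g \<in> carrier (fibre G (snd e (1 - 1, vertex 0)))"
    using g path_simplicesD(4) [OF e vertex_in [of 0 "Suc k"]] by (simp add: simplex_fibre_pullback)
qed (rule vertex_in, simp)

text \<open>Both sides are transports along paths from \<open>(1, vertex 1)\<close> to
  \<open>(0, vertex 0)\<close> in the cylinder: one goes down over vertex 1 and then along the
  bottom edge, the other along the top edge and then down over vertex 0. These are the two ways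
  around a square in a convex set.\<close>

lemma path_transport_face_0:
  assumes e: "e \<in> path_simplices X Y f (Suc k)" and g: "g \<in> carrier (simplex_fibre (pullback f G) (fst e))"
  shows "path_transport G (path_face (Suc k) 0 e) (transport (pullback f G) (edge_path (fst e)) g)
       = transport G (edge_path (path_target e)) (path_transport G e g)"
proof -
  let ?v = "f \<circ> edge_path (fst e)" and ?v' = "\<lambda>t. snd e (1 - t, vertex 0)"
  let ?u = "\<lambda>t. snd (path_face (Suc k) 0 e) (1 - t, vertex 0)" and ?u' = "edge_path (path_target e)"
  have e0: "path_face (Suc k) 0 e \<in> path_simplices X Y f k"
    by (rule face_system.face_in [OF face_system_path e]) simp
  have bottom: "snd e (0, x) = f (fst e x)" if "x \<in> standard_simplex (Suc k)" for x
    using path_simplicesD(4) [OF e that] .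
  have u: "?u t = snd e (1 - t, vertex 1)" if "t \<in> {0..1}" for t
    using that by (simp add: path_face_apply vertex_in face_vertex)
  have v: "?v t = snd e (0, simplex_edge t)" if "t \<in> {0..1}" for t
    using bottom [OF simplex_edge_in [OF that]] by (simp add: edge_path_eq)
  have u': "?u' t = snd e (1, simplex_edge t)" for t
    by (simp add: edge_path_eq path_target_def)
  have c: "pathin (simplex_cyl (Suc k)) (\<lambda>t. (1 - t, vertex i))" if "i \<le> Suc k" for i
    by (rule pathin_reverse_time [OF vertex_in [OF that]])
  \<comment> \<open>Along the bottom the homotopy agrees with \<open>f\<close> after the source
    simplex only for parameters in the unit interval, hence the passage through
    \<open>continuous_map_eq\<close>.\<close>
  have pv: "pathin Y ?v"
    by (rule continuous_map_eq [OF path_simplices_pathin [OF e pathin_simplex_cyl_edge [of 0], unfolded pathin_def], folded pathin_def])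
      (use v in auto)
  have pu: "pathin Y ?u" by (rule path_simplices_pathin [OF e0 pathin_reverse_time [OF vertex_in]]) simp
  have pu': "pathin Y ?u'"
    using path_simplices_pathin [OF e pathin_simplex_cyl_edge [of 1]] by (simp add: u' [abs_def])
  have pv': "pathin Y ?v'" by (rule path_simplices_pathin [OF e c]) simp
  have gv: "g \<in> carrier (fibre G (?v 1))" using g by (simp add: simplex_fibre_pullback edge_path_eq)
  have gv': "g \<in> carrier (fibre G (?v' 1))"
    using g bottom [OF vertex_in [of 0 "Suc k"]] by (simp add: simplex_fibre_pullback)
  have "transport G ?u (transport G ?v g) = transport G (path_concat ?u ?v) g"
    by (rule transport_concat [OF G pu pv _ gv, symmetric]) (use u [of 1] v [of 0] in simp)
  also have "\<dots> = transport G (path_concat ?u' ?v') g"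
  proof (rule transport_simplex_cyl [OF G path_simplicesD(3) [OF e],
        where c = "path_concat (\<lambda>t. (1 - t, vertex 1)) (\<lambda>t. (0, simplex_edge t))"
        and c' = "path_concat (\<lambda>t. (1, simplex_edge t)) (\<lambda>t. (1 - t, vertex 0))"])
    show "pathin (simplex_cyl (Suc k)) (path_concat (\<lambda>t. (1 - t, vertex 1)) (\<lambda>t. (0, simplex_edge t)))"
      by (rule pathin_concat [OF c pathin_simplex_cyl_edge]) simp_all
    show "pathin (simplex_cyl (Suc k)) (path_concat (\<lambda>t. (1, simplex_edge t)) (\<lambda>t. (1 - t, vertex 0)))"
      by (rule pathin_concat [OF pathin_simplex_cyl_edge c]) simp_all
    show "snd e (path_concat (\<lambda>t. (1 - t, vertex 1)) (\<lambda>t. (0, simplex_edge t)) t) = path_concat ?u ?v t" if "t \<in> {0..1}" for t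
      using u [of "2 * t"] v [of "2 * t - 1"] that by (simp add: path_concat_def)
    show "snd e (path_concat (\<lambda>t. (1, simplex_edge t)) (\<lambda>t. (1 - t, vertex 0)) t) = path_concat ?u' ?v' t" for t
      by (simp add: path_concat_def u')
    show "g \<in> carrier (fibre G (path_concat ?u ?v 1))" unfolding path_concat_ends by (rule gv)
  qed (simp_all add: path_concat_ends)
  also have "\<dots> = transport G ?u' (transport G ?v' g)"
    by (rule transport_concat [OF G pu' pv' _ gv']) (simp add: u')
  finally show ?thesis by (simp add: path_transport_def transport_pullback)
qed

end

section \<open>The section of constant homotopies\<close>

lemma const_path_in:
  fixes f :: "'a \<Rightarrow> 'b" and \<tau> :: "(nat \<Rightarrow> real) \<Rightarrow> 'a"
  assumes f: "continuous_map X Y f" and \<tau>: "singular_simplex k X \<tau>"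
  shows "(\<tau>, restrict (\<lambda>z. f (\<tau> (snd z))) ({0..1} \<times> standard_simplex k)) \<in> path_simplices X Y f k"
proof -
  have "continuous_map (simplex_cyl k) Y (\<lambda>z. f (\<tau> (snd z)))"
    using continuous_map_compose [OF continuous_map_compose [OF continuous_map_snd singular_simplexD(1) [OF \<tau>]] f] by (simp add: o_def)
  from path_simplexI [OF singular_simplexD(1) [OF \<tau>] this, of f] show ?thesis
    using singular_simplexD(2) [OF \<tau>] by (simp add: extensional_restrict)
qed

lemma path_face_const:
  assumes "i \<le> Suc k"
  shows "path_face (Suc k) i (\<tau>, restrict (\<lambda>z. f (\<tau> (snd z))) ({0..1} \<times> standard_simplex (Suc k)))
    = (singular_face (Suc k) i \<tau>, restrict (\<lambda>z. f (singular_face (Suc k) i \<tau> (snd z))) ({0..1} \<times> standard_simplex k))"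
  using assms by (auto simp: path_face_def fun_eq_iff singular_face_apply simplical_face_in)

lemma path_target_const:
  "path_target (\<tau>, restrict (\<lambda>z. f (\<tau> (snd z))) ({0..1} \<times> standard_simplex k)) = simplex_map k f \<tau>"
  by (auto simp: path_target_def simplex_map_def fun_eq_iff)

text \<open>The path of a constant homotopy is constant on the unit interval, and a constant path
  transports by the identity.\<close>

lemma path_transport_const:
  assumes f: "continuous_map X Y f" and G: "coefficient_system Y G" and \<tau>: "singular_simplex k X \<tau>"
    and g: "g \<in> carrier (fibre G (f (\<tau> (vertex 0))))"
  shows "path_transport G (\<tau>, restrict (\<lambda>z. f (\<tau> (snd z))) ({0..1} \<times> standard_simplex k)) g = g"
proof -
  have y: "f (\<tau> (vertex 0)) \<in> topspace Y"
    using simplex_vertex_in [OF \<tau>, of 0] f by (auto simp: continuous_map_def)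
  have "transport G (\<lambda>_. f (\<tau> (vertex 0))) g
      = path_transport G (\<tau>, restrict (\<lambda>z. f (\<tau> (snd z))) ({0..1} \<times> standard_simplex k)) g"
    unfolding path_transport_def
    by (rule transport_cong [OF G]) (use y g in \<open>simp_all add: vertex_in\<close>)
  then show ?thesis
    using transport_const [OF G y g] by simp
qed

section \<open>The map induced by \<open>f\<close> as a composite of equivalences\<close>

lemma quot_equiv_cong:
  assumes F: "quot_equiv C Z B C' Z' B' F" and eq: "\<forall>c\<in>carrier C. F' c = F c"
    and C: "group C" "Z \<subseteq> carrier C" "B \<subseteq> carrier C"
  shows "quot_equiv C Z B C' Z' B' F'"
proof -
  have h: "F' \<in> hom C C'"
    by (rule hom_cong_carrier [OF quot_equivD(1) [OF F] _ C(1)]) (use eq in blast)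
  have "F' z = F z" if "z \<in> Z \<union> B" for z using eq C(2,3) that by blast
  then show ?thesis
    using F h unfolding quot_equiv_def by (simp add: image_subset_iff)
qed

context
  fixes S :: "nat \<Rightarrow> 's set" and A :: "'s \<Rightarrow> 'g monoid" and D
    and S' :: "nat \<Rightarrow> 't set" and A' :: "'t \<Rightarrow> 'g monoid" and D'
    and S'' :: "nat \<Rightarrow> 'u set" and A'' :: "'u \<Rightarrow> 'g monoid" and D'' and k \<Phi> \<Psi>
  assumes K: "op_complex S A D" and K': "op_complex S' A' D'" and K'': "op_complex S'' A'' D''"
    and \<Phi>: "local_op (S k) A (S' k) A' \<Phi>" and \<Psi>: "local_op (S' k) A' (S'' k) A'' \<Psi>"
begin

lemma op_chain_equiv_comp:
  assumes 1: "quot_equiv (sum_group (S k) A) (op_cycles S A D k) (op_boundaries S A D k)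
      (sum_group (S' k) A') (op_cycles S' A' D' k) (op_boundaries S' A' D' k) (op_chain (S k) A (S' k) A' \<Phi>)"
    and 2: "quot_equiv (sum_group (S' k) A') (op_cycles S' A' D' k) (op_boundaries S' A' D' k)
      (sum_group (S'' k) A'') (op_cycles S'' A'' D'' k) (op_boundaries S'' A'' D'' k) (op_chain (S' k) A' (S'' k) A'' \<Psi>)"
  shows "quot_equiv (sum_group (S k) A) (op_cycles S A D k) (op_boundaries S A D k)
      (sum_group (S'' k) A'') (op_cycles S'' A'' D'' k) (op_boundaries S'' A'' D'' k)
      (op_chain (S k) A (S'' k) A'' (op_comp A \<Psi> \<Phi>))"
proof (rule quot_equiv_cong)
  show "quot_equiv (sum_group (S k) A) (op_cycles S A D k) (op_boundaries S A D k)
      (sum_group (S'' k) A'') (op_cycles S'' A'' D'' k) (op_boundaries S'' A'' D'' k)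
      (op_chain (S' k) A' (S'' k) A'' \<Psi> \<circ> op_chain (S k) A (S' k) A' \<Phi>)"
    by (rule quot_equiv_comp [OF 1 2 comm_group_sum_group [OF op_complexD(1) [OF K'']] subgroup_op_boundaries [OF K'']
        subgroup.subset [OF subgroup_op_cycles [OF K]] subgroup.subset [OF subgroup_op_boundaries [OF K']]])
  show "\<forall>c\<in>carrier (sum_group (S k) A). op_chain (S k) A (S'' k) A'' (op_comp A \<Psi> \<Phi>) c
      = (op_chain (S' k) A' (S'' k) A'' \<Psi> \<circ> op_chain (S k) A (S' k) A' \<Phi>) c"
    using op_chain_comp [OF op_complexD(1) [OF K] op_complexD(1) [OF K'] op_complexD(1) [OF K''] \<Phi> \<Psi>] by simp
qed (rule comm_group.axioms(2) [OF comm_group_sum_group [OF op_complexD(1) [OF K]]],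
    rule subgroup.subset [OF subgroup_op_cycles [OF K]], rule subgroup.subset [OF subgroup_op_boundaries [OF K]])

lemma op_cochain_equiv_comp:
  assumes 1: "quot_equiv (product_group (S' k) A') (op_cocycles S' A' D' k) (op_coboundaries S' A' D' k)
      (product_group (S k) A) (op_cocycles S A D k) (op_coboundaries S A D k) (op_cochain (S k) A \<Phi>)"
    and 2: "quot_equiv (product_group (S'' k) A'') (op_cocycles S'' A'' D'' k) (op_coboundaries S'' A'' D'' k)
      (product_group (S' k) A') (op_cocycles S' A' D' k) (op_coboundaries S' A' D' k) (op_cochain (S' k) A' \<Psi>)"
  shows "quot_equiv (product_group (S'' k) A'') (op_cocycles S'' A'' D'' k) (op_coboundaries S'' A'' D'' k)
      (product_group (S k) A) (op_cocycles S A D k) (op_coboundaries S A D k)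
      (op_cochain (S k) A (op_comp A \<Psi> \<Phi>))"
proof (rule quot_equiv_cong)
  show "quot_equiv (product_group (S'' k) A'') (op_cocycles S'' A'' D'' k) (op_coboundaries S'' A'' D'' k)
      (product_group (S k) A) (op_cocycles S A D k) (op_coboundaries S A D k)
      (op_cochain (S k) A \<Phi> \<circ> op_cochain (S' k) A' \<Psi>)"
    by (rule quot_equiv_comp [OF 2 1 comm_group_product_group [OF op_complexD(1) [OF K]] subgroup_op_coboundaries [OF K]
        subgroup.subset [OF subgroup_op_cocycles [OF K'']] subgroup.subset [OF subgroup_op_coboundaries [OF K']]])
  show "\<forall>c\<in>carrier (product_group (S'' k) A''). op_cochain (S k) A (op_comp A \<Psi> \<Phi>) c
      = (op_cochain (S k) A \<Phi> \<circ> op_cochain (S' k) A' \<Psi>) c"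
    using op_cochain_comp [OF op_complexD(1) [OF K] op_complexD(1) [OF K'] op_complexD(1) [OF K''] \<Phi> \<Psi>] by simp
qed (rule comm_group.axioms(2) [OF comm_group_product_group [OF op_complexD(1) [OF K'']]],
    rule subgroup.subset [OF subgroup_op_cocycles [OF K'']], rule subgroup.subset [OF subgroup_op_coboundaries [OF K'']])

end

abbreviation singular_op :: "('a, 'g) coeff_system \<Rightarrow> nat \<Rightarrow> ((nat \<Rightarrow> real) \<Rightarrow> 'a) \<Rightarrow> (((nat \<Rightarrow> real) \<Rightarrow> 'a) \<times> ('g \<Rightarrow> 'g)) \<Rightarrow>\<^sub>0 int" where
  "singular_op G \<equiv> face_op singular_face (simplex_fibre G) (\<lambda>\<sigma>. transport G (edge_path \<sigma>))"

text \<open>The fibre of the pull-back at \<open>\<tau>\<close> is the fibre of \<open>G\<close> at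
  the image simplex, so the map of coefficients is the identity.\<close>

definition map_op :: "('a \<Rightarrow> 'b) \<Rightarrow> ('b, 'g) coeff_system \<Rightarrow> nat \<Rightarrow> ((nat \<Rightarrow> real) \<Rightarrow> 'a) \<Rightarrow> (((nat \<Rightarrow> real) \<Rightarrow> 'b) \<times> ('g \<Rightarrow> 'g)) \<Rightarrow>\<^sub>0 int" where
  "map_op f G k \<tau> = frag_of (simplex_map k f \<tau>, \<lambda>g\<in>carrier (simplex_fibre (pullback f G) \<tau>). g)"

lemma map_op_equiv:
  fixes X :: "'a topology" and Y :: "'b topology" and f :: "'a \<Rightarrow> 'b" and G :: "('b, 'g) coeff_system"
  assumes weq: "weak_homotopy_equivalence X Y f" and G: "coefficient_system Y G"
  defines "SX \<equiv> \<lambda>k. singular_simplex_set k X" and "AX \<equiv> simplex_fibre (pullback f G)"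
    and "SY \<equiv> \<lambda>k. singular_simplex_set k Y" and "AY \<equiv> simplex_fibre G"
    and "DX \<equiv> singular_op (pullback f G)" and "DY \<equiv> singular_op G"
  shows "quot_equiv (sum_group (SX k) AX) (op_cycles SX AX DX k) (op_boundaries SX AX DX k)
           (sum_group (SY k) AY) (op_cycles SY AY DY k) (op_boundaries SY AY DY k)
           (op_chain (SX k) AX (SY k) AY (map_op f G k))"
    and "quot_equiv (product_group (SY k) AY) (op_cocycles SY AY DY k) (op_coboundaries SY AY DY k)
           (product_group (SX k) AX) (op_cocycles SX AX DX k) (op_coboundaries SX AX DX k)
           (op_cochain (SX k) AX (map_op f G k))"
proof -
  have f: "continuous_map X Y f" by (rule weq_continuous [OF weq])
  let ?E = "path_simplices X Y f"
  let ?TX = "\<lambda>\<sigma>. transport (pullback f G) (edge_path \<sigma>)" and ?TY = "\<lambda>\<sigma>. transport G (edge_path \<sigma>)"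
  let ?j = "\<lambda>k (\<tau>::(nat \<Rightarrow> real) \<Rightarrow> 'a). (\<tau>, restrict (\<lambda>z. f (\<tau> (snd z))) ({0..1} \<times> standard_simplex k))"
  interpret p0: trivial_fibration SY singular_face AY ?TY ?E path_face path_target simplex_degen
    unfolding SY_def AY_def by (rule trivial_fibration_path_target [OF weq G])
  interpret p: trivial_fibration_section SY singular_face AY ?TY ?E path_face path_target simplex_degen p0.sect
    by unfold_locales (rule p0.is_section_sect)
  interpret q0: trivial_fibration SX singular_face AX ?TX ?E path_face fst simplex_degen
    unfolding SX_def AX_def by (rule trivial_fibration_path_source [OF f coefficient_system_pullback [OF G f]])
  have j: "?j k \<tau> \<in> ?E k" if "\<tau> \<in> SX k" for k \<tau>
    using const_path_in [OF f] that by (simp add: SX_def)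
  \<comment> \<open>The constant homotopies commute with faces exactly. With them as the section,
    the projection to \<open>path_target\<close> gives the image under \<open>f\<close> itself; an
    arbitrary section would give it only up to homotopy.\<close>
  interpret q: trivial_fibration_section SX singular_face AX ?TX ?E path_face fst simplex_degen ?j
  proof unfold_locales
    have "path_face (Suc k) i (?j (Suc k) \<tau>) = ?j k (singular_face (Suc k) i \<tau>)" if "i \<le> Suc k" for k i \<tau>
      by (rule path_face_const [OF that])
    then show "q0.is_section ?j"
      unfolding q0.is_section_def using j by auto
  qed
  let ?AE = "\<lambda>e::((nat \<Rightarrow> real) \<Rightarrow> 'a) \<times> (real \<times> (nat \<Rightarrow> real) \<Rightarrow> 'b). AX (fst e)"
    and ?AE' = "\<lambda>e::((nat \<Rightarrow> real) \<Rightarrow> 'a) \<times> (real \<times> (nat \<Rightarrow> real) \<Rightarrow> 'b). AY (path_target e)"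
  let ?\<Theta> = "\<lambda>e. frag_of (e, restrict (path_transport G e) (carrier (?AE e)))"
  have 1: "\<forall>k. \<forall>e\<in>?E k. path_transport G e \<in> iso (?AE e) (?AE' e)"
    using path_transport_iso [OF G] unfolding AX_def AY_def by blast
  have 2: "\<forall>k. \<forall>e\<in>?E (Suc k). \<forall>g\<in>carrier (?AE e). path_transport G (path_face (Suc k) 0 e) (?TX (fst e) g) = ?TY (path_target e) (path_transport G e g)"
    using path_transport_face_0 [OF G] unfolding AX_def by blast
  have 3: "\<forall>k. \<forall>e\<in>?E (Suc k). \<forall>g\<in>carrier (?AE e). \<forall>i. 1 \<le> i \<and> i \<le> Suc k \<longrightarrow> path_transport G (path_face (Suc k) i e) g = path_transport G e g"
    using path_transport_face [OF G] unfolding AX_def by blast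
  note \<Theta> = local_system_iso_equiv [OF q0.E.local_system_axioms p0.E.local_system_axioms 1 2 3]
  note KX = q0.B.op_complex_face_op and KE = q0.E.op_complex_face_op and KE' = p0.E.op_complex_face_op and KY = p0.B.op_complex_face_op
  note J_op = op_chain_map_op [OF KX KE q.sect_op_chain_map] and \<Theta>_op = op_chain_map_op [OF KE KE' \<Theta>(1)]
    and P_op = op_chain_map_op [OF KE' KY p.proj_op_chain_map]
  have A_grp: "\<forall>\<sigma>\<in>SX k. group (AX \<sigma>)" by (rule op_complexD(7) [OF KX])
  let ?F = "op_comp AX (p.proj_op k) (op_comp AX ?\<Theta> (q.sect_op k))"
  have F: "map_op f G k \<tau> = ?F \<tau>" if \<tau>: "\<tau> \<in> SX k" for \<tau>
  proof -
    \<comment> \<open>Over a constant homotopy the two fibres coincide and the comparison is the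
      identity, so the composite leaves the coefficient alone.\<close>
    have *: "g \<in> carrier (AY (simplex_map k f \<tau>))" "path_transport G (?j k \<tau>) g = g" if "g \<in> carrier (AX \<tau>)" for g
      using path_transport_const [OF f G, of k \<tau> g] \<tau> that
      by (simp_all add: AX_def AY_def SX_def simplex_fibre_pullback simplex_fibre_def [of G] simplex_map_def vertex_in)
    have "compose (carrier (AX \<tau>)) (\<lambda>g\<in>carrier (AY (simplex_map k f \<tau>)). g)
        (compose (carrier (AX \<tau>)) (restrict (path_transport G (?j k \<tau>)) (carrier (AX \<tau>))) (\<lambda>g\<in>carrier (AX \<tau>). g)) = (\<lambda>g\<in>carrier (AX \<tau>). g)"
      by (rule extensionalityI [of _ "carrier (AX \<tau>)"]) (use * in \<open>simp_all add: compose_eq\<close>)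
    then show ?thesis
      unfolding q.sect_op_def [abs_def] p.proj_op_def [abs_def] op_comp_single path_target_const fst_conv map_op_def
      by (simp add: AX_def)
  qed
  have local_F: "local_op (SX k) AX (SY k) AY ?F"
    by (rule local_op_comp [OF P_op local_op_comp [OF \<Theta>_op J_op A_grp] A_grp])
  note JT_op = local_op_comp [OF \<Theta>_op J_op A_grp]
  have c: "quot_equiv (sum_group (SX k) AX) (op_cycles SX AX DX k) (op_boundaries SX AX DX k)
           (sum_group (SY k) AY) (op_cycles SY AY DY k) (op_boundaries SY AY DY k) (op_chain (SX k) AX (SY k) AY ?F)"
    unfolding DX_def DY_def AX_def [symmetric] AY_def [symmetric]
    by (rule op_chain_equiv_comp [OF KX KE' KY JT_op P_op
        op_chain_equiv_comp [OF KX KE KE' J_op \<Theta>_op q.sect_op_equiv(1) \<Theta>(2)] p.proj_op_equiv(1)])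
  show "quot_equiv (sum_group (SX k) AX) (op_cycles SX AX DX k) (op_boundaries SX AX DX k)
           (sum_group (SY k) AY) (op_cycles SY AY DY k) (op_boundaries SY AY DY k)
           (op_chain (SX k) AX (SY k) AY (map_op f G k))"
  proof (rule quot_equiv_cong [OF c])
    show "\<forall>c\<in>carrier (sum_group (SX k) AX). op_chain (SX k) AX (SY k) AY (map_op f G k) c = op_chain (SX k) AX (SY k) AY ?F c"
      using op_chain_cong [OF op_complexD(1) [OF KX] op_complexD(1) [OF KY] F local_F] by blast
  qed (use KX in \<open>simp_all add: DX_def AX_def [symmetric] comm_group.axioms(2) comm_group_sum_group op_complexD(1)
      subgroup.subset [OF subgroup_op_cycles] subgroup.subset [OF subgroup_op_boundaries]\<close>)
  have "quot_equiv (product_group (SY k) AY) (op_cocycles SY AY DY k) (op_coboundaries SY AY DY k)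
           (product_group (SX k) AX) (op_cocycles SX AX DX k) (op_coboundaries SX AX DX k) (op_cochain (SX k) AX ?F)"
    unfolding DX_def DY_def AX_def [symmetric] AY_def [symmetric]
    by (rule op_cochain_equiv_comp [OF KX KE' KY JT_op P_op
        op_cochain_equiv_comp [OF KX KE KE' J_op \<Theta>_op q.sect_op_equiv(2) \<Theta>(3)] p.proj_op_equiv(2)])
  moreover have "op_cochain (SX k) AX (map_op f G k) = op_cochain (SX k) AX ?F"
    by (rule op_cochain_cong [OF F])
  ultimately show "quot_equiv (product_group (SY k) AY) (op_cocycles SY AY DY k) (op_coboundaries SY AY DY k)
           (product_group (SX k) AX) (op_cocycles SX AX DX k) (op_coboundaries SX AX DX k)
           (op_cochain (SX k) AX (map_op f G k))" by simp
qed

section \<open>Singular chains and cochains as operators\<close>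

text \<open>The factor of face 0 is split off, to match the separate treatment of that face in
  \<open>boundary_single\<close> and \<open>local_coboundary\<close>.\<close>

lemma (in comm_group) frag_eval_face_op:
  assumes \<phi>: "\<And>j. j \<le> Suc k \<Longrightarrow> \<phi> (d (Suc k) j \<sigma>, face_transport A T j \<sigma>) \<in> carrier G"
  shows "frag_eval G \<phi> (face_op d A T (Suc k) \<sigma>)
     = \<phi> (d (Suc k) 0 \<sigma>, face_transport A T 0 \<sigma>) \<otimes>
       finprod G (\<lambda>i. \<phi> (d (Suc k) i \<sigma>, face_transport A T i \<sigma>) [^] ((- 1) ^ i :: int)) {1..Suc k}"
proof -
  let ?x = "\<lambda>j. frag_of (d (Suc k) j \<sigma>, face_transport A T j \<sigma>)"
  have in_carrier: "\<phi> \<in> Poly_Mapping.keys (?x j) \<rightarrow> carrier G" if "j \<le> Suc k" for j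
    using \<phi> [OF that] by simp
  have in_carrier': "\<phi> \<in> Poly_Mapping.keys (frag_cmul ((- 1) ^ j) (?x j)) \<rightarrow> carrier G" if "j \<le> Suc k" for j
    using in_carrier [OF that] keys_cmul [of "(- 1) ^ j" "?x j"] by blast
  have eval: "frag_eval G \<phi> (frag_cmul ((- 1) ^ j) (?x j)) = \<phi> (d (Suc k) j \<sigma>, face_transport A T j \<sigma>) [^] ((- 1) ^ j :: int)"
    if "j \<le> Suc k" for j
    using frag_eval_cmul [OF in_carrier [OF that]] \<phi> [OF that] by simp
  have "frag_eval G \<phi> (face_op d A T (Suc k) \<sigma>) = finprod G (\<lambda>j. frag_eval G \<phi> (frag_cmul ((- 1) ^ j) (?x j))) {..Suc k}"
    unfolding face_op_Suc by (rule frag_eval_sum) (use in_carrier' in auto)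
  also have "\<dots> = finprod G (\<lambda>j. \<phi> (d (Suc k) j \<sigma>, face_transport A T j \<sigma>) [^] ((- 1) ^ j :: int)) (insert 0 {1..Suc k})"
  proof (rule finprod_cong')
    show "{..Suc k} = insert 0 {1..Suc k}" by auto
    show "(\<lambda>j. \<phi> (d (Suc k) j \<sigma>, face_transport A T j \<sigma>) [^] ((- 1) ^ j :: int)) \<in> insert 0 {1..Suc k} \<rightarrow> carrier G"
      using \<phi> by auto
    show "frag_eval G \<phi> (frag_cmul ((- 1) ^ j) (?x j)) = \<phi> (d (Suc k) j \<sigma>, face_transport A T j \<sigma>) [^] ((- 1) ^ j :: int)"
      if "j \<in> insert 0 {1..Suc k}" for j
      by (rule eval) (use that in auto)
  qed
  also have "\<dots> = \<phi> (d (Suc k) 0 \<sigma>, face_transport A T 0 \<sigma>) [^] ((- 1) ^ 0 :: int) \<otimes>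
       finprod G (\<lambda>i. \<phi> (d (Suc k) i \<sigma>, face_transport A T i \<sigma>) [^] ((- 1) ^ i :: int)) {1..Suc k}"
    by (rule finprod_insert) (use \<phi> in auto)
  finally show ?thesis using \<phi> [of 0] by simp
qed

lemma chain_single_eq: "chain_single k X G g \<sigma> = sum_single (singular_simplex_set k X) (simplex_fibre G) \<sigma> g"
  by (simp add: chain_single_def sum_single_def)

context
  fixes X :: "'a topology" and G :: "('a, 'g) coeff_system"
  assumes G: "coefficient_system X G"
begin

private abbreviation (input) "S \<equiv> \<lambda>k. singular_simplex_set k X"
private abbreviation (input) "A \<equiv> simplex_fibre G"
private abbreviation (input) "D \<equiv> singular_op G"

lemma op_complex_singular: "op_complex S A D"
  by (rule local_system.op_complex_face_op [OF local_system_singular [OF G]])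

lemma singular_face_transport:
  assumes "\<sigma> \<in> S (Suc k)" "j \<le> Suc k"
  shows "face_transport A (\<lambda>\<sigma>. transport G (edge_path \<sigma>)) j \<sigma> \<in> iso (A \<sigma>) (A (singular_face (Suc k) j \<sigma>))"
    and "singular_face (Suc k) j \<sigma> \<in> S k"
  using local_system.face_transport_iso [OF local_system_singular [OF G] assms]
    face_system.face_in [OF face_system_singular assms] by blast+

text \<open>Both sides are products over the support of \<open>c\<close>, so it suffices to compare
  one simplex at a time; there the restricted transports are evaluated at elements of the fibre and
  the restriction disappears.\<close>

lemma local_boundary_eq:
  assumes c: "c \<in> carrier (sum_group (S k) A)"
  shows "local_boundary k X G c = op_chain (S k) A (S (k - 1)) A (D k) c"
proof (cases k)
  case 0
  then show ?thesis
    using op_chain_zero [OF op_complexD(1) [OF op_complex_singular, of 0] op_complexD(1) [OF op_complex_singular, of 0], of c] by (simp add: local_boundary_def local_chain_group_def)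
next
  case (Suc l)
  let ?H = "sum_group (S l) A"
  have A: "\<forall>\<sigma>\<in>S l. comm_group (A \<sigma>)" for l by (rule op_complexD(1) [OF op_complex_singular])
  interpret H: comm_group ?H by (rule comm_group_sum_group [OF A])
  have "finprod ?H (\<lambda>\<sigma>. boundary_single (Suc l) X G (c \<sigma>) \<sigma>) {\<sigma> \<in> S (Suc l). c \<sigma> \<noteq> \<one>\<^bsub>A \<sigma>\<^esub>}
      = finprod ?H (\<lambda>\<sigma>. frag_eval ?H (\<lambda>x. sum_single (S l) A (fst x) (snd x (c \<sigma>))) (D (Suc l) \<sigma>)) {\<sigma> \<in> S (Suc l). c \<sigma> \<noteq> \<one>\<^bsub>A \<sigma>\<^esub>}"
  proof (rule H.finprod_cong' [OF refl])
    show "(\<lambda>\<sigma>. frag_eval ?H (\<lambda>x. sum_single (S l) A (fst x) (snd x (c \<sigma>))) (D (Suc l) \<sigma>)) \<in> {\<sigma> \<in> S (Suc l). c \<sigma> \<noteq> \<one>\<^bsub>A \<sigma>\<^esub>} \<rightarrow> carrier ?H"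
    proof
      fix \<sigma> assume "\<sigma> \<in> {\<sigma> \<in> S (Suc l). c \<sigma> \<noteq> \<one>\<^bsub>A \<sigma>\<^esub>}"
      then have \<sigma>: "\<sigma> \<in> S (Suc l)" by blast
      then have "c \<sigma> \<in> carrier (A \<sigma>)" using c Suc by (auto simp: sum_group_carrier_iff [OF A])
      then show "frag_eval ?H (\<lambda>x. sum_single (S l) A (fst x) (snd x (c \<sigma>))) (D (Suc l) \<sigma>) \<in> carrier ?H"
        by (intro H.frag_eval_closed single_image_closed [OF A A op_complexD(3) [OF op_complex_singular] \<sigma>])
    qed
    fix \<sigma> assume "\<sigma> \<in> {\<sigma> \<in> S (Suc l). c \<sigma> \<noteq> \<one>\<^bsub>A \<sigma>\<^esub>}"
    then have \<sigma>: "\<sigma> \<in> S (Suc l)" by blast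
    then have g: "c \<sigma> \<in> carrier (A \<sigma>)" using c Suc by (auto simp: sum_group_carrier_iff [OF A])
    let ?t = "\<lambda>j. face_transport A (\<lambda>\<sigma>. transport G (edge_path \<sigma>)) j \<sigma>"
    have t: "?t j (c \<sigma>) = (if j = 0 then transport G (edge_path \<sigma>) (c \<sigma>) else c \<sigma>)" for j
      using g by (simp add: face_transport_def)
    have closed: "sum_single (S l) A (singular_face (Suc l) j \<sigma>) (?t j (c \<sigma>)) \<in> carrier ?H" if "j \<le> Suc l" for j
      using singular_face_transport [OF \<sigma> that] g by (intro sum_single_closed [OF A]) (auto simp: iso_def hom_in_carrier)
    have "frag_eval ?H (\<lambda>x. sum_single (S l) A (fst x) (snd x (c \<sigma>))) (D (Suc l) \<sigma>)
      = sum_single (S l) A (singular_face (Suc l) 0 \<sigma>) (?t 0 (c \<sigma>)) \<otimes>\<^bsub>?H\<^esub>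
        finprod ?H (\<lambda>i. sum_single (S l) A (singular_face (Suc l) i \<sigma>) (?t i (c \<sigma>)) [^]\<^bsub>?H\<^esub> ((- 1) ^ i :: int)) {1..Suc l}"
      using closed by (subst H.frag_eval_face_op) simp_all
    also have "\<dots> = boundary_single (Suc l) X G (c \<sigma>) \<sigma>"
    proof -
      have "finprod ?H (\<lambda>i. sum_single (S l) A (singular_face (Suc l) i \<sigma>) (?t i (c \<sigma>)) [^]\<^bsub>?H\<^esub> ((- 1) ^ i :: int)) {1..Suc l}
        = finprod ?H (\<lambda>i. sum_single (S l) A (singular_face (Suc l) i \<sigma>) (c \<sigma>) [^]\<^bsub>?H\<^esub> ((- 1) ^ i :: int)) {1..Suc l}"
      proof (rule H.finprod_cong' [OF refl])
        show "(\<lambda>i. sum_single (S l) A (singular_face (Suc l) i \<sigma>) (c \<sigma>) [^]\<^bsub>?H\<^esub> ((- 1) ^ i :: int)) \<in> {1..Suc l} \<rightarrow> carrier ?H"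
        proof
          fix i assume "i \<in> {1..Suc l}"
          then show "sum_single (S l) A (singular_face (Suc l) i \<sigma>) (c \<sigma>) [^]\<^bsub>?H\<^esub> ((- 1) ^ i :: int) \<in> carrier ?H"
            using closed [of i] unfolding t by (intro H.int_pow_closed) simp
        qed
      qed (simp add: t)
      then show ?thesis
        unfolding boundary_single_def chain_single_eq local_chain_group_def diff_Suc_1 by (simp add: t)
    qed
    finally show "boundary_single (Suc l) X G (c \<sigma>) \<sigma> = frag_eval ?H (\<lambda>x. sum_single (S l) A (fst x) (snd x (c \<sigma>))) (D (Suc l) \<sigma>)"
      by (rule sym)
  qed
  then show ?thesis
    unfolding Suc op_chain_def local_boundary_def chain_support_def local_chain_group_def by simp
qed

lemma local_cycles_eq: "local_cycles k X G = op_cycles S A D k"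
  unfolding local_cycles_def op_cycles_def local_chain_group_def kernel_def using local_boundary_eq by auto

lemma local_boundaries_eq: "local_boundaries k X G = op_boundaries S A D k"
  unfolding local_boundaries_def op_boundaries_def local_chain_group_def
  by (rule image_cong [OF refl]) (use local_boundary_eq [of _ "Suc k"] in simp)

text \<open>The coboundary up to its global sign. The inverse of the transport stays at face 0; the
  other faces have the same fibre and carry the identity.\<close>

lemma op_cochain_singular:
  assumes c: "c \<in> carrier (product_group (S k) A)" and \<sigma>: "\<sigma> \<in> S (Suc k)"
  shows "op_cochain (S (Suc k)) A (D (Suc k)) c \<sigma> =
     inv_into (carrier (A \<sigma>)) (transport G (edge_path \<sigma>)) (c (singular_face (Suc k) 0 \<sigma>)) \<otimes>\<^bsub>A \<sigma>\<^esub>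
     finprod (A \<sigma>) (\<lambda>i. c (singular_face (Suc k) i \<sigma>) [^]\<^bsub>A \<sigma>\<^esub> ((- 1) ^ i :: int)) {1..Suc k}"
proof -
  interpret A: comm_group "A \<sigma>" using op_complexD(1) [OF op_complex_singular, of "Suc k"] \<sigma> by blast
  let ?t = "\<lambda>j. face_transport A (\<lambda>\<sigma>. transport G (edge_path \<sigma>)) j \<sigma>"
  let ?\<phi> = "\<lambda>x. inv_into (carrier (A \<sigma>)) (snd x) (c (fst x))"
  have cj: "c (singular_face (Suc k) j \<sigma>) \<in> carrier (A (singular_face (Suc k) j \<sigma>))" if "j \<le> Suc k" for j
    using c singular_face_transport(2) [OF \<sigma> that] by auto
  have closed: "inv_into (carrier (A \<sigma>)) (?t j) (c (singular_face (Suc k) j \<sigma>)) \<in> carrier (A \<sigma>)" if "j \<le> Suc k" for j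
    using cj [OF that] singular_face_transport(1) [OF \<sigma> that] by (intro inv_into_into) (auto simp: iso_def bij_betw_def)
  \<comment> \<open>\<open>inv_into\<close> looks only at the values on the carrier, where the
    restriction in \<open>face_transport\<close> has no effect.\<close>
  have t0: "inv_into (carrier (A \<sigma>)) (?t 0) y = inv_into (carrier (A \<sigma>)) (transport G (edge_path \<sigma>)) y" for y
    by (simp add: inv_into_def face_transport_def cong: conj_cong)
  have face: "A (singular_face (Suc k) j \<sigma>) = A \<sigma>" if "1 \<le> j" "j \<le> Suc k" for j
    by (rule local_system.A_face [OF local_system_singular [OF G] \<sigma> that])
  have tj: "inv_into (carrier (A \<sigma>)) (?t j) (c (singular_face (Suc k) j \<sigma>)) = c (singular_face (Suc k) j \<sigma>)"
    if j: "1 \<le> j" "j \<le> Suc k" for j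
    by (rule inv_into_iso_eq [OF singular_face_transport(1) [OF \<sigma> j(2)]])
      (use cj [OF j(2)] face [OF j] j(1) in \<open>simp_all add: face_transport_def\<close>)
  have "op_cochain (S (Suc k)) A (D (Suc k)) c \<sigma> = frag_eval (A \<sigma>) ?\<phi> (D (Suc k) \<sigma>)"
    using \<sigma> by (simp add: op_cochain_def)
  also have "\<dots> = inv_into (carrier (A \<sigma>)) (?t 0) (c (singular_face (Suc k) 0 \<sigma>)) \<otimes>\<^bsub>A \<sigma>\<^esub>
     finprod (A \<sigma>) (\<lambda>i. inv_into (carrier (A \<sigma>)) (?t i) (c (singular_face (Suc k) i \<sigma>)) [^]\<^bsub>A \<sigma>\<^esub> ((- 1) ^ i :: int)) {1..Suc k}"
    using closed by (subst A.frag_eval_face_op) simp_all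
  also have "finprod (A \<sigma>) (\<lambda>i. inv_into (carrier (A \<sigma>)) (?t i) (c (singular_face (Suc k) i \<sigma>)) [^]\<^bsub>A \<sigma>\<^esub> ((- 1) ^ i :: int)) {1..Suc k}
     = finprod (A \<sigma>) (\<lambda>i. c (singular_face (Suc k) i \<sigma>) [^]\<^bsub>A \<sigma>\<^esub> ((- 1) ^ i :: int)) {1..Suc k}"
  proof (rule A.finprod_cong' [OF refl])
    show "(\<lambda>i. c (singular_face (Suc k) i \<sigma>) [^]\<^bsub>A \<sigma>\<^esub> ((- 1) ^ i :: int)) \<in> {1..Suc k} \<rightarrow> carrier (A \<sigma>)"
    proof
      fix i assume "i \<in> {1..Suc k}"
      then show "c (singular_face (Suc k) i \<sigma>) [^]\<^bsub>A \<sigma>\<^esub> ((- 1) ^ i :: int) \<in> carrier (A \<sigma>)"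
        using cj [of i] face [of i] by (intro A.int_pow_closed) simp
    qed
  qed (use tj in simp)
  finally show ?thesis unfolding t0 .
qed

text \<open>The sign \<open>(-1)^k\<close> of the definition becomes inversion in odd degrees. It
  changes neither kernel nor image, so cocycles and coboundaries are those of the unsigned
  operator.\<close>

lemma local_coboundary_eq:
  assumes c: "c \<in> carrier (product_group (S k) A)"
  shows "local_coboundary k X G c = (if even k then op_cochain (S (Suc k)) A (D (Suc k)) c
      else inv\<^bsub>product_group (S (Suc k)) A\<^esub> op_cochain (S (Suc k)) A (D (Suc k)) c)"
proof -
  let ?x = "op_cochain (S (Suc k)) A (D (Suc k)) c" and ?P = "product_group (S (Suc k)) A"
  have A: "\<forall>\<sigma>\<in>S k. comm_group (A \<sigma>)" for k by (rule op_complexD(1) [OF op_complex_singular])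
  have x: "?x \<in> carrier ?P"
    using op_cochain_hom [OF A A op_complexD(3) [OF op_complex_singular, of k]] c by (rule hom_in_carrier)
  then have xE: "?x \<in> (\<Pi>\<^sub>E \<sigma>\<in>S (Suc k). carrier (A \<sigma>))" by simp
  have grp: "group (A \<sigma>)" if "\<sigma> \<in> S (Suc k)" for \<sigma>
    using A that by (blast intro: comm_group.axioms(2))
  have "local_coboundary k X G c = (\<lambda>\<sigma>\<in>S (Suc k). ?x \<sigma> [^]\<^bsub>A \<sigma>\<^esub> ((- 1) ^ k :: int))"
    unfolding local_coboundary_def by (rule restrict_ext) (simp only: op_cochain_singular [OF c])
  also have "\<dots> = (if even k then ?x else inv\<^bsub>?P\<^esub> ?x)"
  proof (cases "even k")
    case True
    have "(\<lambda>\<sigma>\<in>S (Suc k). ?x \<sigma> [^]\<^bsub>A \<sigma>\<^esub> (1 :: int)) = ?x"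
      by (rule extensionalityI [of _ "S (Suc k)"])
        (use xE group.int_pow_1 [OF grp] in \<open>simp_all add: PiE_def Pi_def\<close>)
    then show ?thesis using True by simp
  next
    case False
    have "(\<lambda>\<sigma>\<in>S (Suc k). ?x \<sigma> [^]\<^bsub>A \<sigma>\<^esub> (- 1 :: int)) = (\<lambda>\<sigma>\<in>S (Suc k). inv\<^bsub>A \<sigma>\<^esub> (?x \<sigma>))"
    proof (rule restrict_ext)
      fix \<sigma> assume \<sigma>: "\<sigma> \<in> S (Suc k)"
      have "?x \<sigma> \<in> carrier (A \<sigma>)" using xE \<sigma> by (rule PiE_mem)
      then show "?x \<sigma> [^]\<^bsub>A \<sigma>\<^esub> (- 1 :: int) = inv\<^bsub>A \<sigma>\<^esub> (?x \<sigma>)"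
        using group.int_pow_neg [OF grp [OF \<sigma>], of "?x \<sigma>" 1] group.int_pow_1 [OF grp [OF \<sigma>], of "?x \<sigma>"] by simp
    qed
    then show ?thesis
      using False inv_product_group [OF xE] grp by simp
  qed
  finally show ?thesis .
qed

lemma local_cocycles_eq: "local_cocycles k X G = op_cocycles S A D k"
proof -
  have A: "\<forall>\<sigma>\<in>S k. comm_group (A \<sigma>)" for k by (rule op_complexD(1) [OF op_complex_singular])
  interpret P: comm_group "product_group (S (Suc k)) A" by (rule comm_group_product_group [OF A])
  have "local_coboundary k X G c = \<one>\<^bsub>product_group (S (Suc k)) A\<^esub> \<longleftrightarrow>
      op_cochain (S (Suc k)) A (D (Suc k)) c = \<one>\<^bsub>product_group (S (Suc k)) A\<^esub>"
    if c: "c \<in> carrier (product_group (S k) A)" for c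
  proof -
    have "op_cochain (S (Suc k)) A (D (Suc k)) c \<in> carrier (product_group (S (Suc k)) A)"
      using op_cochain_hom [OF A A op_complexD(3) [OF op_complex_singular, of k]] c by (rule hom_in_carrier)
    then show ?thesis
      unfolding local_coboundary_eq [OF c] using P.inv_eq_1_iff by presburger
  qed
  then show ?thesis
    unfolding local_cocycles_def op_cocycles_def local_cochain_group_def kernel_def by blast
qed

lemma local_coboundaries_eq: "local_coboundaries k X G = op_coboundaries S A D k"
proof (cases k)
  case 0
  have A: "\<forall>\<sigma>\<in>S k. comm_group (A \<sigma>)" for k by (rule op_complexD(1) [OF op_complex_singular])
  interpret P: comm_group "product_group (S 0) A" by (rule comm_group_product_group [OF A])
  have "op_cochain (S 0) A (D 0) ` carrier (product_group (S 0) A) = {\<one>\<^bsub>product_group (S 0) A\<^esub>}"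
    unfolding face_op_0 op_cochain_zero [OF A A] using P.one_closed by blast
  then show ?thesis
    using 0 by (simp add: local_coboundaries_def op_coboundaries_def local_cochain_group_def)
next
  case (Suc l)
  have A: "\<forall>\<sigma>\<in>S k. comm_group (A \<sigma>)" for k by (rule op_complexD(1) [OF op_complex_singular])
  let ?P = "product_group (S l) A" and ?\<delta> = "op_cochain (S (Suc l)) A (D (Suc l))"
  interpret P: comm_group ?P by (rule comm_group_product_group [OF A])
  interpret \<delta>: group_hom ?P "product_group (S (Suc l)) A" ?\<delta>
    using op_cochain_hom [OF A A op_complexD(3) [OF op_complex_singular, of l]] comm_group_product_group [OF A]
    by (simp add: group_hom_def group_hom_axioms_def comm_group.axioms(2))
  have eq: "local_coboundary l X G c = (if even l then ?\<delta> c else ?\<delta> (inv\<^bsub>?P\<^esub> c))" if "c \<in> carrier ?P" for c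
    unfolding local_coboundary_eq [OF that] using \<delta>.hom_inv [OF that] by presburger
  have "local_coboundary l X G ` carrier ?P = ?\<delta> ` carrier ?P"
  proof (intro equalityI subsetI)
    fix y assume "y \<in> local_coboundary l X G ` carrier ?P"
    then obtain c where c: "c \<in> carrier ?P" "y = local_coboundary l X G c" by blast
    have "y = ?\<delta> c \<or> y = ?\<delta> (inv\<^bsub>?P\<^esub> c)"
      unfolding c(2) eq [OF c(1)] by presburger
    then show "y \<in> ?\<delta> ` carrier ?P"
      using imageI [OF c(1), of ?\<delta>] imageI [OF P.inv_closed [OF c(1)], of ?\<delta>] by fast
  next
    fix y assume "y \<in> ?\<delta> ` carrier ?P"
    then obtain c where c: "c \<in> carrier ?P" "y = ?\<delta> c" by blast
    show "y \<in> local_coboundary l X G ` carrier ?P"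
    proof (cases "even l")
      case True
      then show ?thesis using eq [OF c(1)] c by (auto intro!: image_eqI [of _ _ c])
    next
      \<comment> \<open>The sign is absorbed by taking the inverse of \<open>c\<close> as
        preimage.\<close>
      case False
      then have "y = local_coboundary l X G (inv\<^bsub>?P\<^esub> c)"
        using eq [OF P.inv_closed [OF c(1)]] c(2) P.inv_inv [OF c(1)] by simp
      then show ?thesis using P.inv_closed [OF c(1)] by blast
    qed
  qed
  then show ?thesis
    unfolding Suc local_coboundaries_def op_coboundaries_def local_cochain_group_def by simp
qed

end

section \<open>The induced maps as operators, and the conclusion\<close>

context
  fixes X :: "'a topology" and Y :: "'b topology" and f :: "'a \<Rightarrow> 'b" and G :: "('b, 'g) coeff_system"
  assumes f: "continuous_map X Y f" and G: "coefficient_system Y G"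
begin

lemma map_op_fibre:
  assumes "\<sigma> \<in> singular_simplex_set k X"
  shows "simplex_map k f \<sigma> \<in> singular_simplex_set k Y"
    and "simplex_fibre G (simplex_map k f \<sigma>) = simplex_fibre (pullback f G) \<sigma>"
    and "comm_group (simplex_fibre (pullback f G) \<sigma>)"
  using assms singular_simplex_simplex_map [of k X \<sigma> Y f] f
    local_system.grp [OF local_system_singular [OF coefficient_system_pullback [OF G f]] assms]
  by (simp_all add: simplex_fibre_pullback simplex_fibre_def [of G] simplex_map_def vertex_in)

lemma local_chain_map_eq:
  assumes c: "c \<in> carrier (sum_group (singular_simplex_set k X) (simplex_fibre (pullback f G)))"
  shows "local_chain_map k X Y G f c
    = op_chain (singular_simplex_set k X) (simplex_fibre (pullback f G)) (singular_simplex_set k Y) (simplex_fibre G) (map_op f G k) c"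
proof -
  let ?S = "singular_simplex_set k X" and ?A = "simplex_fibre (pullback f G)"
  let ?S' = "singular_simplex_set k Y" and ?A' = "simplex_fibre G"
  have A: "\<forall>\<sigma>\<in>?S. comm_group (?A \<sigma>)" using map_op_fibre(3) by blast
  have A': "\<forall>\<sigma>\<in>?S'. comm_group (?A' \<sigma>)" using local_system.grp [OF local_system_singular [OF G]] by blast
  interpret H: comm_group "sum_group ?S' ?A'" by (rule comm_group_sum_group [OF A'])
  have "finprod (sum_group ?S' ?A') (\<lambda>\<sigma>. frag_eval (sum_group ?S' ?A') (\<lambda>x. sum_single ?S' ?A' (fst x) (snd x (c \<sigma>))) (map_op f G k \<sigma>))
       {\<sigma> \<in> ?S. c \<sigma> \<noteq> \<one>\<^bsub>?A \<sigma>\<^esub>}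
    = finprod (sum_group ?S' ?A') (\<lambda>\<sigma>. sum_single ?S' ?A' (simplex_map k f \<sigma>) (c \<sigma>)) {\<sigma> \<in> ?S. c \<sigma> \<noteq> \<one>\<^bsub>?A \<sigma>\<^esub>}"
  proof (rule H.finprod_cong' [OF refl])
    have closed: "c \<sigma> \<in> carrier (?A \<sigma>) \<and> sum_single ?S' ?A' (simplex_map k f \<sigma>) (c \<sigma>) \<in> carrier (sum_group ?S' ?A')"
      if \<sigma>: "\<sigma> \<in> ?S" for \<sigma>
    proof -
      have g: "c \<sigma> \<in> carrier (?A \<sigma>)" using c \<sigma> by (auto simp: sum_group_carrier_iff [OF A])
      then have "sum_single ?S' ?A' (simplex_map k f \<sigma>) (c \<sigma>) \<in> carrier (sum_group ?S' ?A')"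
        by (intro sum_single_closed [OF A' map_op_fibre(1) [OF \<sigma>]]) (simp add: map_op_fibre(2) [OF \<sigma>])
      with g show ?thesis by blast
    qed
    then show "(\<lambda>\<sigma>. sum_single ?S' ?A' (simplex_map k f \<sigma>) (c \<sigma>)) \<in> {\<sigma> \<in> ?S. c \<sigma> \<noteq> \<one>\<^bsub>?A \<sigma>\<^esub>} \<rightarrow> carrier (sum_group ?S' ?A')"
      by blast
    show "frag_eval (sum_group ?S' ?A') (\<lambda>x. sum_single ?S' ?A' (fst x) (snd x (c \<sigma>))) (map_op f G k \<sigma>)
        = sum_single ?S' ?A' (simplex_map k f \<sigma>) (c \<sigma>)" if "\<sigma> \<in> {\<sigma> \<in> ?S. c \<sigma> \<noteq> \<one>\<^bsub>?A \<sigma>\<^esub>}" for \<sigma>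
      using closed [of \<sigma>] that unfolding map_op_def by (subst H.frag_eval_of) simp_all
  qed
  then show ?thesis
    unfolding op_chain_def local_chain_map_def chain_support_def local_chain_group_def chain_single_eq by (rule sym)
qed

text \<open>The formal combination has a single term with the identity of the fibre, whose inverse
  image is the value itself.\<close>

lemma local_cochain_map_eq:
  assumes c: "c \<in> carrier (product_group (singular_simplex_set k Y) (simplex_fibre G))"
  shows "local_cochain_map k X f c = op_cochain (singular_simplex_set k X) (simplex_fibre (pullback f G)) (map_op f G k) c"
  unfolding local_cochain_map_def op_cochain_def
proof (rule restrict_ext)
  fix \<sigma> assume \<sigma>: "\<sigma> \<in> singular_simplex_set k X"
  let ?A = "simplex_fibre (pullback f G) \<sigma>"
  interpret A: comm_group ?A by (rule map_op_fibre(3) [OF \<sigma>])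
  have g: "c (simplex_map k f \<sigma>) \<in> carrier ?A"
    using c map_op_fibre(1,2) [OF \<sigma>] by (auto dest: PiE_mem)
  have "inv_into (carrier ?A) (\<lambda>g\<in>carrier ?A. g) (c (simplex_map k f \<sigma>)) = c (simplex_map k f \<sigma>)"
    by (rule inv_into_iso_eq [OF restrict_id_iso [OF A.comm_group_axioms] g]) (simp add: g)
  then show "c (simplex_map k f \<sigma>) = frag_eval ?A (\<lambda>x. inv_into (carrier ?A) (snd x) (c (fst x))) (map_op f G k \<sigma>)"
    unfolding map_op_def using g by (subst A.frag_eval_of) simp_all
qed

end

theorem theorem1:
  fixes X :: "'a topology" and Y :: "'b topology" and f :: "'a \<Rightarrow> 'b"
    and G :: "('b, 'g) coeff_system" and k :: nat
  assumes "weak_homotopy_equivalence X Y f"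
    and "coefficient_system Y G"
  shows "local_homology_map k X Y G f
           \<in> iso (local_homology k X (pullback f G)) (local_homology k Y G) \<and>
         local_cohomology_map k X G f
           \<in> iso (local_cohomology k Y G) (local_cohomology k X (pullback f G))"
proof -
  have f: "continuous_map X Y f" by (rule weq_continuous [OF assms(1)])
  note fG = coefficient_system_pullback [OF assms(2) f]
  note K = op_complex_singular [OF fG] and K' = op_complex_singular [OF assms(2)]
  note equiv = map_op_equiv [OF assms, of k]
  \<comment> \<open>The operator form agrees with the induced map on the carrier, and cycles and
    boundaries are identified by the equations above; so the equivalence carries over.\<close>
  have chain: "quot_equiv (local_chain_group k X (pullback f G)) (local_cycles k X (pullback f G)) (local_boundaries k X (pullback f G))
      (local_chain_group k Y G) (local_cycles k Y G) (local_boundaries k Y G) (local_chain_map k X Y G f)"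
    unfolding local_chain_group_def local_cycles_eq [OF fG] local_cycles_eq [OF assms(2)]
      local_boundaries_eq [OF fG] local_boundaries_eq [OF assms(2)]
    by (rule quot_equiv_cong [OF equiv(1) _ comm_group.axioms(2) [OF comm_group_sum_group [OF op_complexD(1) [OF K]]]
          subgroup.subset [OF subgroup_op_cycles [OF K]] subgroup.subset [OF subgroup_op_boundaries [OF K]]])
      (use local_chain_map_eq [OF f assms(2)] in blast)
  have cochain: "quot_equiv (local_cochain_group k Y G) (local_cocycles k Y G) (local_coboundaries k Y G)
      (local_cochain_group k X (pullback f G)) (local_cocycles k X (pullback f G)) (local_coboundaries k X (pullback f G)) (local_cochain_map k X f)"
    unfolding local_cochain_group_def local_cocycles_eq [OF fG] local_cocycles_eq [OF assms(2)]
      local_coboundaries_eq [OF fG] local_coboundaries_eq [OF assms(2)]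
    by (rule quot_equiv_cong [OF equiv(2) _ comm_group.axioms(2) [OF comm_group_product_group [OF op_complexD(1) [OF K']]]
          subgroup.subset [OF subgroup_op_cocycles [OF K']] subgroup.subset [OF subgroup_op_coboundaries [OF K']]])
      (use local_cochain_map_eq [OF f assms(2)] in blast)
  have "local_homology_map k X Y G f \<in> iso (local_homology k X (pullback f G)) (local_homology k Y G)"
    unfolding local_homology_def local_homology_map_def [abs_def]
    by (rule quot_equiv_iso [OF chain], unfold local_chain_group_def local_cycles_eq [OF fG] local_cycles_eq [OF assms(2)]
        local_boundaries_eq [OF fG] local_boundaries_eq [OF assms(2)])
      (rule comm_group_sum_group op_complexD(1) subgroup_op_cycles subgroup_op_boundaries op_boundaries_subset K K')+
  moreover have "local_cohomology_map k X G f \<in> iso (local_cohomology k Y G) (local_cohomology k X (pullback f G))"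
    unfolding local_cohomology_def local_cohomology_map_def [abs_def]
    by (rule quot_equiv_iso [OF cochain], unfold local_cochain_group_def local_cocycles_eq [OF fG] local_cocycles_eq [OF assms(2)]
        local_coboundaries_eq [OF fG] local_coboundaries_eq [OF assms(2)])
      (rule comm_group_product_group op_complexD(1) subgroup_op_cocycles subgroup_op_coboundaries op_coboundaries_subset K K')+
  ultimately show ?thesis by blast
qed

end
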